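(* Let $l\ge 1$, let $P$ be a symmetric integer $l\times l$ matrix, let $G$ be an abelian group and let $V$ be a $G$-valued Vassiliev invariant of type $m$ of framed pure tangles with $l$ strands. Suppose that $V$ descends, via the closure map, to a well defined invariant of links with linking matrix $P$; i.e. there is an invariant $W$ of framed oriented $l$-component links with linking matrix $P$ such that $V(T)=W(\text{closure of }T)$ for every pure tangle $T$ whose closure has linking matrix $P$. Then $W$ is an invariant of type $m$ of links with linking matrix $P$, both in the DD sense and in the $\bigwedge$ sense.
   Context: Links are framed, oriented, with ordered components, in $S^3$, up to isotopy. The linking matrix of a link has as off-diagonal entries the pairwise linking numbers and as diagonal entries the framings. Links are drawn by diagrams with blackboard framing. A $P$-link is a link with linking matrix $P$. A pure tangle (string link) with $l$ strands is a framed tangle in a cylinder with $l$ ordered oriented strands, the $i$-th strand running from the $i$-th marked point at the bottom to the $i$-th marked point at the top, up to isotopy fixing the ends; its closure is the $l$-component link obtained by joining the top and bottom ends in the standard way. A Vassiliev invariant of type $m$ of pure tangles is an invariant which, extended to tangles with transverse double points by $V(\text{double point})=V(\text{positive crossing})-V(\text{negative crossing})$, vanishes on all tangles with more than $m$ double points. DD-singular links: a $DD^{n}$-singular $P$-link is a link with $2n$ transverse double points grouped into $n$ pairs. In each pair one double point is labelled $+$ and the other $-$, and both are intersections between the same two components $i$ and $j$ (possibly $i=j$). Resolving a pair means replacing the singular link $L$ by one of two links. In $\overline{L}$ the $+$ double point becomes a positive crossing and the $-$ double point a negative crossing; in $\underline{L}$ the $+$ double point becomes a negative crossing and the $-$ double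 point a positive crossing. It is required that resolving all pairs gives links with linking matrix $P$. $\bigwedge$-singular links: a $\bigwedge^{n}$-singular $P$-link is a $DD^{n}$-singular $P$-link in which every pair is close. That is, the link is drawn so that for each pair there is a segment of one of the components, running from one double point of the pair to the other, which meets no other crossing or double point in its interior (as drawn in the paper, along the orientation of this segment the $-$ double point comes first and the $+$ double point second; exchanging the labels of a pair only changes the sign of the extended invariant). An invariant $W$ of $P$-links is extended to $DD^n$- and $\bigwedge^n$-singular $P$-links by $W(L)=W(\overline L)-W(\underline L)$ for each pair. $W$ is of type $m$ in the DD (respectively $\bigwedge$) sense if it vanishes on all $DD^{m+1}$-singular (respectively $\bigwedge^{m+1}$-singular) $P$-links. *)

theory Defs
  imports "HOL-Analysis.Analysis"
begin

text \<open>
  Links are tame and represented by closed polygons in \<open>\<real>\<^sup>3\<close> (one point of \<open>S\<^sup>3\<close> is omitted, which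
  does not affect isotopy classes); they are compared up to ambient isotopy.  Components are
  numbered from 0.  A framing is recorded by its framing number, one integer per component: this
  is the diagonal entry of the linking matrix, and for a diagram with blackboard framing it is
  the writhe of the component.  For strings with fixed ends it is likewise the writhe of the
  string in a blackboard-framed diagram.
\<close>

type_synonym point = "real ^ 3"
type_synonym framed = "point list list \<times> int list"


subsection \<open>Polygons\<close>

text \<open>
  A list of vertices is read cyclically.  Its closed polygon is traversed, at one edge per unit of
  time, by the periodic map \<open>curve p\<close>; the corresponding open polygonal string is the restriction
  of \<open>curve p\<close> to \<open>{0..length p - 1}\<close>, which leaves out the edge from the last vertex back to the
  first.
\<close>

definition vtx :: "point list \<Rightarrow> int \<Rightarrow> point" where
  "vtx p k = p ! nat (k mod int (length p))"

definition edge :: "point list \<Rightarrow> real \<Rightarrow> point" where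
  "edge p t = vtx p (\<lfloor>t\<rfloor> + 1) - vtx p \<lfloor>t\<rfloor>"

definition curve :: "point list \<Rightarrow> real \<Rightarrow> point" where
  "curve p t = vtx p \<lfloor>t\<rfloor> + frac t *\<^sub>R edge p t"

definition link_dom :: "point list list \<Rightarrow> (nat \<times> real) set" where
  "link_dom ps = {(i, t). i < length ps \<and> 0 \<le> t \<and> t < real (length (ps ! i))}"

definition tangle_dom :: "point list list \<Rightarrow> (nat \<times> real) set" where
  "tangle_dom ps = {(i, t). i < length ps \<and> 0 \<le> t \<and> t \<le> real (length (ps ! i)) - 1}"


subsection \<open>Double points\<close>

text \<open>
  A place \<open>(i, k)\<close> is vertex \<open>k\<close> of component \<open>i\<close>.  A double point is given by the two places which
  coincide there.  The representing polygons are subdivided so that every double point is a vertex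
  of both branches, at which both branches are straight.
\<close>

type_synonym place = "nat \<times> nat"
type_synonym dpoint = "place \<times> place"

definition at_place :: "point list list \<Rightarrow> place \<Rightarrow> point" where
  "at_place ps a = ps ! fst a ! snd a"

definition tangent :: "point list list \<Rightarrow> place \<Rightarrow> point" where
  "tangent ps a = edge (ps ! fst a) (real (snd a))"

definition straight_at :: "point list list \<Rightarrow> place \<Rightarrow> bool" where
  "straight_at ps a \<longleftrightarrow> at_place ps a \<in>
     open_segment (vtx (ps ! fst a) (int (snd a) - 1)) (vtx (ps ! fst a) (int (snd a) + 1))"

definition normal :: "point list list \<Rightarrow> dpoint \<Rightarrow> point" where
  "normal ps d = cross3 (tangent ps (fst d)) (tangent ps (snd d))"

text \<open>
  \<open>D\<close> lists exactly the self-intersections of the curves with parameter domain \<open>X\<close>, each once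
  (injectivity also excludes triple points), and all of them are transverse double points.  For
  \<open>D = {}\<close> this says that the curves are embedded and pairwise disjoint.
\<close>

definition double_points_of ::
    "(nat \<times> real) set \<Rightarrow> point list list \<Rightarrow> dpoint set \<Rightarrow> bool" where
  "double_points_of X ps D \<longleftrightarrow>
     (\<forall>(a, b) \<in> D. a \<noteq> b \<and> (fst a, real (snd a)) \<in> X \<and> (fst b, real (snd b)) \<in> X \<and>
        at_place ps a = at_place ps b \<and> straight_at ps a \<and> straight_at ps b \<and>
        normal ps (a, b) \<noteq> 0) \<and>
     inj_on (\<lambda>d. at_place ps (fst d)) D \<and>
     (\<forall>(i, s) \<in> X. \<forall>(j, t) \<in> X. (i, s) \<noteq> (j, t) \<and> curve (ps ! i) s = curve (ps ! j) t \<longrightarrow>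
        (\<exists>k m. s = real k \<and> t = real m \<and>
           (((i, k), (j, m)) \<in> D \<or> ((j, m), (i, k)) \<in> D)))"

definition singular_link :: "nat \<Rightarrow> framed \<Rightarrow> dpoint set \<Rightarrow> bool" where
  "singular_link l L D \<longleftrightarrow> length (fst L) = l \<and> length (snd L) = l \<and> [] \<notin> set (fst L) \<and>
     double_points_of (link_dom (fst L)) (fst L) D"

definition framed_link :: "nat \<Rightarrow> framed \<Rightarrow> bool" where
  "framed_link l L \<longleftrightarrow> singular_link l L {}"

text \<open>
  Resolutions: the double points in \<open>N\<close> become negative crossings, the other ones positive
  crossings.  A crossing of branches with directions \<open>a\<close> and \<open>b\<close>, seen along the line joining the
  points \<open>x\<close> and \<open>y\<close> of the two branches, has the sign of \<open>cross3 a b \<bullet> (x - y)\<close>; so moving the first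
  branch in direction \<open>cross3 a b\<close> makes the crossing positive.

  The framing number of a component of a singular link leaves out its self-intersections; each of
  them contributes its sign to the framing number (the writhe) of a resolution.  This is the
  change of blackboard framing.
\<close>

definition dsign :: "dpoint set \<Rightarrow> dpoint \<Rightarrow> int" where
  "dsign N d = (if d \<in> N then - 1 else 1)"

definition resolve :: "real \<Rightarrow> framed \<Rightarrow> dpoint set \<Rightarrow> dpoint set \<Rightarrow> framed" where
  "resolve \<epsilon> L D N =
    (map (\<lambda>i. map (\<lambda>k. fst L ! i ! k +
              (\<Sum>d\<in>D. if fst d = (i, k)
                     then (\<epsilon> * real_of_int (dsign N d)) *\<^sub>R normal (fst L) d else 0))
           [0..<length (fst L ! i)])
       [0..<length (fst L)],
     map (\<lambda>i. snd L ! i +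
            (\<Sum>d\<in>D. if fst (fst d) = i \<and> fst (snd d) = i then dsign N d else 0))
       [0..<length (snd L)])"

text \<open>
  The isotopy class of \<open>resolve \<epsilon> L D N\<close> does not depend on \<open>\<epsilon>\<close> when \<open>\<epsilon> > 0\<close> is small.  Hence
  statements about "the" resolution are made below for all sufficiently small \<open>\<epsilon> > 0\<close>.
\<close>

definition signed :: "nat \<Rightarrow> 'g::ab_group_add \<Rightarrow> 'g" where
  "signed n g = (if even n then g else - g)"

text \<open>The iterated rule \<open>V(double point) = V(positive) - V(negative)\<close>, applied at every double point.\<close>

definition extension ::
    "(framed \<Rightarrow> 'g::ab_group_add) \<Rightarrow> real \<Rightarrow> framed \<Rightarrow> dpoint set \<Rightarrow> 'g" where
  "extension V \<epsilon> L D = (\<Sum>N\<in>Pow D. signed (card N) (V (resolve \<epsilon> L D N)))"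


subsection \<open>Isotopy\<close>

definition ambient_isotopy :: "(real \<Rightarrow> point \<Rightarrow> point) \<Rightarrow> bool" where
  "ambient_isotopy H \<longleftrightarrow>
     continuous_on ({0..1} \<times> UNIV) (\<lambda>(t, x). H t x) \<and>
     (\<forall>t\<in>{0..1}. \<exists>g. homeomorphism UNIV UNIV (H t) g) \<and>
     (\<forall>x. H 0 x = x)"

text \<open>
  \<open>\<phi>\<close> is a lift to \<open>\<real>\<close> of an orientation preserving homeomorphism between the two parameter circles.
\<close>

definition isotopic :: "framed \<Rightarrow> framed \<Rightarrow> bool" where
  "isotopic L L' \<longleftrightarrow> length (fst L) = length (fst L') \<and> snd L = snd L' \<and>
     (\<exists>H. ambient_isotopy H \<and>
        (\<forall>i < length (fst L). \<exists>\<phi>. continuous_on UNIV \<phi> \<and> strict_mono \<phi> \<and>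
           (\<forall>t. \<phi> (t + real (length (fst L ! i))) = \<phi> t + real (length (fst L' ! i))) \<and>
           (\<forall>t. H 1 (curve (fst L ! i) t) = curve (fst L' ! i) (\<phi> t))))"


subsection \<open>Diagrams and the linking matrix\<close>

definition xy :: "point \<Rightarrow> real \<times> real" where
  "xy x = (x $ 1, x $ 2)"

text \<open>
  The projection to the \<open>xy\<close>-plane is a diagram: apart from double points in space there are only
  crossings, which are double points of the projection, transverse, and away from the vertices.
\<close>

definition diagram :: "point list list \<Rightarrow> bool" where
  "diagram ps \<longleftrightarrow>
     (\<forall>(i, s) \<in> link_dom ps. \<forall>(j, t) \<in> link_dom ps.
        (i, s) \<noteq> (j, t) \<and> xy (curve (ps ! i) s) = xy (curve (ps ! j) t) \<longrightarrow>
          cross3 (edge (ps ! i) s) (edge (ps ! j) t) $ 3 \<noteq> 0 \<and>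
          (curve (ps ! i) s = curve (ps ! j) t \<or> s \<notin> \<int> \<and> t \<notin> \<int>) \<and>
          (\<forall>(k, u) \<in> link_dom ps. xy (curve (ps ! k) u) = xy (curve (ps ! i) s) \<longrightarrow>
             (k, u) = (i, s) \<or> (k, u) = (j, t)))"

definition crossings :: "point list list \<Rightarrow> nat \<Rightarrow> nat \<Rightarrow> (real \<times> real) set" where
  "crossings ps i j = {(s, t). (i, s) \<in> link_dom ps \<and> (j, t) \<in> link_dom ps \<and>
     xy (curve (ps ! i) s) = xy (curve (ps ! j) t)}"

definition crossing_sign :: "point list \<Rightarrow> point list \<Rightarrow> real \<Rightarrow> real \<Rightarrow> real" where
  "crossing_sign p q s t = sgn (cross3 (edge p s) (edge q t) \<bullet> (curve p s - curve q t))"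

text \<open>
  The linking number of two components is half the sum of the signs of their crossings, in any
  diagram of the link.
\<close>

definition has_linking_matrix :: "nat \<Rightarrow> (nat \<Rightarrow> nat \<Rightarrow> int) \<Rightarrow> framed \<Rightarrow> bool" where
  "has_linking_matrix l P L \<longleftrightarrow>
     (\<forall>i<l. snd L ! i = P i i) \<and>
     (\<exists>L'. framed_link l L' \<and> isotopic L L' \<and> diagram (fst L') \<and>
        (\<forall>i<l. \<forall>j<l. i \<noteq> j \<longrightarrow>
           (\<Sum>(s, t)\<in>crossings (fst L') i j. crossing_sign (fst L' ! i) (fst L' ! j) s t)
             = 2 * real_of_int (P i j)))"

definition p_link :: "nat \<Rightarrow> (nat \<Rightarrow> nat \<Rightarrow> int) \<Rightarrow> framed \<Rightarrow> bool" where
  "p_link l P L \<longleftrightarrow> framed_link l L \<and> has_linking_matrix l P L"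

definition link_invariant ::
    "nat \<Rightarrow> (nat \<Rightarrow> nat \<Rightarrow> int) \<Rightarrow> (framed \<Rightarrow> 'g) \<Rightarrow> bool" where
  "link_invariant l P W \<longleftrightarrow>
     (\<forall>L L'. p_link l P L \<and> p_link l P L' \<and> isotopic L L' \<longrightarrow> W L = W L')"


subsection \<open>Pure tangles\<close>

definition cylinder :: "point set" where
  "cylinder = {x. (x $ 1)\<^sup>2 + (x $ 2)\<^sup>2 \<le> 1 \<and> 0 \<le> x $ 3 \<and> x $ 3 \<le> 1}"

definition mark :: "nat \<Rightarrow> nat \<Rightarrow> real" where
  "mark l i = 2 * real (i + 1) / real (l + 1) - 1"

definition bottom :: "nat \<Rightarrow> nat \<Rightarrow> point" where
  "bottom l i = vector [mark l i, 0, 0]"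

definition top_point :: "nat \<Rightarrow> nat \<Rightarrow> point" where
  "top_point l i = vector [mark l i, 0, 1]"

definition singular_tangle :: "nat \<Rightarrow> framed \<Rightarrow> dpoint set \<Rightarrow> bool" where
  "singular_tangle l T D \<longleftrightarrow> length (fst T) = l \<and> length (snd T) = l \<and>
     (\<forall>i<l. fst T ! i \<noteq> [] \<and> hd (fst T ! i) = bottom l i \<and> last (fst T ! i) = top_point l i \<and>
        (\<forall>k. 0 < k \<and> k < length (fst T ! i) - 1 \<longrightarrow> fst T ! i ! k \<in> interior cylinder)) \<and>
     double_points_of (tangle_dom (fst T)) (fst T) D"

definition pure_tangle :: "nat \<Rightarrow> framed \<Rightarrow> bool" where
  "pure_tangle l T \<longleftrightarrow> singular_tangle l T {}"

text \<open>The ends are fixed, so the orientations of the strings need not be mentioned.\<close>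

definition tangle_isotopic :: "framed \<Rightarrow> framed \<Rightarrow> bool" where
  "tangle_isotopic T T' \<longleftrightarrow> length (fst T) = length (fst T') \<and> snd T = snd T' \<and>
     (\<exists>H. ambient_isotopy H \<and> (\<forall>t\<in>{0..1}. \<forall>x. x \<notin> interior cylinder \<longrightarrow> H t x = x) \<and>
        (\<forall>i < length (fst T).
           H 1 ` curve (fst T ! i) ` {0..real (length (fst T ! i)) - 1} =
           curve (fst T' ! i) ` {0..real (length (fst T' ! i)) - 1}))"

definition tangle_invariant :: "nat \<Rightarrow> (framed \<Rightarrow> 'g) \<Rightarrow> bool" where
  "tangle_invariant l V \<longleftrightarrow>
     (\<forall>T T'. pure_tangle l T \<and> pure_tangle l T' \<and> tangle_isotopic T T' \<longrightarrow> V T = V T')"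

definition vassiliev_invariant :: "nat \<Rightarrow> nat \<Rightarrow> (framed \<Rightarrow> 'g::ab_group_add) \<Rightarrow> bool" where
  "vassiliev_invariant l m V \<longleftrightarrow> tangle_invariant l V \<and>
     (\<forall>T D. singular_tangle l T D \<and> card D > m \<longrightarrow>
        (\<forall>\<^sub>F \<epsilon> in at_right 0. extension V \<epsilon> T D = 0))"

text \<open>
  The closing arcs are nested rectangles in the half plane \<open>y = 0\<close>, to the right of the cylinder.
  They are crossingless, so closing does not change framing numbers.
\<close>

definition closing_arc :: "nat \<Rightarrow> nat \<Rightarrow> point list" where
  "closing_arc l i =
     [vector [mark l i, 0, 2 - mark l i],
      vector [2 - mark l i, 0, 2 - mark l i],
      vector [2 - mark l i, 0, mark l i - 1],
      vector [mark l i, 0, mark l i - 1]]"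

definition tangle_closure :: "nat \<Rightarrow> framed \<Rightarrow> framed" where
  "tangle_closure l T = (map (\<lambda>i. fst T ! i @ closing_arc l i) [0..<l], snd T)"


subsection \<open>Paired double points\<close>

text \<open>
  A pair consists of the double point labelled \<open>+\<close> and the double point labelled \<open>-\<close>, in this order.
  \<open>resolve_pairs \<epsilon> L Q U\<close> replaces \<open>L\<close> by its underlined resolution at the pairs in \<open>U\<close> and by its
  overlined resolution at the other pairs of \<open>Q\<close>.
\<close>

type_synonym dpair = "dpoint \<times> dpoint"

definition pair_points :: "dpair set \<Rightarrow> dpoint set" where
  "pair_points Q = fst ` Q \<union> snd ` Q"

definition resolve_pairs :: "real \<Rightarrow> framed \<Rightarrow> dpair set \<Rightarrow> dpair set \<Rightarrow> framed" where
  "resolve_pairs \<epsilon> L Q U = resolve \<epsilon> L (pair_points Q) (snd ` (Q - U) \<union> fst ` U)"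

text \<open>The unordered pair of components meeting at a double point.\<close>

definition components :: "dpoint \<Rightarrow> nat set" where
  "components d = {fst (fst d), fst (snd d)}"

definition DD_singular ::
    "nat \<Rightarrow> (nat \<Rightarrow> nat \<Rightarrow> int) \<Rightarrow> nat \<Rightarrow> framed \<Rightarrow> dpair set \<Rightarrow> bool" where
  "DD_singular l P n L Q \<longleftrightarrow>
     singular_link l L (pair_points Q) \<and>
     finite Q \<and> card Q = n \<and> card (pair_points Q) = 2 * n \<and>
     (\<forall>(dp, dn) \<in> Q. components dp = components dn) \<and>
     (\<forall>\<^sub>F \<epsilon> in at_right 0. \<forall>U\<subseteq>Q. p_link l P (resolve_pairs \<epsilon> L Q U))"

text \<open>
  A close pair: between its two double points runs a segment of a component whose interior meets,
  in the diagram, no other part of the link.  Either of the two double points may come first.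
\<close>

definition close_pair :: "point list list \<Rightarrow> dpair \<Rightarrow> bool" where
  "close_pair ps q \<longleftrightarrow>
     (\<exists>i < length ps. \<exists>s t. s < t \<and>
        {curve (ps ! i) s, curve (ps ! i) t} =
          {at_place ps (fst (fst q)), at_place ps (fst (snd q))} \<and>
        (\<forall>u. s < u \<and> u < t \<longrightarrow>
           (\<forall>j < length ps. \<forall>v. xy (curve (ps ! j) v) = xy (curve (ps ! i) u) \<longrightarrow>
              j = i \<and> (\<exists>z::int. v = u + real_of_int z * real (length (ps ! i))))))"

definition wedge_singular ::
    "nat \<Rightarrow> (nat \<Rightarrow> nat \<Rightarrow> int) \<Rightarrow> nat \<Rightarrow> framed \<Rightarrow> dpair set \<Rightarrow> bool" where
  "wedge_singular l P n L Q \<longleftrightarrow>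
     DD_singular l P n L Q \<and> diagram (fst L) \<and> (\<forall>q\<in>Q. close_pair (fst L) q)"

text \<open>The iterated rule \<open>W(L) = W(overlined L) - W(underlined L)\<close>, applied at every pair.\<close>

definition pair_extension ::
    "(framed \<Rightarrow> 'g::ab_group_add) \<Rightarrow> real \<Rightarrow> framed \<Rightarrow> dpair set \<Rightarrow> 'g" where
  "pair_extension W \<epsilon> L Q = (\<Sum>U\<in>Pow Q. signed (card U) (W (resolve_pairs \<epsilon> L Q U)))"

definition DD_type ::
    "nat \<Rightarrow> (nat \<Rightarrow> nat \<Rightarrow> int) \<Rightarrow> nat \<Rightarrow> (framed \<Rightarrow> 'g::ab_group_add) \<Rightarrow> bool" where
  "DD_type l P m W \<longleftrightarrow> link_invariant l P W \<and>
     (\<forall>L Q. DD_singular l P (m + 1) L Q \<longrightarrow>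
        (\<forall>\<^sub>F \<epsilon> in at_right 0. pair_extension W \<epsilon> L Q = 0))"

definition wedge_type ::
    "nat \<Rightarrow> (nat \<Rightarrow> nat \<Rightarrow> int) \<Rightarrow> nat \<Rightarrow> (framed \<Rightarrow> 'g::ab_group_add) \<Rightarrow> bool" where
  "wedge_type l P m W \<longleftrightarrow> link_invariant l P W \<and>
     (\<forall>L Q. wedge_singular l P (m + 1) L Q \<longrightarrow>
        (\<forall>\<^sub>F \<epsilon> in at_right 0. pair_extension W \<epsilon> L Q = 0))"

end

theory Submission
  imports Defs
begin

text \<open>
  Every singular link \<open>L\<close> is isotopic to the closure of a singular tangle: shrink \<open>L\<close> into the
  cylinder, in front of the plane that contains the closing arcs, and pull from a descending edge
  of each component a horizontal finger, at pairwise different heights, whose tip is then led around the closing arc.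
  All of this happens away from the double points, so it is compatible with their resolutions.  Hence
  \<open>W\<close> of a resolution of \<open>L\<close> is \<open>V\<close> of a resolution of a single singular tangle \<open>T\<close>.

  In each pair, \<open>W(+ -) - W(- +) = (W(+ -) - W(- -)) - (W(- +) - W(- -))\<close>.  The links on the right
  need not have linking matrix \<open>P\<close>, but their tangles are resolutions of \<open>T\<close>, where \<open>V\<close> is defined.  So the alternating sum over
  \<open>m + 1\<close> pairs becomes a signed sum of values of the extension of \<open>V\<close> on tangles with \<open>m + 1\<close> double points,
  one from each pair, and these vanish.

  Isotopies between polygonal links are obtained from families of displacements of the vertices: as
  long as the displaced polygons stay embedded, a compactness argument makes each displacement field Lipschitz with respect to
  the distance in space; for short times it extends to a contraction of space, and adding a contraction to the identity gives an ambient isotopy.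
\<close>

subsection \<open>Polygonal curves\<close>

text \<open>The type condition on \<open>V\<close> concerns a tangle in which some double points are
  resolved by an amount tending to 0 while the others have already been opened by a fixed amount;
  \<open>W\<close> is evaluated where all of them are opened by the same amount. So resolutions of
  different sizes must be recognised as isotopic. This is the purpose of \<open>splitting\<close>:
  apart from uniform bounds it depends only on the signs of the crossings, and it is convex in the
  displacement field, so the straight line between two such fields is an isotopy. For tangles the
  isotopy must also fix the complement of the cylinder, on whose boundary the strands end. Hence the
  set \<open>Z\<close> in \<open>isotopy_extension\<close>, and the estimate that bounds the
  displacement by a multiple of the distance to that complement. A finger has to avoid the link, but
  the link differs a little from one resolution to the next. The fingers are therefore chosen once,
  with a margin valid for all small displacements at the double points (\<open>finger_room\<close>).
  All resolutions then receive the same tails, which is why a single tangle serves them all.\<close>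

abbreviation places :: "dpoint set \<Rightarrow> place set" where
  "places D \<equiv> fst ` D \<union> snd ` D"

lemma vtx_add_multiple: "vtx p (k + z * int (length p)) = vtx p k"
  by (simp add: vtx_def)

lemma vtx_nat: "k < length p \<Longrightarrow> vtx p (int k) = p ! k"
  by (simp add: vtx_def)

lemma nat_mod_length_less: "p \<noteq> [] \<Longrightarrow> nat (k mod int (length p)) < length p"
  using pos_mod_sign[of "int (length p)" k] pos_mod_bound[of "int (length p)" k]
  by (simp add: nat_less_iff)

lemma vtx_in_set: "p \<noteq> [] \<Longrightarrow> vtx p k \<in> set p"
  unfolding vtx_def by (intro nth_mem nat_mod_length_less)

lemma curve_of_int: "curve p (of_int k) = vtx p k"
  by (simp add: curve_def)

lemma curve_of_nat: "k < length p \<Longrightarrow> curve p (real k) = p ! k"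
  using curve_of_int[of p "int k"] vtx_nat by simp

lemma curve_on_edge:
  assumes "of_int k \<le> t" "t \<le> of_int k + 1"
  shows "curve p t = vtx p k + (t - of_int k) *\<^sub>R (vtx p (k + 1) - vtx p k)"
proof (cases "t = of_int k + 1")
  case True
  then have "curve p t = vtx p (k + 1)" using curve_of_int[of p "k + 1"] by simp
  then show ?thesis using True by simp
next
  case False
  then have "\<lfloor>t\<rfloor> = k" using assms by (simp add: floor_eq_iff)
  then show ?thesis by (simp add: curve_def edge_def frac_def)
qed

lemma curve_add_multiple: "curve p (t + of_int z * real (length p)) = curve p t"
proof -
  have fl: "\<lfloor>t + of_int z * real (length p)\<rfloor> = \<lfloor>t\<rfloor> + z * int (length p)"
    using floor_add_int[of t "z * int (length p)"] by simp
  have v: "vtx p (\<lfloor>t\<rfloor> + z * int (length p) + 1) = vtx p (\<lfloor>t\<rfloor> + 1)"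
    using vtx_add_multiple[of p "\<lfloor>t\<rfloor> + 1" z] by (simp add: algebra_simps)
  show ?thesis
    unfolding curve_def edge_def frac_def fl v vtx_add_multiple by simp
qed

lemma edge_of_nat: "edge p (real k) = vtx p (int k + 1) - vtx p (int k)"
  by (simp add: edge_def)

lemma curve_lincomb:
  assumes "\<And>k. vtx r k = vtx p k + s *\<^sub>R vtx q k"
  shows "curve r t = curve p t + s *\<^sub>R curve q t"
  by (simp add: curve_def edge_def assms algebra_simps)

lemma curve_in_segment: "curve p t \<in> closed_segment (vtx p \<lfloor>t\<rfloor>) (vtx p (\<lfloor>t\<rfloor> + 1))"
  unfolding closed_segment_def curve_def edge_def
  by (rule CollectI, rule exI[of _ "frac t"]) (simp add: frac_ge_0 less_imp_le frac_lt_1 algebra_simps)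

lemma curve_in_convex:
  assumes "convex S" "vtx p \<lfloor>t\<rfloor> \<in> S" "vtx p (\<lfloor>t\<rfloor> + 1) \<in> S"
  shows "curve p t \<in> S"
  using curve_in_segment[of p t] closed_segment_subset[OF assms(2,3,1)] by blast

lemma curve_in_convex_set: "convex S \<Longrightarrow> p \<noteq> [] \<Longrightarrow> set p \<subseteq> S \<Longrightarrow> curve p t \<in> S"
  using vtx_in_set by (intro curve_in_convex) blast+

lemma curve_norm_le:
  assumes "p \<noteq> []" "\<And>v. v \<in> set p \<Longrightarrow> norm v \<le> B"
  shows "norm (curve p t) \<le> B"
  using curve_in_convex_set[of "cball 0 B" p t] assms by (auto simp: subset_iff)

text \<open>
  Parameters at distance at most 1 lie on one edge or on two adjacent ones; the coefficients
  \<open>\<alpha>\<close>, \<open>\<beta>\<close> below depend only on the parameters, so that the formula can be used for a polygon and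
  for a displacement field along it at the same time.
\<close>

lemma curve_diff:
  assumes "a \<le> b" "b \<le> a + 1"
  shows "\<exists>k \<alpha> \<beta>. 0 \<le> \<alpha> \<and> 0 \<le> \<beta> \<and> \<alpha> + \<beta> = b - a \<and>
    (\<forall>p. curve p b - curve p a =
       \<alpha> *\<^sub>R (vtx p (k + 1) - vtx p k) + \<beta> *\<^sub>R (vtx p (k + 2) - vtx p (k + 1)))"
proof -
  define k where "k = \<lfloor>a\<rfloor>"
  have k: "of_int k \<le> a" "a < of_int k + 1" unfolding k_def by linarith+
  show ?thesis
  proof (cases "b \<le> of_int k + 1")
    case True
    have "curve p b - curve p a = (b - a) *\<^sub>R (vtx p (k + 1) - vtx p k)" for p
      using curve_on_edge[of k a p] curve_on_edge[of k b p] k True assms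
      by (simp add: scaleR_left_diff_distrib)
    then show ?thesis using assms by (intro exI[of _ k] exI[of _ "b - a"] exI[of _ 0]) simp
  next
    case False
    have "curve p b - curve p a = (of_int k + 1 - a) *\<^sub>R (vtx p (k + 1) - vtx p k) +
        (b - (of_int k + 1)) *\<^sub>R (vtx p (k + 2) - vtx p (k + 1))" for p
    proof -
      have 1: "curve p a = vtx p k + (a - of_int k) *\<^sub>R (vtx p (k + 1) - vtx p k)"
        using k by (intro curve_on_edge) auto
      have 2: "curve p b = vtx p (k + 1) + (b - of_int (k + 1)) *\<^sub>R (vtx p (k + 1 + 1) - vtx p (k + 1))"
        using k False assms by (intro curve_on_edge) auto
      show ?thesis unfolding 1 2 by (simp add: vec_eq_iff algebra_simps)
    qed
    then show ?thesis using k False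
      by (intro exI[of _ k] exI[of _ "of_int k + 1 - a"] exI[of _ "b - (of_int k + 1)"]) simp
  qed
qed

lemma curve_diff_le:
  assumes "\<bar>a - b\<bar> \<le> 1" "\<And>k. norm (vtx p (k + 1) - vtx p k) \<le> B"
  shows "norm (curve p a - curve p b) \<le> B * \<bar>a - b\<bar>"
proof -
  have *: "norm (curve p b - curve p a) \<le> B * (b - a)" if ab: "a \<le> b" "b \<le> a + 1" for a b
  proof -
    obtain k \<alpha> \<beta> where c: "0 \<le> \<alpha>" "0 \<le> \<beta>" "\<alpha> + \<beta> = b - a"
      and d: "curve p b - curve p a =
       \<alpha> *\<^sub>R (vtx p (k + 1) - vtx p k) + \<beta> *\<^sub>R (vtx p (k + 2) - vtx p (k + 1))"
      using curve_diff[OF ab] by blast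
    have "norm (vtx p (k + 2) - vtx p (k + 1)) \<le> B" using assms(2)[of "k + 1"] by (simp add: add.assoc)
    then have "norm (curve p b - curve p a) \<le> \<alpha> * B + \<beta> * B"
      unfolding d using c assms(2)[of k]
      by (intro norm_triangle_le add_mono) (simp_all add: mult_left_mono)
    then show ?thesis using c(3) by (metis distrib_right mult.commute)
  qed
  show ?thesis
  proof (cases "a \<le> b")
    case True
    then have "norm (curve p b - curve p a) \<le> B * (b - a)" using assms(1) by (intro *) auto
    then show ?thesis using True by (simp add: norm_minus_commute)
  next
    case False
    then have "norm (curve p a - curve p b) \<le> B * (a - b)" using assms(1) by (intro *) auto
    then show ?thesis using False by simp
  qed
qed

lemma continuous_on_curve:
  assumes "p \<noteq> []"
  shows "continuous_on S (curve p)"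
proof -
  obtain B where B: "\<And>v. v \<in> set p \<Longrightarrow> norm v \<le> B"
    using bounded_iff finite_imp_bounded[of "set p"] by blast
  have "norm (vtx p (k + 1) - vtx p k) \<le> 2 * B" for k
    using norm_triangle_ineq4[of "vtx p (k + 1)" "vtx p k"] B[OF vtx_in_set[OF assms, of k]]
      B[OF vtx_in_set[OF assms, of "k + 1"]] by linarith
  then have d: "\<bar>a - b\<bar> \<le> 1 \<Longrightarrow> norm (curve p a - curve p b) \<le> (2 * \<bar>B\<bar> + 1) * \<bar>a - b\<bar>" for a b
    by (intro curve_diff_le) (auto intro: order_trans[where y = "2 * B"])
  have "isCont (curve p) x" for x
    unfolding continuous_at_eps_delta
  proof (intro allI impI)
    fix e :: real assume "e > 0"
    define r where "r = min 1 (e / (2 * \<bar>B\<bar> + 1))"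
    have "r > 0" using \<open>e > 0\<close> by (simp add: r_def add_nonneg_pos)
    moreover have "dist (curve p y) (curve p x) < e" if "dist y x < r" for y
    proof -
      have 1: "\<bar>y - x\<bar> < 1" "\<bar>y - x\<bar> < e / (2 * \<bar>B\<bar> + 1)" using that by (auto simp: r_def dist_real_def)
      have "norm (curve p y - curve p x) \<le> (2 * \<bar>B\<bar> + 1) * \<bar>y - x\<bar>" using d 1 by simp
      also have "\<dots> < e" using 1(2) by (simp add: pos_less_divide_eq mult.commute add_nonneg_pos)
      finally show ?thesis by (simp add: dist_norm)
    qed
    ultimately show "\<exists>d>0. \<forall>y. dist y x < d \<longrightarrow> dist (curve p y) (curve p x) < e" by blast
  qed
  then show ?thesis by (simp add: continuous_at_imp_continuous_on)
qed

section \<open>Displacing the vertices of polygons\<close>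

definition disp :: "point list list \<Rightarrow> (nat \<Rightarrow> nat \<Rightarrow> point) \<Rightarrow> point list list" where
  "disp ps w = map (\<lambda>i. map (\<lambda>k. ps ! i ! k + w i k) [0..<length (ps ! i)]) [0..<length ps]"

text \<open>The displacement vectors are themselves read as the vertices of a polygon, so that
  \<open>curve\<close> interpolates them: \<open>curve (field ps w i) t\<close> is the displacement
  of the point \<open>curve (ps ! i) t\<close>, as \<open>curve_disp\<close> confirms.\<close>

definition field :: "point list list \<Rightarrow> (nat \<Rightarrow> nat \<Rightarrow> point) \<Rightarrow> nat \<Rightarrow> point list" where
  "field ps w i = map (w i) [0..<length (ps ! i)]"

lemma length_disp [simp]: "length (disp ps w) = length ps"
  by (simp add: disp_def)

lemma length_disp_nth [simp]: "i < length ps \<Longrightarrow> length (disp ps w ! i) = length (ps ! i)"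
  by (simp add: disp_def)

lemma length_field [simp]: "length (field ps w i) = length (ps ! i)"
  by (simp add: field_def)

lemma disp_nth: "i < length ps \<Longrightarrow> k < length (ps ! i) \<Longrightarrow> disp ps w ! i ! k = ps ! i ! k + w i k"
  by (simp add: disp_def)

lemma vtx_field:
  "ps ! i \<noteq> [] \<Longrightarrow> vtx (field ps w i) k = w i (nat (k mod int (length (ps ! i))))"
  using nat_mod_length_less[of "ps ! i" k] by (simp add: vtx_def field_def)

lemma vtx_disp:
  "i < length ps \<Longrightarrow> ps ! i \<noteq> [] \<Longrightarrow> vtx (disp ps w ! i) k = vtx (ps ! i) k + vtx (field ps w i) k"
  using nat_mod_length_less[of "ps ! i" k] by (simp add: vtx_def disp_nth field_def)

lemma curve_disp:
  "i < length ps \<Longrightarrow> ps ! i \<noteq> [] \<Longrightarrow>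
    curve (disp ps w ! i) t = curve (ps ! i) t + curve (field ps w i) t"
  using curve_lincomb[of "disp ps w ! i" "ps ! i" 1 "field ps w i"] by (simp add: vtx_disp)

lemma curve_field_scale:
  assumes "ps ! i \<noteq> []"
  shows "curve (field ps (\<lambda>i k. s *\<^sub>R w i k) i) t = s *\<^sub>R curve (field ps w i) t"
  by (simp add: curve_def edge_def vtx_field assms algebra_simps)

lemma disp_disp: "disp (disp ps u) w = disp ps (\<lambda>i k. u i k + w i k)"
  by (auto simp: disp_def intro!: nth_equalityI)

lemma disp_to:
  assumes "length ps = length qs" "\<And>i. i < length ps \<Longrightarrow> length (ps ! i) = length (qs ! i)"
  shows "disp ps (\<lambda>i k. qs ! i ! k - ps ! i ! k) = qs"
  using assms by (auto simp: disp_def intro!: nth_equalityI)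

lemma Nil_notin_disp: "[] \<notin> set ps \<Longrightarrow> [] \<notin> set (disp ps w)"
  by (auto simp: in_set_conv_nth disp_def)

subsection \<open>Ambient isotopies\<close>

text \<open>McShane's construction: the infimum of the cones \<open>g y + L * dist x y\<close> over
  \<open>y\<close> in \<open>K\<close> is again \<open>L\<close>-Lipschitz and agrees with
  \<open>g\<close> on \<open>K\<close>.\<close>

lemma lipschitz_real_extension:
  fixes g :: "'a::metric_space \<Rightarrow> real"
  assumes "L \<ge> 0" and g: "\<And>x y. x \<in> K \<Longrightarrow> y \<in> K \<Longrightarrow> \<bar>g x - g y\<bar> \<le> L * dist x y"
  obtains G where "\<And>x. x \<in> K \<Longrightarrow> G x = g x" "\<And>x y. \<bar>G x - G y\<bar> \<le> L * dist x y"
proof (cases "K = {}")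
  case True
  then show ?thesis using that[of "\<lambda>_. 0"] \<open>L \<ge> 0\<close> by simp
next
  case False
  define G where "G = (\<lambda>x. INF y\<in>K. g y + L * dist x y)"
  have bdd: "bdd_below ((\<lambda>y. g y + L * dist x y) ` K)" for x
  proof -
    obtain y0 where y0: "y0 \<in> K" using False by blast
    have "g y0 - L * dist x y0 \<le> g y + L * dist x y" if "y \<in> K" for y
    proof -
      have "g y0 - g y \<le> L * dist y0 y" using g[OF y0 that] by linarith
      also have "\<dots> \<le> L * (dist x y0 + dist x y)"
        using \<open>L \<ge> 0\<close> by (intro mult_left_mono) (metis dist_commute dist_triangle)
      finally show ?thesis by (simp add: algebra_simps)
    qed
    then show ?thesis by (intro bdd_belowI[of _ "g y0 - L * dist x y0"]) blast
  qed
  have "G x = g x" if "x \<in> K" for x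
  proof (rule antisym)
    show "G x \<le> g x" unfolding G_def using cINF_lower[OF bdd that, of x] by simp
    show "g x \<le> G x" unfolding G_def
      using g that by (intro cINF_greatest[OF False]) (smt (verit))
  qed
  moreover have "G x \<le> G y + L * dist x y" for x y
  proof -
    have "G x - L * dist x y \<le> g z + L * dist y z" if "z \<in> K" for z
    proof -
      have "G x \<le> g z + L * dist x z" unfolding G_def by (rule cINF_lower[OF bdd that])
      moreover have "L * dist x z \<le> L * (dist x y + dist y z)"
        using \<open>L \<ge> 0\<close> by (intro mult_left_mono dist_triangle)
      ultimately show ?thesis by (simp add: algebra_simps)
    qed
    then have "G x - L * dist x y \<le> G y" unfolding G_def[of ] by (intro cINF_greatest[OF False])
    then show ?thesis by simp
  qed
  then have "\<bar>G x - G y\<bar> \<le> L * dist x y" for x y by (smt (verit) dist_commute)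
  ultimately show ?thesis using that by blast
qed

text \<open>The three coordinates are extended separately, each with constant 1/4. Adding them up
  costs a factor 3, and 3/4 is still a contraction constant; this is where the 1/4 comes
  from.\<close>

lemma lipschitz_point_extension:
  fixes g :: "point \<Rightarrow> point"
  assumes g: "\<And>x y. x \<in> K \<Longrightarrow> y \<in> K \<Longrightarrow> norm (g x - g y) \<le> dist x y / 4"
  obtains G where "\<And>x. x \<in> K \<Longrightarrow> G x = g x" "\<And>x y. norm (G x - G y) \<le> 3 / 4 * dist x y"
proof -
  have "\<exists>G. (\<forall>x\<in>K. G x = g x $ i) \<and> (\<forall>x y. \<bar>G x - G y\<bar> \<le> 1 / 4 * dist x y)" for i
  proof -
    have "\<bar>g x $ i - g y $ i\<bar> \<le> 1 / 4 * dist x y" if "x \<in> K" "y \<in> K" for x y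
      using component_le_norm_cart[of "g x - g y" i] g[OF that] by simp
    then show ?thesis
      using lipschitz_real_extension[of "1 / 4" K "\<lambda>x. g x $ i"] by (metis zero_le_divide_1_iff zero_le_numeral)
  qed
  then obtain G where G: "\<And>i x. x \<in> K \<Longrightarrow> G i x = g x $ i"
    "\<And>i x y. \<bar>G i x - G i y\<bar> \<le> 1 / 4 * dist x y" by metis
  have "norm ((\<chi> i. G i x) - (\<chi> i. G i y)) \<le> 3 / 4 * dist x y" for x y
  proof -
    have "norm ((\<chi> i. G i x) - (\<chi> i. G i y)) \<le> (\<Sum>i\<in>UNIV. \<bar>((\<chi> i. G i x) - (\<chi> i. G i y)) $ i\<bar>)"
      by (rule norm_le_l1_cart)
    also have "\<dots> \<le> (\<Sum>i\<in>(UNIV :: 3 set). 1 / 4 * dist x y)"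
      using G(2) by (intro sum_mono) simp
    finally show ?thesis by simp
  qed
  then show ?thesis using that[of "\<lambda>x. \<chi> i. G i x"] G(1) by (simp add: vec_eq_iff)
qed

text \<open>The inverse is found as a fixed point: \<open>x + g x = y\<close> iff \<open>x\<close> is fixed by the contraction \<open>x \<mapsto> y - g x\<close>.\<close>

lemma homeomorphism_add_contraction:
  fixes g :: "point \<Rightarrow> point"
  assumes g: "\<And>x y. norm (g x - g y) \<le> 3 / 4 * dist x y"
  shows "\<exists>h. homeomorphism UNIV UNIV (\<lambda>x. x + g x) h"
proof -
  let ?f = "\<lambda>x. x + g x"
  have exp: "dist x y \<le> 4 * dist (?f x) (?f y)" for x y
  proof -
    have "norm (x - y) \<le> norm (?f x - ?f y) + norm (g x - g y)"
      using norm_triangle_ineq4[of "?f x - ?f y" "g x - g y"] by simp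
    then show ?thesis using g[of x y] by (simp add: dist_norm)
  qed
  have surj: "\<exists>x. ?f x = y" for y
  proof -
    have "\<exists>!x. y - g x = x"
    proof (rule banach_fix_type[of "3 / 4"])
      show "\<forall>x z. dist (y - g x) (y - g z) \<le> 3 / 4 * dist x z"
        using g by (simp add: dist_norm norm_minus_commute)
    qed simp_all
    then show ?thesis by (metis add.commute diff_add_cancel)
  qed
  have inj: "inj ?f" using exp by (intro injI) (metis dist_eq_0_iff mult_zero_right dist_le_zero_iff)
  have c1: "continuous_on UNIV ?f"
  proof -
    have "dist (?f x) (?f y) \<le> 2 * dist x y" for x y
    proof -
      have "norm (?f x - ?f y) \<le> norm (x - y) + norm (g x - g y)"
        using norm_triangle_ineq[of "x - y" "g x - g y"] by (simp add: algebra_simps)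
      then show ?thesis using g[of x y] zero_le_dist[of x y] unfolding dist_norm by linarith
    qed
    then have "2-lipschitz_on UNIV ?f" by (simp add: lipschitz_on_def)
    then show ?thesis by (rule lipschitz_on_continuous_on)
  qed
  define h where "h = inv ?f"
  have fh: "?f (h y) = y" for y using surj[of y] unfolding h_def by (meson f_inv_into_f rangeI surj_def)
  have hf: "h (?f x) = x" for x unfolding h_def using inj by (rule inv_f_f)
  have "dist (h x) (h y) \<le> 4 * dist x y" for x y using exp[of "h x" "h y"] fh by simp
  then have "4-lipschitz_on UNIV h" by (simp add: lipschitz_on_def)
  then have c2: "continuous_on UNIV h" by (rule lipschitz_on_continuous_on)
  have "homeomorphism UNIV UNIV ?f h"
    by (rule homeomorphismI) (use c1 c2 fh hf in auto)
  then show ?thesis by blast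
qed

lemma ambient_isotopy_add_contraction:
  fixes g :: "point \<Rightarrow> point"
  assumes g: "\<And>x y. norm (g x - g y) \<le> 3 / 4 * dist x y"
  shows "ambient_isotopy (\<lambda>t x. x + t *\<^sub>R g x)"
  unfolding ambient_isotopy_def
proof (intro conjI ballI)
  have "(3/4)-lipschitz_on UNIV g" using g by (simp add: lipschitz_on_def dist_norm)
  then have "continuous_on UNIV g" by (rule lipschitz_on_continuous_on)
  show "continuous_on ({0..1} \<times> UNIV) (\<lambda>(t, x). x + t *\<^sub>R g x)"
    unfolding case_prod_beta
    by (intro continuous_intros continuous_on_compose2[OF \<open>continuous_on UNIV g\<close>, of _ snd]) auto
  fix t :: real assume "t \<in> {0..1}"
  then have "\<bar>t\<bar> \<le> 1" by auto
  have "norm (t *\<^sub>R g x - t *\<^sub>R g y) \<le> 3 / 4 * dist x y" for x y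
  proof -
    have "norm (t *\<^sub>R g x - t *\<^sub>R g y) = \<bar>t\<bar> * norm (g x - g y)"
      by (simp flip: scaleR_right_diff_distrib)
    also have "\<dots> \<le> norm (g x - g y)" using \<open>\<bar>t\<bar> \<le> 1\<close> by (simp add: mult_left_le_one_le)
    finally show ?thesis using g[of x y] by linarith
  qed
  then show "\<exists>h. homeomorphism UNIV UNIV (\<lambda>x. x + t *\<^sub>R g x) h"
    by (rule homeomorphism_add_contraction)
qed simp

lemma ambient_isotopy_id: "ambient_isotopy (\<lambda>t x. x)"
  using ambient_isotopy_add_contraction[of "\<lambda>x. 0"] by simp

lemma ambient_isotopy_compose:
  assumes "ambient_isotopy H" "ambient_isotopy K"
  shows "ambient_isotopy (\<lambda>t x. K t (H t x))"
  unfolding ambient_isotopy_def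
proof (intro conjI ballI)
  have H: "continuous_on ({0..1} \<times> UNIV) (\<lambda>(t, x). H t x)"
    and K: "continuous_on ({0..1} \<times> UNIV) (\<lambda>(t, x). K t x)"
    using assms by (auto simp: ambient_isotopy_def)
  have "continuous_on ({0..1} \<times> UNIV) (\<lambda>z. (fst z, (\<lambda>(t, x). H t x) z))"
    by (intro continuous_intros H)
  then have "continuous_on ({0..1} \<times> UNIV) (\<lambda>z. (\<lambda>(t, x). K t x) (fst z, (\<lambda>(t, x). H t x) z))"
    by (rule continuous_on_compose2[OF K]) auto
  then show "continuous_on ({0..1} \<times> UNIV) (\<lambda>(t, x). K t (H t x))"
    by (simp add: case_prod_beta)
  fix t :: real assume t: "t \<in> {0..1}"
  obtain g h where "homeomorphism UNIV UNIV (H t) g" "homeomorphism UNIV UNIV (K t) h"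
    using assms t by (meson ambient_isotopy_def)
  then have "homeomorphism UNIV UNIV (K t \<circ> H t) (g \<circ> h)" by (rule homeomorphism_compose)
  then show "\<exists>g. homeomorphism UNIV UNIV (\<lambda>x. K t (H t x)) g" by (auto simp: o_def)
qed (use assms in \<open>simp add: ambient_isotopy_def\<close>)

text \<open>Running an isotopy backwards: \<open>H\<^sub>1\<^sub>-\<^sub>t \<circ> H\<^sub>1\<inverse>\<close> is jointly continuous without further ado.\<close>

lemma ambient_isotopy_reverse:
  assumes "ambient_isotopy H"
  obtains K where "ambient_isotopy K" "\<And>x. K 1 (H 1 x) = x"
proof -
  obtain g where g: "homeomorphism UNIV UNIV (H 1) g"
    using assms by (fastforce simp: ambient_isotopy_def)
  have H: "continuous_on ({0..1} \<times> UNIV) (\<lambda>(t, x). H t x)" and H0: "\<And>x. H 0 x = x"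
    using assms by (auto simp: ambient_isotopy_def)
  have gH: "\<And>x. g (H 1 x) = x" and Hg: "\<And>x. H 1 (g x) = x" and cg: "continuous_on UNIV g"
    using g by (auto simp: homeomorphism_def)
  have "ambient_isotopy (\<lambda>t x. H (1 - t) (g x))"
    unfolding ambient_isotopy_def
  proof (intro conjI ballI allI)
    have "continuous_on ({0..1} \<times> UNIV) (\<lambda>z :: real \<times> point. (1 - fst z, g (snd z)))"
      by (intro continuous_intros continuous_on_compose2[OF cg]) auto
    then have "continuous_on ({0..1} \<times> UNIV)
        (\<lambda>z. (\<lambda>(t, x). H t x) ((\<lambda>z :: real \<times> point. (1 - fst z, g (snd z))) z))"
      by (rule continuous_on_compose2[OF H]) auto
    then show "continuous_on ({0..1} \<times> UNIV) (\<lambda>(t, x). H (1 - t) (g x))"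
      by (simp add: case_prod_beta)
    fix t :: real assume t: "t \<in> {0..1}"
    then have "1 - t \<in> {0..1}" by auto
    then obtain h where "homeomorphism UNIV UNIV (H (1 - t)) h"
      using assms by (meson ambient_isotopy_def)
    then have "homeomorphism UNIV UNIV (H (1 - t) \<circ> g) (H 1 \<circ> h)"
      using homeomorphism_compose[OF homeomorphism_symD[OF g]] by blast
    then show "\<exists>g'. homeomorphism UNIV UNIV (\<lambda>x. H (1 - t) (g x)) g'" by (auto simp: o_def)
  qed (simp add: Hg)
  moreover have "H (1 - 1) (g (H 1 x)) = x" for x using H0 gH by simp
  ultimately show ?thesis using that by blast
qed

lemma isotopic_trans:
  assumes "isotopic L M" "isotopic M N"
  shows "isotopic L N"
proof -
  obtain H \<phi> where H: "ambient_isotopy H"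
    and \<phi>: "\<And>i. i < length (fst L) \<Longrightarrow> continuous_on UNIV (\<phi> i) \<and> strict_mono (\<phi> i) \<and>
      (\<forall>t. \<phi> i (t + real (length (fst L ! i))) = \<phi> i t + real (length (fst M ! i))) \<and>
      (\<forall>t. H 1 (curve (fst L ! i) t) = curve (fst M ! i) (\<phi> i t))"
    using assms(1) unfolding isotopic_def by metis
  obtain K \<psi> where K: "ambient_isotopy K"
    and \<psi>: "\<And>i. i < length (fst M) \<Longrightarrow> continuous_on UNIV (\<psi> i) \<and> strict_mono (\<psi> i) \<and>
      (\<forall>t. \<psi> i (t + real (length (fst M ! i))) = \<psi> i t + real (length (fst N ! i))) \<and>
      (\<forall>t. K 1 (curve (fst M ! i) t) = curve (fst N ! i) (\<psi> i t))"
    using assms(2) unfolding isotopic_def by metis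
  have len: "length (fst L) = length (fst M)" "length (fst M) = length (fst N)" "snd L = snd N"
    using assms by (auto simp: isotopic_def)
  show ?thesis
    unfolding isotopic_def
  proof (intro conjI exI[of _ "\<lambda>t x. K t (H t x)"] allI impI)
    fix i assume i: "i < length (fst L)"
    then have i': "i < length (fst M)" using len by simp
    have "continuous_on UNIV (\<lambda>t. \<psi> i (\<phi> i t))"
      using \<phi>[OF i] \<psi>[OF i'] by (metis continuous_on_compose2 subset_UNIV)
    moreover have "strict_mono (\<lambda>t. \<psi> i (\<phi> i t))"
      using \<phi>[OF i] \<psi>[OF i'] by (auto simp: strict_mono_def)
    ultimately show "\<exists>\<xi>. continuous_on UNIV \<xi> \<and> strict_mono \<xi> \<and>
         (\<forall>t. \<xi> (t + real (length (fst L ! i))) = \<xi> t + real (length (fst N ! i))) \<and>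
         (\<forall>t. K 1 (H 1 (curve (fst L ! i) t)) = curve (fst N ! i) (\<xi> t))"
      using \<phi>[OF i] \<psi>[OF i'] by (intro exI[of _ "\<lambda>t. \<psi> i (\<phi> i t)"]) simp
  qed (use len ambient_isotopy_compose[OF H K] in auto)
qed

text \<open>Since \<open>m > 0\<close>, the shift rule makes \<phi> unbounded in both directions,
  and the intermediate value theorem gives surjectivity. \<open>isotopic_sym\<close> needs the
  inverses of such circle reparametrisations.\<close>

lemma strict_mono_affine_shift_inverse:
  fixes \<phi> :: "real \<Rightarrow> real"
  assumes \<phi>: "continuous_on UNIV \<phi>" "strict_mono \<phi>" "\<And>t. \<phi> (t + real n) = \<phi> t + real m" "m > 0"
  obtains \<psi> where "continuous_on UNIV \<psi>" "strict_mono \<psi>" "\<And>t. \<psi> (t + real m) = \<psi> t + real n"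
    "\<And>t. \<phi> (\<psi> t) = t"
proof -
  have mult: "\<phi> (t + real k * real n) = \<phi> t + real k * real m" for t k
  proof (induction k)
    case (Suc k)
    have "\<phi> (t + real (Suc k) * real n) = \<phi> (t + real k * real n + real n)" by (simp add: algebra_simps)
    also have "\<dots> = \<phi> t + real k * real m + real m" unfolding \<phi>(3) Suc ..
    finally show ?case by (simp add: algebra_simps)
  qed simp
  have surj: "\<exists>x. \<phi> x = y" for y
  proof -
    obtain k :: nat where k: "real k > \<bar>y - \<phi> 0\<bar>" using reals_Archimedean2 by blast
    have "real k \<le> real k * real m"
      using \<open>m > 0\<close> mult_left_mono[of 1 "real m" "real k"] by simp
    then have km: "real k * real m > \<bar>y - \<phi> 0\<bar>" using k by linarith
    have "\<phi> (0 - real k * real n) = \<phi> 0 - real k * real m"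
      using mult[of "- (real k * real n)" k] by simp
    then have "\<phi> (0 - real k * real n) \<le> y" using km by linarith
    moreover have "y \<le> \<phi> (0 + real k * real n)" using mult[of 0 k] km by simp
    moreover have "0 - real k * real n \<le> 0 + real k * real n" by simp
    moreover have "continuous_on {0 - real k * real n..0 + real k * real n} \<phi>"
      using \<phi>(1) by (rule continuous_on_subset) simp
    ultimately show ?thesis using IVT'[of \<phi> "0 - real k * real n" y "0 + real k * real n"] by blast
  qed
  have inj: "inj \<phi>" using \<phi>(2) by (rule strict_mono_imp_inj_on)
  define \<psi> where "\<psi> = inv \<phi>"
  have f\<psi>: "\<phi> (\<psi> t) = t" for t using surj[of t] unfolding \<psi>_def by (meson f_inv_into_f rangeI surj_def)
  have \<psi>f: "\<psi> (\<phi> t) = t" for t unfolding \<psi>_def using inj by (rule inv_f_f)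
  have mono: "strict_mono \<psi>"
  proof (rule strict_monoI)
    fix x y :: real assume "x < y"
    then have "\<phi> (\<psi> x) < \<phi> (\<psi> y)" unfolding f\<psi> .
    then show "\<psi> x < \<psi> y" using \<phi>(2) by (simp add: strict_mono_less)
  qed
  have "continuous_on UNIV \<psi>"
  proof -
    have "isCont \<psi> y" for y
      unfolding continuous_at_eps_delta
    proof (intro allI impI)
      fix e :: real assume "e > 0"
      have "\<phi> (\<psi> y - e) < \<phi> (\<psi> y)" "\<phi> (\<psi> y) < \<phi> (\<psi> y + e)"
        using \<phi>(2) \<open>e > 0\<close> by (simp_all add: strict_mono_less)
      then have "\<phi> (\<psi> y - e) < y" "y < \<phi> (\<psi> y + e)" unfolding f\<psi> .
      moreover have "dist (\<psi> z) (\<psi> y) < e" if "\<phi> (\<psi> y - e) < z" "z < \<phi> (\<psi> y + e)" for z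
      proof -
        have "\<phi> (\<psi> y - e) < \<phi> (\<psi> z)" "\<phi> (\<psi> z) < \<phi> (\<psi> y + e)" using that f\<psi>[of z] by simp_all
        then have "\<psi> y - e < \<psi> z" "\<psi> z < \<psi> y + e" using \<phi>(2) by (simp_all add: strict_mono_less)
        then show ?thesis by (auto simp: dist_real_def)
      qed
      ultimately show "\<exists>d>0. \<forall>z. dist z y < d \<longrightarrow> dist (\<psi> z) (\<psi> y) < e"
        by (intro exI[of _ "min (y - \<phi> (\<psi> y - e)) (\<phi> (\<psi> y + e) - y)"]) (auto simp: dist_real_def)
    qed
    then show ?thesis by (simp add: continuous_at_imp_continuous_on)
  qed
  moreover have "\<psi> (t + real m) = \<psi> t + real n" for t
    using \<phi>(3)[of "\<psi> t"] \<psi>f[of "\<psi> t + real n"] unfolding f\<psi> by simp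
  ultimately show ?thesis using that mono f\<psi> by blast
qed

lemma isotopic_sym:
  assumes "isotopic L M" "[] \<notin> set (fst M)"
  shows "isotopic M L"
proof -
  obtain H where H: "ambient_isotopy H"
    and \<phi>: "\<And>i. i < length (fst L) \<Longrightarrow> \<exists>\<phi>. continuous_on UNIV \<phi> \<and> strict_mono \<phi> \<and>
      (\<forall>t. \<phi> (t + real (length (fst L ! i))) = \<phi> t + real (length (fst M ! i))) \<and>
      (\<forall>t. H 1 (curve (fst L ! i) t) = curve (fst M ! i) (\<phi> t))"
    using assms(1) unfolding isotopic_def by metis
  obtain K where K: "ambient_isotopy K" "\<And>x. K 1 (H 1 x) = x"
    using ambient_isotopy_reverse[OF H] by blast
  have len: "length (fst L) = length (fst M)" "snd L = snd M" using assms by (auto simp: isotopic_def)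
  show ?thesis
    unfolding isotopic_def
  proof (intro conjI exI[of _ K] allI impI)
    fix i assume i: "i < length (fst M)"
    obtain \<phi> where p: "continuous_on UNIV \<phi>" "strict_mono \<phi>"
      "\<And>t. \<phi> (t + real (length (fst L ! i))) = \<phi> t + real (length (fst M ! i))"
      "\<And>t. H 1 (curve (fst L ! i) t) = curve (fst M ! i) (\<phi> t)"
      using \<phi>[of i] i len by auto
    have "length (fst M ! i) > 0" using assms(2) i by (metis length_greater_0_conv nth_mem)
    then obtain \<psi> where \<psi>: "continuous_on UNIV \<psi>" "strict_mono \<psi>"
      "\<And>t. \<psi> (t + real (length (fst M ! i))) = \<psi> t + real (length (fst L ! i))"
      "\<And>t. \<phi> (\<psi> t) = t"
      using strict_mono_affine_shift_inverse[OF p(1-3)] by metis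
    have "K 1 (curve (fst M ! i) t) = curve (fst L ! i) (\<psi> t)" for t
      using p(4)[of "\<psi> t"] \<psi>(4)[of t] K(2) by metis
    then show "\<exists>\<phi>. continuous_on UNIV \<phi> \<and> strict_mono \<phi> \<and>
         (\<forall>t. \<phi> (t + real (length (fst M ! i))) = \<phi> t + real (length (fst L ! i))) \<and>
         (\<forall>t. K 1 (curve (fst M ! i) t) = curve (fst L ! i) (\<phi> t))"
      using \<psi> by blast
  qed (use len K(1) in auto)
qed

subsection \<open>Isotopy extension for polygons\<close>

text \<open>Curves are parametrised by all of \<real>, so this is equality of points of the
  parameter circles. Working modulo the period avoids case distinctions at the base vertex.\<close>

definition same_param :: "point list list \<Rightarrow> nat \<Rightarrow> real \<Rightarrow> nat \<Rightarrow> real \<Rightarrow> bool" where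
  "same_param ps i s j t \<longleftrightarrow> i = j \<and> (\<exists>z::int. t = s + of_int z * real (length (ps ! i)))"

definition embedded :: "point list list \<Rightarrow> bool" where
  "embedded ps \<longleftrightarrow> [] \<notin> set ps \<and> (\<forall>i < length ps. \<forall>j < length ps. \<forall>s t.
     curve (ps ! i) s = curve (ps ! j) t \<longrightarrow> same_param ps i s j t)"

lemma same_param_disp [simp]: "i < length ps \<Longrightarrow> same_param (disp ps w) i s j t = same_param ps i s j t"
  by (simp add: same_param_def)

text \<open>The circumference of a parameter circle is an integer, so 1/2 is never a multiple of it.
  This single distance is all that the local injectivity estimate asks about.\<close>

lemma not_same_param_close:
  assumes "\<bar>s - t\<bar> = 1 / 2" shows "\<not> same_param ps i s i t"
proof
  assume "same_param ps i s i t"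
  then obtain z :: int where "t = s + of_int z * real (length (ps ! i))"
    by (auto simp: same_param_def)
  then have z: "t - s = of_int z * real (length (ps ! i))" by simp
  then have "t - s = of_int (z * int (length (ps ! i)))" by simp
  then obtain m :: int where "t - s = of_int m" by blast
  then have "s - t = - of_int m" by simp
  then have "\<bar>real_of_int m\<bar> = 1 / 2" using assms by (metis abs_minus_cancel)
  then have "2 * \<bar>real_of_int m\<bar> = 1" by linarith
  then have "real_of_int (2 * \<bar>m\<bar>) = of_int 1" by (simp only: of_int_mult of_int_abs of_int_numeral of_int_1)
  then have "2 * \<bar>m\<bar> = 1" by (simp only: of_int_eq_iff)
  then show False by presburger
qed

text \<open>Merges constants found separately for each component, corner or double point: the
  minimum serves for all, because \<open>P i\<close> allows the constant to shrink.\<close>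

lemma uniform_positive:
  assumes "finite I" "\<And>i. i \<in> I \<Longrightarrow> \<exists>m>0::real. P i m"
    "\<And>i m m'. P i m \<Longrightarrow> 0 < m' \<Longrightarrow> m' \<le> m \<Longrightarrow> P i m'"
  shows "\<exists>m>0. \<forall>i\<in>I. P i m"
  using assms(1,2)
proof (induction I rule: finite_induct)
  case empty
  show ?case by (auto intro: exI[of _ 1])
next
  case (insert x F)
  obtain m1 where "m1 > 0" "P x m1" using insert.prems[of x] by blast
  moreover obtain m2 where "m2 > 0" "\<forall>i\<in>F. P i m2" using insert.IH insert.prems by blast
  ultimately have "0 < min m1 m2" "P x (min m1 m2)" "\<And>i. i \<in> F \<Longrightarrow> P i (min m1 m2)"
    using assms(3)[of x m1 "min m1 m2"] assms(3)[of _ m2 "min m1 m2"] by auto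
  then show ?case by (intro exI[of _ "min m1 m2"]) blast
qed

lemma compact_positive_lower_bound:
  fixes f :: "'a::topological_space \<Rightarrow> real"
  assumes "compact S" "continuous_on S f" "\<And>x. x \<in> S \<Longrightarrow> 0 < f x"
  shows "\<exists>m>0. \<forall>x\<in>S. m \<le> f x"
proof (cases "S = {}")
  case True
  then show ?thesis by (auto intro: exI[of _ 1])
next
  case False
  then obtain x where "x \<in> S" "\<forall>y\<in>S. f x \<le> f y" using continuous_attains_inf[OF assms(1) _ assms(2)] by blast
  then show ?thesis using assms(3) by blast
qed

text \<open>
  Only \<open>\<alpha> + \<beta> = 1 / 2\<close> matters, because the bound is homogeneous.
\<close>

lemma homogeneous_lower_bound:
  fixes e f :: point
  assumes "\<And>\<alpha> \<beta>. 0 \<le> \<alpha> \<Longrightarrow> 0 \<le> \<beta> \<Longrightarrow> \<alpha> + \<beta> = 1 / 2 \<Longrightarrow> m \<le> norm (\<alpha> *\<^sub>R e + \<beta> *\<^sub>R f)"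
    "0 \<le> \<alpha>" "0 \<le> \<beta>"
  shows "2 * m * (\<alpha> + \<beta>) \<le> norm (\<alpha> *\<^sub>R e + \<beta> *\<^sub>R f)"
proof (cases "\<alpha> + \<beta> = 0")
  case False
  then have pos: "\<alpha> + \<beta> > 0" using assms by linarith
  define r where "r = 1 / (2 * (\<alpha> + \<beta>))"
  have "r > 0" using pos by (simp add: r_def)
  have "m \<le> norm ((r * \<alpha>) *\<^sub>R e + (r * \<beta>) *\<^sub>R f)"
  proof (rule assms(1))
    have "r * (\<alpha> + \<beta>) = 1 / 2" using pos by (simp add: r_def)
    then show "r * \<alpha> + r * \<beta> = 1 / 2" by (simp add: distrib_left)
  qed (use assms \<open>r > 0\<close> in auto)
  also have "(r * \<alpha>) *\<^sub>R e + (r * \<beta>) *\<^sub>R f = r *\<^sub>R (\<alpha> *\<^sub>R e + \<beta> *\<^sub>R f)" by (simp add: algebra_simps)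
  finally have "m \<le> r * norm (\<alpha> *\<^sub>R e + \<beta> *\<^sub>R f)" using \<open>r > 0\<close> by simp
  then show ?thesis using pos by (simp add: r_def field_simps)
qed (use assms in auto)

lemma cyclic_representative:
  fixes a b :: real and n :: nat
  assumes "n > 0"
  obtains z :: int where "0 \<le> b - a + of_int z * real n" "b - a + of_int z * real n < real n"
proof
  define z where "z = - \<lfloor>(b - a) / real n\<rfloor>"
  have "of_int (- z) \<le> (b - a) / real n" "(b - a) / real n < of_int (- z) + 1" unfolding z_def by linarith+
  then have "of_int (- z) * real n \<le> b - a" "b - a < (of_int (- z) + 1) * real n"
    using assms by (simp_all only: pos_le_divide_eq pos_divide_less_eq of_nat_0_less_iff)
  then show "0 \<le> b - a + of_int z * real n" "b - a + of_int z * real n < real n"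
    by (simp_all add: algebra_simps)
qed

text \<open>The index \<open>k'\<close> is chosen before \<open>q\<close>, so that a polygon and its
  displacement field are reduced to the same one of finitely many corners.\<close>

lemma vtx_cyclic_edge:
  assumes "p \<noteq> []"
  shows "\<exists>k'\<in>{0..<int (length p)}. \<forall>q. length q = length p \<longrightarrow>
    vtx q k = vtx q k' \<and> vtx q (k + 1) = vtx q (k' + 1) \<and> vtx q (k + 2) = vtx q (k' + 2)"
proof
  let ?n = "int (length p)"
  show "k mod ?n \<in> {0..<?n}" using assms by simp
  have k: "k = k mod ?n + (k div ?n) * ?n" by simp
  have "vtx q (k + m) = vtx q (k mod ?n + m)" if "length q = length p" for q m
    using vtx_add_multiple[of q "k mod ?n + m" "k div ?n"] that k by (metis add.assoc add.commute)
  from this[of _ 0] this[of _ 1] this[of _ 2] show "\<forall>q. length q = length p \<longrightarrow> vtx q k = vtx q (k mod ?n) \<and>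
      vtx q (k + 1) = vtx q (k mod ?n + 1) \<and> vtx q (k + 2) = vtx q (k mod ?n + 2)" by simp
qed

text \<open>A chord over a parameter interval of length at most 1 is a nonnegative combination of
  two adjacent edges, hence homogeneous in the parameter length. So it suffices that points at
  parameter distance 1/2 differ, which is true even of singular links, whose double points sit at
  integers. Compactness in the time and in the coefficient, at each of finitely many corners, gives
  the constant.\<close>

lemma uniform_local_injectivity:
  fixes w :: "nat \<Rightarrow> nat \<Rightarrow> point"
  assumes ne: "[] \<notin> set ps"
  defines "h \<equiv> \<lambda>i. curve (field ps w i)"
  defines "c \<equiv> \<lambda>s i a. curve (ps ! i) a + s *\<^sub>R h i a"
  assumes inj: "\<And>s i a b. 0 \<le> s \<Longrightarrow> s \<le> 1 \<Longrightarrow> i < length ps \<Longrightarrow> \<bar>a - b\<bar> = 1/2 \<Longrightarrow> c s i a \<noteq> c s i b"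
  shows "\<exists>m>0. \<forall>s\<in>{0..1}. \<forall>i<length ps. \<forall>a b. \<bar>a - b\<bar> \<le> 1 \<longrightarrow>
    m * \<bar>a - b\<bar> \<le> norm (c s i a - c s i b)"
proof -
  let ?l = "length ps"
  have nz: "ps ! i \<noteq> []" if "i < ?l" for i using ne that nth_mem by metis
  let ?e = "\<lambda>s i k. (vtx (ps ! i) (k + 1) - vtx (ps ! i) k) + s *\<^sub>R (vtx (field ps w i) (k + 1) - vtx (field ps w i) k)"
  \<comment> \<open>The chords of parameter length 1/2 around vertex \<open>k + 1\<close> realise
    all pairs of coefficients with sum 1/2.\<close>
  have cd: "c s i (of_int k + 1 + b) - c s i (of_int k + 1 - a) = a *\<^sub>R ?e s i k + b *\<^sub>R ?e s i (k + 1)"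
    if "0 \<le> a" "0 \<le> b" "a + b = 1/2" for s i k a b
  proof -
    have "curve p (of_int k + 1 + b) - curve p (of_int k + 1 - a) =
        a *\<^sub>R (vtx p (k + 1) - vtx p k) + b *\<^sub>R (vtx p (k + 1 + 1) - vtx p (k + 1))" for p
    proof -
      have 1: "curve p (of_int k + 1 - a) = vtx p k + (of_int k + 1 - a - of_int k) *\<^sub>R (vtx p (k + 1) - vtx p k)"
        using that by (intro curve_on_edge) auto
      have 2: "curve p (of_int k + 1 + b) = vtx p (k + 1) +
          (of_int k + 1 + b - of_int (k + 1)) *\<^sub>R (vtx p (k + 1 + 1) - vtx p (k + 1))"
        using that by (intro curve_on_edge) auto
      show ?thesis unfolding 1 2 by (simp add: vec_eq_iff algebra_simps)
    qed
    note eq = this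
    have "c s i (of_int k + 1 + b) - c s i (of_int k + 1 - a) =
        (curve (ps ! i) (of_int k + 1 + b) - curve (ps ! i) (of_int k + 1 - a)) +
        s *\<^sub>R (curve (field ps w i) (of_int k + 1 + b) - curve (field ps w i) (of_int k + 1 - a))"
      unfolding c_def h_def by (simp add: algebra_simps)
    then show ?thesis unfolding eq by (simp add: algebra_simps)
  qed
  have "\<exists>m>0. \<forall>s\<in>{0..1}. \<forall>\<alpha>\<in>{0..1/2}. m \<le> norm (\<alpha> *\<^sub>R ?e s i k + (1/2 - \<alpha>) *\<^sub>R ?e s i (k + 1))"
    if i: "i < ?l" for i k
  proof -
    let ?f = "\<lambda>z :: real \<times> real. norm (snd z *\<^sub>R ?e (fst z) i k + (1/2 - snd z) *\<^sub>R ?e (fst z) i (k + 1))"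
    have "\<exists>m>0. \<forall>z\<in>{0..1} \<times> {0..1/2}. m \<le> ?f z"
    proof (rule compact_positive_lower_bound)
      fix z :: "real \<times> real" assume z: "z \<in> {0..1} \<times> {0..1/2}"
      then have "c (fst z) i (of_int k + 1 + (1/2 - snd z)) \<noteq> c (fst z) i (of_int k + 1 - snd z)"
        using i by (intro inj) auto
      moreover have "c (fst z) i (of_int k + 1 + (1/2 - snd z)) - c (fst z) i (of_int k + 1 - snd z) =
          snd z *\<^sub>R ?e (fst z) i k + (1/2 - snd z) *\<^sub>R ?e (fst z) i (k + 1)"
        using z by (intro cd) auto
      ultimately show "0 < ?f z" by (metis eq_iff_diff_eq_0 zero_less_norm_iff)
    qed (intro compact_Times continuous_intros; simp)+
    then obtain m where "m > 0" "\<forall>z\<in>{0..1} \<times> {0..1/2}. m \<le> ?f z" by blast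
    then show ?thesis by (intro exI[of _ m]) auto
  qed
  then have "\<exists>m>0. \<forall>s\<in>{0..1}. \<forall>\<alpha>\<in>{0..1/2}. m \<le> norm (\<alpha> *\<^sub>R ?e s (fst x) (snd x) + (1/2 - \<alpha>) *\<^sub>R ?e s (fst x) (snd x + 1))"
    if "x \<in> (SIGMA i:{..<?l}. {0..<int (length (ps ! i))})" for x using that by auto
  then have "\<exists>m>0. \<forall>x\<in>(SIGMA i:{..<?l}. {0..<int (length (ps ! i))}). \<forall>s\<in>{0..1}. \<forall>\<alpha>\<in>{0..1/2}.
      m \<le> norm (\<alpha> *\<^sub>R ?e s (fst x) (snd x) + (1/2 - \<alpha>) *\<^sub>R ?e s (fst x) (snd x + 1))"
    by (rule uniform_positive[where P = "\<lambda>x m. \<forall>s\<in>{0..1}. \<forall>\<alpha>\<in>{0..1/2}. m \<le> norm (\<alpha> *\<^sub>R ?e s (fst x) (snd x) + (1/2 - \<alpha>) *\<^sub>R ?e s (fst x) (snd x + 1))", rotated 1]) (auto intro: order_trans)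
  then obtain m where m: "m > 0" "\<And>i k s \<alpha>. i < ?l \<Longrightarrow> k \<in> {0..<int (length (ps ! i))} \<Longrightarrow> s \<in> {0..1} \<Longrightarrow> \<alpha> \<in> {0..1/2} \<Longrightarrow>
      m \<le> norm (\<alpha> *\<^sub>R ?e s i k + (1/2 - \<alpha>) *\<^sub>R ?e s i (k + 1))" by fastforce
  have local: "2 * m * \<bar>a - b\<bar> \<le> norm (c s i a - c s i b)" if "\<bar>a - b\<bar> \<le> 1" "i < ?l" "s \<in> {0..1}" for a b s i
  proof -
    have *: "2 * m * (b - a) \<le> norm (c s i b - c s i a)" if ab: "a \<le> b" "b \<le> a + 1" for a b
    proof -
      obtain k \<alpha> \<beta> where k: "0 \<le> \<alpha>" "0 \<le> \<beta>" "\<alpha> + \<beta> = b - a"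
        and eq: "\<And>p. curve p b - curve p a = \<alpha> *\<^sub>R (vtx p (k + 1) - vtx p k) + \<beta> *\<^sub>R (vtx p (k + 2) - vtx p (k + 1))"
        using curve_diff[OF ab] by blast
      obtain k' where k': "k' \<in> {0..<int (length (ps ! i))}" and
        q: "\<And>q. length q = length (ps ! i) \<Longrightarrow> vtx q k = vtx q k' \<and> vtx q (k + 1) = vtx q (k' + 1) \<and> vtx q (k + 2) = vtx q (k' + 2)"
        using vtx_cyclic_edge[OF nz[OF \<open>i < ?l\<close>], of k] by blast
      have "c s i b - c s i a = (curve (ps ! i) b - curve (ps ! i) a) + s *\<^sub>R (curve (field ps w i) b - curve (field ps w i) a)"
        unfolding c_def h_def by (simp add: algebra_simps)
      also have "\<dots> = \<alpha> *\<^sub>R ?e s i k' + \<beta> *\<^sub>R ?e s i (k' + 1)"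
        unfolding eq using q[of "ps ! i"] q[of "field ps w i"] by (simp add: algebra_simps)
      finally have d: "c s i b - c s i a = \<alpha> *\<^sub>R ?e s i k' + \<beta> *\<^sub>R ?e s i (k' + 1)" .
      have "2 * m * (\<alpha> + \<beta>) \<le> norm (\<alpha> *\<^sub>R ?e s i k' + \<beta> *\<^sub>R ?e s i (k' + 1))"
      proof (rule homogeneous_lower_bound[OF _ k(1,2)])
        fix x y :: real assume xy: "0 \<le> x" "0 \<le> y" "x + y = 1/2"
        then have y: "y = 1/2 - x" by simp
        show "m \<le> norm (x *\<^sub>R ?e s i k' + y *\<^sub>R ?e s i (k' + 1))"
          unfolding y using m(2)[OF \<open>i < ?l\<close> k' \<open>s \<in> {0..1}\<close>, of x] xy by simp
      qed
      then show ?thesis using k(3) d by simp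
    qed
    show ?thesis
    proof (cases "a \<le> b")
      case True
      then have "2 * m * (b - a) \<le> norm (c s i b - c s i a)" using that(1) by (intro *) auto
      then show ?thesis using True by (simp add: norm_minus_commute)
    next
      case False
      then have "2 * m * (a - b) \<le> norm (c s i a - c s i b)" using that(1) by (intro *) auto
      then show ?thesis using False by simp
    qed
  qed
  then show ?thesis using m(1) by (intro exI[of _ "2 * m"]) simp
qed

text \<open>This makes the displacement a Lipschitz function of the position in space, uniformly in
  the time \<open>s\<close>. For close parameters, the linear lower bound on chords meets the
  Lipschitz bound on the field; all other pairs of points keep a positive distance by compactness,
  while the field is bounded.\<close>

lemma uniform_chord_arc:
  assumes ne: "[] \<notin> set ps"
    and emb: "\<And>s. 0 \<le> s \<Longrightarrow> s \<le> 1 \<Longrightarrow> embedded (disp ps (\<lambda>i k. s *\<^sub>R w i k))"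
  defines "h \<equiv> \<lambda>i. curve (field ps w i)"
  defines "c \<equiv> \<lambda>s i a. curve (ps ! i) a + s *\<^sub>R h i a"
  shows "\<exists>\<gamma>>0. \<forall>s\<in>{0..1}. \<forall>i<length ps. \<forall>j<length ps. \<forall>a b.
    \<gamma> * norm (h i a - h j b) \<le> norm (c s i a - c s j b)"
proof -
  let ?l = "length ps"
  let ?n = "\<lambda>i. real (length (ps ! i))"
  have nz: "ps ! i \<noteq> []" if "i < ?l" for i using ne that nth_mem by metis
  have npos: "?n i > 0" if "i < ?l" for i using nz[OF that] by simp
  have fne: "field ps w i \<noteq> []" if "i < ?l" for i using nz[OF that] by (simp add: field_def)
  have cdisp: "curve (disp ps (\<lambda>i k. s *\<^sub>R w i k) ! i) a = c s i a" if "i < ?l" for s i a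
    using that nz[OF that] by (simp add: curve_disp curve_field_scale c_def h_def)
  have inj: "same_param ps i a j b" if "0 \<le> s" "s \<le> 1" "i < ?l" "j < ?l" "c s i a = c s j b" for s i j a b
    using emb[OF that(1,2)] that(3-5) by (auto simp: embedded_def cdisp)
  have ccont: "continuous_on S (\<lambda>x. c (f x) i (g x))"
    if "continuous_on S f" "continuous_on S g" "i < ?l" for S :: "'z::topological_space set" and f g i
    unfolding c_def h_def using that nz fne
    by (intro continuous_intros continuous_on_compose2[OF continuous_on_curve[of _ UNIV], of _ S g]) auto
  have cshift: "c s i (a + of_int z * ?n i) = c s i a" for s i a z
    using curve_add_multiple[of "ps ! i" a z] curve_add_multiple[of "field ps w i" a z] by (simp add: c_def h_def)
  have hshift: "h i (a + of_int z * ?n i) = h i a" for i a z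
    using curve_add_multiple[of "field ps w i" a z] by (simp add: h_def)
  obtain B where B: "B > 0" "\<And>i v. i < ?l \<Longrightarrow> v \<in> set (field ps w i) \<Longrightarrow> norm v \<le> B"
  proof -
    have "bounded (\<Union>i<?l. set (field ps w i))" by (intro finite_imp_bounded) auto
    then obtain B where "B > 0" "\<forall>v\<in>(\<Union>i<?l. set (field ps w i)). norm v \<le> B" by (meson bounded_pos)
    then show ?thesis using that by blast
  qed
  have hB: "norm (h i a) \<le> B" if "i < ?l" for i a
    unfolding h_def by (rule curve_norm_le[OF fne[OF that]]) (use B that in blast)
  have hdiff: "norm (h i a - h j b) \<le> 2 * B" if "i < ?l" "j < ?l" for i j a b
    using norm_triangle_ineq4[of "h i a" "h j b"] hB that by (smt (verit))
  have hlip: "norm (h i a - h i b) \<le> 2 * B * \<bar>a - b\<bar>" if "i < ?l" "\<bar>a - b\<bar> \<le> 1" for i a b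
    unfolding h_def
  proof (rule curve_diff_le[OF that(2)])
    fix k show "norm (vtx (field ps w i) (k + 1) - vtx (field ps w i) k) \<le> 2 * B"
      using norm_triangle_ineq4[of "vtx (field ps w i) (k + 1)" "vtx (field ps w i) k"]
        B(2)[OF that(1) vtx_in_set[OF fne[OF that(1)]], of k] B(2)[OF that(1) vtx_in_set[OF fne[OF that(1)]], of "k + 1"]
      by linarith
  qed
  have "\<exists>m>0. \<forall>s\<in>{0..1}. \<forall>i<?l. \<forall>a b. \<bar>a - b\<bar> \<le> 1 \<longrightarrow> m * \<bar>a - b\<bar> \<le> norm (c s i a - c s i b)"
    unfolding c_def h_def
  proof (rule uniform_local_injectivity[OF ne])
    fix s a b :: real and i
    assume "0 \<le> s" "s \<le> 1" "i < ?l" "\<bar>a - b\<bar> = 1/2"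
    then have "c s i a \<noteq> c s i b" using inj not_same_param_close by blast
    then show "curve (ps ! i) a + s *\<^sub>R curve (field ps w i) a \<noteq> curve (ps ! i) b + s *\<^sub>R curve (field ps w i) b"
      by (simp add: c_def h_def)
  qed
  then obtain m where m: "m > 0" and local: "\<And>s i a b. \<bar>a - b\<bar> \<le> 1 \<Longrightarrow> i < ?l \<Longrightarrow> s \<in> {0..1} \<Longrightarrow>
      m * \<bar>a - b\<bar> \<le> norm (c s i a - c s i b)" by blast
  \<comment> \<open>Differences between 1/2 and the length minus 1/2 stay away from all multiples of
    the period, so these points of one component are distinct.\<close>
  have "\<exists>m>0. \<forall>s\<in>{0..1}. \<forall>a\<in>{0..?n i}. \<forall>d\<in>{1/2..?n i - 1/2}. m \<le> norm (c s i a - c s i (a + d))"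
    if i: "i < ?l" for i
  proof -
    let ?f = "\<lambda>z :: real \<times> real \<times> real. norm (c (fst z) i (fst (snd z)) - c (fst z) i (fst (snd z) + snd (snd z)))"
    have "\<exists>m>0. \<forall>z\<in>{0..1} \<times> {0..?n i} \<times> {1/2..?n i - 1/2}. m \<le> ?f z"
    proof (rule compact_positive_lower_bound)
      fix z :: "real \<times> real \<times> real" assume z: "z \<in> {0..1} \<times> {0..?n i} \<times> {1/2..?n i - 1/2}"
      have "\<not> same_param ps i (fst (snd z)) i (fst (snd z) + snd (snd z))"
      proof
        assume "same_param ps i (fst (snd z)) i (fst (snd z) + snd (snd z))"
        then obtain y :: int where y: "snd (snd z) = of_int y * ?n i" by (auto simp: same_param_def)
        have lo: "0 < of_int y * ?n i" and hi: "of_int y * ?n i < 1 * ?n i"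
          unfolding y[symmetric] using z by auto
        have "0 < real_of_int y" using lo npos[OF i] by (simp add: zero_less_mult_iff)
        moreover have "real_of_int y < 1" using hi npos[OF i] by (simp only: mult_less_cancel_right_pos)
        ultimately show False by simp
      qed
      then show "0 < ?f z" using inj[of "fst z" i i "fst (snd z)" "fst (snd z) + snd (snd z)"] i z by auto
    qed (intro compact_Times continuous_intros ccont i; simp)+
    then obtain m where "m > 0" "\<forall>z\<in>{0..1} \<times> {0..?n i} \<times> {1/2..?n i - 1/2}. m \<le> ?f z" by blast
    then show ?thesis by (intro exI[of _ m]) auto
  qed
  then have "\<exists>m>0. \<forall>i\<in>{..<?l}. \<forall>s\<in>{0..1}. \<forall>a\<in>{0..?n i}. \<forall>d\<in>{1/2..?n i - 1/2}. m \<le> norm (c s i a - c s i (a + d))"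
    by (rule uniform_positive[where P = "\<lambda>i m. \<forall>s\<in>{0..1}. \<forall>a\<in>{0..?n i}. \<forall>d\<in>{1/2..?n i - 1/2}. m \<le> norm (c s i a - c s i (a + d))", rotated 1]) (auto intro: order_trans)
  then obtain m2 where m2: "m2 > 0" "\<And>i s a d. i < ?l \<Longrightarrow> s \<in> {0..1} \<Longrightarrow> a \<in> {0..?n i} \<Longrightarrow> d \<in> {1/2..?n i - 1/2} \<Longrightarrow>
      m2 \<le> norm (c s i a - c s i (a + d))" by blast
  have "\<exists>m>0. \<forall>s\<in>{0..1}. \<forall>a\<in>{0..?n i}. \<forall>b\<in>{0..?n j}. m \<le> norm (c s i a - c s j b)"
    if ij: "i < ?l" "j < ?l" "i \<noteq> j" for i j
  proof -
    let ?f = "\<lambda>z :: real \<times> real \<times> real. norm (c (fst z) i (fst (snd z)) - c (fst z) j (snd (snd z)))"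
    have "\<exists>m>0. \<forall>z\<in>{0..1} \<times> {0..?n i} \<times> {0..?n j}. m \<le> ?f z"
    proof (rule compact_positive_lower_bound)
      fix z :: "real \<times> real \<times> real" assume z: "z \<in> {0..1} \<times> {0..?n i} \<times> {0..?n j}"
      then show "0 < ?f z" using inj[of "fst z" i j "fst (snd z)" "snd (snd z)"] ij by (auto simp: same_param_def)
    qed (intro compact_Times continuous_intros ccont ij; simp)+
    then obtain m where "m > 0" "\<forall>z\<in>{0..1} \<times> {0..?n i} \<times> {0..?n j}. m \<le> ?f z" by blast
    then show ?thesis by (intro exI[of _ m]) auto
  qed
  then have "\<exists>m>0. \<forall>s\<in>{0..1}. \<forall>a\<in>{0..?n (fst x)}. \<forall>b\<in>{0..?n (snd x)}. m \<le> norm (c s (fst x) a - c s (snd x) b)"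
    if "x \<in> {x \<in> {..<?l} \<times> {..<?l}. fst x \<noteq> snd x}" for x using that by auto
  then have "\<exists>m>0. \<forall>x\<in>{x \<in> {..<?l} \<times> {..<?l}. fst x \<noteq> snd x}. \<forall>s\<in>{0..1}. \<forall>a\<in>{0..?n (fst x)}. \<forall>b\<in>{0..?n (snd x)}. m \<le> norm (c s (fst x) a - c s (snd x) b)"
    by (rule uniform_positive[where P = "\<lambda>x m. \<forall>s\<in>{0..1}. \<forall>a\<in>{0..?n (fst x)}. \<forall>b\<in>{0..?n (snd x)}. m \<le> norm (c s (fst x) a - c s (snd x) b)", rotated 1]) (auto intro: order_trans)
  then obtain m3 where m3: "m3 > 0" "\<And>i j s a b. i < ?l \<Longrightarrow> j < ?l \<Longrightarrow> i \<noteq> j \<Longrightarrow> s \<in> {0..1} \<Longrightarrow> a \<in> {0..?n i} \<Longrightarrow> b \<in> {0..?n j} \<Longrightarrow>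
      m3 \<le> norm (c s i a - c s j b)" by fastforce
  \<comment> \<open>\<open>2 * B\<close> bounds both the variation of the field between any two
    points and its Lipschitz constant for close parameters, so one quotient serves all three
    regimes.\<close>
  define \<gamma> where "\<gamma> = min m (min m2 m3) / (2 * B)"
  have \<gamma>: "\<gamma> > 0" "\<gamma> * (2 * B) \<le> m" "\<gamma> * (2 * B) \<le> m2" "\<gamma> * (2 * B) \<le> m3"
    using m m2 m3 B(1) by (auto simp: \<gamma>_def)
  have main: "\<gamma> * norm (h i a - h j b) \<le> norm (c s i a - c s j b)"
    if s: "s \<in> {0..1}" and i: "i < ?l" and j: "j < ?l" and a: "a \<in> {0..?n i}" for s i j a b
  proof (cases "i = j")
    case False
    obtain z where z: "0 \<le> b - 0 + of_int z * ?n j" "b - 0 + of_int z * ?n j < ?n j"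
      using cyclic_representative[of "length (ps ! j)" b 0] npos[OF j] by auto
    have "\<gamma> * norm (h i a - h j b) \<le> \<gamma> * (2 * B)" using hdiff[OF i j] \<gamma>(1) by (intro mult_left_mono) auto
    also have "\<dots> \<le> m3" by (rule \<gamma>)
    also have "\<dots> \<le> norm (c s i a - c s j (b + of_int z * ?n j))" using z by (intro m3 i j False s a) auto
    finally show ?thesis unfolding cshift .
  next
    case True
    have close: ?thesis if d: "\<bar>a - (b + of_int z * ?n i)\<bar> \<le> 1" for z :: int
    proof -
      let ?b = "b + of_int z * ?n i"
      have "\<gamma> * norm (h i a - h i ?b) \<le> \<gamma> * (2 * B * \<bar>a - ?b\<bar>)" using hlip[OF i d] \<gamma>(1) by (intro mult_left_mono) auto
      also have "\<dots> = \<gamma> * (2 * B) * \<bar>a - ?b\<bar>" by simp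
      also have "\<dots> \<le> m * \<bar>a - ?b\<bar>" by (intro mult_right_mono \<gamma>) simp
      also have "\<dots> \<le> norm (c s i a - c s i ?b)" by (rule local[OF d i s])
      finally show ?thesis unfolding cshift hshift True[symmetric] .
    qed
    obtain z where z: "0 \<le> b - a + of_int z * ?n i" "b - a + of_int z * ?n i < ?n i"
      using cyclic_representative[of "length (ps ! i)" b a] npos[OF i] by auto
    define d where "d = b - a + of_int z * ?n i"
    consider "d \<le> 1/2" | "d \<ge> ?n i - 1/2" | "d \<in> {1/2..?n i - 1/2}" by force
    then show ?thesis
    proof cases
      case 1
      then show ?thesis using close[of z] z by (simp add: d_def)
    next
      case 2
      \<comment> \<open>Here \<open>b\<close> lies just behind \<open>a\<close> on the circle, so
        the representative one period earlier is the close one.\<close>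
      have e: "a - (b + of_int (z - 1) * ?n i) = ?n i - d" by (simp add: d_def algebra_simps)
      show ?thesis by (rule close[of "z - 1"], unfold e) (use 2 z in \<open>simp add: d_def\<close>)
    next
      case 3
      have "a + d = b + of_int z * ?n i" by (simp add: d_def)
      then have "norm (c s i a - c s i (a + d)) = norm (c s i a - c s j b)" using cshift True by simp
      moreover have "\<gamma> * norm (h i a - h j b) \<le> \<gamma> * (2 * B)" using hdiff[OF i j] \<gamma>(1) by (intro mult_left_mono) auto
      ultimately show ?thesis using m2(2)[OF i s a 3] \<gamma>(3) by linarith
    qed
  qed
  show ?thesis
  proof (intro exI[of _ \<gamma>] conjI ballI allI impI \<gamma>(1))
    fix s i j a b assume s: "s \<in> {0..1::real}" and i: "i < ?l" and j: "j < ?l"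
    obtain z where z: "0 \<le> a - 0 + of_int z * ?n i" "a - 0 + of_int z * ?n i < ?n i"
      using cyclic_representative[of "length (ps ! i)" a 0] npos[OF i] by auto
    then have "\<gamma> * norm (h i (a + of_int z * ?n i) - h j b) \<le> norm (c s i (a + of_int z * ?n i) - c s j b)"
      by (intro main s i j) auto
    then show "\<gamma> * norm (h i a - h j b) \<le> norm (c s i a - c s j b)" unfolding cshift hshift .
  qed
qed

text \<open>The field is extended by 0 to \<open>Z\<close>. The bound by \<open>C\<close> times the
  distance to \<open>Z\<close>, required at all times, is what keeps this extension Lipschitz. For
  tangles, \<open>Z\<close> will be the complement of the open cylinder.\<close>

theorem isotopy_extension:
  assumes ne: "[] \<notin> set ps"
    and emb: "\<And>s. 0 \<le> s \<Longrightarrow> s \<le> 1 \<Longrightarrow> embedded (disp ps (\<lambda>i k. s *\<^sub>R w i k))"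
    and Z: "\<And>s i t z. 0 \<le> s \<Longrightarrow> s \<le> 1 \<Longrightarrow> i < length ps \<Longrightarrow> z \<in> Z \<Longrightarrow>
      norm (curve (field ps w i) t) \<le> C * dist (curve (ps ! i) t + s *\<^sub>R curve (field ps w i) t) z"
  shows "\<exists>H. ambient_isotopy H \<and> (\<forall>t\<in>{0..1}. \<forall>z\<in>Z. H t z = z) \<and>
    (\<forall>i < length ps. \<forall>t. H 1 (curve (ps ! i) t) = curve (disp ps w ! i) t)"
proof -
  let ?l = "length ps"
  define h where "h = (\<lambda>i. curve (field ps w i))"
  define c where "c = (\<lambda>s i a. curve (ps ! i) a + s *\<^sub>R h i a)"
  have nz: "ps ! i \<noteq> []" if "i < ?l" for i using ne that nth_mem by metis
  obtain \<gamma> where \<gamma>: "\<gamma> > 0" "\<And>s i j a b. s \<in> {0..1} \<Longrightarrow> i < ?l \<Longrightarrow> j < ?l \<Longrightarrow>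
      \<gamma> * norm (h i a - h j b) \<le> norm (c s i a - c s j b)"
    using uniform_chord_arc[OF ne emb] unfolding h_def c_def by blast
  have Z': "norm (h i a) \<le> \<bar>C\<bar> * dist (c s i a) z" if "s \<in> {0..1}" "i < ?l" "z \<in> Z" for s i a z
    using Z[of s i z a] that unfolding h_def c_def by (smt (verit) mult_right_mono zero_le_dist atLeastAtMost_iff)
  \<comment> \<open>A time step of at most \<delta> scales the field down to the constant 1/4, both
    between two points of the curves (through \<gamma>) and between a curve and \<open>Z\<close>
    (through \<open>C\<close>).\<close>
  define \<delta> where "\<delta> = min (\<gamma> / 4) (1 / (4 * (\<bar>C\<bar> + 1)))"
  have \<delta>: "\<delta> > 0" "\<delta> \<le> \<gamma> / 4" "\<delta> * \<bar>C\<bar> \<le> 1 / 4"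
  proof -
    show "\<delta> > 0" using \<gamma>(1) by (simp add: \<delta>_def add_nonneg_pos)
    show "\<delta> \<le> \<gamma> / 4" by (simp add: \<delta>_def)
    have "\<delta> * \<bar>C\<bar> \<le> \<delta> * (\<bar>C\<bar> + 1)" using \<open>\<delta> > 0\<close> by simp
    also have "\<dots> \<le> 1 / (4 * (\<bar>C\<bar> + 1)) * (\<bar>C\<bar> + 1)" by (intro mult_right_mono) (auto simp: \<delta>_def)
    also have "\<dots> = 1 / 4" by (simp add: add_nonneg_eq_0_iff)
    finally show "\<delta> * \<bar>C\<bar> \<le> 1 / 4" .
  qed
  have step: "\<exists>H. ambient_isotopy H \<and> (\<forall>t\<in>{0..1}. \<forall>z\<in>Z. H t z = z) \<and>
      (\<forall>i<?l. \<forall>a. H 1 (c s i a) = c s' i a)"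
    if s: "s \<in> {0..1}" and ss: "\<bar>s' - s\<bar> \<le> \<delta>" for s s'
  proof -
    have uniq: "h i a = h j b" if "i < ?l" "j < ?l" "c s i a = c s j b" for i j a b
      using \<gamma>(2)[OF s that(1,2), of a b] that(3) \<gamma>(1) by (simp add: mult_le_0_iff)
    \<comment> \<open>The displacement of one time step as a function of the position; by
      \<open>uniq\<close> it does not depend on the parameters that represent the point.\<close>
    define g where "g x = (if \<exists>i a. i < ?l \<and> x = c s i a
      then (s' - s) *\<^sub>R (SOME v. \<exists>i a. i < ?l \<and> x = c s i a \<and> v = h i a) else 0)" for x
    have gc: "g (c s i a) = (s' - s) *\<^sub>R h i a" if "i < ?l" for i a
    proof -
      have "(SOME v. \<exists>j b. j < ?l \<and> c s i a = c s j b \<and> v = h j b) = h i a"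
        using that uniq by (intro some_equality) metis+
      then show ?thesis using that by (auto simp: g_def)
    qed
    have gz: "g z = 0" if "z \<in> Z" for z
    proof (cases "\<exists>i a. i < ?l \<and> z = c s i a")
      case True
      then obtain i a where "i < ?l" "z = c s i a" by blast
      then show ?thesis using gc Z'[OF s _ that, of i a] by simp
    next
      case False
      then show ?thesis unfolding g_def by (simp only: if_False)
    qed
    let ?K = "Z \<union> {c s i a | i a. i < ?l}"
    have c1: "norm (g (c s i a) - g (c s j b)) \<le> dist (c s i a) (c s j b) / 4" if "i < ?l" "j < ?l" for i j a b
    proof -
      have "norm (g (c s i a) - g (c s j b)) = \<bar>s' - s\<bar> * norm (h i a - h j b)"
        using gc that by (simp flip: scaleR_right_diff_distrib)
      also have "\<dots> \<le> \<gamma> / 4 * norm (h i a - h j b)" using ss \<delta> by (intro mult_right_mono) auto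
      also have "\<dots> \<le> dist (c s i a) (c s j b) / 4" using \<gamma>(2)[OF s that, of a b] by (simp add: dist_norm)
      finally show ?thesis .
    qed
    have c2: "norm (g (c s i a) - g z) \<le> dist (c s i a) z / 4" if "i < ?l" "z \<in> Z" for i a z
    proof -
      have "norm (g (c s i a) - g z) = \<bar>s' - s\<bar> * norm (h i a)" using gc gz that by simp
      also have "\<dots> \<le> \<delta> * (\<bar>C\<bar> * dist (c s i a) z)" using ss \<delta> Z'[OF s that] by (intro mult_mono) auto
      also have "\<dots> = (\<delta> * \<bar>C\<bar>) * dist (c s i a) z" by simp
      also have "\<dots> \<le> 1 / 4 * dist (c s i a) z" by (intro mult_right_mono \<delta>) simp
      finally show ?thesis by simp
    qed
    have "norm (g x - g y) \<le> dist x y / 4" if "x \<in> ?K" "y \<in> ?K" for x y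
    proof -
      consider "x \<in> Z" "y \<in> Z" | i a where "x = c s i a" "i < ?l" "y \<in> Z" | i a where "y = c s i a" "i < ?l" "x \<in> Z"
        | i a j b where "x = c s i a" "i < ?l" "y = c s j b" "j < ?l" using \<open>x \<in> ?K\<close> \<open>y \<in> ?K\<close> by blast
      then show ?thesis
      proof cases
        case 1 then show ?thesis using gz by simp
      next
        case 2 then show ?thesis using c2 by blast
      next
        case 3 then show ?thesis using c2 by (metis dist_commute norm_minus_commute)
      next
        case 4 then show ?thesis using c1 by blast
      qed
    qed
    then obtain G where G: "\<And>x. x \<in> ?K \<Longrightarrow> G x = g x" "\<And>x y. norm (G x - G y) \<le> 3 / 4 * dist x y"
      using lipschitz_point_extension by blast
    have Gc: "G (c s i a) = (s' - s) *\<^sub>R h i a" if "i < ?l" for i a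
    proof -
      have "c s i a \<in> ?K" using that by blast
      then show ?thesis using G(1) gc that by simp
    qed
    show ?thesis
    proof (intro exI conjI ballI allI impI)
      show "ambient_isotopy (\<lambda>t x. x + t *\<^sub>R G x)" by (rule ambient_isotopy_add_contraction[OF G(2)])
      show "z + t *\<^sub>R G z = z" if "z \<in> Z" for z t using G(1) gz that by simp
      show "c s i a + 1 *\<^sub>R G (c s i a) = c s' i a" if "i < ?l" for i a
        using Gc[OF that] by (simp add: c_def algebra_simps)
    qed
  qed
  obtain n :: nat where n: "real n > 1 / \<delta>" using reals_Archimedean2 by blast
  then have n0: "n > 0" using \<delta>(1) by (metis divide_pos_pos less_le_not_le of_nat_0 of_nat_le_0_iff gr0I zero_less_one order_less_trans)
  have n\<delta>: "1 / real n \<le> \<delta>" using n n0 \<delta>(1) by (simp add: field_simps less_imp_le)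
  have "\<exists>H. ambient_isotopy H \<and> (\<forall>t\<in>{0..1}. \<forall>z\<in>Z. H t z = z) \<and>
      (\<forall>i<?l. \<forall>a. H 1 (c 0 i a) = c (real m / real n) i a)" if "m \<le> n" for m
    using that
  proof (induction m)
    case 0
    show ?case using ambient_isotopy_id by (intro exI[of _ "\<lambda>t x. x"]) simp
  next
    case (Suc m)
    then obtain H where H: "ambient_isotopy H" "\<forall>t\<in>{0..1}. \<forall>z\<in>Z. H t z = z"
      "\<forall>i<?l. \<forall>a. H 1 (c 0 i a) = c (real m / real n) i a" by auto
    have "real m / real n \<in> {0..1}" using Suc.prems n0 by (auto simp: field_simps)
    moreover have "\<bar>real (Suc m) / real n - real m / real n\<bar> \<le> \<delta>"
      using n\<delta> n0 by (simp flip: diff_divide_distrib)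
    ultimately obtain K where K: "ambient_isotopy K" "\<forall>t\<in>{0..1}. \<forall>z\<in>Z. K t z = z"
      "\<forall>i<?l. \<forall>a. K 1 (c (real m / real n) i a) = c (real (Suc m) / real n) i a"
      using step by blast
    show ?case
      using ambient_isotopy_compose[OF H(1) K(1)] H K by (intro exI[of _ "\<lambda>t x. K t (H t x)"]) simp
  qed
  from this[of n] obtain H where H: "ambient_isotopy H" "\<forall>t\<in>{0..1}. \<forall>z\<in>Z. H t z = z"
      "\<forall>i<?l. \<forall>a. H 1 (c 0 i a) = c 1 i a" using n0 by auto
  have "H 1 (curve (ps ! i) t) = curve (disp ps w ! i) t" if "i < ?l" for i t
    using H(3) that nz[OF that] by (simp add: c_def h_def curve_disp)
  then show ?thesis using H by (intro exI[of _ H]) blast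
qed

corollary isotopic_disp:
  assumes "[] \<notin> set ps" "\<And>s. 0 \<le> s \<Longrightarrow> s \<le> 1 \<Longrightarrow> embedded (disp ps (\<lambda>i k. s *\<^sub>R w i k))"
  shows "isotopic (ps, f) (disp ps w, f)"
proof -
  have "\<exists>H. ambient_isotopy H \<and> (\<forall>t\<in>{0..1}. \<forall>z\<in>{}. H t z = z) \<and>
      (\<forall>i < length ps. \<forall>t. H 1 (curve (ps ! i) t) = curve (disp ps w ! i) t)"
    by (rule isotopy_extension[where C = 0]) (use assms in auto)
  then obtain H where "ambient_isotopy H"
    and "\<And>i t. i < length ps \<Longrightarrow> H 1 (curve (ps ! i) t) = curve (disp ps w ! i) t" by auto
  then show ?thesis
    unfolding isotopic_def
    by (intro conjI exI[of _ H] allI impI exI[of _ "\<lambda>t. t"]) (auto simp: strict_mono_def)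
qed

subsection \<open>Small displacements of singular links\<close>

text \<open>The condition of \<open>singular_link\<close> on the polygons alone; the framing is
  carried along separately as a list of integers.\<close>

definition singular :: "point list list \<Rightarrow> dpoint set \<Rightarrow> bool" where
  "singular ps D \<longleftrightarrow> [] \<notin> set ps \<and> double_points_of (link_dom ps) ps D"

abbreviation pm :: "point list list \<Rightarrow> nat \<Rightarrow> int \<Rightarrow> place" where
  "pm ps i k \<equiv> (i, nat (k mod int (length (ps ! i))))"

lemma singular_D:
  assumes "singular ps D" "(a, b) \<in> D"
  shows "fst a < length ps" "snd a < length (ps ! fst a)" "fst b < length ps" "snd b < length (ps ! fst b)"
    "a \<noteq> b" "at_place ps a = at_place ps b" "straight_at ps a" "straight_at ps b" "normal ps (a, b) \<noteq> 0"
  using assms by (auto simp: singular_def double_points_of_def link_dom_def)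

lemma norm_diff_of_sum_eq: "a + p = b + q \<Longrightarrow> norm (a - b) = norm (p - q)" for a :: "'a::real_normed_vector"
proof -
  assume "a + p = b + q"
  then have "a - b = - (p - q)" by (simp add: algebra_simps)
  then show ?thesis by (simp only: norm_minus_cancel)
qed

lemma diff_multiple_mod: "(k - z * n) mod n = k mod (n::int)"
  using mod_mult_self1[of k "- z" n] by simp

text \<open>\<open>double_points_of\<close> speaks of fundamental domains only. Both parameters are
  shifted there and back, so that coincidences can be analysed at arbitrary real parameters;
  \<open>singularI\<close> is the way back.\<close>

lemma singular_coincidence:
  assumes "singular ps D" "i < length ps" "j < length ps" "curve (ps ! i) s = curve (ps ! j) t"
  shows "same_param ps i s j t \<or> (\<exists>k m::int. s = of_int k \<and> t = of_int m \<and>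
    ((pm ps i k, pm ps j m) \<in> D \<or> (pm ps j m, pm ps i k) \<in> D))"
proof -
  let ?n = "\<lambda>i. length (ps ! i)"
  have npos: "?n i > 0" if "i < length ps" for i
    using assms(1) that by (metis length_greater_0_conv nth_mem singular_def)
  obtain y where y: "0 \<le> s - 0 + of_int y * real (?n i)" "s - 0 + of_int y * real (?n i) < real (?n i)"
    using cyclic_representative[OF npos[OF assms(2)]] by blast
  obtain z where z: "0 \<le> t - 0 + of_int z * real (?n j)" "t - 0 + of_int z * real (?n j) < real (?n j)"
    using cyclic_representative[OF npos[OF assms(3)]] by blast
  define s' where "s' = s + of_int y * real (?n i)"
  define t' where "t' = t + of_int z * real (?n j)"
  have dom: "(i, s') \<in> link_dom ps" "(j, t') \<in> link_dom ps"
    using y z assms(2,3) by (auto simp: link_dom_def s'_def t'_def)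
  have eq: "curve (ps ! i) s' = curve (ps ! j) t'"
    using assms(4) by (simp add: s'_def t'_def curve_add_multiple)
  show ?thesis
  proof (cases "(i, s') = (j, t')")
    case True
    then have ij: "i = j" "s + of_int y * real (?n i) = t + of_int z * real (?n j)" by (auto simp: s'_def t'_def)
    then have "t = s + of_int (y - z) * real (?n i)" by (simp add: left_diff_distrib)
    then have "same_param ps i s j t" unfolding same_param_def using ij(1) by blast
    then show ?thesis ..
  next
    case False
    have all: "\<forall>(i, s)\<in>link_dom ps. \<forall>(j, t)\<in>link_dom ps. (i, s) \<noteq> (j, t) \<and> curve (ps ! i) s = curve (ps ! j) t \<longrightarrow>
        (\<exists>k m. s = real k \<and> t = real m \<and> (((i, k), (j, m)) \<in> D \<or> ((j, m), (i, k)) \<in> D))"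
      using assms(1) unfolding singular_def double_points_of_def by (elim conjE)
    have "\<exists>k m. s' = real k \<and> t' = real m \<and> (((i, k), (j, m)) \<in> D \<or> ((j, m), (i, k)) \<in> D)"
      by (rule mp[OF bspec[OF bspec[OF all dom(1), unfolded prod.case] dom(2), unfolded prod.case] conjI[OF False eq]])
    then obtain k m where km: "s' = real k" "t' = real m" "((i, k), (j, m)) \<in> D \<or> ((j, m), (i, k)) \<in> D" by blast
    have "k < ?n i" "m < ?n j" using dom km by (auto simp: link_dom_def)
    then have "pm ps i (int k - y * int (?n i)) = (i, k)" "pm ps j (int m - z * int (?n j)) = (j, m)"
      by (simp_all add: diff_multiple_mod)
    moreover have "s = of_int (int k - y * int (?n i))" "t = of_int (int m - z * int (?n j))"
      using km by (auto simp: s'_def t'_def)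
    ultimately show ?thesis using km(3) by metis
  qed
qed

lemma singularI:
  assumes "[] \<notin> set ps"
    and "\<And>a b. (a, b) \<in> D \<Longrightarrow> a \<noteq> b \<and> fst a < length ps \<and> snd a < length (ps ! fst a) \<and>
      fst b < length ps \<and> snd b < length (ps ! fst b) \<and> at_place ps a = at_place ps b \<and>
      straight_at ps a \<and> straight_at ps b \<and> normal ps (a, b) \<noteq> 0"
    and "inj_on (\<lambda>d. at_place ps (fst d)) D"
    and "\<And>i j s t. i < length ps \<Longrightarrow> j < length ps \<Longrightarrow> curve (ps ! i) s = curve (ps ! j) t \<Longrightarrow>
      same_param ps i s j t \<or> (\<exists>k m::int. s = of_int k \<and> t = of_int m \<and>
      ((pm ps i k, pm ps j m) \<in> D \<or> (pm ps j m, pm ps i k) \<in> D))"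
  shows "singular ps D"
  unfolding singular_def double_points_of_def
proof (intro conjI assms(1,3) ballI)
  fix d assume "d \<in> D"
  then show "case d of (a, b) \<Rightarrow> a \<noteq> b \<and> (fst a, real (snd a)) \<in> link_dom ps \<and> (fst b, real (snd b)) \<in> link_dom ps \<and>
      at_place ps a = at_place ps b \<and> straight_at ps a \<and> straight_at ps b \<and> normal ps (a, b) \<noteq> 0"
    using assms(2) by (cases d) (auto simp: link_dom_def)
next
  fix x assume x: "x \<in> link_dom ps"
  obtain i s where xe: "x = (i, s)" by (cases x)
  have "\<exists>k m. s = real k \<and> t = real m \<and> (((i, k), (j, m)) \<in> D \<or> ((j, m), (i, k)) \<in> D)"
    if jt: "(j, t) \<in> link_dom ps" and ne: "(i, s) \<noteq> (j, t)" and eq: "curve (ps ! i) s = curve (ps ! j) t" for j t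
  proof -
    let ?n = "\<lambda>i. real (length (ps ! i))"
    have bd: "i < length ps" "0 \<le> s" "s < ?n i" "j < length ps" "0 \<le> t" "t < ?n j"
      using x xe jt by (auto simp: link_dom_def)
    have "\<not> same_param ps i s j t"
    proof
      assume "same_param ps i s j t"
      then obtain z :: int where z: "i = j" "t = s + of_int z * ?n i" by (auto simp: same_param_def)
      then have "of_int z * ?n i < 1 * ?n i" "(- 1) * ?n i < of_int z * ?n i" using bd by auto
      then have "real_of_int z < 1" "- 1 < real_of_int z"
        using mult_less_cancel_right_disj[of "real_of_int z" "?n i" 1] mult_less_cancel_right_disj[of "- 1" "?n i" "real_of_int z"]
        by auto
      then have "z = 0" by simp
      then show False using z ne by simp
    qed
    then obtain k m :: int where km: "s = of_int k" "t = of_int m"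
      "(pm ps i k, pm ps j m) \<in> D \<or> (pm ps j m, pm ps i k) \<in> D" using assms(4)[OF bd(1,4) eq] by blast
    have "nat (k mod int (length (ps ! i))) = nat k" "nat (m mod int (length (ps ! j))) = nat m" "k \<ge> 0" "m \<ge> 0"
      using bd km by auto
    then show ?thesis using km by (intro exI[of _ "nat k"] exI[of _ "nat m"]) auto
  qed
  then show "case x of (i, s) \<Rightarrow> \<forall>(j, t)\<in>link_dom ps. (i, s) \<noteq> (j, t) \<and> curve (ps ! i) s = curve (ps ! j) t \<longrightarrow>
      (\<exists>k m. s = real k \<and> t = real m \<and> (((i, k), (j, m)) \<in> D \<or> ((j, m), (i, k)) \<in> D))"
    unfolding xe by auto
qed

lemma embedded_iff_singular: "embedded ps \<longleftrightarrow> singular ps {}"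
proof
  assume "embedded ps"
  then show "singular ps {}" by (intro singularI) (auto simp: embedded_def)
next
  assume "singular ps {}"
  then show "embedded ps" using singular_coincidence[of ps "{}"] by (auto simp: embedded_def singular_def)
qed

lemma finite_double_points:
  assumes "singular ps D" shows "finite D"
proof -
  have "D \<subseteq> (SIGMA i:{..<length ps}. {..<length (ps ! i)}) \<times> (SIGMA i:{..<length ps}. {..<length (ps ! i)})"
    using singular_D[OF assms] by fastforce
  then show ?thesis by (rule finite_subset) (intro finite_cartesian_product finite_SigmaI; simp)
qed

lemma at_place_vtx: "snd a < length (ps ! fst a) \<Longrightarrow> at_place ps a = vtx (ps ! fst a) (int (snd a))"
  by (simp add: at_place_def vtx_nat)

text \<open>At a straight vertex the incoming edge is a positive multiple \<open>r\<close> of the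
  outgoing one, so within parameter distance 1 the curve stays on one line, with relative speed
  \<open>r\<close> before the vertex and 1 after it.\<close>

lemma straight_curve:
  assumes "snd a < length (ps ! fst a)" "straight_at ps a"
  shows "\<exists>r>0. \<forall>x. \<bar>x\<bar> \<le> 1 \<longrightarrow> curve (ps ! fst a) (real (snd a) + x) =
    at_place ps a + (if 0 \<le> x then x else r * x) *\<^sub>R tangent ps a"
proof -
  let ?p = "ps ! fst a" and ?k = "int (snd a)"
  let ?v = "at_place ps a"
  have v: "?v = vtx ?p ?k" using at_place_vtx assms(1) by blast
  have tan: "tangent ps a = vtx ?p (?k + 1) - ?v" by (simp add: tangent_def edge_of_nat v)
  obtain u where u: "0 < u" "u < 1" "?v = (1 - u) *\<^sub>R vtx ?p (?k - 1) + u *\<^sub>R vtx ?p (?k + 1)"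
    using assms(2) by (auto simp: straight_at_def in_segment)
  define r where "r = u / (1 - u)"
  have r: "r > 0" using u by (simp add: r_def)
  have "(1 - u) *\<^sub>R (?v - vtx ?p (?k - 1)) = u *\<^sub>R tangent ps a"
    unfolding tan using u(3) by (simp add: algebra_simps)
  then have bw: "?v - vtx ?p (?k - 1) = r *\<^sub>R tangent ps a"
    using u(2) by (simp add: r_def eq_vector_fraction_iff vector_fraction_eq_iff)
  have "curve ?p (real (snd a) + x) = ?v + (if 0 \<le> x then x else r * x) *\<^sub>R tangent ps a" if "\<bar>x\<bar> \<le> 1" for x
  proof (cases "0 \<le> x")
    case True
    then show ?thesis using curve_on_edge[of ?k "real (snd a) + x" ?p] that by (simp add: v tan)
  next
    case False
    have "curve ?p (real (snd a) + x) = vtx ?p (?k - 1) + (real (snd a) + x - of_int (?k - 1)) *\<^sub>R (vtx ?p (?k - 1 + 1) - vtx ?p (?k - 1))"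
      using False that by (intro curve_on_edge) auto
    also have "\<dots> = ?v + x *\<^sub>R (?v - vtx ?p (?k - 1))" by (simp add: v algebra_simps)
    also have "\<dots> = ?v + (r * x) *\<^sub>R tangent ps a" unfolding bw by (simp add: mult.commute)
    finally show ?thesis using False by simp
  qed
  then show ?thesis using r by blast
qed

text \<open>The cross product of \<open>p *\<^sub>R u + q *\<^sub>R v\<close> with \<open>u\<close>
  or with \<open>v\<close> isolates one coefficient, and its norm is at most the product of the
  norms.\<close>

lemma cross3_lower_bound:
  assumes "cross3 u v \<noteq> 0"
  shows "\<exists>g>0. \<forall>p q. g * (\<bar>p\<bar> + \<bar>q\<bar>) \<le> norm (p *\<^sub>R u + q *\<^sub>R v)"
proof -
  have le: "norm (cross3 x y) \<le> norm x * norm y" for x y :: point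
  proof -
    have "(norm (cross3 x y))\<^sup>2 \<le> (norm x * norm y)\<^sup>2"
      using norm_cross[of x y] by (simp add: power_mult_distrib)
    then show ?thesis by (rule power2_le_imp_le) simp
  qed
  let ?c = "norm (cross3 u v)"
  have c: "?c > 0" using assms by simp
  have pos: "norm u > 0" "norm v > 0" using assms by (auto simp: cross_zero_left cross_zero_right)
  define g where "g = ?c / (norm u + norm v)"
  have "g > 0" using c pos by (simp add: g_def add_pos_pos)
  moreover have "g * (\<bar>p\<bar> + \<bar>q\<bar>) \<le> norm (p *\<^sub>R u + q *\<^sub>R v)" for p q
  proof -
    let ?w = "p *\<^sub>R u + q *\<^sub>R v"
    have "cross3 u ?w = q *\<^sub>R cross3 u v" "cross3 ?w v = p *\<^sub>R cross3 u v"
      by (simp_all add: cross_add_left cross_add_right cross_mult_left cross_mult_right cross_refl)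
    then have "\<bar>q\<bar> * ?c \<le> norm u * norm ?w" "\<bar>p\<bar> * ?c \<le> norm ?w * norm v"
      using le[of u ?w] le[of ?w v] by simp_all
    then have "(\<bar>p\<bar> + \<bar>q\<bar>) * ?c \<le> norm ?w * (norm u + norm v)" by (simp add: algebra_simps)
    then show ?thesis using pos by (simp add: g_def pos_divide_le_eq add_pos_pos mult.commute)
  qed
  ultimately show ?thesis by blast
qed

text \<open>Near a double point both branches are straight, so their difference is a combination of
  the two tangents. Independence of the tangents bounds it from below, and the normal is orthogonal
  to both.\<close>

lemma transverse_lower_bound:
  assumes S: "singular ps D" and D: "(a, b) \<in> D \<or> (b, a) \<in> D"
  shows "\<exists>g>0. \<forall>x y. \<bar>x\<bar> \<le> 1 \<longrightarrow> \<bar>y\<bar> \<le> 1 \<longrightarrow>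
    g * (\<bar>x\<bar> + \<bar>y\<bar>) \<le> norm (curve (ps ! fst a) (real (snd a) + x) - curve (ps ! fst b) (real (snd b) + y)) \<and>
    normal ps (a, b) \<bullet> (curve (ps ! fst a) (real (snd a) + x) - curve (ps ! fst b) (real (snd b) + y)) = 0"
proof -
  have ab: "snd a < length (ps ! fst a)" "snd b < length (ps ! fst b)" "straight_at ps a" "straight_at ps b"
    "at_place ps a = at_place ps b" "normal ps (a, b) \<noteq> 0"
  proof -
    have "normal ps (b, a) = - normal ps (a, b)" by (simp add: normal_def cross_skew[of "tangent ps b"])
    then have "normal ps (b, a) \<noteq> 0 \<Longrightarrow> normal ps (a, b) \<noteq> 0" by simp
    then show "snd a < length (ps ! fst a)" "snd b < length (ps ! fst b)" "straight_at ps a" "straight_at ps b"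
      "at_place ps a = at_place ps b" "normal ps (a, b) \<noteq> 0"
      using D singular_D[OF S, of a b] singular_D[OF S, of b a] by metis+
  qed
  obtain r where r: "r > 0" "\<And>x. \<bar>x\<bar> \<le> 1 \<Longrightarrow> curve (ps ! fst a) (real (snd a) + x) =
    at_place ps a + (if 0 \<le> x then x else r * x) *\<^sub>R tangent ps a" using straight_curve[OF ab(1,3)] by blast
  obtain q where q: "q > 0" "\<And>x. \<bar>x\<bar> \<le> 1 \<Longrightarrow> curve (ps ! fst b) (real (snd b) + x) =
    at_place ps b + (if 0 \<le> x then x else q * x) *\<^sub>R tangent ps b" using straight_curve[OF ab(2,4)] by blast
  obtain g where g: "g > 0" "\<And>x y. g * (\<bar>x\<bar> + \<bar>y\<bar>) \<le> norm (x *\<^sub>R tangent ps a + y *\<^sub>R tangent ps b)"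
    using cross3_lower_bound ab(6) unfolding normal_def by (metis fst_conv snd_conv)
  define m where "m = min 1 (min r q)"
  have m: "m > 0" "m \<le> 1" "m \<le> r" "m \<le> q" using r q by (auto simp: m_def)
  have sc: "m * \<bar>x\<bar> \<le> \<bar>if 0 \<le> x then x else r' * x\<bar>" if "m \<le> r'" "r' > 0" for r' x
    using m that by (auto simp: abs_mult mult_right_mono mult_left_le_one_le)
  have "g * m * (\<bar>x\<bar> + \<bar>y\<bar>) \<le> norm (curve (ps ! fst a) (real (snd a) + x) - curve (ps ! fst b) (real (snd b) + y)) \<and>
    normal ps (a, b) \<bullet> (curve (ps ! fst a) (real (snd a) + x) - curve (ps ! fst b) (real (snd b) + y)) = 0"
    if "\<bar>x\<bar> \<le> 1" "\<bar>y\<bar> \<le> 1" for x y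
  proof -
    let ?x = "if 0 \<le> x then x else r * x" and ?y = "if 0 \<le> y then y else q * y"
    have d: "curve (ps ! fst a) (real (snd a) + x) - curve (ps ! fst b) (real (snd b) + y) = ?x *\<^sub>R tangent ps a + (- ?y) *\<^sub>R tangent ps b"
      using r(2)[OF that(1)] q(2)[OF that(2)] ab(5) by simp
    have "g * m * (\<bar>x\<bar> + \<bar>y\<bar>) = g * (m * \<bar>x\<bar> + m * \<bar>y\<bar>)" by (simp add: algebra_simps)
    also have "\<dots> \<le> g * (\<bar>?x\<bar> + \<bar>- ?y\<bar>)"
      using sc[OF m(3) r(1), of x] sc[OF m(4) q(1), of y] g(1) by (intro mult_left_mono add_mono) (simp_all only: abs_minus_cancel less_imp_le)
    also have "\<dots> \<le> norm (?x *\<^sub>R tangent ps a + (- ?y) *\<^sub>R tangent ps b)" by (rule g(2))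
    finally have "g * m * (\<bar>x\<bar> + \<bar>y\<bar>) \<le> norm (?x *\<^sub>R tangent ps a + (- ?y) *\<^sub>R tangent ps b)" .
    moreover have "normal ps (a, b) \<bullet> tangent ps a = 0" "normal ps (a, b) \<bullet> tangent ps b = 0"
      by (simp_all add: normal_def dot_cross_self inner_commute)
    then have "normal ps (a, b) \<bullet> (?x *\<^sub>R tangent ps a + (- ?y) *\<^sub>R tangent ps b) = 0"
      by (simp only: inner_add_right inner_scaleR_right mult_zero_right add_0_right)
    ultimately show ?thesis unfolding d by blast
  qed
  then show ?thesis using g(1) m(1) by (intro exI[of _ "g * m"]) auto
qed


text \<open>Up to the norm of the normal, the height by which the two branches are moved apart. Its
  sign is the sign of the crossing that arises.\<close>

definition gap :: "point list list \<Rightarrow> (nat \<Rightarrow> nat \<Rightarrow> point) \<Rightarrow> dpoint \<Rightarrow> real" where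
  "gap ps w d = normal ps d \<bullet> (w (fst (fst d)) (snd (fst d)) - w (fst (snd d)) (snd (snd d)))"

text \<open>The displacement vectors at a place and at its two neighbours. They determine the
  displacement along both edges at the place, that is, for parameters within distance 1.\<close>

definition near_values :: "point list list \<Rightarrow> (nat \<Rightarrow> nat \<Rightarrow> point) \<Rightarrow> place \<Rightarrow> point set" where
  "near_values ps w a = (\<lambda>e. vtx (field ps w (fst a)) (int (snd a) + e)) ` {- 1, 0, 1}"

lemma field_near:
  assumes "snd a < length (ps ! fst a)" "\<bar>x\<bar> \<le> 1" "\<And>p. p \<in> near_values ps w a \<Longrightarrow> norm p \<le> M"
  shows "norm (curve (field ps w (fst a)) (real (snd a) + x) - w (fst a) (snd a)) \<le> 2 * M * \<bar>x\<bar>"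
    "norm (curve (field ps w (fst a)) (real (snd a) + x)) \<le> M"
proof -
  let ?f = "field ps w (fst a)" and ?k = "int (snd a)"
  have w: "vtx ?f ?k = w (fst a) (snd a)" using assms(1) by (simp add: vtx_nat field_def)
  have M: "norm (vtx ?f (?k - 1)) \<le> M" "norm (vtx ?f ?k) \<le> M" "norm (vtx ?f (?k + 1)) \<le> M"
    using assms(3) by (auto simp: near_values_def)
  have *: "\<exists>v. norm v \<le> M \<and> curve ?f (real (snd a) + x) = (1 - \<bar>x\<bar>) *\<^sub>R vtx ?f ?k + \<bar>x\<bar> *\<^sub>R v"
  proof (cases "0 \<le> x")
    case True
    then show ?thesis using curve_on_edge[of ?k "real (snd a) + x" ?f] assms(2) M(3)
      by (intro exI[of _ "vtx ?f (?k + 1)"]) (simp add: algebra_simps)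
  next
    case False
    have "curve ?f (real (snd a) + x) = vtx ?f (?k - 1) + (real (snd a) + x - of_int (?k - 1)) *\<^sub>R (vtx ?f (?k - 1 + 1) - vtx ?f (?k - 1))"
      using False assms(2) by (intro curve_on_edge) auto
    then show ?thesis using False M(1)
      by (intro exI[of _ "vtx ?f (?k - 1)"]) (simp add: algebra_simps)
  qed
  then obtain v where v: "norm v \<le> M" "curve ?f (real (snd a) + x) = (1 - \<bar>x\<bar>) *\<^sub>R vtx ?f ?k + \<bar>x\<bar> *\<^sub>R v" by blast
  have "curve ?f (real (snd a) + x) - w (fst a) (snd a) = \<bar>x\<bar> *\<^sub>R (v - vtx ?f ?k)"
    unfolding v(2) w by (simp add: algebra_simps)
  moreover have "norm (v - vtx ?f ?k) \<le> 2 * M" using norm_triangle_ineq4[of v "vtx ?f ?k"] v(1) M(2) by linarith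
  then have "\<bar>x\<bar> * norm (v - vtx ?f ?k) \<le> \<bar>x\<bar> * (2 * M)" by (intro mult_left_mono) auto
  ultimately show "norm (curve ?f (real (snd a) + x) - w (fst a) (snd a)) \<le> 2 * M * \<bar>x\<bar>"
    by (simp add: mult.commute)
  have "norm (curve ?f (real (snd a) + x)) \<le> (1 - \<bar>x\<bar>) * M + \<bar>x\<bar> * M"
    unfolding v(2) using assms(2) v(1) M(2) by (intro norm_triangle_le add_mono) (simp_all add: mult_left_mono)
  then show "norm (curve ?f (real (snd a) + x)) \<le> M" by (simp add: algebra_simps)
qed

text \<open>
  At a double point the displacements of the two branches differ along the normal, while both
  branches lie in the plane orthogonal to it; hence the branches can meet again only at a definite
  distance from the double point, and there transversality keeps them apart.
\<close>

theorem small_displacement: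
  assumes S: "singular ps D" and "B > 0"
  shows "\<exists>\<epsilon>>0. \<forall>w D1 D2. D = D1 \<union> D2 \<and>
    (\<forall>i < length ps. \<forall>k < length (ps ! i). norm (w i k) \<le> \<epsilon>) \<and>
    (\<forall>d\<in>D1. gap ps w d \<noteq> 0 \<and>
      (\<forall>p \<in> near_values ps w (fst d) \<union> near_values ps w (snd d). norm p \<le> B * \<bar>gap ps w d\<bar>)) \<and>
    (\<forall>d\<in>D2. \<forall>p \<in> near_values ps w (fst d) \<union> near_values ps w (snd d). p = 0)
    \<longrightarrow> singular (disp ps w) D2"
proof -
  let ?l = "length ps"
  let ?n = "\<lambda>i. real (length (ps ! i))"
  have ne: "[] \<notin> set ps" using S by (simp add: singular_def)
  have nz: "ps ! i \<noteq> []" if "i < ?l" for i using ne that nth_mem by metis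
  have npos: "?n i > 0" if "i < ?l" for i using nz[OF that] by simp
  \<comment> \<open>Distinct points of a singular link can coincide only at integer parameters,
    which are never 1/2 apart.\<close>
  have half: "curve (ps ! i) a \<noteq> curve (ps ! i) b" if i: "i < ?l" and h: "\<bar>a - b\<bar> = 1/2" for i a b
  proof
    assume "curve (ps ! i) a = curve (ps ! i) b"
    then consider "same_param ps i a i b" | k m :: int where "a = of_int k" "b = of_int m"
      using singular_coincidence[OF S i i] by blast
    then show False
    proof cases
      case 1
      then show False using not_same_param_close h by blast
    next
      case 2
      define c where "c = \<bar>k - m\<bar>"
      have "real_of_int c = 1/2" unfolding c_def using 2 h by (simp only: of_int_abs of_int_diff)
      then have "real_of_int (2 * c) = of_int 1" by simp
      then have "2 * c = 1" by (simp only: of_int_eq_iff)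
      then show False by presburger
    qed
  qed
  have f0: "curve (field ps (\<lambda>_ _. 0) i) a = 0" if "i < ?l" for i a
    using nz[OF that] by (simp add: curve_def edge_def vtx_field)
  \<comment> \<open>The static case, with the zero field.\<close>
  have "\<exists>m>0. \<forall>s\<in>{0..1}. \<forall>i<?l. \<forall>a b. \<bar>a - b\<bar> \<le> 1 \<longrightarrow> m * \<bar>a - b\<bar> \<le>
      norm ((curve (ps ! i) a + s *\<^sub>R curve (field ps (\<lambda>_ _. 0) i) a) - (curve (ps ! i) b + s *\<^sub>R curve (field ps (\<lambda>_ _. 0) i) b))"
    by (rule uniform_local_injectivity[OF ne]) (simp add: f0 half)
  then obtain \<mu> where "\<mu> > 0" and \<mu>: "\<And>s i a b. s \<in> {0..1} \<Longrightarrow> i < ?l \<Longrightarrow> \<bar>a - b\<bar> \<le> 1 \<Longrightarrow> \<mu> * \<bar>a - b\<bar> \<le>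
      norm ((curve (ps ! i) a + s *\<^sub>R curve (field ps (\<lambda>_ _. 0) i) a) - (curve (ps ! i) b + s *\<^sub>R curve (field ps (\<lambda>_ _. 0) i) b))"
    by blast
  have local: "\<mu> * \<bar>a - b\<bar> \<le> norm (curve (ps ! i) a - curve (ps ! i) b)" if "i < ?l" "\<bar>a - b\<bar> \<le> 1" for i a b
    using \<mu>[of 0 i a b] that by (simp add: f0)
  let ?T = "\<lambda>d g. \<forall>x y. \<bar>x\<bar> \<le> 1 \<longrightarrow> \<bar>y\<bar> \<le> 1 \<longrightarrow>
    g * (\<bar>x\<bar> + \<bar>y\<bar>) \<le> norm (curve (ps ! fst (fst d)) (real (snd (fst d)) + x) - curve (ps ! fst (snd d)) (real (snd (snd d)) + y)) \<and>
    normal ps d \<bullet> (curve (ps ! fst (fst d)) (real (snd (fst d)) + x) - curve (ps ! fst (snd d)) (real (snd (snd d)) + y)) = 0"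
  have "\<exists>g>0. \<forall>d\<in>D. ?T d g"
  proof (rule uniform_positive[OF finite_double_points[OF S]])
    show "\<exists>g>0. ?T d g" if "d \<in> D" for d
      using transverse_lower_bound[OF S, of "fst d" "snd d"] that by simp
    show "?T d m'" if "?T d m" "0 < m'" "m' \<le> m" for d m m'
      using that by (meson order_trans mult_right_mono add_nonneg_nonneg abs_ge_zero)
  qed
  then obtain g where "g > 0" and g: "\<And>d x y. d \<in> D \<Longrightarrow> \<bar>x\<bar> \<le> 1 \<Longrightarrow> \<bar>y\<bar> \<le> 1 \<Longrightarrow>
    g * (\<bar>x\<bar> + \<bar>y\<bar>) \<le> norm (curve (ps ! fst (fst d)) (real (snd (fst d)) + x) - curve (ps ! fst (snd d)) (real (snd (snd d)) + y)) \<and>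
    normal ps d \<bullet> (curve (ps ! fst (fst d)) (real (snd (fst d)) + x) - curve (ps ! fst (snd d)) (real (snd (snd d)) + y)) = 0"
    by blast
  define far where "far = (\<lambda>i (k::nat). {a::real. \<forall>z::int. 1/2 \<le> \<bar>a - real k - of_int z * ?n i\<bar>})"
  have closed_far: "closed (far i k)" for i k
    unfolding far_def by (intro closed_Collect_all closed_Collect_le continuous_intros)
  \<comment> \<open>Parameter pairs away from the diagonal for which, at each double point, at least
    one parameter is away from its place. This set is compact and contains no coincidence;
    \<open>D\<inverse>\<close> covers the pairs in the other order.\<close>
  define K where "K = (\<lambda>i j. {c. c \<in> {0..?n i} \<times> {0..?n j} \<and>
    (i = j \<longrightarrow> (\<forall>z::int. 1/2 \<le> \<bar>snd c - fst c - of_int z * ?n i\<bar>)) \<and>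
    (\<forall>d\<in>D \<union> D\<inverse>. fst (fst d) = i \<and> fst (snd d) = j \<longrightarrow> fst c \<in> far i (snd (fst d)) \<or> snd c \<in> far j (snd (snd d)))})"
  have compK: "compact (K i j)" for i j
  proof -
    have c1: "closed {c :: real \<times> real. i = j \<longrightarrow> (\<forall>z::int. 1/2 \<le> \<bar>snd c - fst c - of_int z * ?n i\<bar>)}"
      by (cases "i = j") (auto intro!: closed_Collect_all closed_Collect_le continuous_intros)
    have "closed {c :: real \<times> real. fst c \<in> far i x \<or> snd c \<in> far j y}" for x y
    proof -
      have "closed (fst -` far i x :: (real \<times> real) set)" "closed (snd -` far j y :: (real \<times> real) set)"
        using closed_far by (auto intro!: closed_vimage continuous_intros)
      then have "closed (fst -` far i x \<union> snd -` far j y :: (real \<times> real) set)" by (rule closed_Un)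
      moreover have "fst -` far i x \<union> snd -` far j y = {c :: real \<times> real. fst c \<in> far i x \<or> snd c \<in> far j y}" by auto
      ultimately show ?thesis by simp
    qed
    then have "closed (\<Inter>d\<in>D \<union> D\<inverse>. {c :: real \<times> real. fst (fst d) = i \<and> fst (snd d) = j \<longrightarrow> fst c \<in> far i (snd (fst d)) \<or> snd c \<in> far j (snd (snd d))})"
      by (intro closed_INT ballI) (auto simp: closed_Collect_imp)
    then have "compact (({0..?n i} \<times> {0..?n j}) \<inter>
       ({c. i = j \<longrightarrow> (\<forall>z::int. 1/2 \<le> \<bar>snd c - fst c - of_int z * ?n i\<bar>)} \<inter>
       (\<Inter>d\<in>D \<union> D\<inverse>. {c. fst (fst d) = i \<and> fst (snd d) = j \<longrightarrow> fst c \<in> far i (snd (fst d)) \<or> snd c \<in> far j (snd (snd d))})))"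
      using c1 by (intro compact_Int_closed closed_Int compact_Times) auto
    moreover have "K i j = ({0..?n i} \<times> {0..?n j}) \<inter>
       ({c. i = j \<longrightarrow> (\<forall>z::int. 1/2 \<le> \<bar>snd c - fst c - of_int z * ?n i\<bar>)} \<inter>
       (\<Inter>d\<in>D \<union> D\<inverse>. {c. fst (fst d) = i \<and> fst (snd d) = j \<longrightarrow> fst c \<in> far i (snd (fst d)) \<or> snd c \<in> far j (snd (snd d))}))"
      unfolding K_def by blast
    ultimately show ?thesis by simp
  qed
  have notfar: "of_int k \<notin> far i (nat (k mod int (length (ps ! i))))" if "i < ?l" for i k
  proof -
    have "k = int (nat (k mod int (length (ps ! i)))) + (k div int (length (ps ! i))) * int (length (ps ! i))"
      using nz[OF that] by simp
    then have "real_of_int k = real_of_int (int (nat (k mod int (length (ps ! i)))) + (k div int (length (ps ! i))) * int (length (ps ! i)))"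
      by (rule arg_cong)
    then have "real_of_int k = real (nat (k mod int (length (ps ! i)))) + of_int (k div int (length (ps ! i))) * ?n i"
      by (simp only: of_int_add of_int_mult of_int_of_nat_eq)
    then have "\<not> 1/2 \<le> \<bar>of_int k - real (nat (k mod int (length (ps ! i)))) - of_int (k div int (length (ps ! i))) * ?n i\<bar>" by simp
    then show ?thesis unfolding far_def by blast
  qed
  have "\<exists>m>0. \<forall>c\<in>K i j. m \<le> norm (curve (ps ! i) (fst c) - curve (ps ! j) (snd c))" if i: "i < ?l" and j: "j < ?l" for i j
  proof (rule compact_positive_lower_bound[OF compK])
    show "continuous_on (K i j) (\<lambda>c. norm (curve (ps ! i) (fst c) - curve (ps ! j) (snd c)))"
      using nz i j by (intro continuous_intros continuous_on_compose2[OF continuous_on_curve[of _ UNIV], of _ _ fst]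
          continuous_on_compose2[OF continuous_on_curve[of _ UNIV], of _ _ snd]) auto
    fix c assume c: "c \<in> K i j"
    have "curve (ps ! i) (fst c) \<noteq> curve (ps ! j) (snd c)"
    proof
      assume "curve (ps ! i) (fst c) = curve (ps ! j) (snd c)"
      from singular_coincidence[OF S i j this] show False
      proof (elim disjE exE conjE)
        assume "same_param ps i (fst c) j (snd c)"
        then obtain z :: int where "i = j" "snd c = fst c + of_int z * ?n i" by (auto simp: same_param_def)
        moreover have "1/2 \<le> \<bar>snd c - fst c - of_int z * ?n i\<bar>" if "i = j" using c that unfolding K_def by blast
        ultimately show False by simp
      next
        fix k m assume e: "fst c = real_of_int k" "snd c = real_of_int m"
        have no: False if "(pm ps i k, pm ps j m) \<in> D \<union> D\<inverse>"
        proof -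
          have "fst c \<in> far i (snd (pm ps i k)) \<or> snd c \<in> far j (snd (pm ps j m))"
            using c that unfolding K_def by force
          then show False using notfar i j e by auto
        qed
        show False if "(pm ps i k, pm ps j m) \<in> D" using no that by blast
        show False if "(pm ps j m, pm ps i k) \<in> D" using no that by blast
      qed
    qed
    then show "0 < norm (curve (ps ! i) (fst c) - curve (ps ! j) (snd c))" by simp
  qed
  then have "\<exists>m>0. \<forall>x\<in>{..<?l} \<times> {..<?l}. \<forall>c\<in>K (fst x) (snd x). m \<le> norm (curve (ps ! fst x) (fst c) - curve (ps ! snd x) (snd c))"
    by (intro uniform_positive[where P = "\<lambda>x m. \<forall>c\<in>K (fst x) (snd x). m \<le> norm (curve (ps ! fst x) (fst c) - curve (ps ! snd x) (snd c))"])
      (auto intro: order_trans)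
  then obtain m2 where "m2 > 0" and m2: "\<And>i j c. i < ?l \<Longrightarrow> j < ?l \<Longrightarrow> c \<in> K i j \<Longrightarrow> m2 \<le> norm (curve (ps ! i) (fst c) - curve (ps ! j) (snd c))"
    by fastforce
  obtain N where "N > 0" and N: "\<And>d. d \<in> D \<Longrightarrow> norm (normal ps d) \<le> N"
  proof -
    have "bounded (normal ps ` D)" using finite_double_points[OF S] by (intro finite_imp_bounded) simp
    then show ?thesis using that by (metis bounded_pos imageI)
  qed
  \<comment> \<open>Two displaced points approach each other by at most
    \<open>2 * \<epsilon>\<close>. This must not use up the bound \<mu> near the diagonal, nor
    \<open>m2\<close> on \<open>K\<close>; the last term gives the contradiction to transversality
    at an opened double point.\<close>
  define \<epsilon> where "\<epsilon> = min (min \<mu> m2 / 3) (g / (5 * B * N))"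
  have \<epsilon>: "\<epsilon> > 0" "2 * \<epsilon> < \<mu>" "2 * \<epsilon> < m2" "4 * B * N * \<epsilon> < g"
  proof -
    show "\<epsilon> > 0" "2 * \<epsilon> < \<mu>" "2 * \<epsilon> < m2"
      using \<open>\<mu> > 0\<close> \<open>m2 > 0\<close> \<open>g > 0\<close> \<open>B > 0\<close> \<open>N > 0\<close> by (auto simp: \<epsilon>_def)
    have "\<epsilon> * (5 * B * N) \<le> g" using \<open>B > 0\<close> \<open>N > 0\<close> by (simp add: \<epsilon>_def pos_le_divide_eq[symmetric])
    moreover have "0 < \<epsilon> * (B * N)" using \<open>\<epsilon> > 0\<close> \<open>B > 0\<close> \<open>N > 0\<close> by simp
    ultimately show "4 * B * N * \<epsilon> < g" by (simp add: algebra_simps)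
  qed
  show ?thesis
  proof (intro exI[of _ \<epsilon>] conjI allI impI \<epsilon>(1), elim conjE)
    fix w D1 D2
    assume DD: "D = D1 \<union> D2"
      and wsmall: "\<forall>i<?l. \<forall>k<length (ps ! i). norm (w i k) \<le> \<epsilon>"
      and D1: "\<forall>d\<in>D1. gap ps w d \<noteq> 0 \<and> (\<forall>p\<in>near_values ps w (fst d) \<union> near_values ps w (snd d). norm p \<le> B * \<bar>gap ps w d\<bar>)"
      and D2: "\<forall>d\<in>D2. \<forall>p\<in>near_values ps w (fst d) \<union> near_values ps w (snd d). p = 0"
    let ?h = "\<lambda>i. curve (field ps w i)"
    have hsmall: "norm (?h i a) \<le> \<epsilon>" if i: "i < ?l" for i a
      by (rule curve_norm_le) (use wsmall i nz[OF i] in \<open>auto simp: field_def\<close>)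
    have hlip: "norm (?h i a - ?h i b) \<le> 2 * \<epsilon> * \<bar>a - b\<bar>" if i: "i < ?l" "\<bar>a - b\<bar> \<le> 1" for i a b
    proof (rule curve_diff_le[OF i(2)])
      fix k show "norm (vtx (field ps w i) (k + 1) - vtx (field ps w i) k) \<le> 2 * \<epsilon>"
        using norm_triangle_ineq4[of "vtx (field ps w i) (k + 1)" "vtx (field ps w i) k"]
          hsmall[OF i(1), of "of_int (k + 1)"] hsmall[OF i(1), of "of_int k"] unfolding curve_of_int by linarith
    qed
    have near: "(p, q) \<in> D2 \<and> x = 0 \<and> y = 0"
      if pq: "(p, q) \<in> D" and x: "\<bar>x\<bar> \<le> 1" and y: "\<bar>y\<bar> \<le> 1"
        and eq: "curve (ps ! fst p) (real (snd p) + x) + ?h (fst p) (real (snd p) + x) =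
          curve (ps ! fst q) (real (snd q) + y) + ?h (fst q) (real (snd q) + y)" for p q x y
    proof -
      let ?hp = "?h (fst p) (real (snd p) + x)" and ?hq = "?h (fst q) (real (snd q) + y)"
      let ?\<Delta> = "curve (ps ! fst p) (real (snd p) + x) - curve (ps ! fst q) (real (snd q) + y)"
      have \<Delta>: "?\<Delta> = ?hq - ?hp" using eq by (simp add: algebra_simps)
      have gd: "g * (\<bar>x\<bar> + \<bar>y\<bar>) \<le> norm ?\<Delta>" and n0: "normal ps (p, q) \<bullet> ?\<Delta> = 0"
        using g[OF pq x y] by auto
      note ok = singular_D(1-4)[OF S pq]
      show ?thesis
      proof (cases "(p, q) \<in> D2")
        case True
        have "norm ?hp \<le> 0" "norm ?hq \<le> 0"
          by (rule field_near(2)[OF ok(2) x], use D2 True in force)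
            (rule field_near(2)[OF ok(4) y], use D2 True in force)
        then have "g * (\<bar>x\<bar> + \<bar>y\<bar>) \<le> 0" using gd \<Delta> by simp
        then have "\<bar>x\<bar> + \<bar>y\<bar> \<le> 0" using \<open>g > 0\<close> by (simp add: mult_le_0_iff)
        then show ?thesis using True by auto
      next
        case False
        then have d1: "(p, q) \<in> D1" using pq DD by blast
        let ?G = "gap ps w (p, q)"
        let ?u = "?hp - w (fst p) (snd p)" and ?v = "?hq - w (fst q) (snd q)"
        have u: "norm ?u \<le> 2 * (B * \<bar>?G\<bar>) * \<bar>x\<bar>" and v: "norm ?v \<le> 2 * (B * \<bar>?G\<bar>) * \<bar>y\<bar>"
          using D1 d1 by (auto intro!: field_near(1) ok x y)
        \<comment> \<open>\<open>?u\<close> and \<open>?v\<close> are the changes of the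
          displacements since the double point. The branches stay in the plane orthogonal to the
          normal, so these changes alone would have to compensate the gap.\<close>
        have "normal ps (p, q) \<bullet> (?v - ?u) = ?G + normal ps (p, q) \<bullet> ?\<Delta>"
          unfolding \<Delta> by (simp add: gap_def inner_diff_right)
        then have "\<bar>?G\<bar> = \<bar>normal ps (p, q) \<bullet> (?v - ?u)\<bar>" using n0 by simp
        also have "\<dots> \<le> norm (normal ps (p, q)) * norm (?v - ?u)" by (rule Cauchy_Schwarz_ineq2)
        also have "\<dots> \<le> N * (2 * (B * \<bar>?G\<bar>) * \<bar>x\<bar> + 2 * (B * \<bar>?G\<bar>) * \<bar>y\<bar>)"
          using N[OF pq] \<open>N > 0\<close> u v norm_triangle_ineq4[of ?v ?u] by (intro mult_mono) auto
        also have "\<dots> = \<bar>?G\<bar> * (2 * N * B * (\<bar>x\<bar> + \<bar>y\<bar>))" by (simp add: algebra_simps)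
        finally have "\<bar>?G\<bar> * 1 \<le> \<bar>?G\<bar> * (2 * N * B * (\<bar>x\<bar> + \<bar>y\<bar>))" by simp
        moreover have "\<bar>?G\<bar> > 0" using D1 d1 by auto
        \<comment> \<open>The gap cancels. A coincidence can thus occur only at a parameter distance
          independent of the gap, and there transversality separates the branches by more than
          \<open>2 * \<epsilon>\<close>.\<close>
        ultimately have "1 \<le> 2 * N * B * (\<bar>x\<bar> + \<bar>y\<bar>)" by (simp only: mult_le_cancel_left_pos)
        then have "g * 1 \<le> g * (2 * N * B * (\<bar>x\<bar> + \<bar>y\<bar>))" using \<open>g > 0\<close> by (intro mult_left_mono) auto
        also have "\<dots> = 2 * N * B * (g * (\<bar>x\<bar> + \<bar>y\<bar>))" by simp
        also have "\<dots> \<le> 2 * N * B * (2 * \<epsilon>)"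
          using gd \<open>N > 0\<close> \<open>B > 0\<close> hsmall[OF ok(1), of "real (snd p) + x"] hsmall[OF ok(3), of "real (snd q) + y"]
            norm_triangle_ineq4[of ?hq ?hp] \<Delta> by (intro mult_left_mono) auto
        also have "\<dots> < g" using \<epsilon>(4) by (simp add: algebra_simps)
        finally show ?thesis by simp
      qed
    qed
    have coin: "same_param ps i a j b \<or> (\<exists>k m::int. a = of_int k \<and> b = of_int m \<and>
        ((pm ps i k, pm ps j m) \<in> D2 \<or> (pm ps j m, pm ps i k) \<in> D2))"
      if i: "i < ?l" and j: "j < ?l" and a: "a \<in> {0..?n i}" and b: "b \<in> {0..?n j}"
        and eq: "curve (ps ! i) a + ?h i a = curve (ps ! j) b + ?h j b" for i j a b
    proof -
      have "norm (curve (ps ! i) a - curve (ps ! j) b) = norm (?h i a - ?h j b)"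
        using eq by (rule norm_diff_of_sum_eq)
      also have "\<dots> \<le> 2 * \<epsilon>" using norm_triangle_ineq4[of "?h i a" "?h j b"] hsmall[OF i, of a] hsmall[OF j, of b] by linarith
      also have "\<dots> < m2" by (rule \<epsilon>)
      finally have "(a, b) \<notin> K i j" using m2[OF i j, of "(a, b)"] by auto
      \<comment> \<open>Outside \<open>K\<close>, the parameters are close to the diagonal or both
        close to the places of one double point.\<close>
      have "(i = j \<and> (\<exists>z::int. \<bar>b - a - of_int z * ?n i\<bar> < 1/2)) \<or>
          (\<exists>d\<in>D \<union> D\<inverse>. fst (fst d) = i \<and> fst (snd d) = j \<and> a \<notin> far i (snd (fst d)) \<and> b \<notin> far j (snd (snd d)))"
      proof (rule ccontr)
        assume neg: "\<not> ?thesis"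
        have "(a, b) \<in> K i j"
          unfolding K_def mem_Collect_eq fst_conv snd_conv
        proof (intro conjI impI allI ballI)
          show "(a, b) \<in> {0..?n i} \<times> {0..?n j}" using a b by simp
        next
          fix z :: int assume "i = j"
          then show "1/2 \<le> \<bar>b - a - of_int z * ?n i\<bar>" using neg not_less by blast
        next
          fix d assume "d \<in> D \<union> D\<inverse>" "fst (fst d) = i \<and> fst (snd d) = j"
          then show "a \<in> far i (snd (fst d)) \<or> b \<in> far j (snd (snd d))" using neg by blast
        qed
        then show False using \<open>(a, b) \<notin> K i j\<close> by simp
      qed
      then consider z :: int where "i = j" "\<bar>b - a - of_int z * ?n i\<bar> < 1/2"
        | d where "d \<in> D \<union> D\<inverse>" "fst (fst d) = i" "fst (snd d) = j" "a \<notin> far i (snd (fst d))" "b \<notin> far j (snd (snd d))"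
        by blast
      then show ?thesis
      proof cases
        case 1
        define b' where "b' = b + of_int (- z) * ?n i"
        have b': "curve (ps ! i) b' = curve (ps ! i) b" "?h i b' = ?h i b"
          using curve_add_multiple[of "ps ! i" b "- z"] curve_add_multiple[of "field ps w i" b "- z"] by (simp_all add: b'_def)
        have "b' = b - of_int z * ?n i" by (simp add: b'_def)
        then have close: "\<bar>a - b'\<bar> \<le> 1" using 1(2) by linarith
        have "\<mu> * \<bar>a - b'\<bar> \<le> norm (curve (ps ! i) a - curve (ps ! i) b')" by (rule local[OF i close])
        also have "\<dots> = norm (?h i a - ?h i b')"
          using eq unfolding b' \<open>i = j\<close>[symmetric] by (rule norm_diff_of_sum_eq)
        also have "\<dots> \<le> 2 * \<epsilon> * \<bar>a - b'\<bar>" by (rule hlip[OF i close])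
        finally have "(\<mu> - 2 * \<epsilon>) * \<bar>a - b'\<bar> \<le> 0" by (simp add: algebra_simps)
        then have "\<bar>a - b'\<bar> \<le> 0" using \<epsilon>(2) by (simp add: mult_le_0_iff)
        then have "b = a + of_int z * ?n i" by (simp add: b'_def)
        then show ?thesis using \<open>i = j\<close> by (auto simp: same_param_def)
      next
        case 2
        obtain p q where d: "d = (p, q)" by (cases d)
        obtain y z :: int where yz: "\<bar>a - real (snd p) - of_int y * ?n i\<bar> < 1/2" "\<bar>b - real (snd q) - of_int z * ?n j\<bar> < 1/2"
          using 2(4,5) unfolding far_def d by (auto simp: not_le)
        define x1 where "x1 = a - real (snd p) - of_int y * ?n i"
        define x2 where "x2 = b - real (snd q) - of_int z * ?n j"
        have fp: "fst p = i" "fst q = j" using 2 d by auto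
        have e1: "curve (ps ! i) (real (snd p) + x1) = curve (ps ! i) a" "?h i (real (snd p) + x1) = ?h i a"
          using curve_add_multiple[of "ps ! i" "real (snd p) + x1" y] curve_add_multiple[of "field ps w i" "real (snd p) + x1" y]
          by (simp_all add: x1_def)
        have e2: "curve (ps ! j) (real (snd q) + x2) = curve (ps ! j) b" "?h j (real (snd q) + x2) = ?h j b"
          using curve_add_multiple[of "ps ! j" "real (snd q) + x2" z] curve_add_multiple[of "field ps w j" "real (snd q) + x2" z]
          by (simp_all add: x2_def)
        have pqD: "(p, q) \<in> D \<or> (q, p) \<in> D" using 2(1) d by auto
        moreover have "curve (ps ! fst p) (real (snd p) + x1) + ?h (fst p) (real (snd p) + x1) =
            curve (ps ! fst q) (real (snd q) + x2) + ?h (fst q) (real (snd q) + x2)"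
          unfolding fp e1 e2 by (rule eq)
        moreover have "\<bar>x1\<bar> \<le> 1" "\<bar>x2\<bar> \<le> 1" using yz by (simp_all only: x1_def x2_def)
        ultimately have "((p, q) \<in> D2 \<or> (q, p) \<in> D2) \<and> x1 = 0 \<and> x2 = 0"
          using near[of p q x1 x2] near[of q p x2 x1] by metis
        moreover have "snd p < length (ps ! i)" "snd q < length (ps ! j)"
          using singular_D(2,4)[OF S, of p q] singular_D(2,4)[OF S, of q p] pqD fp by auto
        then have "pm ps i (int (snd p) + y * int (length (ps ! i))) = p" "pm ps j (int (snd q) + z * int (length (ps ! j))) = q"
          using fp by (auto simp: prod_eq_iff)
        ultimately show ?thesis
          by (intro disjI2 exI[of _ "int (snd p) + y * int (length (ps ! i))"] exI[of _ "int (snd q) + z * int (length (ps ! j))"])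
            (auto simp: x1_def x2_def)
      qed
    qed
    have D2sub: "D2 \<subseteq> D" using DD by blast
    have unmoved: "at_place (disp ps w) a = at_place ps a \<and> tangent (disp ps w) a = tangent ps a \<and> (straight_at ps a \<longrightarrow> straight_at (disp ps w) a)"
      if a: "fst a < ?l" "snd a < length (ps ! fst a)" and w0: "\<forall>p\<in>near_values ps w a. p = 0" for a
    proof -
      let ?k = "int (snd a)"
      have "vtx (field ps w (fst a)) (?k - 1) = 0" "vtx (field ps w (fst a)) ?k = 0" "vtx (field ps w (fst a)) (?k + 1) = 0"
        using w0 by (auto simp: near_values_def)
      then have v: "vtx (disp ps w ! fst a) (?k - 1) = vtx (ps ! fst a) (?k - 1)" "vtx (disp ps w ! fst a) ?k = vtx (ps ! fst a) ?k"
        "vtx (disp ps w ! fst a) (?k + 1) = vtx (ps ! fst a) (?k + 1)" using a nz by (simp_all add: vtx_disp)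
      have "at_place (disp ps w) a = at_place ps a" using at_place_vtx a v by simp
      then show ?thesis using v by (simp add: tangent_def edge_of_nat straight_at_def)
    qed
    show "singular (disp ps w) D2"
    proof (rule singularI)
      show "[] \<notin> set (disp ps w)" by (rule Nil_notin_disp[OF ne])
      fix a b assume ab: "(a, b) \<in> D2"
      then have abD: "(a, b) \<in> D" using D2sub by blast
      note ok = singular_D[OF S abD]
      have "\<forall>p\<in>near_values ps w a. p = 0" "\<forall>p\<in>near_values ps w b. p = 0" using D2 ab by auto
      then show "a \<noteq> b \<and> fst a < length (disp ps w) \<and> snd a < length (disp ps w ! fst a) \<and> fst b < length (disp ps w) \<and>
        snd b < length (disp ps w ! fst b) \<and> at_place (disp ps w) a = at_place (disp ps w) b \<and> straight_at (disp ps w) a \<and>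
        straight_at (disp ps w) b \<and> normal (disp ps w) (a, b) \<noteq> 0"
        using unmoved[of a] unmoved[of b] ok by (simp add: normal_def)
    next
      have "inj_on (\<lambda>d. at_place ps (fst d)) D" using S by (simp add: singular_def double_points_of_def)
      then have "inj_on (\<lambda>d. at_place ps (fst d)) D2" using D2sub by (rule inj_on_subset)
      moreover have "at_place (disp ps w) (fst d) = at_place ps (fst d)" if "d \<in> D2" for d
        using unmoved[of "fst d"] singular_D(1,2)[OF S, of "fst d" "snd d"] D2 D2sub that by auto
      ultimately show "inj_on (\<lambda>d. at_place (disp ps w) (fst d)) D2" by (simp cong: inj_on_cong)
    next
      fix i j s t assume "i < length (disp ps w)" "j < length (disp ps w)"
        and eq: "curve (disp ps w ! i) s = curve (disp ps w ! j) t"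
      then have i: "i < ?l" and j: "j < ?l" by auto
      obtain y where y: "0 \<le> s - 0 + of_int y * ?n i" "s - 0 + of_int y * ?n i < ?n i"
        using cyclic_representative[of "length (ps ! i)" s 0] npos[OF i] by auto
      obtain z where z: "0 \<le> t - 0 + of_int z * ?n j" "t - 0 + of_int z * ?n j < ?n j"
        using cyclic_representative[of "length (ps ! j)" t 0] npos[OF j] by auto
      let ?s = "s + of_int y * ?n i" and ?t = "t + of_int z * ?n j"
      have "curve (ps ! i) ?s + ?h i ?s = curve (ps ! j) ?t + ?h j ?t"
        using eq curve_add_multiple[of "field ps w i" s y] curve_add_multiple[of "field ps w j" t z]
        by (simp add: curve_disp i j nz curve_add_multiple)
      then have "same_param ps i ?s j ?t \<or> (\<exists>k m::int. ?s = of_int k \<and> ?t = of_int m \<and>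
          ((pm ps i k, pm ps j m) \<in> D2 \<or> (pm ps j m, pm ps i k) \<in> D2))"
        using y z by (intro coin i j) auto
      then show "same_param (disp ps w) i s j t \<or> (\<exists>k m::int. s = of_int k \<and> t = of_int m \<and>
          ((pm (disp ps w) i k, pm (disp ps w) j m) \<in> D2 \<or> (pm (disp ps w) j m, pm (disp ps w) i k) \<in> D2))"
      proof (elim disjE exE conjE)
        assume "same_param ps i ?s j ?t"
        then obtain x :: int where "i = j" "?t = ?s + of_int x * ?n i" by (auto simp: same_param_def)
        then have "t = s + of_int (y + x - z) * ?n i" by (simp add: algebra_simps)
        then have "same_param ps i s j t" unfolding same_param_def using \<open>i = j\<close> by blast
        then show ?thesis using i by simp
      next
        fix k m :: int assume km: "?s = of_int k" "?t = of_int m"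
        have "s = of_int (k - y * int (length (ps ! i)))" "t = of_int (m - z * int (length (ps ! j)))" using km by auto
        moreover have "(k - y * int (length (ps ! i))) mod int (length (ps ! i)) = k mod int (length (ps ! i))"
          "(m - z * int (length (ps ! j))) mod int (length (ps ! j)) = m mod int (length (ps ! j))"
          by (rule diff_multiple_mod)+
        moreover assume "(pm ps i k, pm ps j m) \<in> D2"
        ultimately show ?thesis using i j
          by (intro disjI2 exI[of _ "k - y * int (length (ps ! i))"] exI[of _ "m - z * int (length (ps ! j))"]) auto
      next
        fix k m :: int assume km: "?s = of_int k" "?t = of_int m"
        have "s = of_int (k - y * int (length (ps ! i)))" "t = of_int (m - z * int (length (ps ! j)))" using km by auto
        moreover have "(k - y * int (length (ps ! i))) mod int (length (ps ! i)) = k mod int (length (ps ! i))"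
          "(m - z * int (length (ps ! j))) mod int (length (ps ! j)) = m mod int (length (ps ! j))"
          by (rule diff_multiple_mod)+
        moreover assume "(pm ps j m, pm ps i k) \<in> D2"
        ultimately show ?thesis using i j
          by (intro disjI2 exI[of _ "k - y * int (length (ps ! i))"] exI[of _ "m - z * int (length (ps ! j))"]) auto
      qed
    qed
  qed
qed

subsection \<open>Opening all double points\<close>

text \<open>Fields that open every double point, with crossing signs \<sigma>. The bound by
  \<open>B\<close> says that nearby displacements are controlled by the gap itself, however small it
  is; this is the hypothesis of \<open>small_displacement\<close>. All conditions are convex in
  \<open>w\<close>.\<close>

definition splitting :: "point list list \<Rightarrow> dpoint set \<Rightarrow> real \<Rightarrow> real \<Rightarrow> (dpoint \<Rightarrow> real) \<Rightarrow> (nat \<Rightarrow> nat \<Rightarrow> point) \<Rightarrow> bool" where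
  "splitting ps D B \<epsilon> \<sigma> w \<longleftrightarrow>
    (\<forall>i < length ps. \<forall>k < length (ps ! i). norm (w i k) \<le> \<epsilon>) \<and>
    (\<forall>d\<in>D. \<bar>\<sigma> d\<bar> = 1 \<and> 0 < \<sigma> d * gap ps w d \<and>
      (\<forall>p \<in> near_values ps w (fst d) \<union> near_values ps w (snd d). norm p \<le> B * (\<sigma> d * gap ps w d)))"

lemma near_values_comb:
  assumes "ps ! fst a \<noteq> []" "p \<in> near_values ps (\<lambda>i k. x *\<^sub>R u i k + y *\<^sub>R w i k) a"
  shows "\<exists>q \<in> near_values ps u a. \<exists>r \<in> near_values ps w a. p = x *\<^sub>R q + y *\<^sub>R r"
  using assms by (fastforce simp: near_values_def vtx_field)

text \<open>For fixed signs, \<open>\<sigma> d * gap ps w d\<close> is linear in \<open>w\<close>,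
  so both its positivity and the upper bounds on norms in terms of it survive convex
  combinations.\<close>

lemma splitting_convex:
  assumes ne: "[] \<notin> set ps" and D: "\<And>d. d \<in> D \<Longrightarrow> fst (fst d) < length ps \<and> fst (snd d) < length ps"
    and u: "splitting ps D B \<epsilon> \<sigma> u" and w: "splitting ps D B \<epsilon> \<sigma> w" and s: "0 \<le> s" "s \<le> 1"
  shows "splitting ps D B \<epsilon> \<sigma> (\<lambda>i k. (1 - s) *\<^sub>R u i k + s *\<^sub>R w i k)" (is "splitting ps D B \<epsilon> \<sigma> ?v")
  unfolding splitting_def
proof (intro conjI allI impI ballI)
  have conv: "norm ((1 - s) *\<^sub>R x + s *\<^sub>R y) \<le> (1 - s) * X + s * Y" if "norm x \<le> X" "norm y \<le> Y" for x y :: point and X Y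
    using that s by (intro norm_triangle_le add_mono) (simp_all add: mult_left_mono)
  fix i k assume "i < length ps" "k < length (ps ! i)"
  then have "norm (?v i k) \<le> (1 - s) * \<epsilon> + s * \<epsilon>" using u w by (intro conv) (auto simp: splitting_def)
  then show "norm (?v i k) \<le> \<epsilon>" by (simp add: algebra_simps)
next
  have conv: "norm ((1 - s) *\<^sub>R x + s *\<^sub>R y) \<le> (1 - s) * X + s * Y" if "norm x \<le> X" "norm y \<le> Y" for x y :: point and X Y
    using that s by (intro norm_triangle_le add_mono) (simp_all add: mult_left_mono)
  fix d assume d: "d \<in> D"
  have g: "gap ps ?v d = (1 - s) * gap ps u d + s * gap ps w d"
    by (simp add: gap_def inner_add_right inner_diff_right algebra_simps)
  have sg: "\<sigma> d * gap ps ?v d = (1 - s) * (\<sigma> d * gap ps u d) + s * (\<sigma> d * gap ps w d)"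
    unfolding g by (simp add: algebra_simps)
  have pos: "0 < \<sigma> d * gap ps u d" "0 < \<sigma> d * gap ps w d" using u w d by (auto simp: splitting_def)
  show "\<bar>\<sigma> d\<bar> = 1" using u d by (auto simp: splitting_def)
  show "0 < \<sigma> d * gap ps ?v d"
  proof (cases "s = 0")
    case False
    then have "0 < s * (\<sigma> d * gap ps w d)" using s pos by simp
    then show ?thesis unfolding sg using s pos(1) by (smt (verit) mult_nonneg_nonneg)
  qed (simp add: sg pos)
  fix p assume p: "p \<in> near_values ps ?v (fst d) \<union> near_values ps ?v (snd d)"
  have nz: "ps ! fst (fst d) \<noteq> []" "ps ! fst (snd d) \<noteq> []" using D[OF d] ne nth_mem by metis+
  obtain q r where qr: "q \<in> near_values ps u (fst d) \<union> near_values ps u (snd d)"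
    "r \<in> near_values ps w (fst d) \<union> near_values ps w (snd d)" "p = (1 - s) *\<^sub>R q + s *\<^sub>R r"
    using p near_values_comb[OF nz(1), of p "1 - s" u s w] near_values_comb[OF nz(2), of p "1 - s" u s w] by blast
  have "norm p \<le> (1 - s) * (B * (\<sigma> d * gap ps u d)) + s * (B * (\<sigma> d * gap ps w d))"
    unfolding qr(3) using qr(1,2) u w d by (intro conv) (auto simp: splitting_def)
  then show "norm p \<le> B * (\<sigma> d * gap ps ?v d)" unfolding sg by (simp add: algebra_simps)
qed

text \<open>By convexity, the whole straight line between two such fields opens all double points.
  The isotopies between resolutions of different sizes come from here.\<close>

lemma splitting_embedded_family:
  assumes S: "singular ps D" and "B > 0"
  shows "\<exists>\<epsilon>>0. \<forall>\<sigma> u w s. splitting ps D B \<epsilon> \<sigma> u \<and> splitting ps D B \<epsilon> \<sigma> w \<and> 0 \<le> s \<and> s \<le> 1 \<longrightarrow>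
    embedded (disp (disp ps u) (\<lambda>i k. s *\<^sub>R (w i k - u i k)))"
proof -
  obtain \<epsilon> where \<epsilon>: "\<epsilon> > 0" "\<And>w D1 D2. D = D1 \<union> D2 \<and>
    (\<forall>i < length ps. \<forall>k < length (ps ! i). norm (w i k) \<le> \<epsilon>) \<and>
    (\<forall>d\<in>D1. gap ps w d \<noteq> 0 \<and>
      (\<forall>p \<in> near_values ps w (fst d) \<union> near_values ps w (snd d). norm p \<le> B * \<bar>gap ps w d\<bar>)) \<and>
    (\<forall>d\<in>D2. \<forall>p \<in> near_values ps w (fst d) \<union> near_values ps w (snd d). p = 0)
    \<longrightarrow> singular (disp ps w) D2" using small_displacement[OF assms] by blast
  have emb: "embedded (disp ps w)" if w: "splitting ps D B \<epsilon> \<sigma> w" for w \<sigma>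
  proof -
    have "gap ps w d \<noteq> 0 \<and> \<sigma> d * gap ps w d = \<bar>gap ps w d\<bar>" if "d \<in> D" for d
    proof -
      have "\<bar>\<sigma> d\<bar> = 1" "0 < \<sigma> d * gap ps w d" using w that by (auto simp: splitting_def)
      then show ?thesis by (metis abs_mult abs_of_pos mult_1 mult_zero_right less_irrefl)
    qed
    then have "singular (disp ps w) {}" using \<epsilon>(2)[of D "{}" w] w by (auto simp: splitting_def)
    then show ?thesis by (simp add: embedded_iff_singular)
  qed
  show ?thesis
  proof (intro exI[of _ \<epsilon>] conjI allI impI \<epsilon>(1), elim conjE)
    fix \<sigma> u w s assume "splitting ps D B \<epsilon> \<sigma> u" "splitting ps D B \<epsilon> \<sigma> w" "0 \<le> s" "s \<le> (1::real)"
    moreover have "fst (fst d) < length ps \<and> fst (snd d) < length ps" if "d \<in> D" for d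
      using singular_D(1,3)[OF S, of "fst d" "snd d"] that by simp
    moreover have "[] \<notin> set ps" using S by (simp add: singular_def)
    ultimately have "splitting ps D B \<epsilon> \<sigma> (\<lambda>i k. (1 - s) *\<^sub>R u i k + s *\<^sub>R w i k)" by (intro splitting_convex)
    moreover have "(\<lambda>i k. (1 - s) *\<^sub>R u i k + s *\<^sub>R w i k) = (\<lambda>i k. u i k + s *\<^sub>R (w i k - u i k))"
      by (simp add: algebra_simps)
    ultimately show "embedded (disp (disp ps u) (\<lambda>i k. s *\<^sub>R (w i k - u i k)))"
      using emb by (simp add: disp_disp)
  qed
qed

text \<open>The displacement made by \<open>resolve\<close>, with a free coefficient for each double
  point, so that signs and sizes may vary independently. A coefficient 0 leaves the double point
  closed.\<close>

definition resolution_field :: "point list list \<Rightarrow> dpoint set \<Rightarrow> (dpoint \<Rightarrow> real) \<Rightarrow> nat \<Rightarrow> nat \<Rightarrow> point" where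
  "resolution_field ps D c i k = (\<Sum>d\<in>D. if fst d = (i, k) then c d *\<^sub>R normal ps d else 0)"

lemma fst_resolve:
  "fst (resolve \<epsilon> L D N) = disp (fst L) (resolution_field (fst L) D (\<lambda>d. \<epsilon> * real_of_int (dsign N d)))"
  by (simp add: resolve_def disp_def resolution_field_def)

text \<open>No place belongs to two double points, since they would then have the same position,
  against injectivity. So the sum over \<open>D\<close> has one term at the first place and none at
  the second.\<close>

lemma resolution_field_at:
  assumes S: "singular ps D" and d: "d \<in> D"
  shows "resolution_field ps D c (fst (fst d)) (snd (fst d)) = c d *\<^sub>R normal ps d"
    "resolution_field ps D c (fst (snd d)) (snd (snd d)) = 0"
proof -
  have inj: "inj_on (\<lambda>d. at_place ps (fst d)) D" using S by (simp add: singular_def double_points_of_def)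
  have e: "fst d' = fst d \<longleftrightarrow> d' = d" if "d' \<in> D" for d'
    by (rule iffI) (rule inj_onD[OF inj _ that d], simp, simp)
  have "resolution_field ps D c (fst (fst d)) (snd (fst d)) = (\<Sum>d'\<in>D. if d' = d then c d' *\<^sub>R normal ps d' else 0)"
    unfolding resolution_field_def prod.collapse by (intro sum.cong refl if_cong) (use e in auto)
  then show "resolution_field ps D c (fst (fst d)) (snd (fst d)) = c d *\<^sub>R normal ps d"
    using d finite_double_points[OF S] by simp
  have "fst d' \<noteq> snd d" if "d' \<in> D" for d'
  proof
    assume "fst d' = snd d"
    then have "at_place ps (fst d') = at_place ps (fst d)"
      using singular_D(6)[OF S, of "fst d" "snd d"] d by simp
    then have "d' = d" using inj that d by (auto dest: inj_onD)
    then show False using \<open>fst d' = snd d\<close> singular_D(5)[OF S, of "fst d" "snd d"] d by simp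
  qed
  then show "resolution_field ps D c (fst (snd d)) (snd (snd d)) = 0"
    unfolding resolution_field_def prod.collapse by (intro sum.neutral) auto
qed

lemma resolution_field_zero: "(i, k) \<notin> fst ` D \<Longrightarrow> resolution_field ps D c i k = 0"
  unfolding resolution_field_def by (intro sum.neutral) (auto simp: image_iff)

lemma gap_resolution_field:
  assumes "singular ps D" "d \<in> D"
  shows "gap ps (resolution_field ps D c) d = c d * (norm (normal ps d))\<^sup>2"
  by (simp add: gap_def resolution_field_at[OF assms] power2_norm_eq_inner)

lemma resolution_field_norm:
  assumes S: "singular ps D" and "C \<ge> 0" "\<And>d. d \<in> D \<Longrightarrow> \<bar>c d\<bar> * norm (normal ps d) \<le> C"
  shows "norm (resolution_field ps D c i k) \<le> C"
proof (cases "(i, k) \<in> fst ` D")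
  case True
  then obtain d where "d \<in> D" "fst d = (i, k)" by force
  then show ?thesis using resolution_field_at(1)[OF S, of d c] assms(3)[of d] by simp
qed (simp add: resolution_field_zero \<open>C \<ge> 0\<close>)

text \<open>No edge joins two places of double points. Therefore \<open>near_values\<close> at a
  double point sees no displacement but its own.\<close>

definition isolated :: "point list list \<Rightarrow> dpoint set \<Rightarrow> bool" where
  "isolated ps D \<longleftrightarrow> (\<forall>a \<in> places D. \<forall>e \<in> {- 1, 1}. pm ps (fst a) (int (snd a) + e) \<notin> places D)"

lemma near_values_resolution_field:
  assumes S: "singular ps D" and I: "isolated ps D" and d: "d \<in> D" and D': "D' \<subseteq> D"
    and p: "p \<in> near_values ps (resolution_field ps D' c) (fst d) \<union> near_values ps (resolution_field ps D' c) (snd d)"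
  shows "p = 0 \<or> d \<in> D' \<and> p = c d *\<^sub>R normal ps d"
proof -
  let ?w = "resolution_field ps D' c"
  note ok = singular_D[OF S, of "fst d" "snd d", unfolded prod.collapse, OF d]
  have inj: "inj_on (\<lambda>d. at_place ps (fst d)) D" using S by (simp add: singular_def double_points_of_def)
  obtain a where a1: "a = fst d \<or> a = snd d" "p \<in> near_values ps ?w a" using p by blast
  obtain e where "p = vtx (field ps ?w (fst a)) (int (snd a) + e)" "e \<in> {- 1, 0, 1}"
    using a1(2) unfolding near_values_def by (rule imageE)
  note a = a1(1) this(2,1)
  have al: "fst a < length ps" "snd a < length (ps ! fst a)" using a(1) ok by auto
  then have nz: "ps ! fst a \<noteq> []" by auto
  have pw: "p = ?w (fst (pm ps (fst a) (int (snd a) + e))) (snd (pm ps (fst a) (int (snd a) + e)))"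
    unfolding a(3) by (simp add: vtx_field nz)
  show ?thesis
  proof (cases "e = 0")
    case False
    then have "pm ps (fst a) (int (snd a) + e) \<notin> places D"
      using I a(1,2) d unfolding isolated_def by blast
    then have "pm ps (fst a) (int (snd a) + e) \<notin> fst ` D'" using D' by blast
    then show ?thesis using pw resolution_field_zero[of "fst a"] by simp
  next
    case True
    then have pa: "p = ?w (fst a) (snd a)" using pw al by simp
    show ?thesis
    proof (cases "a \<in> fst ` D'")
      case False
      then show ?thesis using pa resolution_field_zero[of "fst a" "snd a"] by simp
    next
      case True
      then obtain d' where d': "d' \<in> D'" "fst d' = a" by blast
      have "at_place ps (fst d') = at_place ps (fst d)" using d' a(1) ok(6) by auto
      then have "d' = d" using inj d' D' d by (auto dest: inj_onD)
      have "(\<Sum>x\<in>D'. if fst x = (fst a, snd a) then c x *\<^sub>R normal ps x else 0) = (\<Sum>x\<in>D'. if x = d then c x *\<^sub>R normal ps x else 0)"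
      proof (intro sum.cong refl if_cong)
        fix x assume "x \<in> D'"
        then have "x \<in> D" using D' by blast
        show "(fst x = (fst a, snd a)) = (x = d)"
          using d' \<open>d' = d\<close> by (auto intro: inj_onD[OF inj _ \<open>x \<in> D\<close> d])
      qed
      moreover have "finite D'" using finite_double_points[OF S] D' by (rule finite_subset[rotated])
      ultimately show ?thesis using pa d' \<open>d' = d\<close> by (simp add: resolution_field_def)
    qed
  qed
qed

text \<open>The coefficient \<open>c d\<close> makes a gap of \<open>c d\<close> times the squared
  norm of the normal, with a displacement of \<open>|c d|\<close> times that norm. So
  \<open>B\<close> only has to dominate the reciprocals of the norms, whatever the sizes
  are.\<close>

lemma splitting_resolution_field:
  assumes S: "singular ps D" and I: "isolated ps D"
    and B: "\<And>d. d \<in> D \<Longrightarrow> 1 \<le> B * norm (normal ps d)"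
    and c: "\<And>d. d \<in> D \<Longrightarrow> \<bar>\<sigma> d\<bar> = 1 \<and> 0 < \<sigma> d * c d \<and> \<bar>c d\<bar> * norm (normal ps d) \<le> \<epsilon>" and "\<epsilon> \<ge> 0"
  shows "splitting ps D B \<epsilon> \<sigma> (resolution_field ps D c)"
  unfolding splitting_def
proof (intro conjI allI impI ballI)
  show "norm (resolution_field ps D c i k) \<le> \<epsilon>" for i k
    using c \<open>\<epsilon> \<ge> 0\<close> by (intro resolution_field_norm[OF S]) auto
  fix d assume d: "d \<in> D"
  show "\<bar>\<sigma> d\<bar> = 1" using c d by blast
  have n: "norm (normal ps d) > 0" using singular_D(9)[OF S, of "fst d" "snd d"] d by simp
  have g: "\<sigma> d * gap ps (resolution_field ps D c) d = (\<sigma> d * c d) * (norm (normal ps d))\<^sup>2"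
    by (simp add: gap_resolution_field[OF S d])
  show pos: "0 < \<sigma> d * gap ps (resolution_field ps D c) d" unfolding g using c[OF d] n by simp
  have sc: "\<sigma> d * c d = \<bar>c d\<bar>" using c[OF d] by (metis abs_mult abs_of_pos mult_1)
  fix p assume "p \<in> near_values ps (resolution_field ps D c) (fst d) \<union> near_values ps (resolution_field ps D c) (snd d)"
  then have "p = 0 \<or> p = c d *\<^sub>R normal ps d" using near_values_resolution_field[OF S I d] by blast
  then have "norm p \<le> \<bar>c d\<bar> * norm (normal ps d) * 1" by auto
  also have "\<dots> \<le> \<bar>c d\<bar> * norm (normal ps d) * (B * norm (normal ps d))"
    using B[OF d] by (intro mult_left_mono) auto
  also have "\<dots> = B * (\<sigma> d * gap ps (resolution_field ps D c) d)"
    unfolding g sc by (simp add: power2_eq_square algebra_simps)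
  finally show "norm p \<le> B * (\<sigma> d * gap ps (resolution_field ps D c) d)" .
qed

subsection \<open>Subdivision, rotation and affine images\<close>

text \<open>One construction covers affine images (\<open>N = 1\<close>, \<open>r = 0\<close>),
  subdivision and renumbering, so that the transport of double points and of resolutions is proved
  once for all three.\<close>

definition resample :: "nat \<Rightarrow> nat \<Rightarrow> (point \<Rightarrow> point) \<Rightarrow> point list \<Rightarrow> point list" where
  "resample N r A p = map (\<lambda>k. A (curve p (real (k + r) / real N))) [0..<N * length p]"

lemma length_resample [simp]: "length (resample N r A p) = N * length p"
  by (simp add: resample_def)

lemma vtx_resample:
  assumes "N > 0" "p \<noteq> []"
  shows "vtx (resample N r A p) k = A (curve p (of_int (k + int r) / real N))"
proof -
  let ?m = "int (N * length p)"
  have m: "?m > 0" using assms by simp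
  let ?j = "nat (k mod ?m)"
  have j: "?j < N * length p" using nat_mod_length_less[of "resample N r A p" k] assms by (simp add: resample_def)
  have "vtx (resample N r A p) k = A (curve p (real (?j + r) / real N))"
    using j by (simp add: vtx_def resample_def)
  moreover have "curve p (of_int (k + int r) / real N) = curve p (real (?j + r) / real N)"
  proof -
    have "int ?j = k mod ?m" by (rule nat_0_le) (rule pos_mod_sign[OF m])
    then have "k = int ?j + (k div ?m) * ?m" by (simp only: mod_div_mult_eq)
    then have "real_of_int k = real_of_int (int ?j + (k div ?m) * ?m)" by (rule arg_cong)
    then have "real_of_int k = real ?j + of_int (k div ?m) * (real N * real (length p))"
      by (simp only: of_int_add of_int_mult of_int_of_nat_eq of_nat_mult)
    then have "of_int (k + int r) / real N = real (?j + r) / real N + of_int (k div ?m) * real (length p)"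
      using assms(1) by (simp add: field_simps)
    then show ?thesis by (simp only: curve_add_multiple)
  qed
  ultimately show ?thesis by simp
qed

lemma curve_resample:
  assumes "N > 0" "p \<noteq> []" and A: "linear f" "\<And>x. A x = f x + c"
  shows "curve (resample N r A p) t = A (curve p ((t + real r) / real N))"
proof -
  define k where "k = \<lfloor>t\<rfloor>"
  define u where "u = t - of_int k"
  have u: "0 \<le> u" "u \<le> 1" unfolding u_def k_def by linarith+
  \<comment> \<open>The old edge that contains the whole small edge in question; no small edge
    passes over an old vertex, so the curve is affine on it.\<close>
  define j where "j = (k + int r) div int N"
  let ?a = "of_int (k + int r) / real N" and ?b = "of_int (k + 1 + int r) / real N"
  have N: "real N > 0" using assms by simp
  have jN: "j * int N \<le> k + int r" "k + int r + 1 \<le> (j + 1) * int N"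
  proof -
    have "(k + int r) mod int N \<ge> 0" "(k + int r) mod int N < int N" using assms(1) by simp_all
    moreover have "k + int r = j * int N + (k + int r) mod int N" by (simp add: j_def)
    ultimately show "j * int N \<le> k + int r" "k + int r + 1 \<le> (j + 1) * int N" by (simp_all add: distrib_right)
  qed
  have "real_of_int (j * int N) \<le> of_int (k + int r)" "real_of_int (k + int r + 1) \<le> of_int ((j + 1) * int N)"
    using jN by (simp_all only: of_int_le_iff)
  then have jr: "of_int j * real N \<le> of_int (k + int r)" "of_int (k + 1 + int r) \<le> (of_int j + 1) * real N" by (simp_all add: add_ac)
  have ab: "of_int j \<le> ?a" "?b \<le> of_int j + 1" "?a \<le> ?b"
    using jr N by (simp_all add: pos_le_divide_eq pos_divide_le_eq divide_right_mono)
  have x: "(t + real r) / real N = ?a + u / real N" "?b = ?a + 1 / real N"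
    by (simp_all add: u_def add_divide_distrib[symmetric] diff_divide_distrib[symmetric])
  have un: "0 \<le> u / real N" "u / real N \<le> 1 / real N" using u N by (simp_all add: divide_right_mono)
  let ?v = "vtx p j" and ?e = "vtx p (j + 1) - vtx p j"
  have ca: "curve p ?a = ?v + (?a - of_int j) *\<^sub>R ?e" by (rule curve_on_edge) (use ab in auto)
  have cb: "curve p ?b = ?v + (?b - of_int j) *\<^sub>R ?e" by (rule curve_on_edge) (use ab in auto)
  have ct: "curve p ((t + real r) / real N) = ?v + ((t + real r) / real N - of_int j) *\<^sub>R ?e"
    by (rule curve_on_edge) (use ab un x in auto)
  have sub: "(?v + (y - of_int j) *\<^sub>R ?e) - (?v + (z - of_int j) *\<^sub>R ?e) = (y - z) *\<^sub>R ?e" for y z :: real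
    by (simp add: algebra_simps)
  have yz: "?b - ?a = 1 / real N" "(t + real r) / real N - ?a = u / real N" using x by linarith+
  have d1: "curve p ?b - curve p ?a = (1 / real N) *\<^sub>R ?e"
    unfolding ca cb sub yz ..
  have d2: "curve p ((t + real r) / real N) - curve p ?a = (u / real N) *\<^sub>R ?e"
    unfolding ca ct sub yz ..
  have d: "curve p ((t + real r) / real N) = curve p ?a + u *\<^sub>R (curve p ?b - curve p ?a)"
    using d2 unfolding d1 by (simp add: algebra_simps)
  have "curve (resample N r A p) t = A (curve p ?a) + u *\<^sub>R (A (curve p ?b) - A (curve p ?a))"
    using curve_on_edge[of k t "resample N r A p"] u vtx_resample[OF assms(1,2)] by (simp add: u_def add_ac)
  also have "\<dots> = A (curve p ((t + real r) / real N))"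
    unfolding A(2) d by (simp add: linear_add[OF A(1)] linear_diff[OF A(1)] linear_scale[OF A(1)])
  finally show ?thesis .
qed

definition resample_link :: "nat \<Rightarrow> (nat \<Rightarrow> nat) \<Rightarrow> (point \<Rightarrow> point) \<Rightarrow> point list list \<Rightarrow> point list list" where
  "resample_link N r A ps = map (\<lambda>i. resample N (r i) A (ps ! i)) [0..<length ps]"

text \<open>Old vertex \<open>k\<close> has old parameter \<open>k\<close>; new vertex
  \<open>n\<close> has old parameter \<open>(n + r) / N\<close>. Hence the number
  \<open>N * k - r\<close>, reduced cyclically.\<close>

definition resample_place :: "nat \<Rightarrow> (nat \<Rightarrow> nat) \<Rightarrow> point list list \<Rightarrow> place \<Rightarrow> place" where
  "resample_place N r ps a = (fst a, nat ((int N * int (snd a) - int (r (fst a))) mod int (N * length (ps ! fst a))))"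

definition resample_dpoint :: "nat \<Rightarrow> (nat \<Rightarrow> nat) \<Rightarrow> point list list \<Rightarrow> dpoint \<Rightarrow> dpoint" where
  "resample_dpoint N r ps d = (resample_place N r ps (fst d), resample_place N r ps (snd d))"

lemma length_resample_link [simp]: "length (resample_link N r A ps) = length ps"
  by (simp add: resample_link_def)

lemma resample_link_nth [simp]: "i < length ps \<Longrightarrow> resample_link N r A ps ! i = resample N (r i) A (ps ! i)"
  by (simp add: resample_link_def)

lemma Nil_notin_resample_link: "N > 0 \<Longrightarrow> [] \<notin> set ps \<Longrightarrow> [] \<notin> set (resample_link N r A ps)"
  by (auto simp: in_set_conv_nth resample_def)

lemma pm_resample_link:
  assumes "i < length ps" "ps ! i \<noteq> []"
  shows "pm (resample_link N r A ps) i (int N * k - int (r i)) = resample_place N r ps (pm ps i k)"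
proof -
  have "(int N * (k mod int (length (ps ! i))) - int (r i)) mod (int N * int (length (ps ! i))) =
      (int N * k - int (r i)) mod (int N * int (length (ps ! i)))"
    by (metis mod_diff_left_eq mult_mod_right)
  then show ?thesis using assms by (simp add: resample_place_def)
qed

lemma resample_place_less:
  assumes "N > 0" "ps ! fst a \<noteq> []"
  shows "snd (resample_place N r ps a) < N * length (ps ! fst a)"
  using nat_mod_length_less[of "resample N 0 id (ps ! fst a)"] assms by (simp add: resample_place_def resample_def)

lemma inj_on_resample_place:
  assumes "N > 0"
  shows "inj_on (resample_place N r ps) {a. snd a < length (ps ! fst a)}"
proof (rule inj_onI)
  fix a b :: place assume a: "a \<in> {a. snd a < length (ps ! fst a)}" and b: "b \<in> {a. snd a < length (ps ! fst a)}"
    and e: "resample_place N r ps a = resample_place N r ps b"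
  have f: "fst a = fst b" using e by (simp add: resample_place_def)
  let ?m = "int (N * length (ps ! fst a))"
  have "ps ! fst a \<noteq> []" using a by auto
  then have m: "?m > 0" using assms by simp
  have "(int N * int (snd a) - int (r (fst a))) mod ?m = (int N * int (snd b) - int (r (fst a))) mod ?m"
    using e f m by (simp add: resample_place_def eq_nat_nat_iff)
  then have "((int N * int (snd a) - int (r (fst a))) + int (r (fst a))) mod ?m =
      ((int N * int (snd b) - int (r (fst a))) + int (r (fst a))) mod ?m" by (rule mod_add_cong) simp
  then have "(int N * int (snd a)) mod ?m = (int N * int (snd b)) mod ?m" by simp
  moreover have "int N * int (snd a) < ?m" "int N * int (snd b) < ?m"
    using a b f assms by (simp_all flip: of_nat_mult)
  ultimately have "int N * int (snd a) = int N * int (snd b)" by (simp flip: of_nat_mult)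
  then have "snd a = snd b" using assms by simp
  then show "a = b" using f by (simp add: prod_eq_iff)
qed

lemma vtx_resample_link:
  assumes N: "N > 0" and nz: "ps ! fst a \<noteq> []" and i: "fst a < length ps"
  shows "vtx (resample_link N r A ps ! fst a) (int (snd (resample_place N r ps a)) + e) =
    A (curve (ps ! fst a) (real (snd a) + of_int e / real N))"
proof -
  let ?n = "length (ps ! fst a)" and ?r = "int (r (fst a))"
  let ?k = "int N * int (snd a) - ?r"
  let ?m = "int (N * ?n)"
  have m: "?m > 0" using N nz by simp
  have "int (snd (resample_place N r ps a)) = ?k mod ?m" using m by (simp add: resample_place_def)
  then have k: "int (snd (resample_place N r ps a)) + e = (?k + e) + (- (?k div ?m)) * ?m"
    by (simp add: minus_div_mult_eq_mod[symmetric])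
  have "vtx (resample_link N r A ps ! fst a) (int (snd (resample_place N r ps a)) + e) = vtx (resample N (r (fst a)) A (ps ! fst a)) (?k + e)"
    unfolding k using vtx_add_multiple[of "resample N (r (fst a)) A (ps ! fst a)" "?k + e" "- (?k div ?m)"] i by simp
  also have "\<dots> = A (curve (ps ! fst a) (of_int (?k + e + ?r) / real N))" by (rule vtx_resample[OF N nz])
  also have "of_int (?k + e + ?r) / real N = real (snd a) + of_int e / real N" using N by (simp add: field_simps)
  finally show ?thesis .
qed

text \<open>Positive determinant, stated without determinants: the triple product is the determinant
  of \<open>f\<close> times the squared norm of \<open>cross3 u v\<close>. This is what preserves
  the signs of crossings.\<close>

definition orienting :: "(point \<Rightarrow> point) \<Rightarrow> bool" where
  "orienting f \<longleftrightarrow> linear f \<and> inj f \<and> (\<forall>u v. cross3 u v \<noteq> 0 \<longrightarrow> 0 < cross3 (f u) (f v) \<bullet> f (cross3 u v))"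

lemma tangent_resample_link:
  assumes N: "N > 0" and f: "linear f" "\<And>x. A x = f x + c" and a: "fst a < length ps" "snd a < length (ps ! fst a)"
  shows "tangent (resample_link N r A ps) (resample_place N r ps a) = (1 / real N) *\<^sub>R f (tangent ps a)"
    "at_place (resample_link N r A ps) (resample_place N r ps a) = A (at_place ps a)"
proof -
  have nz: "ps ! fst a \<noteq> []" using a by auto
  have fr: "fst (resample_place N r ps a) = fst a" by (simp add: resample_place_def)
  let ?k = "int (snd (resample_place N r ps a))"
  note v = vtx_resample_link[OF N nz a(1), of r A]
  have v0: "vtx (resample_link N r A ps ! fst a) ?k = A (at_place ps a)"
    using v[of 0] curve_of_nat[OF a(2)] by (simp add: at_place_def)
  have "curve (ps ! fst a) (real (snd a) + 1 / real N) = at_place ps a + (1 / real N) *\<^sub>R tangent ps a"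
    using curve_on_edge[of "int (snd a)" "real (snd a) + 1 / real N" "ps ! fst a"] N a
    by (simp add: at_place_vtx tangent_def edge_of_nat)
  then have "vtx (resample_link N r A ps ! fst a) (?k + 1) = A (at_place ps a + (1 / real N) *\<^sub>R tangent ps a)"
    using v[of 1] by simp
  then show "tangent (resample_link N r A ps) (resample_place N r ps a) = (1 / real N) *\<^sub>R f (tangent ps a)"
    using v0 by (simp add: tangent_def edge_of_nat fr f linear_add linear_scale)
  have "snd (resample_place N r ps a) < length (resample_link N r A ps ! fst a)"
    using resample_place_less[OF N nz] a by simp
  then show "at_place (resample_link N r A ps) (resample_place N r ps a) = A (at_place ps a)"
    using v0 by (simp add: at_place_vtx fr)
qed

lemma normal_resample_link:
  assumes S: "singular ps D" and N: "N > 0" and f: "linear f" "\<And>x. A x = f x + c" and d: "d \<in> D"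
  shows "normal (resample_link N r A ps) (resample_dpoint N r ps d) =
    (1 / (real N)\<^sup>2) *\<^sub>R cross3 (f (tangent ps (fst d))) (f (tangent ps (snd d)))"
  using singular_D[OF S, of "fst d" "snd d"] d
  by (simp add: normal_def resample_dpoint_def tangent_resample_link[OF N f] cross_mult_left cross_mult_right power2_eq_square)

lemma singular_resample_link:
  assumes S: "singular ps D" and N: "N > 0" and f: "orienting f" "\<And>x. A x = f x + c"
  shows "singular (resample_link N r A ps) (resample_dpoint N r ps ` D)"
proof (rule singularI)
  let ?ps = "resample_link N r A ps"
  let ?R = "resample_place N r ps"
  have lf: "linear f" and injf: "inj f" using f(1) by (auto simp: orienting_def)
  have ne: "[] \<notin> set ps" using S by (simp add: singular_def)
  have nz: "ps ! i \<noteq> []" if "i < length ps" for i using ne that nth_mem by metis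
  have injA: "A x = A y \<longleftrightarrow> x = y" for x y using injf f(2) by (auto dest: injD)
  have curve: "curve (?ps ! i) t = A (curve (ps ! i) ((t + real (r i)) / real N))" if "i < length ps" for i t
    using curve_resample[OF N nz[OF that] lf f(2)] that by simp
  show "[] \<notin> set ?ps" by (rule Nil_notin_resample_link[OF N ne])
  \<comment> \<open>With \<open>q\<close> the ratio of the speeds before and after the vertex, the
    vertex divides the segment between its new neighbours in the ratio \<open>q\<close> to 1; affine
    maps preserve this.\<close>
  have straight: "straight_at ?ps (?R a)" if a: "fst a < length ps" "snd a < length (ps ! fst a)" "straight_at ps a" "tangent ps a \<noteq> 0" for a
  proof -
    obtain q where q: "q > 0" "\<And>x. \<bar>x\<bar> \<le> 1 \<Longrightarrow> curve (ps ! fst a) (real (snd a) + x) =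
      at_place ps a + (if 0 \<le> x then x else q * x) *\<^sub>R tangent ps a" using straight_curve[OF a(2,3)] by blast
    let ?x = "at_place ps a" and ?t = "(1 / real N) *\<^sub>R tangent ps a"
    have fr: "fst (?R a) = fst a" by (simp add: resample_place_def)
    note v = vtx_resample_link[OF N nz[OF a(1)] a(1), of r A]
    have "\<bar>1 / real N\<bar> \<le> 1" "\<bar>- 1 / real N\<bar> \<le> 1" "\<not> 0 \<le> - 1 / real N" using N by auto
    then have "curve (ps ! fst a) (real (snd a) + 1 / real N) = ?x + ?t"
      "curve (ps ! fst a) (real (snd a) + (- 1) / real N) = ?x - q *\<^sub>R ?t"
      using q(2)[of "1 / real N"] q(2)[of "- 1 / real N"] by simp_all
    then have vv: "vtx (?ps ! fst a) (int (snd (?R a)) + 1) = A (?x + ?t)" "vtx (?ps ! fst a) (int (snd (?R a)) - 1) = A (?x - q *\<^sub>R ?t)"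
      using v[of 1] v[of "- 1"] by simp_all
    have "A ?x = (1 - q / (1 + q)) *\<^sub>R A (?x - q *\<^sub>R ?t) + (q / (1 + q)) *\<^sub>R A (?x + ?t)"
    proof -
      have "(1 - q / (1 + q)) *\<^sub>R A (?x - q *\<^sub>R ?t) + (q / (1 + q)) *\<^sub>R A (?x + ?t) =
        A ?x + (- (1 - q / (1 + q)) * q + q / (1 + q)) *\<^sub>R f ?t"
        unfolding f(2) linear_add[OF lf] linear_diff[OF lf] linear_scale[OF lf, of q] by (simp add: algebra_simps)
      also have "- (1 - q / (1 + q)) * q + q / (1 + q) = 0" using q(1) by (simp add: field_simps)
      finally show ?thesis by simp
    qed
    moreover have "A (?x - q *\<^sub>R ?t) \<noteq> A (?x + ?t)"
    proof
      assume "A (?x - q *\<^sub>R ?t) = A (?x + ?t)"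
      then have "?x - q *\<^sub>R ?t = ?x + ?t" unfolding injA .
      moreover have "(1 + q) *\<^sub>R y = (x + y) - (x - q *\<^sub>R y)" for x y :: point by (simp add: scaleR_add_left)
      ultimately have "(1 + q) *\<^sub>R ?t = 0" by (metis diff_self)
      then show False using q(1) N a(4) by simp
    qed
    ultimately have "A ?x \<in> open_segment (A (?x - q *\<^sub>R ?t)) (A (?x + ?t))"
      using q(1) unfolding in_segment by (intro conjI exI[of _ "q / (1 + q)"]) (auto simp: field_simps)
    then show ?thesis using vv tangent_resample_link(2)[OF N lf f(2) a(1,2)] by (simp add: straight_at_def fr)
  qed
  fix a b assume "(a, b) \<in> resample_dpoint N r ps ` D"
  then obtain p q where pq: "(p, q) \<in> D" "a = ?R p" "b = ?R q" by (auto simp: resample_dpoint_def)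
  note ok = singular_D[OF S pq(1)]
  have "tangent ps p \<noteq> 0" "tangent ps q \<noteq> 0" using ok(9) by (auto simp: normal_def cross_zero_left cross_zero_right)
  moreover have "a \<noteq> b" using inj_on_resample_place[OF N, of r ps] ok pq by (auto dest: inj_onD)
  moreover have "normal ?ps (a, b) \<noteq> 0"
  proof -
    have "cross3 (f (tangent ps p)) (f (tangent ps q)) \<noteq> 0"
      using f(1) ok(9) by (force simp: orienting_def normal_def)
    then show ?thesis using normal_resample_link[OF S N lf f(2) pq(1), of r] pq N by (simp add: resample_dpoint_def)
  qed
  moreover have "snd (?R x) < N * length (ps ! fst x)" if "fst x < length ps" for x
    using resample_place_less[OF N nz[OF that]] .
  ultimately show "a \<noteq> b \<and> fst a < length ?ps \<and> snd a < length (?ps ! fst a) \<and> fst b < length ?ps \<and>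
      snd b < length (?ps ! fst b) \<and> at_place ?ps a = at_place ?ps b \<and> straight_at ?ps a \<and> straight_at ?ps b \<and>
      normal ?ps (a, b) \<noteq> 0"
    using ok straight tangent_resample_link(2)[OF N lf f(2)] pq
    by (auto simp: resample_place_def[of N r ps, THEN arg_cong[of _ _ fst], simplified])
next
  let ?ps = "resample_link N r A ps"
  have lf: "linear f" and injf: "inj f" using f(1) by (auto simp: orienting_def)
  have injA: "A x = A y \<longleftrightarrow> x = y" for x y using injf f(2) by (auto dest: injD)
  have inj: "inj_on (\<lambda>d. at_place ps (fst d)) D" using S by (simp add: singular_def double_points_of_def)
  show "inj_on (\<lambda>d. at_place ?ps (fst d)) (resample_dpoint N r ps ` D)"
  proof (rule inj_onI)
    fix x y assume "x \<in> resample_dpoint N r ps ` D" "y \<in> resample_dpoint N r ps ` D"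
      and e: "at_place ?ps (fst x) = at_place ?ps (fst y)"
    then obtain d d' where d: "d \<in> D" "x = resample_dpoint N r ps d" "d' \<in> D" "y = resample_dpoint N r ps d'" by blast
    have "A (at_place ps (fst d)) = A (at_place ps (fst d'))"
      using e tangent_resample_link(2)[OF N lf f(2)] singular_D(1,2)[OF S, of "fst d" "snd d"]
        singular_D(1,2)[OF S, of "fst d'" "snd d'"] d by (simp add: resample_dpoint_def)
    then have "d = d'" using inj d unfolding injA by (auto dest: inj_onD)
    then show "x = y" using d by simp
  qed
next
  let ?ps = "resample_link N r A ps"
  have lf: "linear f" and injf: "inj f" using f(1) by (auto simp: orienting_def)
  have injA: "A x = A y \<longleftrightarrow> x = y" for x y using injf f(2) by (auto dest: injD)
  have ne: "[] \<notin> set ps" using S by (simp add: singular_def)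
  fix i j s t assume "i < length ?ps" "j < length ?ps" and e: "curve (?ps ! i) s = curve (?ps ! j) t"
  then have i: "i < length ps" and j: "j < length ps" by auto
  have nz: "ps ! i \<noteq> []" "ps ! j \<noteq> []" using ne i j nth_mem by metis+
  have "curve (ps ! i) ((s + real (r i)) / real N) = curve (ps ! j) ((t + real (r j)) / real N)"
    using e injA curve_resample[OF N nz(1) lf f(2)] curve_resample[OF N nz(2) lf f(2)] i j by simp
  from singular_coincidence[OF S i j this]
  show "same_param ?ps i s j t \<or> (\<exists>k m::int. s = of_int k \<and> t = of_int m \<and>
      ((pm ?ps i k, pm ?ps j m) \<in> resample_dpoint N r ps ` D \<or> (pm ?ps j m, pm ?ps i k) \<in> resample_dpoint N r ps ` D))"
  proof (elim disjE exE conjE)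
    assume "same_param ps i ((s + real (r i)) / real N) j ((t + real (r j)) / real N)"
    then obtain z :: int where z: "i = j" "(t + real (r j)) / real N = (s + real (r i)) / real N + of_int z * real (length (ps ! i))"
      by (auto simp: same_param_def)
    then have "t = s + of_int z * (real N * real (length (ps ! i)))" using N by (simp add: field_simps)
    then have "same_param ?ps i s j t" unfolding same_param_def using z(1) i by auto
    then show ?thesis ..
  next
    fix k m :: int
    assume "(s + real (r i)) / real N = of_int k" "(t + real (r j)) / real N = of_int m"
    then have km: "s = of_int (int N * k - int (r i))" "t = of_int (int N * m - int (r j))" using N by (simp_all add: field_simps)
    note pm = pm_resample_link[OF i nz(1), where N = N and r = r and A = A and k = k]
      pm_resample_link[OF j nz(2), where N = N and r = r and A = A and k = m]
    show ?thesis if "(pm ps i k, pm ps j m) \<in> D"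
    proof -
      have "(pm ?ps i (int N * k - int (r i)), pm ?ps j (int N * m - int (r j))) \<in> resample_dpoint N r ps ` D"
        unfolding pm using imageI[OF that, of "resample_dpoint N r ps"] by (simp only: resample_dpoint_def fst_conv snd_conv)
      then show ?thesis using km by blast
    qed
    show ?thesis if "(pm ps j m, pm ps i k) \<in> D"
    proof -
      have "(pm ?ps j (int N * m - int (r j)), pm ?ps i (int N * k - int (r i))) \<in> resample_dpoint N r ps ` D"
        unfolding pm using imageI[OF that, of "resample_dpoint N r ps"] by (simp only: resample_dpoint_def fst_conv snd_conv)
      then show ?thesis using km by blast
    qed
  qed
qed

lemma isotopic_resample_link:
  assumes N: "N > 0" and ne: "[] \<notin> set ps" and f: "linear f" "\<And>x. A x = f x + c"
    and H: "ambient_isotopy H" "\<And>x. H 1 x = A x"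
  shows "isotopic (ps, g) (resample_link N r A ps, g)"
  unfolding isotopic_def
proof (intro conjI exI[of _ H] H(1) allI impI)
  fix i assume "i < length (fst (ps, g))"
  then have i: "i < length ps" by simp
  then have nz: "ps ! i \<noteq> []" using ne nth_mem by metis
  let ?\<phi> = "\<lambda>t. real N * t - real (r i)"
  have "H 1 (curve (ps ! i) t) = curve (resample N (r i) A (ps ! i)) (?\<phi> t)" for t
    using curve_resample[OF N nz f, of "r i" "?\<phi> t"] N H(2) by simp
  moreover have "strict_mono ?\<phi>" using N by (auto simp: strict_mono_def)
  moreover have "continuous_on UNIV ?\<phi>" by (intro continuous_intros)
  ultimately show "\<exists>\<phi>. continuous_on UNIV \<phi> \<and> strict_mono \<phi> \<and>
      (\<forall>t. \<phi> (t + real (length (fst (ps, g) ! i))) = \<phi> t + real (length (fst (resample_link N r A ps, g) ! i))) \<and>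
      (\<forall>t. H 1 (curve (fst (ps, g) ! i) t) = curve (fst (resample_link N r A ps, g) ! i) (\<phi> t))"
    using i by (intro exI[of _ ?\<phi>]) (simp add: algebra_simps)
qed simp_all

subsection \<open>Pulling out fingers\<close>

lemma singular_coincidence_dom:
  assumes "singular ps D" "(i, s) \<in> link_dom ps" "(j, t) \<in> link_dom ps" "(i, s) \<noteq> (j, t)"
    "curve (ps ! i) s = curve (ps ! j) t"
  shows "\<exists>k m. s = real k \<and> t = real m \<and> (((i, k), (j, m)) \<in> D \<or> ((j, m), (i, k)) \<in> D)"
proof -
  have all: "\<forall>(i, s)\<in>link_dom ps. \<forall>(j, t)\<in>link_dom ps. (i, s) \<noteq> (j, t) \<and> curve (ps ! i) s = curve (ps ! j) t \<longrightarrow>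
      (\<exists>k m. s = real k \<and> t = real m \<and> (((i, k), (j, m)) \<in> D \<or> ((j, m), (i, k)) \<in> D))"
    using assms(1) unfolding singular_def double_points_of_def by (elim conjE)
  show ?thesis
    by (rule mp[OF bspec[OF bspec[OF all assms(2), unfolded prod.case] assms(3), unfolded prod.case] conjI[OF assms(4,5)]])
qed

lemma double_points_ofI:
  assumes "\<And>a b. (a, b) \<in> D \<Longrightarrow> a \<noteq> b \<and> (fst a, real (snd a)) \<in> X \<and> (fst b, real (snd b)) \<in> X \<and>
      at_place ps a = at_place ps b \<and> straight_at ps a \<and> straight_at ps b \<and> normal ps (a, b) \<noteq> 0"
    and "inj_on (\<lambda>d. at_place ps (fst d)) D"
    and "\<And>i j s t. (i, s) \<in> X \<Longrightarrow> (j, t) \<in> X \<Longrightarrow> (i, s) \<noteq> (j, t) \<Longrightarrow> curve (ps ! i) s = curve (ps ! j) t \<Longrightarrow>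
      \<exists>k m. s = real k \<and> t = real m \<and> (((i, k), (j, m)) \<in> D \<or> ((j, m), (i, k)) \<in> D)"
  shows "double_points_of X ps D"
  unfolding double_points_of_def
proof (intro conjI assms(2) ballI)
  fix d assume "d \<in> D"
  then show "case d of (a, b) \<Rightarrow> a \<noteq> b \<and> (fst a, real (snd a)) \<in> X \<and> (fst b, real (snd b)) \<in> X \<and>
      at_place ps a = at_place ps b \<and> straight_at ps a \<and> straight_at ps b \<and> normal ps (a, b) \<noteq> 0"
    using assms(1) by (cases d) blast
next
  fix x assume x: "x \<in> X"
  obtain i s where xe: "x = (i, s)" by (cases x)
  have "\<forall>y\<in>X. case y of (j, t) \<Rightarrow> (i, s) \<noteq> (j, t) \<and> curve (ps ! i) s = curve (ps ! j) t \<longrightarrow>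
      (\<exists>k m. s = real k \<and> t = real m \<and> (((i, k), (j, m)) \<in> D \<or> ((j, m), (i, k)) \<in> D))"
  proof
    fix y assume "y \<in> X"
    then show "case y of (j, t) \<Rightarrow> (i, s) \<noteq> (j, t) \<and> curve (ps ! i) s = curve (ps ! j) t \<longrightarrow>
      (\<exists>k m. s = real k \<and> t = real m \<and> (((i, k), (j, m)) \<in> D \<or> ((j, m), (i, k)) \<in> D))"
      using assms(3)[of i s] x xe by (cases y) blast
  qed
  then show "case x of (i, s) \<Rightarrow> \<forall>(j, t)\<in>X. (i, s) \<noteq> (j, t) \<and> curve (ps ! i) s = curve (ps ! j) t \<longrightarrow>
      (\<exists>k m. s = real k \<and> t = real m \<and> (((i, k), (j, m)) \<in> D \<or> ((j, m), (i, k)) \<in> D))"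
    unfolding xe prod.case .
qed

text \<open>Eight vertices are what the final shape requires: two tips, the two ends of the strand
  and the four vertices of a closing arc. The intermediate shapes have eight vertices as well, so
  that they can be blended linearly.\<close>

definition with_tails :: "point list list \<Rightarrow> (nat \<Rightarrow> point list) \<Rightarrow> point list list" where
  "with_tails ps T = map (\<lambda>i. take (length (ps ! i) - 8) (ps ! i) @ T i) [0..<length ps]"

text \<open>The vertices of the replaced part, including its two fixed ends \<open>e = 0\<close> and \<open>e = 9\<close>.\<close>

definition tail_vertex :: "point list \<Rightarrow> point list \<Rightarrow> nat \<Rightarrow> point" where
  "tail_vertex p T e = (if e = 0 then p ! (length p - 9) else if e = 9 then p ! 0 else T ! (e - 1))"

definition tail_point :: "point list \<Rightarrow> point list \<Rightarrow> nat \<Rightarrow> real \<Rightarrow> point" where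
  "tail_point p T e u = (1 - u) *\<^sub>R tail_vertex p T e + u *\<^sub>R tail_vertex p T (e + 1)"

lemma length_with_tails [simp]: "length (with_tails ps T) = length ps"
  by (simp add: with_tails_def)

lemma Nil_notin_with_tails: "(\<And>i. i < length ps \<Longrightarrow> T i \<noteq> []) \<Longrightarrow> [] \<notin> set (with_tails ps T)"
  by (auto simp: with_tails_def)

lemma length_with_tails_nth:
  "i < length ps \<Longrightarrow> length (T i) = 8 \<Longrightarrow> 10 \<le> length (ps ! i) \<Longrightarrow> length (with_tails ps T ! i) = length (ps ! i)"
  by (simp add: with_tails_def)

lemma with_tails_nth_old:
  assumes "i < length ps" "length (T i) = 8" "10 \<le> length (ps ! i)" "k + 8 < length (ps ! i) \<or> k + 9 = length (ps ! i)"
  shows "with_tails ps T ! i ! k = ps ! i ! k"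
  using assms by (auto simp: with_tails_def nth_append)

lemma vtx_tail:
  assumes "i < length ps" "length (T i) = 8" "10 \<le> length (ps ! i)" "e \<le> 9"
  shows "vtx (with_tails ps T ! i) (int (length (ps ! i) - 9 + e)) = tail_vertex (ps ! i) (T i) e"
proof -
  let ?n = "length (ps ! i)"
  have l: "length (with_tails ps T ! i) = ?n" by (rule length_with_tails_nth[of i ps T, OF assms(1-3)])
  have wt: "with_tails ps T ! i = take (?n - 8) (ps ! i) @ T i" using assms(1) by (simp add: with_tails_def)
  consider "e = 0" | "1 \<le> e" "e \<le> 8" | "e = 9" using assms(4) by linarith
  then show ?thesis
  proof cases
    case 1
    then show ?thesis using assms l by (subst vtx_nat) (auto simp: tail_vertex_def wt nth_append)
  next
    case 2
    then have k: "?n - 9 + e < ?n" "\<not> ?n - 9 + e < ?n - 8" "?n - 9 + e - (?n - 8) = e - 1" using assms by auto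
    then show ?thesis using 2 l assms
      by (simp only: vtx_nat[of "?n - 9 + e" "with_tails ps T ! i"]) (simp add: tail_vertex_def wt nth_append min_absorb2)
  next
    case 3
    \<comment> \<open>The ninth edge ends at vertex 0, one period later.\<close>
    then have "int (?n - 9 + e) = 0 + 1 * int ?n" using assms by simp
    then have "vtx (with_tails ps T ! i) (int (?n - 9 + e)) = vtx (with_tails ps T ! i) (int 0)"
      using vtx_add_multiple[of "with_tails ps T ! i" 0 1] l by simp
    also have "\<dots> = ps ! i ! 0" using assms l by (subst vtx_nat) (auto simp: wt nth_append)
    finally show ?thesis using 3 by (simp add: tail_vertex_def)
  qed
qed

lemma curve_tail:
  assumes "i < length ps" "length (T i) = 8" "10 \<le> length (ps ! i)" "e < 9" "0 \<le> u" "u \<le> 1"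
  shows "curve (with_tails ps T ! i) (real (length (ps ! i) - 9) + real e + u) = tail_point (ps ! i) (T i) e u"
proof -
  let ?k = "int (length (ps ! i) - 9 + e)"
  have "curve (with_tails ps T ! i) (real (length (ps ! i) - 9) + real e + u) = vtx (with_tails ps T ! i) ?k +
      u *\<^sub>R (vtx (with_tails ps T ! i) (?k + 1) - vtx (with_tails ps T ! i) ?k)"
    using curve_on_edge[of ?k "real (length (ps ! i) - 9) + real e + u" "with_tails ps T ! i"] assms(5,6) by simp
  moreover have "vtx (with_tails ps T ! i) (?k + 1) = tail_vertex (ps ! i) (T i) (e + 1)"
    using vtx_tail[of i ps T "e + 1", OF assms(1-3)] assms(4) by (simp add: add_ac)
  ultimately show ?thesis using vtx_tail[of i ps T e, OF assms(1-3)] assms(4) by (simp add: tail_point_def algebra_simps)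
qed

lemma tail_param:
  assumes "10 \<le> n" "real n - 9 \<le> s" "s < real n"
  obtains e u where "e < 9" "0 \<le> u" "u < 1" "s = real (n - 9) + real e + u"
proof
  define e where "e = nat \<lfloor>s - real (n - 9)\<rfloor>"
  have r: "real (n - 9) = real n - 9" using assms(1) by simp
  then have e: "real e = of_int \<lfloor>s - real (n - 9)\<rfloor>" using assms by (simp add: e_def)
  then show "0 \<le> s - real (n - 9) - real e" "s - real (n - 9) - real e < 1" by linarith+
  have "real e < 9" using e r assms(3) by linarith
  then show "e < 9" by simp
qed simp

lemma curve_with_tails_old:
  assumes "i < length ps" "length (T i) = 8" "10 \<le> length (ps ! i)" "0 \<le> t" "t < real (length (ps ! i)) - 9"
  shows "curve (with_tails ps T ! i) t = curve (ps ! i) t"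
proof -
  let ?n = "length (ps ! i)"
  define k where "k = nat \<lfloor>t\<rfloor>"
  have k: "int k = \<lfloor>t\<rfloor>" using assms(4) by (simp add: k_def)
  have "real k < real ?n - 9" using k assms(5) by linarith
  then have kn: "k + 9 < ?n" by linarith
  note l = length_with_tails_nth[of i ps T, OF assms(1-3)]
  have "vtx (with_tails ps T ! i) (int k) = vtx (ps ! i) (int k)"
    using kn l by (simp add: vtx_nat with_tails_nth_old[of i ps T, OF assms(1-3)])
  moreover have "vtx (with_tails ps T ! i) (int (k + 1)) = vtx (ps ! i) (int (k + 1))"
    using kn l by (subst (1 2) vtx_nat) (auto simp: with_tails_nth_old[of i ps T, OF assms(1-3)])
  moreover have "curve q t = vtx q (int k) + (t - of_int (int k)) *\<^sub>R (vtx q (int k + 1) - vtx q (int k))" for q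
    unfolding k by (rule curve_on_edge) linarith+
  ultimately show ?thesis by (simp add: add_ac)
qed

text \<open>Coincidences within the kept part are inherited, so only the new chains need checking,
  against the kept part and against each other. The half-open ranges of parameters keep the common
  end points from counting as coincidences, and the bounds on places keep both edges at each double
  point unchanged.\<close>

lemma singular_with_tails:
  assumes S: "singular ps D"
    and len: "\<And>i. i < length ps \<Longrightarrow> 10 \<le> length (ps ! i) \<and> length (T i) = 8"
    and D: "\<And>a. a \<in> places D \<Longrightarrow> 1 \<le> snd a \<and> snd a + 10 \<le> length (ps ! fst a)"
    and old: "\<And>i j e u t. i < length ps \<Longrightarrow> j < length ps \<Longrightarrow> e < 9 \<Longrightarrow> 0 \<le> u \<Longrightarrow> u < 1 \<Longrightarrow> 0 \<le> t \<Longrightarrow>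
      t < real (length (ps ! j)) - 9 \<Longrightarrow> tail_point (ps ! i) (T i) e u \<noteq> curve (ps ! j) t"
    and new: "\<And>i j e u e' u'. i < length ps \<Longrightarrow> j < length ps \<Longrightarrow> e < 9 \<Longrightarrow> 0 \<le> u \<Longrightarrow> u < 1 \<Longrightarrow>
      e' < 9 \<Longrightarrow> 0 \<le> u' \<Longrightarrow> u' < 1 \<Longrightarrow> tail_point (ps ! i) (T i) e u = tail_point (ps ! j) (T j) e' u' \<Longrightarrow>
      i = j \<and> e = e' \<and> u = u'"
  shows "singular (with_tails ps T) D"
proof -
  let ?q = "with_tails ps T"
  have lenq: "length (?q ! i) = length (ps ! i)" if "i < length ps" for i
    using length_with_tails_nth[of i ps T] len that by blast
  have old_curve: "curve (?q ! i) t = curve (ps ! i) t" if "i < length ps" "0 \<le> t" "t < real (length (ps ! i)) - 9" for i t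
    using curve_with_tails_old[of i ps T] len that by blast
  have dom: "link_dom ?q = link_dom ps" using lenq by (auto simp: link_dom_def)
  have same: "at_place ?q a = at_place ps a \<and> tangent ?q a = tangent ps a \<and> (straight_at ps a \<longrightarrow> straight_at ?q a)"
    if a: "a \<in> places D" "fst a < length ps" for a
  proof -
    obtain i k where ik: "a = (i, k)" by (cases a)
    have i: "i < length ps" and k: "1 \<le> k" "k + 10 \<le> length (ps ! i)" using a D[OF a(1)] ik by auto
    have v: "vtx (?q ! i) (int m) = vtx (ps ! i) (int m)" if "m + 9 \<le> length (ps ! i)" for m
      using that len[OF i] lenq[OF i] by (subst (1 2) vtx_nat) (auto intro!: with_tails_nth_old[OF i])
    have "vtx (?q ! i) (int k) = vtx (ps ! i) (int k)" "vtx (?q ! i) (int (k - 1)) = vtx (ps ! i) (int (k - 1))"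
      "vtx (?q ! i) (int (k + 1)) = vtx (ps ! i) (int (k + 1))" by (rule v, use k in linarith)+
    note vv = this
    have e: "int (k - 1) = int k - 1" "int (k + 1) = int k + 1" using k by auto
    note vv[unfolded e]
    moreover have "at_place ?q a = vtx (?q ! i) (int k)" "at_place ps a = vtx (ps ! i) (int k)"
      using k lenq[OF i] ik by (simp_all add: at_place_vtx)
    ultimately show ?thesis using ik by (simp add: tangent_def edge_of_nat straight_at_def)
  qed
  have "[] \<notin> set ?q"
    using len by (intro Nil_notin_with_tails) fastforce
  moreover have "double_points_of (link_dom ?q) ?q D"
  proof (rule double_points_ofI)
    fix a b assume ab: "(a, b) \<in> D"
    then have "a \<in> places D" "b \<in> places D" by force+
    then show "a \<noteq> b \<and> (fst a, real (snd a)) \<in> link_dom ?q \<and> (fst b, real (snd b)) \<in> link_dom ?q \<and>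
      at_place ?q a = at_place ?q b \<and> straight_at ?q a \<and> straight_at ?q b \<and> normal ?q (a, b) \<noteq> 0"
      using singular_D[OF S ab] same[of a] same[of b] unfolding dom by (auto simp: link_dom_def normal_def)
  next
    have "inj_on (\<lambda>d. at_place ps (fst d)) D" using S by (simp add: singular_def double_points_of_def)
    moreover have "at_place ?q (fst d) = at_place ps (fst d)" if "d \<in> D" for d
      using same[of "fst d"] singular_D(1)[OF S, of "fst d" "snd d"] that by auto
    ultimately show "inj_on (\<lambda>d. at_place ?q (fst d)) D" by (simp cong: inj_on_cong)
  next
    fix i j s t assume dom_s: "(i, s) \<in> link_dom ?q" and dom_t: "(j, t) \<in> link_dom ?q" and ne: "(i, s) \<noteq> (j, t)"
      and eq: "curve (?q ! i) s = curve (?q ! j) t"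
    have b: "i < length ps" "0 \<le> s" "s < real (length (ps ! i))" "j < length ps" "0 \<le> t" "t < real (length (ps ! j))"
      using dom_s dom_t unfolding dom by (auto simp: link_dom_def)
    have tail: "\<exists>e u. e < 9 \<and> 0 \<le> u \<and> u < 1 \<and> s = real (length (ps ! i) - 9) + real e + u \<and> curve (?q ! i) s = tail_point (ps ! i) (T i) e u"
      if i: "i < length ps" and s: "real (length (ps ! i)) - 9 \<le> s" "s < real (length (ps ! i))" for i s
    proof -
      obtain e u where eu: "e < 9" "0 \<le> u" "u < 1" "s = real (length (ps ! i) - 9) + real e + u"
        using tail_param[of "length (ps ! i)" s] len[OF i] s by blast
      then show ?thesis using curve_tail[of i ps T e u] len[OF i] i by (intro exI[of _ e] exI[of _ u]) auto
    qed
    show "\<exists>k m. s = real k \<and> t = real m \<and> (((i, k), (j, m)) \<in> D \<or> ((j, m), (i, k)) \<in> D)"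
    proof (cases "s < real (length (ps ! i)) - 9")
      case s: True
      show ?thesis
      proof (cases "t < real (length (ps ! j)) - 9")
        case t: True
        have "curve (ps ! i) s = curve (ps ! j) t" using eq old_curve b s t by simp
        then show ?thesis using singular_coincidence_dom[OF S _ _ ne] dom_s dom_t unfolding dom by blast
      next
        case False
        then obtain e u where eu: "e < 9" "0 \<le> u" "u < 1" "curve (?q ! j) t = tail_point (ps ! j) (T j) e u"
          using tail[of j t] b by auto
        have "curve (ps ! i) s = tail_point (ps ! j) (T j) e u" using eq old_curve b s eu(4) by simp
        then show ?thesis using old[OF b(4,1) eu(1-3) b(2) s] by simp
      qed
    next
      case False
      then obtain e u where eu: "e < 9" "0 \<le> u" "u < 1" "s = real (length (ps ! i) - 9) + real e + u"
        "curve (?q ! i) s = tail_point (ps ! i) (T i) e u"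
        using tail[of i s] b by auto
      show ?thesis
      proof (cases "t < real (length (ps ! j)) - 9")
        case t: True
        have "curve (ps ! j) t = tail_point (ps ! i) (T i) e u" using eq old_curve b t eu(5) by simp
        then show ?thesis using old[OF b(1,4) eu(1-3) b(5) t] by simp
      next
        case False
        then obtain e' u' where eu': "e' < 9" "0 \<le> u'" "u' < 1" "t = real (length (ps ! j) - 9) + real e' + u'"
          "curve (?q ! j) t = tail_point (ps ! j) (T j) e' u'"
          using tail[of j t] b by auto
        have "i = j \<and> e = e' \<and> u = u'"
          by (rule new[OF b(1,4) eu(1-3) eu'(1-3)]) (use eq eu eu' in simp)
        then have "(i, s) = (j, t)" unfolding eu(4) eu'(4) by simp
        then show ?thesis using ne by blast
      qed
    qed
  qed
  ultimately show ?thesis by (simp add: singular_def)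
qed

text \<open>A functional which is strictly monotone along the vertices separates the points of a chain.\<close>

lemma chain_strict:
  fixes F :: "nat \<Rightarrow> real"
  assumes dec: "\<And>e. a \<le> e \<Longrightarrow> e < b \<Longrightarrow> F (e + 1) < F e"
    and e: "a \<le> e" "e < b" "0 \<le> u" "u < 1" and e': "a \<le> e'" "e' < b" "0 \<le> u'" "u' < 1"
    and eq: "(1 - u) * F e + u * F (e + 1) = (1 - u') * F e' + u' * F (e' + 1)"
  shows "e = e' \<and> u = u'"
proof -
  have mono: "F y \<le> F x" if "a \<le> x" "x \<le> y" "y \<le> b" for x y
    using that(2,3)
  proof (induction y rule: dec_induct)
    case (step n)
    then show ?case using dec[of n] that(1) by simp
  qed simp
  have lt: "(1 - u') * F e' + u' * F (e' + 1) < (1 - u) * F e + u * F (e + 1)"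
    if "e < e'" "a \<le> e" "e' < b" "0 \<le> u" "u < 1" "0 \<le> u'" "u' < 1" for e e' u u'
  proof -
    have "(1 - u') * F e' + u' * F (e' + 1) \<le> (1 - u') * F e' + u' * F e'"
      using that dec[of e'] by (intro add_left_mono mult_left_mono) auto
    also have "\<dots> = F e'" by (simp add: algebra_simps)
    also have "\<dots> \<le> F (e + 1)" using that by (intro mono) auto
    also have "\<dots> = (1 - u) * F (e + 1) + u * F (e + 1)" by (simp add: algebra_simps)
    also have "\<dots> < (1 - u) * F e + u * F (e + 1)"
      using that dec[of e] by (intro add_strict_right_mono mult_strict_left_mono) auto
    finally show ?thesis .
  qed
  have "e = e'" using lt[of e e' u u'] lt[of e' e u' u] e e' eq by (metis less_irrefl linorder_neqE_nat)
  moreover have "(u - u') * (F e - F (e + 1)) = 0" using eq unfolding \<open>e = e'\<close> by (simp add: algebra_simps)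
  moreover have "F e - F (e + 1) \<noteq> 0" using dec[of e] e by auto
  ultimately show ?thesis by simp
qed

text \<open>
  A planar looking chain with eight vertices: \<open>Z\<close> separates its first four vertices from the last
  four, \<open>U\<close> and \<open>W\<close> are monotone on the two halves, and the edge joining the halves lies where \<open>F\<close>
  is minimal.
\<close>

lemma chain_pattern:
  fixes v :: "nat \<Rightarrow> point" and U W F Z :: "point \<Rightarrow> real"
  assumes aff: "\<And>f x y u. f \<in> {U, W, F, Z} \<Longrightarrow> f ((1 - u) *\<^sub>R x + u *\<^sub>R y) = (1 - u) * f x + u * f y"
    and U: "\<And>e. 1 \<le> e \<Longrightarrow> e < 4 \<Longrightarrow> U (v (e + 1)) < U (v e)"
    and W: "\<And>e. 5 \<le> e \<Longrightarrow> e < 8 \<Longrightarrow> W (v e) < W (v (e + 1))"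
    and F: "\<And>e. e \<in> {1, 2, 3, 6, 7, 8} \<Longrightarrow> m < F (v e)" "F (v 4) = m" "F (v 5) = m"
    and Z: "\<And>e. 1 \<le> e \<Longrightarrow> e \<le> 4 \<Longrightarrow> c < Z (v e)" "\<And>e. 5 \<le> e \<Longrightarrow> e \<le> 8 \<Longrightarrow> Z (v e) < c"
    and e: "1 \<le> e" "e \<le> 7" "0 \<le> u" "u < 1" and e': "1 \<le> e'" "e' \<le> 7" "0 \<le> u'" "u' < 1"
    and eq: "(1 - u) *\<^sub>R v e + u *\<^sub>R v (e + 1) = (1 - u') *\<^sub>R v e' + u' *\<^sub>R v (e' + 1)"
  shows "e = e' \<and> u = u'"
proof -
  have lo: "c < (1 - u) * x + u * y" if "c < x" "c < y" "0 \<le> u" "u < 1" for c x y u :: real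
  proof -
    have "c = (1 - u) * c + u * c" by (simp add: algebra_simps)
    also have "\<dots> < (1 - u) * x + u * y" using that by (intro add_less_le_mono mult_strict_left_mono mult_left_mono) auto
    finally show ?thesis .
  qed
  have lo1: "c < (1 - u) * x + u * y" if "c < x" "c \<le> y" "0 \<le> u" "u < 1" for c x y u :: real
  proof -
    have "c = (1 - u) * c + u * c" by (simp add: algebra_simps)
    also have "\<dots> < (1 - u) * x + u * y" using that by (intro add_less_le_mono mult_strict_left_mono mult_left_mono) auto
    finally show ?thesis .
  qed
  have hi: "(1 - u) * x + u * y < c" if "x < c" "y < c" "0 \<le> u" "u < 1" for c x y u :: real
  proof -
    have "(1 - u) * x + u * y < (1 - u) * c + u * c" using that by (intro add_less_le_mono mult_strict_left_mono mult_left_mono) auto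
    then show ?thesis by (simp add: algebra_simps)
  qed
  define p where "p = (\<lambda>e u. (1 - u) *\<^sub>R v e + u *\<^sub>R v (e + 1))"
  have pf: "f (p e u) = (1 - u) * f (v e) + u * f (v (e + 1))" if "f \<in> {U, W, F, Z}" for f e u
    unfolding p_def by (rule aff[OF that])
  have eqp: "p e u = p e' u'" using eq by (simp add: p_def)
  have up: "m < F (p e u)" "c < Z (p e u)" if "1 \<le> e" "e \<le> 3" "0 \<le> u" "u < 1" for e u
  proof -
    have "m < F (v e)" "m \<le> F (v (e + 1))"
      using that F(1)[of e] F(1)[of "e + 1"] F(2) by (auto simp: le_Suc_eq numeral_eq_Suc)
    then show "m < F (p e u)" using that by (simp add: pf lo1)
    show "c < Z (p e u)" using that Z(1)[of e] Z(1)[of "e + 1"] by (simp add: pf lo)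
  qed
  have dn: "Z (p e u) < c" "m \<le> F (p e u)" "F (p e u) = m \<Longrightarrow> e = 5 \<and> u = 0" if "5 \<le> e" "e \<le> 7" "0 \<le> u" "u < 1" for e u
  proof -
    show "Z (p e u) < c" using that Z(2)[of e] Z(2)[of "e + 1"] by (simp add: pf hi)
    have "e \<in> {5, 6, 7}" using that by (auto simp: le_Suc_eq numeral_eq_Suc)
    moreover have "m < F (p e u)" if "e = 6 \<or> e = 7"
      using that F(1)[of e] F(1)[of "e + 1"] \<open>0 \<le> u\<close> \<open>u < 1\<close> by (auto simp: pf lo)
    moreover have "F (p 5 u) = m + u * (F (v 6) - m)" using F(3) by (simp add: pf algebra_simps)
    moreover have "F (v 6) - m > 0" using F(1)[of 6] by simp
    ultimately show "m \<le> F (p e u)" "F (p e u) = m \<Longrightarrow> e = 5 \<and> u = 0" using that(3) by auto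
  qed
  have mid: "F (p 4 u) = m" "Z (v 5) < Z (p 4 u)" if "0 \<le> u" "u < 1" for u
  proof -
    show "F (p 4 u) = m" using F(2,3) by (simp add: pf algebra_simps)
    have "Z (v 5) < Z (v 4)" using Z(1)[of 4] Z(2)[of 5] by simp
    then show "Z (v 5) < Z (p 4 u)" using that by (simp add: pf lo1)
  qed
  have v5: "p 5 0 = v 5" by (simp add: p_def)
  have cross: False if "p e u = p e' u'" and cs: "e < 4 \<and> 4 \<le> e' \<or> e = 4 \<and> 5 \<le> e'" and "1 \<le> e" "e' \<le> 7" "0 \<le> u" "u < 1" "0 \<le> u'" "u' < 1" for e e' u u'
  proof -
    consider "e \<le> 3" "e' = 4" | "e \<le> 3" "5 \<le> e'" | "e = 4" "5 \<le> e'" using cs by linarith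
    then show False
    proof cases
      case 1
      then show False using up(1)[of e u] mid(1)[of u'] that by simp
    next
      case 2
      then show False using up(2)[of e u] dn(1)[of e' u'] that by simp
    next
      case 3
      then have "e' = 5 \<and> u' = 0" using dn(3)[of e' u'] mid(1)[of u] that by simp
      then show False using mid(2)[of u] 3 that v5 by simp
    qed
  qed
  consider "e \<le> 3" "e' \<le> 3" | "e = 4" "e' = 4" | "5 \<le> e" "5 \<le> e'" | "e < 4 \<and> 4 \<le> e' \<or> e = 4 \<and> 5 \<le> e'" | "e' < 4 \<and> 4 \<le> e \<or> e' = 4 \<and> 5 \<le> e"
    by linarith
  then show ?thesis
  proof cases
    case 1
    have "(1 - u) * U (v e) + u * U (v (e + 1)) = (1 - u') * U (v e') + u' * U (v (e' + 1))"
      using arg_cong[OF eqp, of U] by (simp add: pf)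
    then show ?thesis using 1 e e' by (intro chain_strict[of 1 4 "\<lambda>e. U (v e)"] U) auto
  next
    case 2
    have "(1 - u) * Z (v 4) + u * Z (v 5) = (1 - u') * Z (v 4) + u' * Z (v 5)"
      using arg_cong[OF eqp, of Z] 2 by (simp add: pf)
    then have "(u - u') * (Z (v 4) - Z (v 5)) = 0" by (simp add: algebra_simps)
    then show ?thesis using 2 Z(1)[of 4] Z(2)[of 5] by auto
  next
    case 3
    have "(1 - u) * W (v e) + u * W (v (e + 1)) = (1 - u') * W (v e') + u' * W (v (e' + 1))"
      using arg_cong[OF eqp, of W] by (simp add: pf)
    then show ?thesis using 3 e e' W by (intro chain_strict[of 5 8 "\<lambda>e. - W (v e)"]) (auto simp: algebra_simps)
  next
    case 4
    then show ?thesis using cross[OF eqp] e e' by blast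
  next
    case 5
    then show ?thesis using cross[OF eqp[symmetric]] e e' by blast
  qed
qed

section \<open>Shapes of a finger and of its tail\<close>

definition tip :: "nat \<Rightarrow> real \<Rightarrow> nat \<Rightarrow> real \<Rightarrow> point" where
  "tip l \<eta> i z = vector [mark l i, \<eta>, z]"

text \<open>By convexity all intermediate chains of the pulling motion stay in this set, so it is
  enough that the rest of the link avoids it.\<close>

definition finger_hull :: "nat \<Rightarrow> point list list \<Rightarrow> (nat \<Rightarrow> real) \<Rightarrow> real \<Rightarrow> real \<Rightarrow> nat \<Rightarrow> point set" where
  "finger_hull l K h \<eta> \<kappa> i = convex hull
    {K ! i ! (length (K ! i) - 9), K ! i ! 0, tip l \<eta> i (h i + \<kappa>), tip l \<eta> i (h i - \<kappa>)}"

text \<open>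
  The last nine edges of component \<open>i\<close> subdivide a short descending segment at height \<open>h i\<close>, from
  which a finger can be pulled horizontally to the line of points with first coordinate \<open>mark l i\<close>
  and second coordinate \<open>\<eta>\<close>.
\<close>

definition finger_position :: "nat \<Rightarrow> point list list \<Rightarrow> (nat \<Rightarrow> real) \<Rightarrow> real \<Rightarrow> real \<Rightarrow> bool" where
  "finger_position l K h \<eta> \<kappa> \<longleftrightarrow> length K = l \<and> 0 < \<eta> \<and> 0 < \<kappa> \<and>
    (\<forall>i<l. 10 \<le> length (K ! i) \<and> (\<forall>v \<in> set (K ! i). \<eta> < v $ 2 \<and> 0 < v $ 3 \<and> v $ 3 < 1) \<and>
      (\<forall>e<8. K ! i ! (length (K ! i) - 8 + e) = K ! i ! (length (K ! i) - 9) +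
        (real (e + 1) / 9) *\<^sub>R (K ! i ! 0 - K ! i ! (length (K ! i) - 9))) \<and>
      h i + \<kappa> < K ! i ! (length (K ! i) - 9) $ 3 \<and> K ! i ! 0 $ 3 < h i - \<kappa> \<and>
      (\<forall>j<l. \<forall>t. 0 \<le> t \<and> t < real (length (K ! j)) - 9 \<and> curve (K ! j) t \<in> finger_hull l K h \<eta> \<kappa> i \<longrightarrow> j = i \<and> t = 0) \<and>
      (\<forall>j<l. j \<noteq> i \<longrightarrow> K ! i ! (length (K ! i) - 9) $ 3 < K ! j ! 0 $ 3 \<or> K ! j ! (length (K ! j) - 9) $ 3 < K ! i ! 0 $ 3))"

lemma mark_bounds:
  assumes "i < l" shows "- 1 < mark l i" "mark l i < 1"
  using assms by (auto simp: mark_def field_simps)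

lemma mark_less: "i < j \<Longrightarrow> j < l \<Longrightarrow> mark l i < mark l j"
  by (simp add: mark_def divide_less_cancel)

lemma mark_inj: "i < l \<Longrightarrow> j < l \<Longrightarrow> mark l i = mark l j \<Longrightarrow> i = j"
  using mark_less[of i j l] mark_less[of j i l] by (cases i j rule: linorder_cases) auto

definition tail_line :: "point list \<Rightarrow> point list" where
  "tail_line p = map (\<lambda>e. p ! (length p - 9) + (real (e + 1) / 9) *\<^sub>R (p ! 0 - p ! (length p - 9))) [0..<8]"

definition tail_tip :: "nat \<Rightarrow> (nat \<Rightarrow> real) \<Rightarrow> real \<Rightarrow> real \<Rightarrow> nat \<Rightarrow> point list" where
  "tail_tip l h \<eta> \<kappa> i = map (\<lambda>e. tip l \<eta> i (h i + \<kappa> * (1 - 2 * real e / 7))) [0..<8]"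

text \<open>The closing arc turned into the plane \<open>x = mark l i\<close>, where different
  components cannot meet. Its first and last vertex are moved half way out, which makes the second
  coordinate strictly monotone on each half of the chain.\<close>

definition tail_fan :: "nat \<Rightarrow> (nat \<Rightarrow> real) \<Rightarrow> real \<Rightarrow> real \<Rightarrow> nat \<Rightarrow> point list" where
  "tail_fan l h \<eta> \<kappa> i = [tip l \<eta> i (h i + \<kappa>), top_point l i,
     vector [mark l i, mark l i - 1, 2 - mark l i], vector [mark l i, 2 * mark l i - 2, 2 - mark l i],
     vector [mark l i, 2 * mark l i - 2, mark l i - 1], vector [mark l i, mark l i - 1, mark l i - 1],
     bottom l i, tip l \<eta> i (h i - \<kappa>)]"

definition tail_closing :: "nat \<Rightarrow> (nat \<Rightarrow> real) \<Rightarrow> real \<Rightarrow> real \<Rightarrow> nat \<Rightarrow> point list" where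
  "tail_closing l h \<eta> \<kappa> i = [tip l \<eta> i (h i + \<kappa>), top_point l i] @ closing_arc l i @ [bottom l i, tip l \<eta> i (h i - \<kappa>)]"

definition blend :: "real \<Rightarrow> point list \<Rightarrow> point list \<Rightarrow> point list" where
  "blend s xs ys = map2 (\<lambda>x y. (1 - s) *\<^sub>R x + s *\<^sub>R y) xs ys"

lemma length_tails [simp]:
  "length (tail_line p) = 8" "length (tail_tip l h \<eta> \<kappa> i) = 8" "length (tail_fan l h \<eta> \<kappa> i) = 8"
  "length (tail_closing l h \<eta> \<kappa> i) = 8" "length (blend s xs ys) = min (length xs) (length ys)"
  by (simp_all add: tail_line_def tail_tip_def tail_fan_def tail_closing_def closing_arc_def blend_def)

lemma blend_nth: "k < length xs \<Longrightarrow> k < length ys \<Longrightarrow> blend s xs ys ! k = (1 - s) *\<^sub>R xs ! k + s *\<^sub>R ys ! k"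
  by (simp add: blend_def)

lemma tail_vertex_nth: "1 \<le> e \<Longrightarrow> e \<le> 8 \<Longrightarrow> tail_vertex p T e = T ! (e - 1)"
  by (simp add: tail_vertex_def)

lemma isotopic_with_tails:
  assumes len: "\<And>i. i < length K \<Longrightarrow> 10 \<le> length (K ! i) \<and> length (T i) = 8 \<and> length (T' i) = 8"
    and emb: "\<And>s. 0 \<le> s \<Longrightarrow> s \<le> 1 \<Longrightarrow> embedded (with_tails K (\<lambda>i. blend s (T i) (T' i)))"
  shows "isotopic (with_tails K T, f) (with_tails K T', f)"
proof -
  let ?q = "with_tails K T" and ?q' = "with_tails K T'"
  have lq: "length (with_tails K T ! i) = length (K ! i)" if "i < length K" "\<And>i. i < length K \<Longrightarrow> length (T i) = 8" for i T
    using length_with_tails_nth[of i K T] len that by blast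
  have l: "length (?q ! i) = length (K ! i)" "length (?q' ! i) = length (K ! i)" if "i < length K" for i
    using lq that len by blast+
  have ne: "[] \<notin> set ?q" using len by (intro Nil_notin_with_tails) fastforce
  have eq: "disp ?q (\<lambda>i k. s *\<^sub>R (?q' ! i ! k - ?q ! i ! k)) = with_tails K (\<lambda>i. blend s (T i) (T' i))" for s
  proof (rule nth_equalityI)
    fix i assume "i < length (disp ?q (\<lambda>i k. s *\<^sub>R (?q' ! i ! k - ?q ! i ! k)))"
    then have i: "i < length K" by simp
    let ?n = "length (K ! i)"
    have lb: "length (with_tails K (\<lambda>i. blend s (T i) (T' i)) ! i) = ?n"
      by (rule lq[OF i]) (use len in simp)
    show "disp ?q (\<lambda>i k. s *\<^sub>R (?q' ! i ! k - ?q ! i ! k)) ! i = with_tails K (\<lambda>i. blend s (T i) (T' i)) ! i"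
    proof (rule nth_equalityI)
      show "length (disp ?q (\<lambda>i k. s *\<^sub>R (?q' ! i ! k - ?q ! i ! k)) ! i) = length (with_tails K (\<lambda>i. blend s (T i) (T' i)) ! i)"
        using i l lb by simp
      fix k assume "k < length (disp ?q (\<lambda>i k. s *\<^sub>R (?q' ! i ! k - ?q ! i ! k)) ! i)"
      then have k: "k < ?n" using i l by simp
      have "disp ?q (\<lambda>i k. s *\<^sub>R (?q' ! i ! k - ?q ! i ! k)) ! i ! k = ?q ! i ! k + s *\<^sub>R (?q' ! i ! k - ?q ! i ! k)"
        using i k l by (intro disp_nth) auto
      also have "\<dots> = with_tails K (\<lambda>i. blend s (T i) (T' i)) ! i ! k"
      proof (cases "k < ?n - 8")
        case True
        then show ?thesis using i len[OF i] by (simp add: with_tails_def nth_append)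
      next
        case False
        then have "k - (?n - 8) < 8" using k by linarith
        then show ?thesis using False i len[OF i] by (simp add: with_tails_def nth_append blend_nth min_absorb2 algebra_simps)
      qed
      finally show "disp ?q (\<lambda>i k. s *\<^sub>R (?q' ! i ! k - ?q ! i ! k)) ! i ! k = with_tails K (\<lambda>i. blend s (T i) (T' i)) ! i ! k" .
    qed
  qed simp
  have "isotopic (?q, f) (disp ?q (\<lambda>i k. ?q' ! i ! k - ?q ! i ! k), f)"
    by (rule isotopic_disp[OF ne]) (unfold eq, rule emb)
  moreover have "disp ?q (\<lambda>i k. ?q' ! i ! k - ?q ! i ! k) = ?q'"
    using l by (intro disp_to) auto
  ultimately show ?thesis by simp
qed

section \<open>Moving the tails of a link in finger position\<close>

locale fingers =
  fixes l :: nat and K :: "point list list" and h :: "nat \<Rightarrow> real" and \<eta> \<kappa> :: real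
  assumes pos: "finger_position l K h \<eta> \<kappa>"
begin

lemma len: "length K = l" and \<eta>: "0 < \<eta>" and \<kappa>: "0 < \<kappa>"
  using pos by (auto simp: finger_position_def)

abbreviation "x_in i \<equiv> K ! i ! (length (K ! i) - 9)"
abbreviation "x_out i \<equiv> K ! i ! 0"

lemma at:
  assumes "i < l"
  shows "10 \<le> length (K ! i)" "\<And>v. v \<in> set (K ! i) \<Longrightarrow> \<eta> < v $ 2 \<and> 0 < v $ 3 \<and> v $ 3 < 1"
    "h i + \<kappa> < x_in i $ 3" "x_out i $ 3 < h i - \<kappa>"
    "\<And>j t. j < l \<Longrightarrow> 0 \<le> t \<Longrightarrow> t < real (length (K ! j)) - 9 \<Longrightarrow> curve (K ! j) t \<in> finger_hull l K h \<eta> \<kappa> i \<Longrightarrow> j = i \<and> t = 0"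
    "\<And>j. j < l \<Longrightarrow> j \<noteq> i \<Longrightarrow> x_in i $ 3 < x_out j $ 3 \<or> x_in j $ 3 < x_out i $ 3"
  using pos assms unfolding finger_position_def by blast+

lemma ends:
  assumes "i < l"
  shows "\<eta> < x_in i $ 2" "x_in i $ 3 < 1" "\<eta> < x_out i $ 2" "0 < x_out i $ 3"
    "0 < h i" "h i < 1" "0 < h i - \<kappa>" "h i + \<kappa> < 1" "x_out i $ 3 < h i" "h i < x_in i $ 3"
proof -
  have "x_in i \<in> set (K ! i)" "x_out i \<in> set (K ! i)" using at(1)[OF assms] by (auto intro!: nth_mem)
  then show "\<eta> < x_in i $ 2" "x_in i $ 3 < 1" "\<eta> < x_out i $ 2" "0 < x_out i $ 3"
    using at(2)[OF assms] by auto
  then show "0 < h i" "h i < 1" "0 < h i - \<kappa>" "h i + \<kappa> < 1" "x_out i $ 3 < h i" "h i < x_in i $ 3"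
    using at(3,4)[OF assms] \<kappa> by auto
qed

lemma curve_0:
  assumes "i < l" shows "curve (K ! i) 0 = x_out i"
proof -
  have "0 < length (K ! i)" using at(1)[OF assms] by linarith
  then show ?thesis using curve_of_nat[of 0 "K ! i"] by simp
qed

lemma tail_line_eq:
  assumes "i < l" shows "with_tails K (\<lambda>i. tail_line (K ! i)) ! i = K ! i"
proof (rule nth_equalityI)
  let ?n = "length (K ! i)"
  show "length (with_tails K (\<lambda>i. tail_line (K ! i)) ! i) = ?n"
    using assms at(1) len by (intro length_with_tails_nth) auto
  fix k assume "k < length (with_tails K (\<lambda>i. tail_line (K ! i)) ! i)"
  then have k: "k < ?n" using assms at(1)[OF assms] len by (simp add: with_tails_def)
  show "with_tails K (\<lambda>i. tail_line (K ! i)) ! i ! k = K ! i ! k"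
  proof (cases "k < ?n - 8")
    case True
    then show ?thesis using assms len by (simp add: with_tails_def nth_append)
  next
    case False
    define e where "e = k - (?n - 8)"
    have e: "e < 8" "k = ?n - 8 + e" using False k by (auto simp: e_def)
    have "K ! i ! (?n - 8 + e) = x_in i + (real (e + 1) / 9) *\<^sub>R (x_out i - x_in i)"
      using pos assms e(1) unfolding finger_position_def by blast
    then have "K ! i ! k = tail_line (K ! i) ! e" using e by (simp add: tail_line_def)
    then show ?thesis using False assms len at(1)[OF assms] by (simp add: with_tails_def nth_append e_def min_absorb2)
  qed
qed

lemma tail_line_id: "with_tails K (\<lambda>i. tail_line (K ! i)) = K"
  using tail_line_eq len by (intro nth_equalityI) auto

lemma old_y:
  assumes "j < l" shows "\<eta> < curve (K ! j) t $ 2"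
proof -
  have "convex {v :: point. \<eta> < v $ 2}"
    using convex_halfspace_gt[of \<eta> "axis 2 1 :: point"] by (simp add: inner_axis' )
  moreover have "K ! j \<noteq> []" using at(1)[OF assms] by auto
  ultimately have "curve (K ! j) t \<in> {v. \<eta> < v $ 2}" using at(2)[OF assms] by (intro curve_in_convex_set) auto
  then show ?thesis by simp
qed

lemma tail_point_nth: "tail_point p T e u $ c = (1 - u) * tail_vertex p T e $ c + u * tail_vertex p T (e + 1) $ c"
  by (simp add: tail_point_def)

lemma strict_comb:
  fixes a b c :: real
  assumes "0 \<le> u" "u < 1"
  shows "c < a \<Longrightarrow> c \<le> b \<Longrightarrow> c < (1 - u) * a + u * b" "a < c \<Longrightarrow> b \<le> c \<Longrightarrow> (1 - u) * a + u * b < c"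
    "c \<le> a \<Longrightarrow> c \<le> b \<Longrightarrow> c \<le> (1 - u) * a + u * b" "a \<le> c \<Longrightarrow> b \<le> c \<Longrightarrow> (1 - u) * a + u * b \<le> c"
proof -
  have c: "(1 - u) * c + u * c = c" by (simp add: algebra_simps)
  show "c < (1 - u) * a + u * b" if "c < a" "c \<le> b"
    using add_less_le_mono[of "(1 - u) * c" "(1 - u) * a" "u * c" "u * b"] that assms c by (simp add: mult_left_mono)
  show "(1 - u) * a + u * b < c" if "a < c" "b \<le> c"
    using add_less_le_mono[of "(1 - u) * a" "(1 - u) * c" "u * b" "u * c"] that assms c by (simp add: mult_left_mono)
  show "c \<le> (1 - u) * a + u * b" if "c \<le> a" "c \<le> b"
    using add_mono[of "(1 - u) * c" "(1 - u) * a" "u * c" "u * b"] that assms c by (simp add: mult_left_mono)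
  show "(1 - u) * a + u * b \<le> c" if "a \<le> c" "b \<le> c"
    using add_mono[of "(1 - u) * a" "(1 - u) * c" "u * b" "u * c"] that assms c by (simp add: mult_left_mono)
qed

text \<open>First stage: all chains stay in the finger hulls and are strictly decreasing in height.\<close>

lemma stage1:
  assumes S: "singular K D" and s: "0 \<le> s" "s \<le> 1"
    and D: "\<And>a. a \<in> places D \<Longrightarrow> 1 \<le> snd a \<and> snd a + 10 \<le> length (K ! fst a)"
  shows "singular (with_tails K (\<lambda>i. blend s (tail_line (K ! i)) (tail_tip l h \<eta> \<kappa> i))) D"
proof -
  let ?T = "\<lambda>i. blend s (tail_line (K ! i)) (tail_tip l h \<eta> \<kappa> i)"
  let ?v = "\<lambda>i. tail_vertex (K ! i) (?T i)"
  let ?H = "finger_hull l K h \<eta> \<kappa>"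
  have v: "?v i e = (1 - s) *\<^sub>R (x_in i + (real e / 9) *\<^sub>R (x_out i - x_in i)) + s *\<^sub>R tip l \<eta> i (h i + \<kappa> * (1 - 2 * real (e - 1) / 7))"
    if "1 \<le> e" "e \<le> 8" for i e
  proof -
    have "e - 1 < 8" using that by simp
    then show ?thesis using that by (simp add: tail_vertex_nth blend_nth tail_line_def tail_tip_def)
  qed
  have vz: "?v i e $ 3 = ((1 - s) * x_in i $ 3 + s * h i) +
      ((1 - s) * (real e / 9 * (x_out i $ 3 - x_in i $ 3)) + s * (\<kappa> * (1 - 2 * real (e - 1) / 7)))"
    if "1 \<le> e" "e \<le> 8" for i e
  proof -
    have "(1 - s) * (a + b) + s * (c + d) = ((1 - s) * a + s * c) + ((1 - s) * b + s * d)" for a b c d :: real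
      by (simp add: algebra_simps)
    then show ?thesis
      unfolding v[OF that] tip_def vector_add_component vector_scaleR_component vector_minus_component real_scaleR_def vector_3 .
  qed
  have dec: "?v i (e + 1) $ 3 < ?v i e $ 3" if i: "i < l" and e: "e < 9" for i e
  proof -
    note E = ends[OF i] at(3,4)[OF i]
    have d: "x_out i $ 3 - x_in i $ 3 < 0" using E by simp
    consider "e = 0" | "1 \<le> e" "e \<le> 7" | "e = 8" using e by linarith
    then show ?thesis
    proof cases
      case 1
      have "(1 - s) * (x_in i $ 3 + (1 / 9) * (x_out i $ 3 - x_in i $ 3)) + s * (h i + \<kappa>) < x_in i $ 3"
      proof (cases "s = 1")
        case False
        then show ?thesis using s d E by (intro strict_comb(2)) auto
      qed (use E in simp)
      then show ?thesis using 1 v[of 1 i] by (simp add: tip_def tail_vertex_def[of _ _ 0])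
    next
      case 2
      have ineq: "(1 - s) * (real (e + 1) / 9 * (x_out i $ 3 - x_in i $ 3)) + s * (\<kappa> * (1 - 2 * real e / 7)) <
          (1 - s) * (real e / 9 * (x_out i $ 3 - x_in i $ 3)) + s * (\<kappa> * (1 - 2 * real (e - 1) / 7))"
      proof -
        have a: "real (e + 1) / 9 * (x_out i $ 3 - x_in i $ 3) < real e / 9 * (x_out i $ 3 - x_in i $ 3)"
          using d by (intro mult_strict_right_mono_neg) auto
        have b: "\<kappa> * (1 - 2 * real e / 7) < \<kappa> * (1 - 2 * real (e - 1) / 7)"
          using \<kappa> 2 by (intro mult_strict_left_mono) (auto simp: of_nat_diff divide_strict_right_mono)
        show ?thesis
        proof (cases "s = 1")
          case False
          then show ?thesis using s
            by (intro add_less_le_mono mult_strict_left_mono[OF a] mult_left_mono[OF less_imp_le[OF b]]) auto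
        qed (use b in simp)
      qed
      have e1: "1 \<le> e + 1" "e + 1 \<le> 8" "e \<le> 8" "e + 1 - 1 = e" using 2 by auto
      show ?thesis unfolding vz[OF e1(1,2)] vz[OF 2(1) e1(3)] e1(4) by (rule add_strict_left_mono[OF ineq])
    next
      case 3
      have "x_out i $ 3 < (1 - s) * (x_in i $ 3 + (8 / 9) * (x_out i $ 3 - x_in i $ 3)) + s * (h i - \<kappa>)"
      proof (cases "s = 1")
        case False
        have "a < b + 8 / 9 * (a - b)" if "a - b < 0" for a b :: real using that by (simp add: field_simps)
        note this[OF d]
        then show ?thesis using s E False by (intro strict_comb(1)) auto
      qed (use E in simp)
      then show ?thesis using 3 v[of 8 i] by (simp add: tip_def tail_vertex_def[of _ _ 9])
    qed
  qed
  have hull: "?v i e \<in> ?H i" if e: "e \<le> 9" for i e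
  proof -
    have cH: "convex (?H i)" by (simp add: finger_hull_def)
    have g: "x_in i \<in> ?H i" "x_out i \<in> ?H i" "tip l \<eta> i (h i + \<kappa>) \<in> ?H i" "tip l \<eta> i (h i - \<kappa>) \<in> ?H i"
      by (auto simp: finger_hull_def intro!: hull_inc)
    consider "e = 0" | "1 \<le> e" "e \<le> 8" | "e = 9" using e by linarith
    then show ?thesis
    proof cases
      case 2
      have "x_in i + (real e / 9) *\<^sub>R (x_out i - x_in i) = (1 - real e / 9) *\<^sub>R x_in i + (real e / 9) *\<^sub>R x_out i"
        by (simp add: algebra_simps)
      then have 1: "x_in i + (real e / 9) *\<^sub>R (x_out i - x_in i) \<in> ?H i"
        using cH g 2 by (simp add: convex_alt)
      let ?r = "real (e - 1) / 7"
      have "tip l \<eta> i (h i + \<kappa> * (1 - 2 * r)) = (1 - r) *\<^sub>R tip l \<eta> i (h i + \<kappa>) + r *\<^sub>R tip l \<eta> i (h i - \<kappa>)" for r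
        by (simp add: tip_def vec_eq_iff forall_3 algebra_simps)
      note this[of ?r]
      then have "tip l \<eta> i (h i + \<kappa> * (1 - 2 * ?r)) \<in> ?H i"
        using cH g 2 by (simp add: convex_alt)
      then have "(1 - s) *\<^sub>R (x_in i + (real e / 9) *\<^sub>R (x_out i - x_in i)) + s *\<^sub>R tip l \<eta> i (h i + \<kappa> * (1 - 2 * ?r)) \<in> ?H i"
        using cH 1 s by (simp add: convex_alt)
      then show ?thesis using v[OF 2] by simp
    qed (use g in \<open>simp_all add: tail_vertex_def\<close>)
  qed
  have inH: "tail_point (K ! i) (?T i) e u \<in> ?H i" if "e < 9" "0 \<le> u" "u < 1" for i e u
  proof -
    have "convex (?H i)" by (simp add: finger_hull_def)
    then show ?thesis using hull[of e i] hull[of "e + 1" i] that unfolding tail_point_def by (simp add: convex_alt)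
  qed
  have mono: "?v i b $ 3 \<le> ?v i a $ 3" if "i < l" "a \<le> b" "b \<le> 9" for i a b
    using that(2,3)
  proof (induction b rule: dec_induct)
    case (step n)
    then show ?case using dec[OF that(1), of n] by simp
  qed simp
  \<comment> \<open>Each chain is confined to the horizontal slab between its two ends, and the
    slabs of different components are disjoint.\<close>
  have slab: "x_out i $ 3 < tail_point (K ! i) (?T i) e u $ 3" "tail_point (K ! i) (?T i) e u $ 3 \<le> x_in i $ 3"
    if "i < l" "e < 9" "0 \<le> u" "u < 1" for i e u
  proof -
    have v9: "?v i 9 = x_out i" "?v i 0 = x_in i" by (simp_all add: tail_vertex_def)
    have "x_out i $ 3 \<le> ?v i (e + 1) $ 3" "?v i e $ 3 \<le> x_in i $ 3" using mono[of i "e + 1" 9] mono[of i 0 e] that v9 by simp_all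
    moreover have "?v i (e + 1) $ 3 < ?v i e $ 3" using dec that by blast
    ultimately show "x_out i $ 3 < tail_point (K ! i) (?T i) e u $ 3" "tail_point (K ! i) (?T i) e u $ 3 \<le> x_in i $ 3"
      unfolding tail_point_nth using that by (auto intro!: strict_comb)
  qed
  show ?thesis
  proof (rule singular_with_tails[OF S _ D])
    show "10 \<le> length (K ! i) \<and> length (?T i) = 8" if "i < length K" for i using that at(1) len by simp
    fix i j e u assume "i < length K" "j < length K" and eu: "e < (9::nat)" "0 \<le> u" "u < (1::real)"
    then have ij: "i < l" "j < l" using len by auto
    show "tail_point (K ! i) (?T i) e u \<noteq> curve (K ! j) t" if t: "0 \<le> t" "t < real (length (K ! j)) - 9" for t
    proof
      assume eq: "tail_point (K ! i) (?T i) e u = curve (K ! j) t"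
      then have "j = i \<and> t = 0" using at(5)[OF ij t] inH[OF eu, of i] by simp
      then have "tail_point (K ! i) (?T i) e u = x_out i" using eq curve_0[OF ij(1)] by auto
      then show False using slab(1)[OF ij(1) eu] by simp
    qed
    fix e' u' assume eu': "e' < (9::nat)" "0 \<le> u'" "u' < (1::real)"
      and eq: "tail_point (K ! i) (?T i) e u = tail_point (K ! j) (?T j) e' u'"
    have "i = j"
    proof (rule ccontr)
      assume "i \<noteq> j"
      then show False using at(6)[OF ij(1), of j] slab[OF ij(1) eu] slab[OF ij(2) eu'] ij eq by auto
    qed
    moreover have "e = e' \<and> u = u'"
    proof (rule chain_strict[of 0 9 "\<lambda>e. ?v i e $ 3"])
      show "(1 - u) * ?v i e $ 3 + u * ?v i (e + 1) $ 3 = (1 - u') * ?v i e' $ 3 + u' * ?v i (e' + 1) $ 3"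
        using arg_cong[OF eq, of "\<lambda>v. v $ 3"] \<open>i = j\<close> by (simp only: tail_point_nth)
    qed (use dec[OF ij(1)] eu eu' in auto)
    ultimately show "i = j \<and> e = e' \<and> u = u'" by blast
  qed
qed

text \<open>From now on the fingers are fixed and only the chain in front of the plane \<open>y = \<eta>\<close> moves.\<close>

lemma front_stage:
  assumes S: "singular K D"
    and D: "\<And>a. a \<in> places D \<Longrightarrow> 1 \<le> snd a \<and> snd a + 10 \<le> length (K ! fst a)"
    and T: "\<And>i. i < l \<Longrightarrow> length (T i) = 8 \<and> T i ! 0 = tip l \<eta> i (h i + \<kappa>) \<and> T i ! 7 = tip l \<eta> i (h i - \<kappa>)"
    and front: "\<And>i e. i < l \<Longrightarrow> 1 \<le> e \<Longrightarrow> e < 7 \<Longrightarrow> T i ! e $ 2 < \<eta>"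
    and sep: "\<And>i j e u e' u'. i < l \<Longrightarrow> j < l \<Longrightarrow> 1 \<le> e \<Longrightarrow> e \<le> 7 \<Longrightarrow> 0 \<le> u \<Longrightarrow> u < 1 \<Longrightarrow>
      1 \<le> e' \<Longrightarrow> e' \<le> 7 \<Longrightarrow> 0 \<le> u' \<Longrightarrow> u' < 1 \<Longrightarrow> tail_point (K ! i) (T i) e u = tail_point (K ! j) (T j) e' u' \<Longrightarrow>
      i = j \<and> e = e' \<and> u = u'"
  shows "singular (with_tails K T) D"
proof -
  let ?v = "\<lambda>i. tail_vertex (K ! i) (T i)"
  let ?H = "finger_hull l K h \<eta> \<kappa>"
  have v: "?v i 0 = x_in i" "?v i 1 = tip l \<eta> i (h i + \<kappa>)" "?v i 8 = tip l \<eta> i (h i - \<kappa>)" "?v i 9 = x_out i" if "i < l" for i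
    using T[OF that] by (simp_all add: tail_vertex_def)
  have mid: "?v i e $ 2 < \<eta>" if "i < l" "2 \<le> e" "e \<le> 7" for i e
    using front[of i "e - 1"] that by (simp add: tail_vertex_nth)
  have f0: "tail_point (K ! i) (T i) 0 u \<in> ?H i" "h i < tail_point (K ! i) (T i) 0 u $ 3" "tail_point (K ! i) (T i) 0 u $ 3 \<le> x_in i $ 3"
    "\<eta> < tail_point (K ! i) (T i) 0 u $ 2" if i: "i < l" and u: "0 \<le> u" "u < 1" for i u
  proof -
    have e: "tail_point (K ! i) (T i) 0 u = (1 - u) *\<^sub>R x_in i + u *\<^sub>R tip l \<eta> i (h i + \<kappa>)" using v[OF i] by (simp add: tail_point_def)
    show "tail_point (K ! i) (T i) 0 u \<in> ?H i"
      unfolding e finger_hull_def using u by (intro convexD_alt[OF convex_convex_hull]) (auto intro!: hull_inc)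
    show "h i < tail_point (K ! i) (T i) 0 u $ 3" "tail_point (K ! i) (T i) 0 u $ 3 \<le> x_in i $ 3" "\<eta> < tail_point (K ! i) (T i) 0 u $ 2"
      unfolding e using ends[OF i] at(3)[OF i] \<kappa> u by (auto simp: tip_def intro!: strict_comb)
  qed
  have f8: "tail_point (K ! i) (T i) 8 u \<in> ?H i" "tail_point (K ! i) (T i) 8 u $ 3 < h i" "x_out i $ 3 < tail_point (K ! i) (T i) 8 u $ 3"
    "\<eta> \<le> tail_point (K ! i) (T i) 8 u $ 2" "tail_point (K ! i) (T i) 8 u $ 2 = \<eta> \<Longrightarrow> u = 0" if i: "i < l" and u: "0 \<le> u" "u < 1" for i u
  proof -
    have e: "tail_point (K ! i) (T i) 8 u = (1 - u) *\<^sub>R tip l \<eta> i (h i - \<kappa>) + u *\<^sub>R x_out i" using v[OF i] by (simp add: tail_point_def)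
    show "tail_point (K ! i) (T i) 8 u \<in> ?H i"
      unfolding e finger_hull_def using u by (intro convexD_alt[OF convex_convex_hull]) (auto intro!: hull_inc)
    show "tail_point (K ! i) (T i) 8 u $ 3 < h i" "x_out i $ 3 < tail_point (K ! i) (T i) 8 u $ 3" "\<eta> \<le> tail_point (K ! i) (T i) 8 u $ 2"
      unfolding e using ends[OF i] at(4)[OF i] \<kappa> u by (auto simp: tip_def intro!: strict_comb)
    assume "tail_point (K ! i) (T i) 8 u $ 2 = \<eta>"
    then have "u * (x_out i $ 2 - \<eta>) = 0" unfolding e by (simp add: tip_def algebra_simps)
    then show "u = 0" using ends(3)[OF i] by simp
  qed
  have ft: "tail_point (K ! i) (T i) e u $ 2 \<le> \<eta>" "tail_point (K ! i) (T i) e u $ 2 = \<eta> \<Longrightarrow> e = 1 \<and> u = 0"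
    if i: "i < l" and e: "1 \<le> e" "e \<le> 7" and u: "0 \<le> u" "u < 1" for i e u
  proof -
    consider "e = 1" | "2 \<le> e" "e \<le> 6" | "e = 7" using e by linarith
    then have "tail_point (K ! i) (T i) e u $ 2 \<le> \<eta> \<and> (tail_point (K ! i) (T i) e u $ 2 = \<eta> \<longrightarrow> e = 1 \<and> u = 0)"
    proof cases
      case 1
      have "tail_point (K ! i) (T i) 1 u $ 2 = \<eta> - u * (\<eta> - ?v i 2 $ 2)"
        using v(2)[OF i] by (simp add: tail_point_nth tip_def algebra_simps numeral_2_eq_2)
      moreover have "0 < \<eta> - ?v i 2 $ 2" using mid[OF i, of 2] by simp
      ultimately show ?thesis using 1 u by auto
    next
      case 2
      then have "tail_point (K ! i) (T i) e u $ 2 < \<eta>" unfolding tail_point_nth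
        using mid[OF i, of e] mid[OF i, of "e + 1"] u by (intro strict_comb(2)) auto
      then show ?thesis by simp
    next
      case 3
      then have "tail_point (K ! i) (T i) e u $ 2 < \<eta>" unfolding tail_point_nth
        using mid[OF i, of 7] v(3)[OF i] u by (intro strict_comb(2)) (auto simp: tip_def)
      then show ?thesis by simp
    qed
    then show "tail_point (K ! i) (T i) e u $ 2 \<le> \<eta>" "tail_point (K ! i) (T i) e u $ 2 = \<eta> \<Longrightarrow> e = 1 \<and> u = 0" by auto
  qed
  have zx: "x_out i $ 3 < tail_point (K ! i) (T i) e u $ 3 \<and> tail_point (K ! i) (T i) e u $ 3 \<le> x_in i $ 3"
    if "i < l" "e = 0 \<or> e = 8" "0 \<le> u" "u < 1" for i e u
    using f0[of i u] f8[of i u] ends[of i] that by auto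
  \<comment> \<open>A finger and a chain can only meet in the plane \<open>y = \<eta>\<close>. With
    half-open edges that leaves the lower tip of the finger against the upper tip where a chain
    begins; tips of different components lie on different vertical lines, and the two tips of one
    component at different heights.\<close>
  have fin_front: False
    if "tail_point (K ! i) (T i) e u = tail_point (K ! j) (T j) e' u'" and ee: "e = 0 \<or> e = 8" "1 \<le> e'" "e' \<le> 7"
      and ij: "i < l" "j < l" and u: "0 \<le> u" "u < 1" and u': "0 \<le> u'" "u' < 1" for i j e u e' u'
  proof -
    have y: "tail_point (K ! i) (T i) e u $ 2 = tail_point (K ! j) (T j) e' u' $ 2" using that(1) by simp
    note b = ft[OF ij(2) ee(2,3) u']
    show False
    proof (cases "e = 0")
      case True
      then show False using f0(4)[OF ij(1) u] b(1) y by simp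
    next
      case False
      then have e: "e = 8" using ee by simp
      then have y0: "tail_point (K ! i) (T i) 8 u $ 2 = \<eta>" using f8(4)[OF ij(1) u] b(1) y by simp
      then have u0: "u = 0" "e' = 1 \<and> u' = 0" using f8(5)[OF ij(1) u] b(2) y e by auto
      then have "?v i 8 = ?v j 1" using that(1) e by (simp add: tail_point_def)
      then have "tip l \<eta> i (h i - \<kappa>) = tip l \<eta> j (h j + \<kappa>)" using v ij by simp
      then have "mark l i = mark l j" "h i - \<kappa> = h j + \<kappa>" by (simp_all add: tip_def vec_eq_iff forall_3)
      then show False using mark_inj[OF ij] \<kappa> by auto
    qed
  qed
  show ?thesis
  proof (rule singular_with_tails[OF S _ D])
    show "10 \<le> length (K ! i) \<and> length (T i) = 8" if "i < length K" for i using that at(1) len T by simp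
    fix i j e u assume "i < length K" "j < length K" and eu: "e < (9::nat)" "0 \<le> u" "u < (1::real)"
    then have ij: "i < l" "j < l" using len by auto
    show "tail_point (K ! i) (T i) e u \<noteq> curve (K ! j) t" if t: "0 \<le> t" "t < real (length (K ! j)) - 9" for t
    proof
      assume eq: "tail_point (K ! i) (T i) e u = curve (K ! j) t"
      consider "e = 0 \<or> e = 8" | "1 \<le> e" "e \<le> 7" using eu(1) by linarith
      then show False
      proof cases
        case 1
        then have "tail_point (K ! i) (T i) e u \<in> ?H i" using f0(1)[OF ij(1) eu(2,3)] f8(1)[OF ij(1) eu(2,3)] by auto
        then have "j = i \<and> t = 0" using at(5)[OF ij t] eq by simp
        then have "tail_point (K ! i) (T i) e u = x_out i" using eq curve_0[OF ij(1)] by auto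
        then show False using zx[OF ij(1) 1 eu(2,3)] by simp
      next
        case 2
        then show False using ft(1)[OF ij(1) 2 eu(2,3)] old_y[OF ij(2), of t] eq by simp
      qed
    qed
    fix e' u' assume eu': "e' < (9::nat)" "0 \<le> u'" "u' < (1::real)"
      and eq: "tail_point (K ! i) (T i) e u = tail_point (K ! j) (T j) e' u'"
    consider "e = 0 \<or> e = 8" "e' = 0 \<or> e' = 8" | "e = 0 \<or> e = 8" "1 \<le> e'" "e' \<le> 7"
      | "e' = 0 \<or> e' = 8" "1 \<le> e" "e \<le> 7" | "1 \<le> e" "e \<le> 7" "1 \<le> e'" "e' \<le> 7" using eu(1) eu'(1) by linarith
    then show "i = j \<and> e = e' \<and> u = u'"
    proof cases
      case 1
      have "i = j"
      proof (rule ccontr)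
        assume "i \<noteq> j"
        then show False using at(6)[OF ij(1), of j] zx[OF ij(1) 1(1) eu(2,3)] zx[OF ij(2) 1(2) eu'(2,3)] ij eq by auto
      qed
      moreover have "e = e'"
        using 1 f0(2)[OF ij(1) eu(2,3)] f8(2)[OF ij(1) eu(2,3)] f0(2)[OF ij(2) eu'(2,3)] f8(2)[OF ij(2) eu'(2,3)] eq \<open>i = j\<close>
        by (metis less_asym)
      moreover have "(u - u') * (?v i e $ 3 - ?v i (e + 1) $ 3) = 0"
        using arg_cong[OF eq, of "\<lambda>v. v $ 3"] unfolding tail_point_nth \<open>i = j\<close>[symmetric] \<open>e = e'\<close>[symmetric] by (simp add: algebra_simps)
      moreover have "?v i e $ 3 - ?v i (e + 1) $ 3 \<noteq> 0"
        using 1(1) v[OF ij(1)] at(3,4)[OF ij(1)] by (auto simp: tip_def)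
      ultimately show ?thesis by simp
    next
      case 2
      then show ?thesis using fin_front[OF eq] ij eu eu' by blast
    next
      case 3
      then show ?thesis using fin_front[OF eq[symmetric]] ij eu eu' by blast
    next
      case 4
      then show ?thesis using sep[OF ij 4(1,2) eu(2,3) 4(3,4) eu'(2,3) eq] by blast
    qed
  qed
qed

lemma convex_gt:
  fixes a b c s :: real
  assumes "0 \<le> s" "s \<le> 1" "c < a" "c < b" shows "c < (1 - s) * a + s * b"
  using convex_bound_lt[of "- a" "- c" "- b" "1 - s" s] assms by simp

lemma convex_lt:
  fixes a b c s :: real
  assumes "0 \<le> s" "s \<le> 1" "a < c" "b < c" shows "(1 - s) * a + s * b < c"
  using convex_bound_lt[of a c b "1 - s" s] assms by simp

lemma blend_0: "length xs = length ys \<Longrightarrow> blend 0 xs ys = xs"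
  by (rule nth_equalityI) (auto simp: blend_nth)

lemma blend_1: "length xs = length ys \<Longrightarrow> blend 1 xs ys = ys"
  by (rule nth_equalityI) (auto simp: blend_nth)

text \<open>Each chain stays in its own plane \<open>x = mark l i\<close>, so different components
  are disjoint. Inside the plane, the second coordinate falls along the upper half and rises along
  the lower half. At \<open>s = 0\<close> it has the constant value \<eta>, and strictness fails;
  that instant is covered by the end of \<open>stage1\<close>.\<close>

lemma stage2:
  assumes S: "singular K D" and s: "0 < s" "s \<le> 1"
    and D: "\<And>a. a \<in> places D \<Longrightarrow> 1 \<le> snd a \<and> snd a + 10 \<le> length (K ! fst a)"
  shows "singular (with_tails K (\<lambda>i. blend s (tail_tip l h \<eta> \<kappa> i) (tail_fan l h \<eta> \<kappa> i))) D"
proof -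
  let ?T = "\<lambda>i. blend s (tail_tip l h \<eta> \<kappa> i) (tail_fan l h \<eta> \<kappa> i)"
  define v where "v = (\<lambda>i. tail_vertex (K ! i) (?T i))"
  have tp: "tail_point (K ! i) (?T i) e u = (1 - u) *\<^sub>R v i e + u *\<^sub>R v i (e + 1)" for i e u
    by (simp add: tail_point_def v_def)
  have tpn: "tail_point (K ! i) (?T i) e u $ c = (1 - u) * v i e $ c + u * v i (e + 1) $ c" for i e u c
    by (simp add: tp)
  have Tk: "?T i ! e = (1 - s) *\<^sub>R tip l \<eta> i (h i + \<kappa> * (1 - 2 * real e / 7)) + s *\<^sub>R (tail_fan l h \<eta> \<kappa> i ! e)" if "e < 8" for i e
    using that by (simp add: blend_nth tail_tip_def)
  have ve: "v i e = ?T i ! (e - 1)" if "1 \<le> e" "e \<le> 8" for i e using that unfolding v_def by (rule tail_vertex_nth)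
  have vk: "v i e $ c = (1 - s) * tip l \<eta> i (h i + \<kappa> * (1 - 2 * real (e - 1) / 7)) $ c + s * tail_fan l h \<eta> \<kappa> i ! (e - 1) $ c"
    if "1 \<le> e" "e \<le> 8" for i e c
  proof -
    have "e - 1 < 8" using that by simp
    then show ?thesis using ve[OF that, of i] Tk[of "e - 1" i] by (simp only: vector_add_component vector_scaleR_component real_scaleR_def)
  qed
  have co: "(1 - s) * a + s * a = a" for a :: real by (simp add: algebra_simps)
  have x: "v i e $ 1 = mark l i" if "1 \<le> e" "e \<le> 8" for i e
  proof -
    have "e - 1 \<in> {0, 1, 2, 3, 4, 5, 6, 7}" using that by auto
    then have "tail_fan l h \<eta> \<kappa> i ! (e - 1) $ 1 = mark l i"
      by (auto simp: tail_fan_def tip_def top_point_def bottom_def)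
    then show ?thesis unfolding vk[OF that] by (simp add: tip_def co)
  qed
  have y: "v i 1 $ 2 = \<eta>" "v i 2 $ 2 = \<eta> - s * \<eta>" "v i 3 $ 2 = \<eta> - s * \<eta> - s * (1 - mark l i)"
    "v i 4 $ 2 = \<eta> - s * \<eta> - 2 * (s * (1 - mark l i))" "v i 5 $ 2 = \<eta> - s * \<eta> - 2 * (s * (1 - mark l i))"
    "v i 6 $ 2 = \<eta> - s * \<eta> - s * (1 - mark l i)" "v i 7 $ 2 = \<eta> - s * \<eta>" "v i 8 $ 2 = \<eta>" for i
    by (simp_all add: vk tail_fan_def tip_def top_point_def bottom_def algebra_simps)
  have p: "0 < s * \<eta>" "0 < s * (1 - mark l i)" if "i < l" for i using s \<eta> mark_bounds[OF that] by simp_all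
  have zu: "h i < v i e $ 3" if i: "i < l" and e: "1 \<le> e" "e \<le> 4" for i e
  proof -
    have "e = 1 \<or> e = 2 \<or> e = 3 \<or> e = 4" using e by linarith
    then have "h i < tail_fan l h \<eta> \<kappa> i ! (e - 1) $ 3"
      using ends[OF i] \<kappa> mark_bounds[OF i] by (auto simp: tail_fan_def tip_def top_point_def)
    moreover have "h i < h i + \<kappa> * (1 - 2 * real (e - 1) / 7)" using \<kappa> e by (simp add: of_nat_diff)
    ultimately show ?thesis using e s by (subst vk) (auto simp: tip_def intro!: convex_gt)
  qed
  have zd: "v i e $ 3 < h i" if i: "i < l" and e: "5 \<le> e" "e \<le> 8" for i e
  proof -
    have "e = 5 \<or> e = 6 \<or> e = 7 \<or> e = 8" using e by linarith
    then have "tail_fan l h \<eta> \<kappa> i ! (e - 1) $ 3 < h i"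
      using ends[OF i] \<kappa> mark_bounds[OF i] by (auto simp: tail_fan_def tip_def bottom_def)
    moreover have "h i + \<kappa> * (1 - 2 * real (e - 1) / 7) < h i"
      using \<kappa> e by (simp add: of_nat_diff mult_less_0_iff)
    ultimately show ?thesis using e s by (subst vk) (auto simp: tip_def intro!: convex_lt)
  qed
  show ?thesis
  proof (rule front_stage[OF S D])
    fix i assume i: "i < l"
    show "length (?T i) = 8 \<and> ?T i ! 0 = tip l \<eta> i (h i + \<kappa>) \<and> ?T i ! 7 = tip l \<eta> i (h i - \<kappa>)"
    proof -
      have "?T i ! 0 = (1 - s) *\<^sub>R tip l \<eta> i (h i + \<kappa>) + s *\<^sub>R tip l \<eta> i (h i + \<kappa>)"
        by (subst Tk) (simp_all add: tail_fan_def)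
      moreover have "?T i ! 7 = (1 - s) *\<^sub>R tip l \<eta> i (h i - \<kappa>) + s *\<^sub>R tip l \<eta> i (h i - \<kappa>)"
        by (subst Tk) (simp_all add: tail_fan_def)
      ultimately show ?thesis by (simp add: scaleR_left_diff_distrib)
    qed
    fix e :: nat assume e: "1 \<le> e" "e < 7"
    have "?T i ! e = v i (e + 1)" using ve[of "e + 1" i] e by simp
    moreover have "e + 1 = 2 \<or> e + 1 = 3 \<or> e + 1 = 4 \<or> e + 1 = 5 \<or> e + 1 = 6 \<or> e + 1 = 7" using e by linarith
    moreover have "v i k $ 2 < \<eta>" if "k = 2 \<or> k = 3 \<or> k = 4 \<or> k = 5 \<or> k = 6 \<or> k = 7" for k
      using that y[of i] p[OF i] by (elim disjE) simp_all
    ultimately show "?T i ! e $ 2 < \<eta>" by metis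
  next
    fix i j e u e' u'
    assume ij: "i < l" "j < l" and e: "1 \<le> e" "e \<le> 7" "0 \<le> u" "u < (1::real)" and e': "1 \<le> e'" "e' \<le> 7" "0 \<le> u'" "u' < (1::real)"
      and eq: "tail_point (K ! i) (?T i) e u = tail_point (K ! j) (?T j) e' u'"
    have "tail_point (K ! i) (?T i) e u $ 1 = mark l i" "tail_point (K ! j) (?T j) e' u' $ 1 = mark l j"
      using x[of e i] x[of "e + 1" i] x[of e' j] x[of "e' + 1" j] e e' by (simp_all add: tpn algebra_simps)
    then have "i = j" using eq ij mark_inj by metis
    have "e = e' \<and> u = u'"
    proof (rule chain_pattern[where U = "\<lambda>v. v $ 2" and W = "\<lambda>v. v $ 2" and F = "\<lambda>v. v $ 2" and Z = "\<lambda>v. v $ 3" and v = "v i"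
          and m = "\<eta> - s * \<eta> - 2 * (s * (1 - mark l i))" and c = "h i", OF _ _ _ _ _ _ _ _ e e'])
      show "(1 - u) *\<^sub>R v i e + u *\<^sub>R v i (e + 1) = (1 - u') *\<^sub>R v i e' + u' *\<^sub>R v i (e' + 1)"
        using eq \<open>i = j\<close> by (simp add: tp)
      fix e :: nat
      show "v i (e + 1) $ 2 < v i e $ 2" if "1 \<le> e" "e < 4"
      proof -
        have "e = 1 \<or> e = 2 \<or> e = 3" using that by linarith
        then show ?thesis using y[of i] p[OF ij(1)] by (elim disjE) (simp_all add: numeral_eq_Suc)
      qed
      show "v i e $ 2 < v i (e + 1) $ 2" if "5 \<le> e" "e < 8"
      proof -
        have "e = 5 \<or> e = 6 \<or> e = 7" using that by linarith
        then show ?thesis using y[of i] p[OF ij(1)] by (elim disjE) (simp_all add: numeral_eq_Suc)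
      qed
      show "\<eta> - s * \<eta> - 2 * (s * (1 - mark l i)) < v i e $ 2" if "e \<in> {1, 2, 3, 6, 7, 8}"
        using that y[of i] p[OF ij(1)] by (elim insertE) simp_all
    qed (use y[of i] zu[OF ij(1)] zd[OF ij(1)] in auto)
    then show "i = j \<and> e = e' \<and> u = u'" using \<open>i = j\<close> by blast
  qed
qed

text \<open>The arcs swing from the parallel planes \<open>x = mark l i\<close> into the common
  plane \<open>y = 0\<close>. They are nested, the arc of the larger mark inside, and they remain so
  at every moment of the swing.\<close>

lemma stage3:
  assumes S: "singular K D" and s: "0 \<le> s" "s \<le> 1"
    and D: "\<And>a. a \<in> places D \<Longrightarrow> 1 \<le> snd a \<and> snd a + 10 \<le> length (K ! fst a)"
  shows "singular (with_tails K (\<lambda>i. blend s (tail_fan l h \<eta> \<kappa> i) (tail_closing l h \<eta> \<kappa> i))) D"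
proof -
  let ?T = "\<lambda>i. blend s (tail_fan l h \<eta> \<kappa> i) (tail_closing l h \<eta> \<kappa> i)"
  define v where "v = (\<lambda>i. tail_vertex (K ! i) (?T i))"
  have tp: "tail_point (K ! i) (?T i) e u = (1 - u) *\<^sub>R v i e + u *\<^sub>R v i (e + 1)" for i e u
    by (simp add: tail_point_def v_def)
  have tpn: "tail_point (K ! i) (?T i) e u $ c = (1 - u) * v i e $ c + u * v i (e + 1) $ c" for i e u c
    by (simp add: tp)
  let ?m = "mark l" and ?b = "\<lambda>i. 1 - mark l i"
  have ve: "v i e = ?T i ! (e - 1)" if "1 \<le> e" "e \<le> 8" for i e using that unfolding v_def by (rule tail_vertex_nth)
  have vk: "v i e $ c = (1 - s) * tail_fan l h \<eta> \<kappa> i ! (e - 1) $ c + s * tail_closing l h \<eta> \<kappa> i ! (e - 1) $ c"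
    if "1 \<le> e" "e \<le> 8" for i e c
  proof -
    have "e - 1 < 8" using that by simp
    then show ?thesis using ve[OF that, of i] by (simp add: blend_nth)
  qed
  note defs = vk tail_fan_def tail_closing_def closing_arc_def tip_def top_point_def bottom_def
  have co: "(1 - s) * a + s * a = a" for a :: real by (simp add: algebra_simps)
  have x: "v i 1 $ 1 = ?m i" "v i 2 $ 1 = ?m i" "v i 3 $ 1 = ?m i" "v i 4 $ 1 = ?m i + 2 * (s * ?b i)"
    "v i 5 $ 1 = ?m i + 2 * (s * ?b i)" "v i 6 $ 1 = ?m i" "v i 7 $ 1 = ?m i" "v i 8 $ 1 = ?m i" for i
    by (simp_all add: defs co) (simp_all add: algebra_simps)
  have y: "v i 1 $ 2 = \<eta>" "v i 2 $ 2 = 0" "v i 3 $ 2 = - ((1 - s) * ?b i)" "v i 4 $ 2 = - 2 * ((1 - s) * ?b i)"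
    "v i 5 $ 2 = - 2 * ((1 - s) * ?b i)" "v i 6 $ 2 = - ((1 - s) * ?b i)" "v i 7 $ 2 = 0" "v i 8 $ 2 = \<eta>" for i
    by (simp_all add: defs co) (simp_all add: algebra_simps)
  have z: "v i 1 $ 3 = h i + \<kappa>" "v i 2 $ 3 = 1" "v i 3 $ 3 = 2 - ?m i" "v i 4 $ 3 = 2 - ?m i"
    "v i 5 $ 3 = ?m i - 1" "v i 6 $ 3 = ?m i - 1" "v i 7 $ 3 = 0" "v i 8 $ 3 = h i - \<kappa>" for i
    by (simp_all add: defs co)
  have b: "0 < ?b i" "?b i < 2" "0 \<le> s * ?b i" "0 \<le> (1 - s) * ?b i" if "i < l" for i
    using mark_bounds[OF that] s by simp_all
  have sb: "s * ?b i + (1 - s) * ?b i = ?b i" for i by (simp add: algebra_simps)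
  have all8: "P e" if "1 \<le> e" "e \<le> 8" "P 1" "P 2" "P 3" "P 4" "P 5" "P 6" "P 7" "P 8" for P and e :: nat
  proof -
    have "e = 1 \<or> e = 2 \<or> e = 3 \<or> e = 4 \<or> e = 5 \<or> e = 6 \<or> e = 7 \<or> e = 8" using that(1,2) by linarith
    then show ?thesis using that(3-) by blast
  qed
  have box: "?m i \<le> v i e $ 1 \<and> v i e $ 1 \<le> ?m i + 2 * (s * ?b i) \<and> - 2 * ((1 - s) * ?b i) \<le> v i e $ 2 \<and>
      ?m i - 1 \<le> v i e $ 3 \<and> v i e $ 3 \<le> 2 - ?m i" if i: "i < l" and e: "1 \<le> e" "e \<le> 8" for i e
    by (rule all8[OF e]) (use x[of i] y[of i] z[of i] b[OF i] ends[OF i] mark_bounds[OF i] \<kappa> \<eta> in simp_all)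
  have pbox: "?m i \<le> tail_point (K ! i) (?T i) e u $ 1 \<and> tail_point (K ! i) (?T i) e u $ 1 \<le> ?m i + 2 * (s * ?b i) \<and>
      - 2 * ((1 - s) * ?b i) \<le> tail_point (K ! i) (?T i) e u $ 2 \<and>
      ?m i - 1 \<le> tail_point (K ! i) (?T i) e u $ 3 \<and> tail_point (K ! i) (?T i) e u $ 3 \<le> 2 - ?m i"
    if i: "i < l" and e: "1 \<le> e" "e \<le> 7" and u: "0 \<le> u" "u < 1" for i e u
  proof -
    have "1 \<le> e + 1" "e + 1 \<le> 8" "e \<le> 8" using e by auto
    then show ?thesis unfolding tpn using box[OF i, of e] box[OF i, of "e + 1"] e u by (auto intro!: strict_comb)
  qed
  \<comment> \<open>The chain with the smaller mark is the outer one: each of its edges violates one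
    of the bounds in \<open>pbox\<close> that confine the inner chain. For the outer edge
    \<open>e = 4\<close> this is the bound on the second coordinate, or on the first one when
    \<open>s = 1\<close>.\<close>
  have other: False if "tail_point (K ! i) (?T i) e u = tail_point (K ! j) (?T j) e' u'" "i < j" and ij: "i < l" "j < l"
    and e: "1 \<le> e" "e \<le> 7" "0 \<le> u" "u < 1" and e': "1 \<le> e'" "e' \<le> 7" "0 \<le> u'" "u' < 1" for i j e u e' u'
  proof -
    have m: "?m i < ?m j" by (rule mark_less[OF \<open>i < j\<close> ij(2)])
    note B = pbox[OF ij(2) e', folded that(1)]
    consider "e \<in> {1, 2, 6, 7}" | "e = 3" | "e = 4" | "e = 5" using e by force
    then show False
    proof cases
      case 1
      then have "tail_point (K ! i) (?T i) e u $ 1 = ?m i"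
        unfolding tpn using x[of i] by (elim insertE) (simp_all add: numeral_eq_Suc algebra_simps)
      then show False using B m by simp
    next
      case 2
      have "(1 - u) * a + u * a = a" for a :: real by (simp add: algebra_simps)
      then have "tail_point (K ! i) (?T i) e u $ 3 = 2 - ?m i"
        unfolding tpn 2 by (simp add: z)
      then show False using B m by simp
    next
      case 4
      have "(1 - u) * a + u * a = a" for a :: real by (simp add: algebra_simps)
      then have "tail_point (K ! i) (?T i) e u $ 3 = ?m i - 1"
        unfolding tpn 4 by (simp add: z)
      then show False using B m by simp
    next
      case 3
      have cu: "(1 - u) * a + u * a = a" for a :: real by (simp add: algebra_simps)
      have "(4::nat) + 1 = 5" by simp
      then have "tail_point (K ! i) (?T i) e u $ 1 = ?m i + 2 * (s * ?b i)" "tail_point (K ! i) (?T i) e u $ 2 = - 2 * ((1 - s) * ?b i)"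
        unfolding tpn 3 by (simp_all only: x y cu)
      then have c: "?m i + 2 * (s * ?b i) \<le> ?m j + 2 * (s * ?b j)" "(1 - s) * ?b i \<le> (1 - s) * ?b j" using B by auto
      show False
      proof (cases "s = 1")
        case True
        then show False using c(1) m by simp
      next
        case False
        then have "(1 - s) * ?b j < (1 - s) * ?b i" using s m by (intro mult_strict_left_mono) auto
        then show False using c(2) by simp
      qed
    qed
  qed
  show ?thesis
  proof (rule front_stage[OF S D])
    fix i assume i: "i < l"
    show "length (?T i) = 8 \<and> ?T i ! 0 = tip l \<eta> i (h i + \<kappa>) \<and> ?T i ! 7 = tip l \<eta> i (h i - \<kappa>)"
      by (simp add: blend_nth tail_fan_def tail_closing_def closing_arc_def scaleR_add_left[symmetric])
    fix e :: nat assume e: "1 \<le> e" "e < 7"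
    have "?T i ! e = v i (e + 1)" using ve[of "e + 1" i] e by simp
    moreover have "e + 1 = 2 \<or> e + 1 = 3 \<or> e + 1 = 4 \<or> e + 1 = 5 \<or> e + 1 = 6 \<or> e + 1 = 7" using e by linarith
    moreover have "v i k $ 2 < \<eta>" if "k = 2 \<or> k = 3 \<or> k = 4 \<or> k = 5 \<or> k = 6 \<or> k = 7" for k
      using that y[of i] b[OF i] \<eta> by (elim disjE) simp_all
    ultimately show "?T i ! e $ 2 < \<eta>" by metis
  next
    fix i j e u e' u'
    assume ij: "i < l" "j < l" and e: "1 \<le> e" "e \<le> 7" "0 \<le> u" "u < (1::real)" and e': "1 \<le> e'" "e' \<le> 7" "0 \<le> u'" "u' < (1::real)"
      and eq: "tail_point (K ! i) (?T i) e u = tail_point (K ! j) (?T j) e' u'"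
    have "i = j" using other[OF eq _ ij e e'] other[OF eq[symmetric] _ ij(2,1) e' e] by (cases i j rule: linorder_cases) auto
    \<comment> \<open>On the outer edge the first two coordinates grow at the same rate during the
      swing, so \<open>?F\<close> keeps its minimal value there. Subtracting or adding the height
      gives functionals monotone on the two halves.\<close>
    let ?F = "\<lambda>v :: point. v $ 2 - (v $ 1 - ?m i)"
    have "e = e' \<and> u = u'"
    proof (rule chain_pattern[where U = "\<lambda>v. ?F v - v $ 3" and W = "\<lambda>v. ?F v + v $ 3" and F = ?F and Z = "\<lambda>v. v $ 3" and v = "v i"
          and m = "- 2 * ?b i" and c = "h i", OF _ _ _ _ _ _ _ _ e e'])
      show "(1 - u) *\<^sub>R v i e + u *\<^sub>R v i (e + 1) = (1 - u') *\<^sub>R v i e' + u' *\<^sub>R v i (e' + 1)"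
        using eq \<open>i = j\<close> by (simp add: tp)
      have sbi: "(1 - s) * ?b i = ?b i - s * ?b i" by (simp add: algebra_simps)
      define q where "q = s * ?b i"
      note facts = x[of i, unfolded sbi, folded q_def] y[of i, unfolded sbi, folded q_def] z[of i]
        b[OF ij(1), unfolded sbi, folded q_def] ends[OF ij(1)] mark_bounds[OF ij(1)] \<kappa> \<eta>
      have q: "0 \<le> q" "0 < ?b i" using b[OF ij(1)] by (simp_all add: q_def)
      have f3: "?F (v i 4) - v i 4 $ 3 < ?F (v i 3) - v i 3 $ 3"
      proof -
        have "?F (v i 4) - v i 4 $ 3 = - 2 * ?b i - (2 - ?m i)" using facts(4,12,20) by simp
        moreover have "?F (v i 3) - v i 3 $ 3 = - (?b i - q) - (2 - ?m i)" using facts(3,11,19) by simp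
        moreover have "a < c" if "a = - 2 * (1 - m) - (2 - m)" "c = - (1 - m - q) - (2 - m)" "0 \<le> q" "0 < 1 - m" for a c m q :: real
          using that by simp
        ultimately show ?thesis using q by blast
      qed
      have f5: "?F (v i 5) + v i 5 $ 3 < ?F (v i 6) + v i 6 $ 3"
      proof -
        have "?F (v i 5) + v i 5 $ 3 = - 2 * ?b i + (?m i - 1)" using facts(5,13,21) by simp
        moreover have "?F (v i 6) + v i 6 $ 3 = - (?b i - q) + (?m i - 1)" using facts(6,14,22) by simp
        moreover have "a < c" if "a = - 2 * (1 - m) + (m - 1)" "c = - (1 - m - q) + (m - 1)" "0 \<le> q" "0 < 1 - m" for a c m q :: real
          using that by simp
        ultimately show ?thesis using q by blast
      qed
      have nums: "(1::nat) + 1 = 2" "(2::nat) + 1 = 3" "(3::nat) + 1 = 4" "(5::nat) + 1 = 6" "(6::nat) + 1 = 7" "(7::nat) + 1 = 8"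
        by simp_all
      fix e :: nat
      show "?F (v i (e + 1)) - v i (e + 1) $ 3 < ?F (v i e) - v i e $ 3" if "1 \<le> e" "e < 4"
      proof -
        have "e = 1 \<or> e = 2 \<or> e = 3" using that by linarith
        then show ?thesis
          by (elim disjE; simp only: nums) (use facts f3 in linarith)+
      qed
      show "?F (v i e) + v i e $ 3 < ?F (v i (e + 1)) + v i (e + 1) $ 3" if "5 \<le> e" "e < 8"
      proof -
        have "e = 5 \<or> e = 6 \<or> e = 7" using that by linarith
        then show ?thesis
          by (elim disjE; simp only: nums) (use facts f5 in linarith)+
      qed
      show "- 2 * ?b i < ?F (v i e)" if "e \<in> {1, 2, 3, 6, 7, 8}"
        using that facts by (elim insertE) simp_all
      show "?F (v i 4) = - 2 * ?b i" "?F (v i 5) = - 2 * ?b i" using facts by (simp_all add: algebra_simps)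
      show "h i < v i e $ 3" if "1 \<le> e" "e \<le> 4"
      proof -
        have "e = 1 \<or> e = 2 \<or> e = 3 \<or> e = 4" using that by linarith
        then show ?thesis using facts by (elim disjE) simp_all
      qed
      show "v i e $ 3 < h i" if "5 \<le> e" "e \<le> 8"
      proof -
        have "e = 5 \<or> e = 6 \<or> e = 7 \<or> e = 8" using that by linarith
        then show ?thesis using facts by (elim disjE) simp_all
      qed
    qed (auto simp: algebra_simps)
    then show "i = j \<and> e = e' \<and> u = u'" using \<open>i = j\<close> by blast
  qed
qed

theorem singular_closing:
  assumes "singular K D" "\<And>a. a \<in> places D \<Longrightarrow> 1 \<le> snd a \<and> snd a + 10 \<le> length (K ! fst a)"
  shows "singular (with_tails K (tail_closing l h \<eta> \<kappa>)) D"
  using stage3[OF assms(1) _ _ assms(2), of 1] by (simp add: blend_1)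

theorem isotopic_closing:
  assumes "embedded K"
  shows "isotopic (K, f) (with_tails K (tail_closing l h \<eta> \<kappa>), f)"
proof -
  have S: "singular K {}" using assms by (simp add: embedded_iff_singular)
  have 1: "isotopic (with_tails K (\<lambda>i. tail_line (K ! i)), f) (with_tails K (tail_tip l h \<eta> \<kappa>), f)"
    using stage1[OF S] at(1) len by (intro isotopic_with_tails) (auto simp: embedded_iff_singular)
  have 2: "isotopic (with_tails K (tail_tip l h \<eta> \<kappa>), f) (with_tails K (tail_fan l h \<eta> \<kappa>), f)"
  proof (rule isotopic_with_tails)
    fix s :: real assume s: "0 \<le> s" "s \<le> 1"
    show "embedded (with_tails K (\<lambda>i. blend s (tail_tip l h \<eta> \<kappa> i) (tail_fan l h \<eta> \<kappa> i)))"
    proof (cases "s = 0")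
      case True
      then show ?thesis using stage1[OF S, of 1] by (simp add: embedded_iff_singular blend_0 blend_1)
    next
      case False
      then show ?thesis using stage2[OF S, of s] s by (simp add: embedded_iff_singular)
    qed
  qed (use at(1) len in auto)
  have 3: "isotopic (with_tails K (tail_fan l h \<eta> \<kappa>), f) (with_tails K (tail_closing l h \<eta> \<kappa>), f)"
    using stage3[OF S] at(1) len by (intro isotopic_with_tails) (auto simp: embedded_iff_singular)
  show ?thesis using isotopic_trans[OF isotopic_trans[OF 1[unfolded tail_line_id] 2] 3] .
qed

end

subsection \<open>Resolutions of a resampled link\<close>

text \<open>The scale \<epsilon> cancels in the quotient of displacement and gap, so the one
  constant \<open>C / g\<close> serves resolutions of all sizes.\<close>

lemma splitting_uniform:
  assumes ne: "[] \<notin> set ps" and D: "\<And>d. d \<in> D \<Longrightarrow> fst (fst d) < length ps \<and> fst (snd d) < length ps"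
    and w: "\<And>i k. i < length ps \<Longrightarrow> k < length (ps ! i) \<Longrightarrow> norm (w i k) \<le> \<epsilon> * C"
    and g: "\<And>d. d \<in> D \<Longrightarrow> \<bar>\<sigma> d\<bar> = 1 \<and> \<epsilon> * g \<le> \<sigma> d * gap ps w d"
    and pos: "0 < g" "0 < \<epsilon>" "\<epsilon> * C \<le> \<epsilon>0" "0 \<le> C"
  shows "splitting ps D (C / g) \<epsilon>0 \<sigma> w"
  unfolding splitting_def
proof (intro conjI allI impI ballI)
  show "norm (w i k) \<le> \<epsilon>0" if "i < length ps" "k < length (ps ! i)" for i k using w[OF that] pos by linarith
  fix d assume d: "d \<in> D"
  show "\<bar>\<sigma> d\<bar> = 1" using g[OF d] by blast
  show "0 < \<sigma> d * gap ps w d" using g[OF d] pos by (smt (verit) mult_pos_pos)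
  fix p assume "p \<in> near_values ps w (fst d) \<union> near_values ps w (snd d)"
  then obtain a where a1: "a = fst d \<or> a = snd d" "p \<in> near_values ps w a" by blast
  obtain e where "p = vtx (field ps w (fst a)) (int (snd a) + e)"
    using a1(2) unfolding near_values_def by (rule imageE)
  note a = a1(1) this
  then have i: "fst a < length ps" using D[OF d] by auto
  then have nz: "ps ! fst a \<noteq> []" using ne nth_mem by metis
  have "norm p \<le> \<epsilon> * C"
    unfolding a(2) vtx_field[where ps = ps and i = "fst a", OF nz] by (rule w[OF i nat_mod_length_less[OF nz]])
  also have "\<dots> = C / g * (\<epsilon> * g)" using pos by simp
  also have "\<dots> \<le> C / g * (\<sigma> d * gap ps w d)" using g[OF d] pos by (intro mult_left_mono) auto
  finally show "norm p \<le> C / g * (\<sigma> d * gap ps w d)" .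
qed

lemma inj_on_resample_dpoint:
  assumes "singular ps D" "N > 0"
  shows "inj_on (resample_dpoint N r ps) D"
proof (rule inj_onI)
  fix x y assume "x \<in> D" "y \<in> D" "resample_dpoint N r ps x = resample_dpoint N r ps y"
  then show "x = y"
    using singular_D(2,4)[OF assms(1), of "fst x" "snd x"] singular_D(2,4)[OF assms(1), of "fst y" "snd y"]
      inj_onD[OF inj_on_resample_place[OF assms(2), of r ps]]
    by (simp add: resample_dpoint_def prod_eq_iff[of x y])
qed

lemma abs_dsign: "\<bar>real_of_int (dsign N d)\<bar> = 1"
  by (simp add: dsign_def)

lemma dsign_mult_self: "real_of_int (dsign N d) * real_of_int (dsign N d) = 1"
  by (simp add: dsign_def)

lemma snd_resolve_resample:
  assumes S: "singular ps D" and N: "N > 0" and M: "M \<subseteq> D"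
  shows "snd (resolve \<epsilon> (ps, g) D M) = snd (resolve \<epsilon>' (qs, g) (resample_dpoint N r ps ` D) (resample_dpoint N r ps ` M))"
proof -
  let ?R = "resample_dpoint N r ps"
  note inj = inj_on_resample_dpoint[OF S N, of r]
  have "(\<Sum>d\<in>?R ` D. if fst (fst d) = i \<and> fst (snd d) = i then dsign (?R ` M) d else 0) =
      (\<Sum>d\<in>D. if fst (fst d) = i \<and> fst (snd d) = i then dsign M d else 0)" for i
  proof -
    have "(\<Sum>d\<in>?R ` D. if fst (fst d) = i \<and> fst (snd d) = i then dsign (?R ` M) d else 0) =
        (\<Sum>d\<in>D. if fst (fst (?R d)) = i \<and> fst (snd (?R d)) = i then dsign (?R ` M) (?R d) else 0)"
      by (simp add: sum.reindex[OF inj])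
    also have "\<dots> = (\<Sum>d\<in>D. if fst (fst d) = i \<and> fst (snd d) = i then dsign M d else 0)"
    proof (rule sum.cong[OF refl])
      fix d assume "d \<in> D"
      then have "?R d \<in> ?R ` M \<longleftrightarrow> d \<in> M" using inj M by (meson inj_on_image_mem_iff)
      then have "dsign (?R ` M) (?R d) = dsign M d" by (simp add: dsign_def)
      moreover have "fst (fst (?R d)) = fst (fst d)" "fst (snd (?R d)) = fst (snd d)"
        by (simp_all add: resample_dpoint_def resample_place_def)
      ultimately show "(if fst (fst (?R d)) = i \<and> fst (snd (?R d)) = i then dsign (?R ` M) (?R d) else 0) =
          (if fst (fst d) = i \<and> fst (snd d) = i then dsign M d else 0)"
        by (simp only:)
    qed
    finally show ?thesis .
  qed
  then show ?thesis by (simp add: resolve_def)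
qed

text \<open>The sizes of the two resolutions are independent of each other. Framings are compared
  too, since \<open>isotopic\<close> demands equal framing numbers.\<close>

abbreviation resolutions_agree ::
    "real \<Rightarrow> framed \<Rightarrow> dpoint set \<Rightarrow> framed \<Rightarrow> dpoint set \<Rightarrow> (dpoint \<Rightarrow> dpoint) \<Rightarrow> bool" where
  "resolutions_agree e L D L' D' \<beta> \<equiv> \<forall>\<epsilon> \<epsilon>' M. 0 < \<epsilon> \<and> \<epsilon> < e \<and> 0 < \<epsilon>' \<and> \<epsilon>' < e \<and> M \<subseteq> D \<longrightarrow>
    isotopic (resolve \<epsilon> L D M) (resolve \<epsilon>' L' D' (\<beta> ` M))"

text \<open>Resampling a resolved link differs from resolving the resampled link: the displacement
  is spread over the new vertices of the adjacent edges, and it is the image of the old normal under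
  \<open>f\<close> instead of the new normal. But since \<open>f\<close> is orienting, both fields
  open every double point with the same sign, so a straight line joins them.\<close>

theorem resolution_resample:
  assumes S: "singular ps D" and N: "N > 0" and f: "orienting f" "\<And>x. A x = f x + c"
    and H: "ambient_isotopy H" "\<And>x. H 1 x = A x"
  shows "\<exists>\<epsilon>0>0. resolutions_agree \<epsilon>0 (ps, g) D (resample_link N r A ps, g) (resample_dpoint N r ps ` D) (resample_dpoint N r ps)"
proof -
  let ?R = "resample_dpoint N r ps"
  let ?q = "resample_link N r A ps"
  let ?D = "?R ` D"
  have lf: "linear f" using f(1) by (auto simp: orienting_def)
  have S': "singular ?q ?D" by (rule singular_resample_link[OF S N f])
  have ne: "[] \<notin> set ps" and ne': "[] \<notin> set ?q" using S S' by (auto simp: singular_def)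
  have nz: "ps ! i \<noteq> []" if "i < length ps" for i using ne that nth_mem by metis
  have fin: "finite D" by (rule finite_double_points[OF S])
  note inj = inj_on_resample_dpoint[OF S N, of r]
  obtain F where F: "F > 0" "\<And>x. norm (f x) \<le> F * norm x" using linear_bounded_pos[OF lf] by blast
  have "\<exists>C>0. \<forall>d\<in>D. norm (normal ps d) \<le> C \<and> norm (normal ?q (?R d)) \<le> C"
  proof -
    have "bounded (normal ps ` D \<union> (\<lambda>d. normal ?q (?R d)) ` D)" using fin by (intro finite_imp_bounded) simp
    then obtain C where "C > 0" "\<forall>x\<in>normal ps ` D \<union> (\<lambda>d. normal ?q (?R d)) ` D. norm x \<le> C" by (meson bounded_pos)
    then show ?thesis by (intro exI[of _ C]) auto
  qed
  then obtain C where C: "C > 0" "\<And>d. d \<in> D \<Longrightarrow> norm (normal ps d) \<le> C \<and> norm (normal ?q (?R d)) \<le> C" by blast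
  define X where "X = max C (F * C)"
  have X: "C \<le> X" "F * C \<le> X" "X > 0" using C(1) by (auto simp: X_def)
  have "\<exists>b>0. \<forall>d\<in>D. b \<le> (norm (normal ?q (?R d)))\<^sup>2 \<and> b \<le> normal ?q (?R d) \<bullet> f (normal ps d)"
  proof (rule uniform_positive[OF fin])
    fix d assume d: "d \<in> D"
    have "normal ?q (?R d) \<noteq> 0" using singular_D(9)[OF S', of "fst (?R d)" "snd (?R d)"] d by simp
    then have "0 < (norm (normal ?q (?R d)))\<^sup>2" by simp
    moreover have "0 < normal ?q (?R d) \<bullet> f (normal ps d)"
    proof -
      have "normal ps d \<noteq> 0" using singular_D(9)[OF S, of "fst d" "snd d"] d by simp
      then have "0 < cross3 (f (tangent ps (fst d))) (f (tangent ps (snd d))) \<bullet> f (normal ps d)"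
        using f(1) by (simp add: orienting_def normal_def)
      then show ?thesis unfolding normal_resample_link[OF S N lf f(2) d] using N by simp
    qed
    ultimately show "\<exists>b>0. b \<le> (norm (normal ?q (?R d)))\<^sup>2 \<and> b \<le> normal ?q (?R d) \<bullet> f (normal ps d)"
      by (intro exI[of _ "min ((norm (normal ?q (?R d)))\<^sup>2) (normal ?q (?R d) \<bullet> f (normal ps d))"]) auto
  qed auto
  then obtain b where b: "b > 0" "\<And>d. d \<in> D \<Longrightarrow> b \<le> (norm (normal ?q (?R d)))\<^sup>2 \<and> b \<le> normal ?q (?R d) \<bullet> f (normal ps d)" by blast
  have "X / b > 0" using X b by simp
  from splitting_embedded_family[OF S' this]
  obtain \<epsilon>1 where \<epsilon>1: "\<epsilon>1 > 0" and family: "\<forall>\<sigma> u w s. splitting ?q ?D (X / b) \<epsilon>1 \<sigma> u \<and> splitting ?q ?D (X / b) \<epsilon>1 \<sigma> w \<and>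
      0 \<le> s \<and> s \<le> 1 \<longrightarrow> embedded (disp (disp ?q u) (\<lambda>i k. s *\<^sub>R (w i k - u i k)))"
    by (elim exE conjE) (rule that)
  have emb: "embedded (disp (disp ?q u) (\<lambda>i k. s *\<^sub>R (w i k - u i k)))"
    if "splitting ?q ?D (X / b) \<epsilon>1 \<sigma> u" "splitting ?q ?D (X / b) \<epsilon>1 \<sigma> w" "0 \<le> s" "s \<le> 1" for \<sigma> u w s
    using family[rule_format, of \<sigma> u w s] that by blast
  define \<epsilon>0 where "\<epsilon>0 = \<epsilon>1 / X"
  have Dl: "fst (fst d) < length ?q \<and> fst (snd d) < length ?q" if "d \<in> ?D" for d
    using singular_D(1,3)[OF S', of "fst d" "snd d"] that by simp
  show ?thesis
  proof (intro exI[of _ \<epsilon>0] conjI allI impI, goal_cases)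
    case 1 then show ?case using \<epsilon>1 X by (simp add: \<epsilon>0_def)
  next
    case (2 \<epsilon> \<epsilon>' M)
    then have \<epsilon>: "0 < \<epsilon>" "\<epsilon> < \<epsilon>0" "0 < \<epsilon>'" "\<epsilon>' < \<epsilon>0" and M: "M \<subseteq> D" by auto
    have eX: "\<epsilon> * X \<le> \<epsilon>1" "\<epsilon>' * X \<le> \<epsilon>1" using \<epsilon> X(3) by (simp_all add: \<epsilon>0_def pos_less_divide_eq less_imp_le)
    define \<sigma> where "\<sigma> = (\<lambda>d. real_of_int (dsign (?R ` M) d))"
    have \<sigma>: "\<sigma> (?R d) = real_of_int (dsign M d)" if "d \<in> D" for d
    proof -
      have "?R d \<in> ?R ` M \<longleftrightarrow> d \<in> M" using inj M that by (meson inj_on_image_mem_iff)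
      then show ?thesis by (simp add: \<sigma>_def dsign_def)
    qed
    define v where "v = resolution_field ps D (\<lambda>d. \<epsilon> * real_of_int (dsign M d))"
    \<comment> \<open>The image under \<open>f\<close> of the old displacement, sampled at the new
      vertices; \<open>u\<close> is the displacement that resolves the resampled link.\<close>
    define w where "w = (\<lambda>i k. f (curve (field ps v i) (real (k + r i) / real N)))"
    define u where "u = resolution_field ?q ?D (\<lambda>d. \<epsilon>' * real_of_int (dsign (?R ` M) d))"
    have vC: "norm (v i k) \<le> \<epsilon> * C" for i k
      unfolding v_def using C \<epsilon> by (intro resolution_field_norm[OF S]) (auto simp: abs_mult abs_dsign mult_left_mono)
    have fvC: "norm (curve (field ps v i) t) \<le> \<epsilon> * C" if "i < length ps" for i t
      using nz[OF that] vC by (intro curve_norm_le) (auto simp: field_def)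
    have w_split: "splitting ?q ?D (X / b) \<epsilon>1 \<sigma> w"
    proof (rule splitting_uniform[OF ne' Dl, where \<epsilon> = \<epsilon>])
      fix i k assume "i < length ?q"
      then have "norm (w i k) \<le> F * (\<epsilon> * C)"
        unfolding w_def using F(1) fvC[of i] by (intro order_trans[OF F(2)] mult_left_mono) auto
      also have "\<dots> = \<epsilon> * (F * C)" by simp
      also have "\<dots> \<le> \<epsilon> * X" using X \<epsilon> by (intro mult_left_mono) auto
      finally show "norm (w i k) \<le> \<epsilon> * X" .
    next
      fix d' assume "d' \<in> ?D"
      then obtain d where d: "d \<in> D" "d' = ?R d" by blast
      note ok = singular_D[OF S, of "fst d" "snd d", unfolded prod.collapse, OF d(1)]
      have at: "w (fst a) (snd (resample_place N r ps a)) = f (v (fst a) (snd a))" if a: "fst a < length ps" "snd a < length (ps ! fst a)" for a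
      proof -
        let ?n = "length (ps ! fst a)"
        let ?k = "int N * int (snd a) - int (r (fst a))"
        let ?m = "int (N * ?n)"
        have m: "?m > 0" using N nz[OF a(1)] by simp
        have "int (snd (resample_place N r ps a)) = ?k mod ?m" using m by (simp add: resample_place_def)
        then have "int (snd (resample_place N r ps a)) = ?k + (- (?k div ?m)) * ?m" by (simp add: minus_div_mult_eq_mod[symmetric])
        then have "real_of_int (int (snd (resample_place N r ps a))) = real_of_int (?k + (- (?k div ?m)) * ?m)" by (rule arg_cong)
        then have "real (snd (resample_place N r ps a)) = real N * real (snd a) - real (r (fst a)) + of_int (- (?k div ?m)) * (real N * real ?n)"
          by (simp only: of_int_add of_int_mult of_int_of_nat_eq of_nat_mult of_int_diff)
        then have "real (snd (resample_place N r ps a) + r (fst a)) / real N = real (snd a) + of_int (- (?k div ?m)) * real (length (field ps v (fst a)))"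
          using N by (simp add: field_simps)
        then have "curve (field ps v (fst a)) (real (snd (resample_place N r ps a) + r (fst a)) / real N) = curve (field ps v (fst a)) (real (snd a))"
          by (simp only: curve_add_multiple)
        also have "\<dots> = v (fst a) (snd a)" using a(2) by (subst curve_of_nat) (simp_all add: field_def)
        finally show ?thesis by (simp add: w_def)
      qed
      have "gap ?q w d' = normal ?q d' \<bullet> (f (v (fst (fst d)) (snd (fst d))) - f (v (fst (snd d)) (snd (snd d))))"
        using at[of "fst d"] at[of "snd d"] ok(1-4) d(2) by (simp add: gap_def resample_dpoint_def resample_place_def[of N r ps, THEN arg_cong[of _ _ fst], simplified])
      also have "\<dots> = \<epsilon> * real_of_int (dsign M d) * (normal ?q d' \<bullet> f (normal ps d))"
        unfolding v_def resolution_field_at[OF S d(1)] by (simp add: linear_scale[OF lf] linear_0[OF lf])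
      finally have "\<sigma> d' * gap ?q w d' = \<epsilon> * (real_of_int (dsign M d) * real_of_int (dsign M d)) * (normal ?q d' \<bullet> f (normal ps d))"
        using \<sigma>[OF d(1)] d(2) by simp
      then have "\<sigma> d' * gap ?q w d' = \<epsilon> * (normal ?q d' \<bullet> f (normal ps d))" unfolding dsign_mult_self by simp
      then show "\<bar>\<sigma> d'\<bar> = 1 \<and> \<epsilon> * b \<le> \<sigma> d' * gap ?q w d'" using b(2)[OF d(1)] d(2) \<epsilon> by (simp add: \<sigma>_def abs_dsign)
    qed (use X b \<epsilon> eX in auto)
    have u_split: "splitting ?q ?D (X / b) \<epsilon>1 \<sigma> u"
    proof (rule splitting_uniform[OF ne' Dl, where \<epsilon> = \<epsilon>'])
      fix i k
      have "norm (u i k) \<le> \<epsilon>' * C"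
        unfolding u_def using C \<epsilon> by (intro resolution_field_norm[OF S']) (auto simp: abs_mult abs_dsign mult_left_mono)
      also have "\<dots> \<le> \<epsilon>' * X" using X \<epsilon> by (intro mult_left_mono) auto
      finally show "norm (u i k) \<le> \<epsilon>' * X" .
    next
      fix d' assume d': "d' \<in> ?D"
      then obtain d where d: "d \<in> D" "d' = ?R d" by blast
      have "\<sigma> d' * gap ?q u d' = \<epsilon>' * (real_of_int (dsign (?R ` M) d') * real_of_int (dsign (?R ` M) d')) * (norm (normal ?q d'))\<^sup>2"
        unfolding u_def gap_resolution_field[OF S' d'] by (simp add: \<sigma>_def)
      then have "\<sigma> d' * gap ?q u d' = \<epsilon>' * (norm (normal ?q d'))\<^sup>2" unfolding dsign_mult_self by simp
      then show "\<bar>\<sigma> d'\<bar> = 1 \<and> \<epsilon>' * b \<le> \<sigma> d' * gap ?q u d'" using b(2)[OF d(1)] d(2) \<epsilon> by (simp add: \<sigma>_def abs_dsign)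
    qed (use X b \<epsilon> eX in auto)
    have eq: "resample_link N r A (disp ps v) = disp ?q w"
    proof (rule nth_equalityI)
      fix i assume "i < length (resample_link N r A (disp ps v))"
      then have i: "i < length ps" by simp
      show "resample_link N r A (disp ps v) ! i = disp ?q w ! i"
      proof (rule nth_equalityI)
        fix k assume "k < length (resample_link N r A (disp ps v) ! i)"
        then have k: "k < N * length (ps ! i)" using i by simp
        have "disp ?q w ! i ! k = A (curve (ps ! i) (real (k + r i) / real N)) + f (curve (field ps v i) (real (k + r i) / real N))"
          using i k by (subst disp_nth) (simp_all add: resample_def w_def)
        also have "\<dots> = A (curve (disp ps v ! i) (real (k + r i) / real N))"
          using i nz[OF i] by (simp add: curve_disp f(2) linear_add[OF lf])
        also have "\<dots> = resample_link N r A (disp ps v) ! i ! k" using i k by (simp add: resample_def)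
        finally show "resample_link N r A (disp ps v) ! i ! k = disp ?q w ! i ! k" by simp
      qed (use i in simp)
    qed simp
    define g' where "g' = snd (resolve \<epsilon> (ps, g) D M)"
    have iso1: "isotopic (disp ps v, g') (disp ?q w, g')"
      unfolding eq[symmetric] by (rule isotopic_resample_link[OF N Nil_notin_disp[OF ne] lf f(2) H])
    have iso2: "isotopic (disp ?q w, g') (disp (disp ?q w) (\<lambda>i k. u i k - w i k), g')"
      by (rule isotopic_disp[OF Nil_notin_disp[OF ne']]) (rule emb[OF w_split u_split])
    have "disp (disp ?q w) (\<lambda>i k. u i k - w i k) = disp ?q u" by (simp add: disp_disp)
    then have iso: "isotopic (disp ps v, g') (disp ?q u, g')" using isotopic_trans[OF iso1 iso2] by simp
    have res1: "resolve \<epsilon> (ps, g) D M = (disp ps v, g')"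
      by (simp add: prod_eq_iff fst_resolve v_def g'_def)
    have "snd (resolve \<epsilon>' (?q, g) ?D (?R ` M)) = g'" unfolding g'_def by (rule snd_resolve_resample[OF S N M, symmetric])
    then have res2: "resolve \<epsilon>' (?q, g) ?D (?R ` M) = (disp ?q u, g')"
      by (simp add: prod_eq_iff fst_resolve u_def)
    show ?case unfolding res1 res2 by (rule iso)
  qed
qed

subsection \<open>General position\<close>

text \<open>The new height of a vector is a polynomial in \<theta> whose coefficients are the three
  coordinates. So each nonzero vector becomes horizontal for finitely many \<theta> only.\<close>

definition skew :: "real \<Rightarrow> point \<Rightarrow> point" where
  "skew \<theta> x = vector [x $ 1, x $ 2, x $ 3 + \<theta> * x $ 1 + \<theta>\<^sup>2 * x $ 2]"

lemma skew_component: "skew \<theta> x $ 1 = x $ 1" "skew \<theta> x $ 2 = x $ 2" "skew \<theta> x $ 3 = x $ 3 + \<theta> * x $ 1 + \<theta>\<^sup>2 * x $ 2"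
  by (simp_all add: skew_def)

lemma linear_skew: "linear (skew \<theta>)"
  by (rule linearI) (simp_all add: vec_eq_iff forall_3 skew_component algebra_simps)

lemma orienting_skew:
  assumes "\<tau> > 0" shows "orienting (\<lambda>x. \<tau> *\<^sub>R skew \<theta> x)"
  unfolding orienting_def
proof (intro conjI allI impI)
  show "linear (\<lambda>x. \<tau> *\<^sub>R skew \<theta> x)" by (rule linear_compose_scale_right[OF linear_skew])
  show "inj (\<lambda>x. \<tau> *\<^sub>R skew \<theta> x)"
    using assms by (intro injI) (auto simp: vec_eq_iff forall_3 skew_component)
  fix u v :: point assume "cross3 u v \<noteq> 0"
  have "cross3 (skew \<theta> u) (skew \<theta> v) \<bullet> skew \<theta> (cross3 u v) = (norm (cross3 u v))\<^sup>2"
    unfolding power2_norm_eq_inner inner_vec_def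
    by (simp add: sum_3 skew_component cross3_def power2_eq_square algebra_simps)
  then have "0 < cross3 (skew \<theta> u) (skew \<theta> v) \<bullet> skew \<theta> (cross3 u v)" using \<open>cross3 u v \<noteq> 0\<close> by simp
  then show "0 < cross3 (\<tau> *\<^sub>R skew \<theta> u) (\<tau> *\<^sub>R skew \<theta> v) \<bullet> \<tau> *\<^sub>R skew \<theta> (cross3 u v)"
    using assms by (simp add: cross_mult_left cross_mult_right)
qed

text \<open>The straight line from the identity to the scaled shear consists of triangular maps
  whose diagonal entries all equal \<open>(1 - t) + t * \<tau>\<close>, which is positive.\<close>

lemma ambient_isotopy_skew:
  assumes "\<tau> > 0"
  shows "\<exists>H. ambient_isotopy H \<and> (\<forall>x. H 1 x = \<tau> *\<^sub>R skew \<theta> x + c)"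
proof (intro exI conjI allI)
  let ?f = "\<lambda>x. \<tau> *\<^sub>R skew \<theta> x"
  let ?H = "\<lambda>t x. ((1 - t) *\<^sub>R x + t *\<^sub>R ?f x) + t *\<^sub>R c"
  have lf: "linear ?f" by (rule linear_compose_scale_right[OF linear_skew])
  have cont: "continuous_on S (skew \<theta>)" for S
    by (rule linear_continuous_on) (use linear_skew in \<open>simp add: linear_conv_bounded_linear\<close>)
  show "ambient_isotopy ?H"
    unfolding ambient_isotopy_def
  proof (intro conjI ballI allI)
    show "continuous_on ({0..1} \<times> UNIV) (\<lambda>(t, x). ?H t x)"
      unfolding case_prod_beta
      by (intro continuous_intros continuous_on_compose2[OF cont, of _ snd UNIV]) auto
    fix t :: real assume t: "t \<in> {0..1}"
    let ?M = "\<lambda>x. (1 - t) *\<^sub>R x + t *\<^sub>R ?f x"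
    have lM: "linear ?M"
      by (intro linear_compose_add linear_compose_scale_right lf linear_ident)
    have pos: "0 < (1 - t) + t * \<tau>" using t assms by (cases "t = 0") (auto intro: add_nonneg_pos)
    have "inj ?M"
    proof (subst linear_injective_0[OF lM], intro allI impI)
      fix x assume "?M x = 0"
      then have e: "?M x $ 1 = 0" "?M x $ 2 = 0" "?M x $ 3 = 0" by simp_all
      have "((1 - t) + t * \<tau>) * x $ 1 = 0" "((1 - t) + t * \<tau>) * x $ 2 = 0"
        using e(1,2) by (simp_all add: skew_component algebra_simps)
      then have x: "x $ 1 = 0" "x $ 2 = 0" using pos by simp_all
      then have "((1 - t) + t * \<tau>) * x $ 3 = 0" using e(3) by (simp add: skew_component algebra_simps)
      then have "x $ 3 = 0" using pos by simp
      then show "x = 0" using x by (simp add: vec_eq_iff forall_3)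
    qed
    then obtain g where g: "linear g" "\<And>x. g (?M x) = x" "\<And>x. ?M (g x) = x"
      using linear_injective_isomorphism[OF lM] by blast
    have "homeomorphism UNIV UNIV (?H t) (\<lambda>y. g (y - t *\<^sub>R c))"
    proof (rule homeomorphismI)
      show "continuous_on UNIV (?H t)"
        by (intro continuous_intros continuous_on_compose2[OF cont, of _ "\<lambda>x. x" UNIV]) auto
      have "continuous_on UNIV g" by (rule linear_continuous_on) (use g(1) in \<open>simp add: linear_conv_bounded_linear\<close>)
      then show "continuous_on UNIV (\<lambda>y. g (y - t *\<^sub>R c))"
        by (rule continuous_on_compose2) (intro continuous_intros, auto)
    qed (use g in auto)
    then show "\<exists>g. homeomorphism UNIV UNIV (?H t) g" by blast
  qed simp
  show "?H 1 x = \<tau> *\<^sub>R skew \<theta> x + c" for x by simp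
qed

lemma exists_skew_nonhorizontal:
  fixes E :: "point set"
  assumes "finite E" "0 \<notin> E"
  shows "\<exists>\<theta>. \<forall>e\<in>E. skew \<theta> e $ 3 \<noteq> 0"
proof -
  let ?p = "\<lambda>e :: point. [:e $ 3, e $ 1, e $ 2:]"
  have "?p e \<noteq> 0" if "e \<in> E" for e
  proof
    assume "?p e = 0"
    then have "e = 0" by (simp add: vec_eq_iff forall_3)
    then show False using assms(2) that by simp
  qed
  then have "finite (\<Union>e\<in>E. {\<theta>. poly (?p e) \<theta> = 0})" using assms(1) by (intro finite_UN_I poly_roots_finite) auto
  then have "\<exists>\<theta>. \<theta> \<notin> (\<Union>e\<in>E. {\<theta>. poly (?p e) \<theta> = 0})" by (rule ex_new_if_finite[OF infinite_UNIV_char_0])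
  then obtain \<theta> where "\<theta> \<notin> (\<Union>e\<in>E. {\<theta>. poly (?p e) \<theta> = 0})" by blast
  then have "\<forall>e\<in>E. skew \<theta> e $ 3 \<noteq> 0" by (auto simp: skew_component power2_eq_square algebra_simps)
  then show ?thesis by blast
qed

text \<open>A degenerate edge would make an integer parameter and one 1/2 further coincide, although
  the latter cannot belong to a double point.\<close>

lemma singular_edge_nonzero:
  assumes S: "singular ps D" and i: "i < length ps"
  shows "vtx (ps ! i) (k + 1) \<noteq> vtx (ps ! i) k"
proof
  assume e: "vtx (ps ! i) (k + 1) = vtx (ps ! i) k"
  have "curve (ps ! i) (of_int k + 1 / 2) = curve (ps ! i) (of_int k)"
    using curve_on_edge[of k "of_int k + 1 / 2" "ps ! i"] e by (simp add: curve_of_int)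
  then consider "same_param ps i (of_int k + 1 / 2) i (of_int k)" | m :: int where "of_int k + 1 / 2 = real_of_int m"
    using singular_coincidence[OF S i i] by blast
  then show False
  proof cases
    case 1
    then show False using not_same_param_close[of "of_int k + 1 / 2" "of_int k" ps i] by simp
  next
    case 2
    then have "real_of_int (2 * (m - k)) = of_int 1" by simp
    then have "2 * (m - k) = 1" by (simp only: of_int_eq_iff)
    then show False by presburger
  qed
qed

text \<open>Edges that are not horizontal meet the horizontal plane of a finger in at most one
  point, which \<open>finger_directions\<close> relies on. The scaling brings the link into the
  prescribed ball.\<close>

lemma exists_placement:
  assumes S: "singular ps D" and ball: "\<rho> > 0"
  shows "\<exists>f H. orienting f \<and> ambient_isotopy H \<and> (\<forall>x. H 1 x = f x + P0) \<and>
    (\<forall>i<length ps. \<forall>v \<in> set (ps ! i). dist P0 (f v + P0) < \<rho>) \<and>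
    (\<forall>i<length ps. \<forall>k. (f (vtx (ps ! i) (k + 1)) + P0) $ 3 \<noteq> (f (vtx (ps ! i) k) + P0) $ 3)"
proof -
  have ne: "[] \<notin> set ps" using S by (simp add: singular_def)
  have nz: "ps ! i \<noteq> []" if "i < length ps" for i using ne that nth_mem by metis
  define W where "W = (\<Union>i<length ps. set (ps ! i))"
  define E where "E = {v - w | v w. v \<in> W \<and> w \<in> W \<and> v \<noteq> w}"
  have fW: "finite W" by (simp add: W_def)
  have "E \<subseteq> (\<lambda>(v, w). v - w) ` (W \<times> W)" by (auto simp: E_def)
  then have "finite E" using fW by (meson finite_SigmaI finite_imageI finite_subset)
  moreover have "0 \<notin> E" by (auto simp: E_def)
  ultimately obtain \<theta> where \<theta>: "\<forall>e\<in>E. skew \<theta> e $ 3 \<noteq> 0" using exists_skew_nonhorizontal by blast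
  have "bounded (skew \<theta> ` W)" using fW by (intro finite_imp_bounded) simp
  then obtain b where b: "b > 0" "\<And>v. v \<in> W \<Longrightarrow> norm (skew \<theta> v) \<le> b" by (metis bounded_pos imageI)
  define \<tau> where "\<tau> = \<rho> / (2 * b)"
  have \<tau>: "\<tau> > 0" using ball b by (simp add: \<tau>_def)
  obtain H where H: "ambient_isotopy H" "\<And>x. H 1 x = \<tau> *\<^sub>R skew \<theta> x + P0" using ambient_isotopy_skew[OF \<tau>] by blast
  show ?thesis
  proof (intro exI[of _ "\<lambda>x. \<tau> *\<^sub>R skew \<theta> x"] exI[of _ H] conjI allI impI ballI)
    show "orienting (\<lambda>x. \<tau> *\<^sub>R skew \<theta> x)" by (rule orienting_skew[OF \<tau>])
    show "ambient_isotopy H" "\<And>x. H 1 x = \<tau> *\<^sub>R skew \<theta> x + P0" by (rule H)+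
    fix i assume i: "i < length ps"
    show "dist P0 (\<tau> *\<^sub>R skew \<theta> v + P0) < \<rho>" if "v \<in> set (ps ! i)" for v
    proof -
      have "v \<in> W" using that i by (auto simp: W_def)
      then have "\<tau> * norm (skew \<theta> v) \<le> \<tau> * b" using b \<tau> by (intro mult_left_mono) auto
      also have "\<dots> < \<rho>" using b(1) ball by (simp add: \<tau>_def)
      finally show ?thesis using \<tau> by (simp add: dist_norm)
    qed
    fix k
    have "vtx (ps ! i) (k + 1) - vtx (ps ! i) k \<in> E"
      using singular_edge_nonzero[OF S i, of k] vtx_in_set[OF nz[OF i], of k] vtx_in_set[OF nz[OF i], of "k + 1"] i
      unfolding E_def W_def by blast
    then have "skew \<theta> (vtx (ps ! i) (k + 1) - vtx (ps ! i) k) $ 3 \<noteq> 0" using \<theta> by blast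
    then have "skew \<theta> (vtx (ps ! i) (k + 1)) $ 3 \<noteq> skew \<theta> (vtx (ps ! i) k) $ 3"
      by (simp add: linear_diff[OF linear_skew])
    then show "(\<tau> *\<^sub>R skew \<theta> (vtx (ps ! i) (k + 1)) + P0) $ 3 \<noteq> (\<tau> *\<^sub>R skew \<theta> (vtx (ps ! i) k) + P0) $ 3"
      using \<tau> by simp
  qed
qed

lemma interval_avoid_finite:
  fixes a b :: real
  assumes "a < b" "finite F" shows "\<exists>x. a < x \<and> x < b \<and> x \<notin> F"
proof -
  have "infinite ({a<..<b} - F)" using assms by (intro Diff_infinite_finite) (auto simp: infinite_Ioo)
  then have "{a<..<b} - F \<noteq> {}" by force
  then show ?thesis by auto
qed

lemma distinct_choice:
  fixes a b :: "nat \<Rightarrow> real"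
  assumes "\<And>i. i < l \<Longrightarrow> a i < b i" "finite F"
  shows "\<exists>h. (\<forall>i<l. a i < h i \<and> h i < b i \<and> h i \<notin> F) \<and> inj_on h {..<l}"
  using assms(1)
proof (induction l)
  case (Suc l)
  then obtain h where h: "\<forall>i<l. a i < h i \<and> h i < b i \<and> h i \<notin> F" "inj_on h {..<l}" by auto
  have "finite (F \<union> h ` {..<l})" using assms(2) by simp
  then obtain x where x: "a l < x" "x < b l" "x \<notin> F \<union> h ` {..<l}"
    using interval_avoid_finite[of "a l" "b l"] Suc.prems[of l] by blast
  have "inj_on (h(l := x)) {..<Suc l}"
    using h(2) x(3) by (auto simp: inj_on_def less_Suc_eq)
  moreover have "\<forall>i<Suc l. a i < (h(l := x)) i \<and> (h(l := x)) i < b i \<and> (h(l := x)) i \<notin> F"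
    using h(1) x by (auto simp: less_Suc_eq)
  ultimately show ?case by (intro exI[of _ "h(l := x)"] conjI)
qed (auto intro: exI[of _ "\<lambda>_. 0"])

lemma finite_if_all_equal: "(\<And>x y. x \<in> S \<Longrightarrow> y \<in> S \<Longrightarrow> x = y) \<Longrightarrow> finite S"
  by (metis finite.simps finite_subset insertI1 subsetI subset_empty)

text \<open>The edge that ends at a lowest vertex descends.\<close>

lemma descending_edge:
  assumes "p \<noteq> []" and nh: "\<And>k. vtx p (k + 1) $ 3 \<noteq> vtx p k $ 3"
  shows "\<exists>k < length p. vtx p (int k + 1) $ 3 < vtx p (int k) $ 3"
proof -
  have "Min ((\<lambda>v. v $ 3) ` set p) \<in> (\<lambda>v. v $ 3) ` set p" using assms(1) by (intro Min_in) auto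
  then obtain v where v: "v \<in> set p" "v $ 3 = Min ((\<lambda>v. v $ 3) ` set p)" by force
  then obtain m where m: "m < length p" "v = p ! m" by (metis in_set_conv_nth)
  have least: "v $ 3 \<le> vtx p k $ 3" for k
    unfolding v(2) using vtx_in_set[OF assms(1), of k] by (intro Min_le) auto
  obtain k where k: "k \<in> {0..<int (length p)}" "vtx p (int m - 1) = vtx p k" "vtx p (int m - 1 + 1) = vtx p (k + 1)"
    using vtx_cyclic_edge[OF assms(1), of "int m - 1"] by blast
  have "vtx p (k + 1) = v" using k(3) m by (simp add: vtx_nat)
  then have "vtx p (k + 1) $ 3 < vtx p k $ 3" using least[of k] nh[of k] by simp
  then show ?thesis using k(1) by (intro exI[of _ "nat k"]) auto
qed

text \<open>
  Fingers are pulled horizontally, at pairwise different heights which are no heights of vertices.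
  All of them end on the lines \<open>y = \<eta>\<close>, \<open>x = mark l i\<close>; each edge and each finger exclude at most one
  value of \<open>\<eta>\<close>.
\<close>

lemma finger_directions:
  assumes S: "singular Q D" and l: "length Q = l"
    and nh: "\<And>i k. i < l \<Longrightarrow> vtx (Q ! i) (k + 1) $ 3 \<noteq> vtx (Q ! i) k $ 3"
    and U: "\<And>i t. i < l \<Longrightarrow> \<eta>0 < curve (Q ! i) t $ 2 \<and> (\<forall>j<l. curve (Q ! i) t $ 1 \<noteq> mark l j)"
    and \<eta>0: "\<eta>0 > 0"
  shows "\<exists>k t \<eta>. 0 < \<eta> \<and> \<eta> < \<eta>0 \<and> inj_on (\<lambda>i. curve (Q ! i) (t i) $ 3) {..<l} \<and>
    (\<forall>i<l. k i < length (Q ! i) \<and> real (k i) < t i \<and> t i < real (k i) + 1 \<and>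
      vtx (Q ! i) (int (k i) + 1) $ 3 < vtx (Q ! i) (int (k i)) $ 3 \<and>
      (\<forall>j<l. \<forall>s. curve (Q ! j) s \<in> closed_segment (curve (Q ! i) (t i)) (tip l \<eta> i (curve (Q ! i) (t i) $ 3)) \<longrightarrow>
        same_param Q i (t i) j s))"
proof -
  have ne: "[] \<notin> set Q" using S by (simp add: singular_def)
  have nz: "Q ! i \<noteq> []" if "i < l" for i using ne that nth_mem l by metis
  have "\<exists>k. \<forall>i<l. k i < length (Q ! i) \<and> vtx (Q ! i) (int (k i) + 1) $ 3 < vtx (Q ! i) (int (k i)) $ 3"
    using descending_edge[OF nz nh] by metis
  then obtain k where k: "\<And>i. i < l \<Longrightarrow> k i < length (Q ! i) \<and> vtx (Q ! i) (int (k i) + 1) $ 3 < vtx (Q ! i) (int (k i)) $ 3" by blast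
  let ?a = "\<lambda>i. vtx (Q ! i) (int (k i) + 1) $ 3" and ?b = "\<lambda>i. vtx (Q ! i) (int (k i)) $ 3"
  obtain h where h: "\<And>i. i < l \<Longrightarrow> ?a i < h i \<and> h i < ?b i" and hinj: "inj_on h {..<l}"
    using distinct_choice[of l ?a ?b "{}"] k by auto
  \<comment> \<open>The parameter at which the chosen edge passes the height
    \<open>h i\<close>.\<close>
  define t where "t = (\<lambda>i. real (k i) + (?b i - h i) / (?b i - ?a i))"
  have t: "real (k i) < t i" "t i < real (k i) + 1" "curve (Q ! i) (t i) $ 3 = h i" if "i < l" for i
  proof -
    have p: "0 < ?b i - ?a i" "0 < ?b i - h i" "?b i - h i < ?b i - ?a i" using h[OF that] by auto
    then show b: "real (k i) < t i" "t i < real (k i) + 1" by (simp_all add: t_def)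
    have "curve (Q ! i) (t i) = vtx (Q ! i) (int (k i)) + (t i - of_int (int (k i))) *\<^sub>R (vtx (Q ! i) (int (k i) + 1) - vtx (Q ! i) (int (k i)))"
      using b by (intro curve_on_edge) auto
    then have "curve (Q ! i) (t i) $ 3 = ?b i + (t i - real (k i)) * (?a i - ?b i)" by simp
    also have "t i - real (k i) = (?b i - h i) / (?b i - ?a i)" by (simp add: t_def)
    also have "?b i + (?b i - h i) / (?b i - ?a i) * (?a i - ?b i) = h i"
      using p(1) by (simp add: field_simps)
    finally show "curve (Q ! i) (t i) $ 3 = h i" .
  qed
  let ?x = "\<lambda>i. curve (Q ! i) (t i)"
  \<comment> \<open>The values of \<eta> for which the finger of component \<open>i\<close> meets
    edge \<open>m\<close> of component \<open>j\<close> elsewhere than at its root.\<close>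
  define bad where "bad = (\<lambda>(i, j, m). {\<eta>. \<exists>s\<in>{real m..real m + 1}.
    curve (Q ! j) s \<in> closed_segment (?x i) (tip l \<eta> i (h i)) \<and> curve (Q ! j) s \<noteq> ?x i})"
  have badfin: "finite (bad (i, j, m))" if i: "i < l" and j: "j < l" for i j m
  proof (rule finite_if_all_equal)
    fix \<eta> \<eta>' assume "\<eta> \<in> bad (i, j, m)" "\<eta>' \<in> bad (i, j, m)"
    then obtain s s' where s: "s \<in> {real m..real m + 1}" "curve (Q ! j) s \<in> closed_segment (?x i) (tip l \<eta> i (h i))" "curve (Q ! j) s \<noteq> ?x i"
      and s': "s' \<in> {real m..real m + 1}" "curve (Q ! j) s' \<in> closed_segment (?x i) (tip l \<eta>' i (h i))" "curve (Q ! j) s' \<noteq> ?x i"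
      by (auto simp: bad_def)
    obtain a where a: "curve (Q ! j) s = (1 - a) *\<^sub>R ?x i + a *\<^sub>R tip l \<eta> i (h i)" using s(2) by (auto simp: closed_segment_def)
    obtain a' where a': "curve (Q ! j) s' = (1 - a') *\<^sub>R ?x i + a' *\<^sub>R tip l \<eta>' i (h i)" using s'(2) by (auto simp: closed_segment_def)
    have z: "curve (Q ! j) s $ 3 = h i" "curve (Q ! j) s' $ 3 = h i"
      unfolding a a' using t(3)[OF i] by (simp_all add: tip_def algebra_simps)
    let ?e = "vtx (Q ! j) (int m + 1) - vtx (Q ! j) (int m)"
    have "curve (Q ! j) s = vtx (Q ! j) (int m) + (s - of_int (int m)) *\<^sub>R ?e" "curve (Q ! j) s' = vtx (Q ! j) (int m) + (s' - of_int (int m)) *\<^sub>R ?e"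
      using s(1) s'(1) curve_on_edge[of "int m" s "Q ! j"] curve_on_edge[of "int m" s' "Q ! j"] by simp_all
    moreover have "(v + (s - x) *\<^sub>R e) $ 3 - (v + (s' - x) *\<^sub>R e) $ 3 = (s - s') * e $ 3" for v e :: point and x
      by (simp add: algebra_simps)
    ultimately have "curve (Q ! j) s $ 3 - curve (Q ! j) s' $ 3 = (s - s') * ?e $ 3" by (simp only:)
    \<comment> \<open>An edge that is not horizontal has only one point at height
      \<open>h i\<close>. The first coordinate of this point determines its position along the
      finger, because the root does not lie over \<open>mark l i\<close>; the second coordinate then
      determines \<eta>.\<close>
    then have "s = s'" using z nh[OF j, of "int m"] by simp
    then have eq: "(1 - a) *\<^sub>R ?x i + a *\<^sub>R tip l \<eta> i (h i) = (1 - a') *\<^sub>R ?x i + a' *\<^sub>R tip l \<eta>' i (h i)" using a a' by simp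
    have "a * (mark l i - ?x i $ 1) = a' * (mark l i - ?x i $ 1)"
      using arg_cong[OF eq, of "\<lambda>v. v $ 1"] by (simp add: tip_def algebra_simps)
    then have "a = a'" using U[OF i, of "t i"] i by auto
    moreover have "a \<noteq> 0" using s(3) a by auto
    moreover have "a * (\<eta> - ?x i $ 2) = a' * (\<eta>' - ?x i $ 2)"
      using arg_cong[OF eq, of "\<lambda>v. v $ 2"] by (simp add: tip_def algebra_simps)
    ultimately show "\<eta> = \<eta>'" by simp
  qed
  let ?I = "{..<l} \<times> (SIGMA j:{..<l}. {..<length (Q ! j)})"
  have "finite (\<Union>x\<in>?I. bad x)"
    using badfin by (intro finite_UN_I finite_cartesian_product finite_SigmaI) auto
  then obtain \<eta> where \<eta>: "0 < \<eta>" "\<eta> < \<eta>0" "\<eta> \<notin> (\<Union>x\<in>?I. bad x)" using interval_avoid_finite[OF \<eta>0] by blast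
  have seg: "same_param Q i (t i) j s"
    if i: "i < l" and j: "j < l" and s: "curve (Q ! j) s \<in> closed_segment (?x i) (tip l \<eta> i (h i))" for i j s
  proof -
    have n: "length (Q ! j) > 0" using nz[OF j] by simp
    obtain z where z: "0 \<le> s - 0 + of_int z * real (length (Q ! j))" "s - 0 + of_int z * real (length (Q ! j)) < real (length (Q ! j))"
      using cyclic_representative[OF n] by blast
    define s' where "s' = s + of_int z * real (length (Q ! j))"
    define m where "m = nat \<lfloor>s'\<rfloor>"
    have "0 \<le> s'" using z by (simp add: s'_def)
    then have mr: "real m = of_int \<lfloor>s'\<rfloor>" by (simp add: m_def)
    have "of_int \<lfloor>s'\<rfloor> \<le> s'" "s' \<le> of_int \<lfloor>s'\<rfloor> + 1" by linarith+
    then have m: "s' \<in> {real m..real m + 1}" using mr by simp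
    have "s' < real (length (Q ! j))" using z by (simp add: s'_def)
    then have "real m < real (length (Q ! j))" unfolding mr by (rule order.strict_trans1[OF \<open>of_int \<lfloor>s'\<rfloor> \<le> s'\<close>])
    then have "m < length (Q ! j)" by simp
    then have "(i, j, m) \<in> ?I" using i j by auto
    then have "\<eta> \<notin> bad (i, j, m)" using \<eta>(3) by blast
    then have all: "\<forall>s\<in>{real m..real m + 1}. curve (Q ! j) s \<in> closed_segment (?x i) (tip l \<eta> i (h i)) \<longrightarrow> curve (Q ! j) s = ?x i"
      by (auto simp: bad_def)
    have "curve (Q ! j) s' = curve (Q ! j) s" by (simp add: s'_def curve_add_multiple)
    then have "curve (Q ! j) s = ?x i" using bspec[OF all m] s by simp
    then have "curve (Q ! i) (t i) = curve (Q ! j) s" by simp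
    from singular_coincidence[OF S _ _ this] i j l
    consider "same_param Q i (t i) j s" | y :: int where "t i = of_int y" by blast
    then show ?thesis
    proof cases
      case 2
      then have "real_of_int (int (k i)) < of_int y" "real_of_int y < of_int (int (k i) + 1)" using t(1,2)[OF i] by simp_all
      then show ?thesis by (simp only: of_int_less_iff)
    qed
  qed
  have "inj_on (\<lambda>i. ?x i $ 3) {..<l}" using hinj t(3) unfolding inj_on_def by simp
  then show ?thesis
    using \<eta> k t seg by (intro exI[of _ k] exI[of _ t] exI[of _ \<eta>] conjI allI impI) simp_all
qed

section \<open>Places of double points after subdivision\<close>

lemma resample_place_mod:
  assumes "N > 0" "ps ! fst a \<noteq> []"
  shows "int (snd (resample_place N r ps a)) = (int N * int (snd a) - int (r (fst a))) mod int (N * length (ps ! fst a))"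
proof -
  have "int (N * length (ps ! fst a)) > 0" using assms by simp
  then show ?thesis by (simp add: resample_place_def)
qed

text \<open>Used in the contrapositive: a new vertex strictly inside an old edge has a nonintegral
  old parameter, hence is not the place of a double point.\<close>

lemma resample_place_integral:
  assumes "N > 0" "i < length ps" "ps ! i \<noteq> []" "snd a < length (ps ! fst a)"
    and eq: "(i, nat (m mod int (N * length (ps ! i)))) = resample_place N r ps a"
  shows "\<exists>z::int. of_int (m + int (r i)) / real N = of_int z"
proof -
  have i: "fst a = i" using eq by (simp add: resample_place_def prod_eq_iff)
  let ?M = "int (N * length (ps ! i))"
  have M: "?M > 0" using assms by simp
  have "m mod ?M = int (nat (m mod ?M))" by (rule nat_0_le[symmetric]) (rule pos_mod_sign[OF M])
  also have "nat (m mod ?M) = snd (resample_place N r ps a)" by (metis eq snd_conv)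
  also have "int \<dots> = (int N * int (snd a) - int (r i)) mod ?M"
    using resample_place_mod[of N ps a r] assms(1,3) i by simp
  finally have "m mod ?M = (int N * int (snd a) - int (r i)) mod ?M" .
  then have "?M dvd m - (int N * int (snd a) - int (r i))" by (simp only: mod_eq_dvd_iff)
  then obtain q where "m - (int N * int (snd a) - int (r i)) = ?M * q" by (elim dvdE)
  then have "m + int (r i) = int N * (int (snd a) + int (length (ps ! i)) * q)" by (simp add: algebra_simps)
  then have "real_of_int (m + int (r i)) = real_of_int (int N * (int (snd a) + int (length (ps ! i)) * q))" by (rule arg_cong)
  then have "of_int (m + int (r i)) / real N = of_int (int (snd a) + int (length (ps ! i)) * q)" using assms(1) by simp
  then show ?thesis by blast
qed

lemma singular_place:
  assumes S: "singular ps D" and "b \<in> places D"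
  shows "fst b < length ps \<and> snd b < length (ps ! fst b)"
proof -
  obtain d where d: "d \<in> D" "b = fst d \<or> b = snd d" using assms(2) by blast
  then show ?thesis using singular_D(1-4)[OF S, of "fst d" "snd d"] by auto
qed

lemma resample_places:
  "places (resample_dpoint N r ps ` D) = resample_place N r ps ` (places D)"
  by (simp add: image_Un image_image resample_dpoint_def)

text \<open>The numbers of the old vertices of a component are congruent modulo \<open>N\<close>,
  and so is the period to 0. With \<open>N\<close> at least 2, no two of them can be
  neighbours.\<close>

lemma isolated_resample_link:
  assumes S: "singular ps D" and N: "2 \<le> N"
  shows "isolated (resample_link N r A ps) (resample_dpoint N r ps ` D)"
  unfolding isolated_def
proof (intro ballI)
  fix a e assume a: "a \<in> places (resample_dpoint N r ps ` D)" and e: "e \<in> {- 1, 1 :: int}"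
  let ?R = "resample_place N r ps"
  have form: "\<exists>b. x = ?R b \<and> fst b < length ps \<and> snd b < length (ps ! fst b)"
    if "x \<in> places (resample_dpoint N r ps ` D)" for x
    using that singular_place[OF S] unfolding resample_places by blast
  obtain b where b: "a = ?R b" "fst b < length ps" "snd b < length (ps ! fst b)" using form[OF a] by blast
  let ?i = "fst b"
  have nz: "ps ! ?i \<noteq> []" using b by auto
  have fa: "fst a = ?i" by (simp add: b(1) resample_place_def)
  let ?M = "int (N * length (ps ! ?i))"
  show "pm (resample_link N r A ps) (fst a) (int (snd a) + e) \<notin> places (resample_dpoint N r ps ` D)"
  proof
    assume mem: "pm (resample_link N r A ps) (fst a) (int (snd a) + e) \<in> places (resample_dpoint N r ps ` D)"
    obtain b' where b0: "pm (resample_link N r A ps) (fst a) (int (snd a) + e) = ?R b'" "snd b' < length (ps ! fst b')"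
      using form[OF mem] by blast
    have "length (resample_link N r A ps ! fst a) = N * length (ps ! ?i)" using b(2) fa by simp
    then have b': "(?i, nat ((int (snd a) + e) mod ?M)) = ?R b'" "snd b' < length (ps ! fst b')" using b0 fa by simp_all
    obtain z :: int where z: "of_int (int (snd a) + e + int (r ?i)) / real N = real_of_int z"
      using resample_place_integral[OF _ b(2) nz b'(2,1)] N by auto
    have b1: "(?i, nat (int (snd a) mod ?M)) = ?R b"
      using resample_place_mod[of N ps b r] N nz by (simp add: b(1) resample_place_def prod_eq_iff)
    obtain y :: int where y: "of_int (int (snd a) + int (r ?i)) / real N = real_of_int y"
      using resample_place_integral[OF _ b(2) nz b(3) b1] N by auto
    have "real_of_int e = real_of_int ((z - y) * int N)" using z y N by (simp add: field_simps)
    then have "e = (z - y) * int N" by (simp only: of_int_eq_iff)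
    then have "int N dvd e" by simp
    then have "int N dvd 1" using e by auto
    then show False using N by simp
  qed
qed

text \<open>The fingers are pulled out of the resolutions, not out of the singular link. So finger
  position is demanded at once for all displacements of size at most \<delta> at the first places of
  double points, the only vertices that \<open>resolve\<close> moves, with the same heights and tips
  for all of them.\<close>

definition finger_room :: "nat \<Rightarrow> point \<Rightarrow> real \<Rightarrow> point list list \<Rightarrow> dpoint set \<Rightarrow> (nat \<Rightarrow> real) \<Rightarrow> real \<Rightarrow> real \<Rightarrow> real \<Rightarrow> bool" where
  "finger_room l P0 \<rho> L D h \<eta> \<kappa> \<delta> \<longleftrightarrow>
    (\<forall>a \<in> places D. 1 \<le> snd a \<and> snd a + 10 \<le> length (L ! fst a)) \<and>
    (\<forall>w. (\<forall>i k. norm (w i k) \<le> \<delta>) \<and> (\<forall>i k. (i, k) \<notin> fst ` D \<longrightarrow> w i k = 0) \<longrightarrow>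
      finger_position l (disp L w) h \<eta> \<kappa> \<and> (\<forall>i<l. \<forall>v \<in> set (disp L w ! i). dist P0 v < \<rho>))"

text \<open>The root of a finger lies strictly inside an edge, away from all vertices that may be
  displaced, and the finger keeps a distance from the rest of the link that exceeds its thickness
  and the displacements together. A fine subdivision makes nine edges fit around the root, and
  renumbering makes them the last ones.\<close>

theorem finger_placement:
  assumes S: "singular Q D" and l: "length Q = l"
    and nh: "\<And>i k. i < l \<Longrightarrow> vtx (Q ! i) (k + 1) $ 3 \<noteq> vtx (Q ! i) k $ 3"
    and U: "\<And>i v. i < l \<Longrightarrow> v \<in> set (Q ! i) \<Longrightarrow> dist P0 v < \<rho>"
    and ball: "\<And>v. dist P0 v < \<rho> \<Longrightarrow> \<eta>0 < v $ 2 \<and> 0 < v $ 3 \<and> v $ 3 < 1 \<and> (\<forall>i<l. v $ 1 \<noteq> mark l i)"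
    and \<eta>0: "\<eta>0 > 0"
  shows "\<exists>N r h \<eta> \<kappa> \<delta>. 2 \<le> N \<and> 0 < \<eta> \<and> \<eta> < \<eta>0 \<and> 0 < \<delta> \<and>
    finger_room l P0 \<rho> (resample_link N r (\<lambda>x. x) Q) (resample_dpoint N r Q ` D) h \<eta> \<kappa> \<delta>"
proof -
  let ?c = "\<lambda>i. curve (Q ! i)"
  let ?n = "\<lambda>i. real (length (Q ! i))"
  have ne: "[] \<notin> set Q" using S by (simp add: singular_def)
  have nz: "Q ! i \<noteq> []" if "i < l" for i using ne that nth_mem l by metis
  have cU: "dist P0 (?c i t) < \<rho>" if "i < l" for i t
    using curve_in_convex_set[of "ball P0 \<rho>" "Q ! i" t] nz[OF that] U[OF that] by (auto simp: subset_iff)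
  have "\<exists>k t \<eta>. 0 < \<eta> \<and> \<eta> < \<eta>0 \<and> inj_on (\<lambda>i. ?c i (t i) $ 3) {..<l} \<and>
    (\<forall>i<l. k i < length (Q ! i) \<and> real (k i) < t i \<and> t i < real (k i) + 1 \<and>
      vtx (Q ! i) (int (k i) + 1) $ 3 < vtx (Q ! i) (int (k i)) $ 3 \<and>
      (\<forall>j<l. \<forall>s. ?c j s \<in> closed_segment (?c i (t i)) (tip l \<eta> i (?c i (t i) $ 3)) \<longrightarrow> same_param Q i (t i) j s))"
    by (rule finger_directions[OF S l nh _ \<eta>0]) (use ball[OF cU] in auto)
  then obtain k t \<eta> where \<eta>: "0 < \<eta>" "\<eta> < \<eta>0" and hinj: "inj_on (\<lambda>i. ?c i (t i) $ 3) {..<l}"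
    and kt: "\<And>i. i < l \<Longrightarrow> k i < length (Q ! i) \<and> real (k i) < t i \<and> t i < real (k i) + 1 \<and>
      vtx (Q ! i) (int (k i) + 1) $ 3 < vtx (Q ! i) (int (k i)) $ 3"
    and seg: "\<And>i j s. i < l \<Longrightarrow> j < l \<Longrightarrow> ?c j s \<in> closed_segment (?c i (t i)) (tip l \<eta> i (?c i (t i) $ 3)) \<Longrightarrow> same_param Q i (t i) j s"
    by blast
  define h where "h = (\<lambda>i. ?c i (t i) $ 3)"
  let ?x = "\<lambda>i. ?c i (t i)"
  let ?S = "\<lambda>i. closed_segment (?x i) (tip l \<eta> i (h i))"
  let ?e = "\<lambda>i. vtx (Q ! i) (int (k i) + 1) - vtx (Q ! i) (int (k i))"
  have ez: "?e i $ 3 < 0" if "i < l" for i using kt[OF that] by simp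
  have edge: "?c i s = ?c i s' + (s - s') *\<^sub>R ?e i"
    if "i < l" "s \<in> {real (k i)..real (k i) + 1}" "s' \<in> {real (k i)..real (k i) + 1}" for i s s'
  proof -
    have 1: "?c i s = vtx (Q ! i) (int (k i)) + (s - of_int (int (k i))) *\<^sub>R ?e i"
      by (rule curve_on_edge) (use that in auto)
    have 2: "?c i s' = vtx (Q ! i) (int (k i)) + (s' - of_int (int (k i))) *\<^sub>R ?e i"
      by (rule curve_on_edge) (use that in auto)
    have "v + (s - x) *\<^sub>R e = (v + (s' - x) *\<^sub>R e) + (s - s') *\<^sub>R e" for v e :: point and x
      by (simp add: algebra_simps)
    then show ?thesis unfolding 1 2 .
  qed
  \<comment> \<open>A parameter radius about the root; twice this radius still fits inside the
    chosen edge.\<close>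
  have "\<exists>\<omega>>0. \<forall>i\<in>{..<l}. real (k i) + 2 * \<omega> < t i \<and> t i + 2 * \<omega> < real (k i) + 1"
  proof (rule uniform_positive)
    fix i assume "i \<in> {..<l}"
    then have "real (k i) < t i" "t i < real (k i) + 1" using kt by auto
    moreover have "\<exists>\<omega>>0. a + 2 * \<omega> < b \<and> b + 2 * \<omega> < c" if "a < b" "b < c" for a b c :: real
      using that by (intro exI[of _ "min (b - a) (c - b) / 3"]) (auto simp: min_def field_simps)
    ultimately show "\<exists>\<omega>>0. real (k i) + 2 * \<omega> < t i \<and> t i + 2 * \<omega> < real (k i) + 1" by blast
  qed auto
  then obtain \<omega> where \<omega>: "\<omega> > 0" "\<And>i. i < l \<Longrightarrow> real (k i) + 2 * \<omega> < t i \<and> t i + 2 * \<omega> < real (k i) + 1" by blast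
  have tn: "0 < t i" "t i < ?n i" if "i < l" for i using kt[OF that] by linarith+
  \<comment> \<open>The distance of the bare finger from everything outside the radius \<omega>
    about its root. One half will go to the thickness of the hull, the other half to the
    displacement.\<close>
  have "\<exists>\<delta>>0. \<forall>x\<in>{..<l} \<times> {..<l}. \<forall>s\<in>{0..?n (snd x)}. \<forall>p\<in>?S (fst x).
      (snd x = fst x \<longrightarrow> \<omega> \<le> \<bar>s - t (fst x)\<bar>) \<longrightarrow> \<delta> \<le> dist (?c (snd x) s) p"
  proof (rule uniform_positive)
    fix x assume "x \<in> {..<l} \<times> {..<l}"
    then obtain i j where x: "x = (i, j)" and i: "i < l" and j: "j < l" by auto
    let ?K = "({0..?n j} \<inter> {s. j = i \<longrightarrow> \<omega> \<le> \<bar>s - t i\<bar>}) \<times> ?S i"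
    have "\<exists>m>0. \<forall>z\<in>?K. m \<le> dist (?c j (fst z)) (snd z)"
    proof (rule compact_positive_lower_bound)
      have "closed {s. j = i \<longrightarrow> \<omega> \<le> \<bar>s - t i\<bar>}"
        by (cases "j = i") (auto intro!: closed_Collect_le continuous_intros)
      then show "compact ?K" by (intro compact_Times compact_Int_closed) auto
      show "continuous_on ?K (\<lambda>z. dist (?c j (fst z)) (snd z))"
        by (intro continuous_intros continuous_on_compose2[OF continuous_on_curve[OF nz[OF j], of UNIV], of _ fst]) auto
      fix z assume z: "z \<in> ?K"
      show "0 < dist (?c j (fst z)) (snd z)"
      proof (rule ccontr)
        assume "\<not> 0 < dist (?c j (fst z)) (snd z)"
        then have "?c j (fst z) \<in> ?S i" using z by auto
        then have "same_param Q i (t i) j (fst z)" using seg[OF i j] by (simp add: h_def)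
        then obtain y :: int where y: "i = j" "fst z = t i + of_int y * ?n i" by (auto simp: same_param_def)
        have "fst z \<in> {0..?n i}" "\<omega> \<le> \<bar>fst z - t i\<bar>" using z y(1) by auto
        then have "- 1 * ?n i < of_int y * ?n i" "of_int y * ?n i < 1 * ?n i" using tn[OF i] y by auto
        then have "- 1 < real_of_int y" "real_of_int y < 1" using tn[OF i] by (simp_all only: mult_less_cancel_right_pos)
        then have "y = 0" by simp
        then show False using y \<open>\<omega> \<le> \<bar>fst z - t i\<bar>\<close> \<omega>(1) by simp
      qed
    qed
    then show "\<exists>\<delta>>0. \<forall>s\<in>{0..?n (snd x)}. \<forall>p\<in>?S (fst x). (snd x = fst x \<longrightarrow> \<omega> \<le> \<bar>s - t (fst x)\<bar>) \<longrightarrow> \<delta> \<le> dist (?c (snd x) s) p"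
      unfolding x by auto
  qed (auto intro: order_trans)
  then obtain \<delta>0 where \<delta>0: "\<delta>0 > 0" and away: "\<And>i j s p. i < l \<Longrightarrow> j < l \<Longrightarrow> s \<in> {0..?n j} \<Longrightarrow> p \<in> ?S i \<Longrightarrow>
      (j = i \<longrightarrow> \<omega> \<le> \<bar>s - t i\<bar>) \<Longrightarrow> \<delta>0 \<le> dist (?c j s) p" by fastforce
  \<comment> \<open>Half the least difference of two heights: the ends of each finger will stay
    closer than this to its height, so the slabs are disjoint.\<close>
  have "\<exists>\<delta>>0. \<forall>x\<in>{x \<in> {..<l} \<times> {..<l}. fst x \<noteq> snd x}. 2 * \<delta> \<le> \<bar>h (fst x) - h (snd x)\<bar>"
  proof (rule uniform_positive)
    show "finite {x \<in> {..<l} \<times> {..<l}. fst x \<noteq> snd x}" by simp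
    fix x assume "x \<in> {x \<in> {..<l} \<times> {..<l}. fst x \<noteq> snd x}"
    then have "h (fst x) \<noteq> h (snd x)" using hinj by (auto simp: h_def dest: inj_onD)
    then show "\<exists>\<delta>>0. 2 * \<delta> \<le> \<bar>h (fst x) - h (snd x)\<bar>" by (intro exI[of _ "\<bar>h (fst x) - h (snd x)\<bar> / 2"]) auto
  qed auto
  then obtain \<delta>1 where \<delta>1: "\<delta>1 > 0" "\<And>i j. i < l \<Longrightarrow> j < l \<Longrightarrow> i \<noteq> j \<Longrightarrow> 2 * \<delta>1 \<le> \<bar>h i - h j\<bar>" by force
  have "\<exists>\<mu>>0. \<forall>i\<in>{..<l}. \<forall>s. \<bar>s - t i\<bar> < \<mu> \<longrightarrow> dist (?c i s) (?x i) < min (\<delta>0 / 2) \<delta>1"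
  proof (rule uniform_positive)
    fix i assume "i \<in> {..<l}"
    then have "continuous_on UNIV (?c i)" using nz by (intro continuous_on_curve) auto
    then have "isCont (?c i) (t i)" by (simp add: continuous_on_eq_continuous_at)
    then show "\<exists>\<mu>>0. \<forall>s. \<bar>s - t i\<bar> < \<mu> \<longrightarrow> dist (?c i s) (?x i) < min (\<delta>0 / 2) \<delta>1"
      unfolding continuous_at_eps_delta dist_real_def using \<delta>0 \<delta>1(1) by (metis half_gt_zero min_less_iff_conj)
  qed auto
  then obtain \<mu> where \<mu>: "\<mu> > 0" "\<And>i s. i < l \<Longrightarrow> \<bar>s - t i\<bar> < \<mu> \<Longrightarrow> dist (?c i s) (?x i) < min (\<delta>0 / 2) \<delta>1" by blast
  \<comment> \<open>\<open>10 / N\<close> below \<omega> and \<mu> lets nine small edges around the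
    root stay within both radii.\<close>
  obtain N0 :: nat where N0: "real N0 > 10 / min \<omega> \<mu>" using reals_Archimedean2 by blast
  define N where "N = N0 + 2"
  have N: "2 \<le> N" "N > 0" and Nr: "real N > 0" by (simp_all add: N_def)
  have "10 / min \<omega> \<mu> < real N" using N0 by (simp add: N_def)
  then have "10 < real N * min \<omega> \<mu>" using \<omega>(1) \<mu>(1) by (simp add: pos_divide_less_eq)
  moreover have "real N * min \<omega> \<mu> \<le> real N * \<omega>" "real N * min \<omega> \<mu> \<le> real N * \<mu>" by (intro mult_left_mono; simp)+
  ultimately have "10 < real N * \<omega>" "10 < real N * \<mu>" by linarith+
  then have N10: "10 / real N < \<omega>" "10 / real N < \<mu>" using Nr by (simp_all add: pos_divide_less_eq mult.commute)
  \<comment> \<open>The last nine edges will run from the old parameter \<open>(r i - 9) / N\<close>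
    to \<open>r i / N\<close>. The offset 4 places the root well between these two.\<close>
  define r where "r = (\<lambda>i. nat \<lfloor>real N * t i\<rfloor> + 4)"
  have r: "real N * t i + 3 < real (r i)" "real (r i) \<le> real N * t i + 4" if "i < l" for i
  proof -
    have "0 \<le> real N * t i" using tn[OF that] Nr by simp
    then have "real (r i) = of_int \<lfloor>real N * t i\<rfloor> + 4" by (simp add: r_def)
    then show "real N * t i + 3 < real (r i)" "real (r i) \<le> real N * t i + 4" by linarith+
  qed
  let ?in = "\<lambda>i. (real (r i) - 9) / real N" and ?out = "\<lambda>i. real (r i) / real N"
  have io: "t i - 10 / real N < ?in i" "?in i < t i" "t i < ?out i" "?out i < t i + 10 / real N" if "i < l" for i
  proof -
    have e: "?in i = t i + (real (r i) - 9 - real N * t i) / real N" "?out i = t i + (real (r i) - real N * t i) / real N"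
      using Nr by (simp_all add: field_simps)
    have "- 10 / real N < (real (r i) - 9 - real N * t i) / real N" "(real (r i) - 9 - real N * t i) / real N < 0 / real N"
      "0 / real N < (real (r i) - real N * t i) / real N" "(real (r i) - real N * t i) / real N < 10 / real N"
      by (rule divide_strict_right_mono[OF _ Nr], use r[OF that] in linarith)+
    then show "t i - 10 / real N < ?in i" "?in i < t i" "t i < ?out i" "?out i < t i + 10 / real N"
      unfolding e by simp_all
  qed
  have near: "\<bar>?in i - t i\<bar> < \<mu>" "\<bar>?out i - t i\<bar> < \<mu>" "\<bar>?in i - t i\<bar> < \<omega>" "\<bar>?out i - t i\<bar> < \<omega>" if "i < l" for i
    using io[OF that] N10 by linarith+
  have ioE: "?in i \<in> {real (k i)..real (k i) + 1}" "?out i \<in> {real (k i)..real (k i) + 1}" "t i \<in> {real (k i)..real (k i) + 1}" if "i < l" for i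
    using near[OF that] \<omega>(2)[OF that] \<omega>(1) by (auto simp: abs_less_iff simp del: times_divide_eq_right)
  have zin: "h i < ?c i (?in i) $ 3" and zout: "?c i (?out i) $ 3 < h i" if i: "i < l" for i
  proof -
    have "?c i (?in i) $ 3 = h i + (?in i - t i) * ?e i $ 3" "?c i (?out i) $ 3 = h i + (?out i - t i) * ?e i $ 3"
      using edge[OF i ioE(1)[OF i] ioE(3)[OF i]] edge[OF i ioE(2)[OF i] ioE(3)[OF i]] by (simp_all add: h_def)
    moreover have "0 < (?in i - t i) * ?e i $ 3" using io[OF i] ez[OF i] by (intro mult_neg_neg) auto
    moreover have "(?out i - t i) * ?e i $ 3 < 0" using io[OF i] ez[OF i] by (intro mult_pos_neg) auto
    ultimately show "h i < ?c i (?in i) $ 3" "?c i (?out i) $ 3 < h i" by linarith+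
  qed
  \<comment> \<open>Half the opening at the tip: narrower than the heights of the two ends allow,
    and small enough to keep the hull within half of \<open>\<delta>0\<close> of the finger.\<close>
  have "\<exists>\<kappa>>0. \<forall>i\<in>{..<l}. \<kappa> < ?c i (?in i) $ 3 - h i \<and> \<kappa> < h i - ?c i (?out i) $ 3 \<and> \<kappa> < \<delta>0 / 2"
  proof (rule uniform_positive)
    fix i assume "i \<in> {..<l}"
    then have "h i < ?c i (?in i) $ 3" "?c i (?out i) $ 3 < h i" using zin zout by auto
    then show "\<exists>\<kappa>>0. \<kappa> < ?c i (?in i) $ 3 - h i \<and> \<kappa> < h i - ?c i (?out i) $ 3 \<and> \<kappa> < \<delta>0 / 2"
      using \<delta>0 by (intro exI[of _ "min (min (?c i (?in i) $ 3 - h i) (h i - ?c i (?out i) $ 3)) (\<delta>0 / 2) / 2"]) (auto simp: min_def)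
  qed auto
  then obtain \<kappa> where \<kappa>: "\<kappa> > 0" "\<And>i. i < l \<Longrightarrow> \<kappa> < ?c i (?in i) $ 3 - h i \<and> \<kappa> < h i - ?c i (?out i) $ 3 \<and> \<kappa> < \<delta>0 / 2" by blast
  let ?L = "resample_link N r (\<lambda>x. x) Q"
  let ?D = "resample_dpoint N r Q ` D"
  have "\<exists>\<delta>>0. \<forall>i\<in>{..<l}. \<forall>s\<in>{0..?n i}. \<delta> \<le> \<rho> - dist P0 (?c i s)"
  proof (rule uniform_positive)
    fix i assume "i \<in> {..<l}"
    then have i: "i < l" by simp
    show "\<exists>\<delta>>0. \<forall>s\<in>{0..?n i}. \<delta> \<le> \<rho> - dist P0 (?c i s)"
      by (rule compact_positive_lower_bound)
        (use cU[OF i] continuous_on_curve[OF nz[OF i]] in \<open>auto intro!: continuous_intros\<close>)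
  qed (auto intro: order_trans)
  then obtain \<delta>2 where \<delta>2: "\<delta>2 > 0" "\<And>i s. i < l \<Longrightarrow> s \<in> {0..?n i} \<Longrightarrow> \<delta>2 \<le> \<rho> - dist P0 (?c i s)" by blast
  define \<delta> where "\<delta> = min (\<delta>0 / 3) (\<delta>2 / 2)"
  have \<delta>: "\<delta> > 0" "\<delta> < \<delta>0 / 2" "\<delta> < \<delta>2" using \<delta>0 \<delta>2(1) by (auto simp: \<delta>_def)
  have Llen: "length (?L ! i) = N * length (Q ! i)" if "i < l" for i using that l by simp
  have big: "real N * ?n i \<ge> 10" "N * length (Q ! i) \<ge> 10" if i: "i < l" for i
  proof -
    have "\<omega> < 1" using \<omega>(1) \<omega>(2)[OF i] by linarith
    then have "10 / real N < 1" using N10 by linarith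
    then have "10 < real N" using Nr by (simp add: field_simps)
    moreover have "1 \<le> ?n i" using nz[OF i] by (simp add: Suc_le_eq)
    ultimately show "real N * ?n i \<ge> 10" using mult_mono[of 10 "real N" 1 "?n i"] by simp
    then have "real (N * length (Q ! i)) \<ge> real 10" by simp
    then show "N * length (Q ! i) \<ge> 10" by (simp only: of_nat_le_iff)
  qed
  have curveL: "curve (?L ! i) s = ?c i ((s + real (r i)) / real N)" if "i < l" for i s
    using curve_resample[OF N(2) nz[OF that] linear_ident, of "\<lambda>x. x" 0 "r i" s] that l by simp
  text \<open>Vertices inside the chosen edge have nonintegral parameters, so they stay where they are.\<close>
  have free: "(i, nat (m mod int (N * length (Q ! i)))) \<notin> places ?D"
    if i: "i < l" and m: "real (k i) < (of_int m + real (r i)) / real N" "(of_int m + real (r i)) / real N < real (k i) + 1" for i m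
  proof
    assume "(i, nat (m mod int (N * length (Q ! i)))) \<in> places ?D"
    then obtain a where a: "(i, nat (m mod int (N * length (Q ! i)))) = resample_place N r Q a" "snd a < length (Q ! fst a)"
      using singular_place[OF S] unfolding resample_places by blast
    obtain z :: int where "of_int (m + int (r i)) / real N = real_of_int z"
      using resample_place_integral[OF N(2) _ nz[OF i] a(2,1)] i l by auto
    then have "real_of_int (int (k i)) < of_int z" "real_of_int z < of_int (int (k i) + 1)" using m by simp_all
    then show False by (simp only: of_int_less_iff)
  qed
  have places: "1 \<le> snd a \<and> snd a + 10 \<le> length (?L ! fst a)" if a: "a \<in> places ?D" for a
  proof -
    obtain b where b: "a = resample_place N r Q b" "fst b < l" "snd b < length (Q ! fst b)"
      using a singular_place[OF S] l unfolding resample_places by blast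
    let ?i = "fst b"
    let ?M = "N * length (Q ! ?i)"
    have fa: "fst a = ?i" by (simp add: b(1) resample_place_def)
    have lt: "snd a < ?M" using resample_place_less[OF N(2) nz[OF b(2)]] b(1) by simp
    \<comment> \<open>The numbers from -9 to 0, read cyclically, are the vertices of the last nine
      edges. They lie strictly inside the chosen edge and so are not places of double
      points.\<close>
    have not: False if "int (snd a) = m + z * int ?M" "- 9 \<le> m" "m \<le> 0" for m z
    proof -
      have mr: "- 9 \<le> real_of_int m" "real_of_int m \<le> 0" using that(2,3) by (simp_all flip: of_int_le_iff)
      have "?in ?i \<le> (of_int m + real (r ?i)) / real N" "(of_int m + real (r ?i)) / real N \<le> ?out ?i"
        using mr Nr by (simp_all add: divide_right_mono)
      then have "real (k ?i) < (of_int m + real (r ?i)) / real N" "(of_int m + real (r ?i)) / real N < real (k ?i) + 1"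
        using near[OF b(2)] \<omega>(2)[OF b(2)] \<omega>(1) by (simp_all only: abs_less_iff) linarith+
      moreover have "nat (m mod int ?M) = snd a"
      proof -
        have "m mod int ?M = int (snd a) mod int ?M" unfolding that(1) by (rule mod_mult_self1[symmetric])
        also have "\<dots> = int (snd a)" using lt by (intro mod_pos_pos_trivial) (simp_all only: of_nat_0_le_iff of_nat_less_iff)
        finally show ?thesis by simp
      qed
      ultimately show False using free[OF b(2), of m] a fa by (metis prod.collapse)
    qed
    have "snd a \<noteq> 0" using not[of 0 0] by auto
    moreover have "\<not> ?M < snd a + 10"
    proof
      assume "?M < snd a + 10"
      moreover have "- 9 \<le> int x - int y" "int x - int y \<le> 0" if "y < x + 10" "x < y" for x y :: nat
        using that by linarith+
      ultimately have bd: "- 9 \<le> int (snd a) - int ?M" "int (snd a) - int ?M \<le> 0" using lt by blast+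
      show False by (rule not[OF _ bd, of 1]) simp
    qed
    ultimately show ?thesis using fa Llen[OF b(2)] by simp
  qed
  have main: "finger_position l (disp ?L w) h \<eta> \<kappa> \<and> (\<forall>i<l. \<forall>v \<in> set (disp ?L w ! i). dist P0 v < \<rho>)"
    if w: "\<And>i k. norm (w i k) \<le> \<delta>" "\<And>i k. (i, k) \<notin> fst ` ?D \<Longrightarrow> w i k = 0" for w
  proof -
    let ?K = "disp ?L w"
    have lL: "length ?L = l" using l by simp
    have Klen: "length (?K ! i) = N * length (Q ! i)" if "i < l" for i using that lL Llen by simp
    have Lnz: "?L ! i \<noteq> []" if "i < l" for i using big(2)[OF that] Llen[OF that] by auto
    have fsmall: "norm (curve (field ?L w i) s) \<le> \<delta>" if "i < l" for i s
      using Lnz[OF that] w(1) by (intro curve_norm_le) (auto simp: field_def)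
    have curveK: "curve (?K ! i) s = ?c i ((s + real (r i)) / real N) + curve (field ?L w i) s" if "i < l" for i s
      using curve_disp[of i ?L w s] that lL Lnz curveL by simp
    have vfree: "vtx (field ?L w i) m = 0"
      if i: "i < l" and m: "real (k i) < (of_int m + real (r i)) / real N" "(of_int m + real (r i)) / real N < real (k i) + 1" for i m
      using vtx_field[of ?L i w m] Lnz[OF i] free[OF i m] w(2) Llen[OF i] by simp
    have vK: "vtx (?K ! i) m = ?c i ((of_int m + real (r i)) / real N)"
      if i: "i < l" and m: "real (k i) < (of_int m + real (r i)) / real N" "(of_int m + real (r i)) / real N < real (k i) + 1" for i m
      using curveK[OF i, of "of_int m"] vfree[OF i m] by (simp add: curve_of_int)
    have tail: "?K ! i ! (N * length (Q ! i) - 9 + e) = ?c i (?in i + real e / real N)" if i: "i < l" and e: "e < 9" for i e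
    proof -
      have lt: "N * length (Q ! i) - 9 + e < N * length (Q ! i)" using big(2)[OF i] e by linarith
      have idx: "int (N * length (Q ! i) - 9 + e) = (int e - 9) + 1 * int (length (?K ! i))" using big(2)[OF i] Klen[OF i] by simp
      have par: "(of_int (int e - 9) + real (r i)) / real N = ?in i + real e / real N" using Nr by (simp add: field_simps)
      have "0 \<le> real e / real N" "real e / real N \<le> 9 / real N" using e Nr by (simp_all add: divide_right_mono)
      moreover have "?in i + 9 / real N = ?out i" using Nr by (simp add: field_simps)
      ultimately have "?in i \<le> ?in i + real e / real N" "?in i + real e / real N \<le> ?out i" by linarith+
      then have rng: "real (k i) < (of_int (int e - 9) + real (r i)) / real N" "(of_int (int e - 9) + real (r i)) / real N < real (k i) + 1"
        unfolding par using near[OF i] \<omega>(2)[OF i] \<omega>(1) by (simp_all only: abs_less_iff) linarith+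
      have "?K ! i ! (N * length (Q ! i) - 9 + e) = vtx (?K ! i) (int (N * length (Q ! i) - 9 + e))"
        using lt Klen[OF i] by (simp only: vtx_nat)
      also have "\<dots> = vtx (?K ! i) (int e - 9)" unfolding idx by (rule vtx_add_multiple)
      also have "\<dots> = ?c i (?in i + real e / real N)" unfolding vK[OF i rng] par ..
      finally show ?thesis .
    qed
    have xin: "?K ! i ! (length (?K ! i) - 9) = ?c i (?in i)" if i: "i < l" for i
      using tail[OF i, of 0] Klen[OF i] by simp
    have xout: "?K ! i ! 0 = ?c i (?out i)" if i: "i < l" for i
    proof -
      have rng: "real (k i) < (of_int 0 + real (r i)) / real N" "(of_int 0 + real (r i)) / real N < real (k i) + 1"
        using near[OF i] \<omega>(2)[OF i] \<omega>(1) by (simp_all only: abs_less_iff of_int_0 add_0) linarith+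
      have "0 < length (?K ! i)" using big(2)[OF i] Klen[OF i] by linarith
      then have "?K ! i ! 0 = vtx (?K ! i) 0" using vtx_nat[of 0 "?K ! i"] by simp
      then show ?thesis using vK[OF i rng] by simp
    qed
    have inside: "dist P0 v < \<rho>" if i: "i < l" and v: "v \<in> set (?K ! i)" for i v
    proof -
      obtain m where m: "m < length (?K ! i)" "v = ?K ! i ! m" using v by (metis in_set_conv_nth)
      have "v = curve (?K ! i) (real m)" using m curve_of_nat by simp
      then have ve: "v = ?c i ((real m + real (r i)) / real N) + curve (field ?L w i) (real m)" using curveK[OF i] by simp
      obtain z where z: "0 \<le> (real m + real (r i)) / real N - 0 + of_int z * ?n i" "(real m + real (r i)) / real N - 0 + of_int z * ?n i < ?n i"
        using cyclic_representative[of "length (Q ! i)" "(real m + real (r i)) / real N" 0] nz[OF i] by auto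
      have "\<delta>2 \<le> \<rho> - dist P0 (?c i ((real m + real (r i)) / real N + of_int z * ?n i))" using z by (intro \<delta>2(2)[OF i]) auto
      then have "dist P0 (?c i ((real m + real (r i)) / real N)) \<le> \<rho> - \<delta>2" by (simp add: curve_add_multiple)
      moreover have "dist P0 v \<le> dist P0 (?c i ((real m + real (r i)) / real N)) + norm (curve (field ?L w i) (real m))"
        unfolding ve dist_norm using norm_triangle_ineq4[of "P0 - ?c i ((real m + real (r i)) / real N)" "curve (field ?L w i) (real m)"]
        by (simp add: diff_diff_eq)
      ultimately show ?thesis using fsmall[OF i, of "real m"] \<delta>(3) by linarith
    qed
    have hull_near: "\<exists>q\<in>?S i. dist p q < \<delta>0 / 2" if i: "i < l" and p: "p \<in> finger_hull l ?K h \<eta> \<kappa> i" for i p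
    proof -
      \<comment> \<open>The open neighbourhood of radius \<open>\<delta>0 / 2\<close> of the finger,
        written as a sum of two convex sets.\<close>
      let ?B = "\<Union>x\<in>?S i. \<Union>y\<in>ball 0 (\<delta>0 / 2). {x + y}"
      have conv: "convex ?B" by (rule convex_sums) auto
      have inB: "p \<in> ?B" if "q \<in> ?S i" "dist p q < \<delta>0 / 2" for p q
      proof -
        have "p - q \<in> ball 0 (\<delta>0 / 2)" "p \<in> {q + (p - q)}" using that(2) by (simp_all add: dist_norm norm_minus_commute)
        then show ?thesis using that(1) by blast
      qed
      have "dist (?c i (?in i)) (?x i) < \<delta>0 / 2" "dist (?c i (?out i)) (?x i) < \<delta>0 / 2"
        using \<mu>(2)[OF i near(1)[OF i]] \<mu>(2)[OF i near(2)[OF i]] by auto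
      moreover have "dist (tip l \<eta> i (h i + \<kappa>)) (tip l \<eta> i (h i)) < \<delta>0 / 2" "dist (tip l \<eta> i (h i - \<kappa>)) (tip l \<eta> i (h i)) < \<delta>0 / 2"
      proof -
        have "tip l \<eta> i (h i + \<kappa>) - tip l \<eta> i (h i) = \<kappa> *\<^sub>R axis 3 1" "tip l \<eta> i (h i - \<kappa>) - tip l \<eta> i (h i) = (- \<kappa>) *\<^sub>R axis 3 1"
          by (simp_all add: tip_def vec_eq_iff forall_3 axis_def)
        then show "dist (tip l \<eta> i (h i + \<kappa>)) (tip l \<eta> i (h i)) < \<delta>0 / 2" "dist (tip l \<eta> i (h i - \<kappa>)) (tip l \<eta> i (h i)) < \<delta>0 / 2"
          using \<kappa> i by (simp_all add: dist_norm norm_axis_1)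
      qed
      ultimately have dd: "dist (?c i (?in i)) (?x i) < \<delta>0 / 2" "dist (?c i (?out i)) (?x i) < \<delta>0 / 2"
        "dist (tip l \<eta> i (h i + \<kappa>)) (tip l \<eta> i (h i)) < \<delta>0 / 2" "dist (tip l \<eta> i (h i - \<kappa>)) (tip l \<eta> i (h i)) < \<delta>0 / 2"
        by blast+
      have "?x i \<in> ?S i" "tip l \<eta> i (h i) \<in> ?S i" by simp_all
      note m = inB[OF this(1) dd(1)] inB[OF this(1) dd(2)] inB[OF this(2) dd(3)] inB[OF this(2) dd(4)]
      have "{?K ! i ! (length (?K ! i) - 9), ?K ! i ! 0, tip l \<eta> i (h i + \<kappa>), tip l \<eta> i (h i - \<kappa>)} \<subseteq> ?B"
        unfolding xin[OF i] xout[OF i] by (intro insert_subsetI m empty_subsetI)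
      then have "finger_hull l ?K h \<eta> \<kappa> i \<subseteq> ?B" unfolding finger_hull_def using conv by (rule hull_minimal)
      then have "p \<in> ?B" using p by blast
      then obtain x y where "p = x + y" "x \<in> ?S i" "norm y < \<delta>0 / 2" by auto
      then show ?thesis by (intro bexI[of _ x]) (auto simp: dist_norm)
    qed
    have hull_z: "?c i (?out i) $ 3 \<le> p $ 3 \<and> p $ 3 \<le> ?c i (?in i) $ 3" if i: "i < l" and p: "p \<in> finger_hull l ?K h \<eta> \<kappa> i" for i p
    proof -
      let ?B = "{p :: point. ?c i (?out i) $ 3 \<le> p $ 3 \<and> p $ 3 \<le> ?c i (?in i) $ 3}"
      have "?B = {p. ?c i (?out i) $ 3 \<le> inner (axis 3 1) p} \<inter> {p. inner (axis 3 1) p \<le> ?c i (?in i) $ 3}"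
        by (auto simp: inner_axis')
      then have "convex ?B" by (simp only:) (intro convex_Int convex_halfspace_ge convex_halfspace_le)
      moreover have "{?K ! i ! (length (?K ! i) - 9), ?K ! i ! 0, tip l \<eta> i (h i + \<kappa>), tip l \<eta> i (h i - \<kappa>)} \<subseteq> ?B"
        unfolding xin[OF i] xout[OF i] using zin[OF i] zout[OF i] \<kappa>(1) \<kappa>(2)[OF i] by (auto simp: tip_def)
      ultimately have "finger_hull l ?K h \<eta> \<kappa> i \<subseteq> ?B" unfolding finger_hull_def by (intro hull_minimal)
      then show ?thesis using p by blast
    qed
    \<comment> \<open>By distance, a point in the hull has its parameter near the root, on the part
      of the chosen edge that is not displaced. Its height then puts it between \<open>?in i\<close>
      and \<open>?out i\<close>, and outside the half-open tail only vertex 0 is left.\<close>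
    have clear: "j = i \<and> s = 0"
      if i: "i < l" and j: "j < l" and s: "0 \<le> s" "s < real (length (?K ! j)) - 9" and p: "curve (?K ! j) s \<in> finger_hull l ?K h \<eta> \<kappa> i" for i j s
    proof -
      let ?u = "(s + real (r j)) / real N"
      obtain z where z: "0 \<le> ?u - 0 + of_int z * ?n j" "?u - 0 + of_int z * ?n j < ?n j"
        using cyclic_representative[of "length (Q ! j)" ?u 0] nz[OF j] by auto
      define u where "u = ?u + of_int z * ?n j"
      have cu: "?c j u = ?c j ?u" by (simp add: u_def curve_add_multiple)
      have u: "u \<in> {0..?n j}" using z by (auto simp: u_def)
      have "\<not> (j = i \<longrightarrow> \<omega> \<le> \<bar>u - t i\<bar>)"
      proof
        assume far: "j = i \<longrightarrow> \<omega> \<le> \<bar>u - t i\<bar>"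
        obtain q where q: "q \<in> ?S i" "dist (curve (?K ! j) s) q < \<delta>0 / 2" using hull_near[OF i p] by blast
        have "\<delta>0 \<le> dist (?c j u) q" by (rule away[OF i j u q(1) far])
        also have "\<dots> \<le> dist (?c j u) (curve (?K ! j) s) + dist (curve (?K ! j) s) q" by (rule dist_triangle)
        also have "dist (?c j u) (curve (?K ! j) s) = norm (curve (field ?L w j) s)"
          unfolding curveK[OF j] cu by (simp add: dist_norm)
        finally show False using q(2) fsmall[OF j, of s] \<delta>(2) by linarith
      qed
      then have ji: "j = i" and ut: "\<bar>u - t i\<bar> < \<omega>" by auto
      have uE: "u \<in> {real (k i)..real (k i) + 1}" using ut \<omega>(2)[OF i] \<omega>(1) by (auto simp: abs_less_iff)
      have "curve (field ?L w i) s = 0"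
      proof -
        have vz: "vtx (field ?L w i) m = 0" if m: "\<bar>of_int m - s\<bar> \<le> 1" for m
        proof -
          let ?m = "m + (z * int (N * length (Q ! i)))"
          have "real_of_int ?m = of_int m + of_int z * (real N * ?n i)" by simp
          then have e: "(of_int ?m + real (r i)) / real N = u + (of_int m - s) / real N"
            using Nr ji by (simp add: u_def field_simps)
          have "\<bar>(of_int m - s) / real N\<bar> \<le> 1 / real N" using m Nr by (simp add: abs_divide divide_right_mono)
          moreover have "1 / real N \<le> 10 / real N" using Nr by (simp add: divide_right_mono)
          ultimately have "\<bar>(of_int m - s) / real N\<bar> < \<omega>" using N10 by linarith
          then have "real (k i) < u + (of_int m - s) / real N" "u + (of_int m - s) / real N < real (k i) + 1"
            using ut \<omega>(2)[OF i] by (simp_all only: abs_less_iff) linarith+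
          then have "vtx (field ?L w i) ?m = 0" using vfree[OF i, of ?m] unfolding e by blast
          then show ?thesis using vtx_add_multiple[of "field ?L w i" m z] Llen[OF i] by simp
        qed
        have "vtx (field ?L w i) \<lfloor>s\<rfloor> = 0" "vtx (field ?L w i) (\<lfloor>s\<rfloor> + 1) = 0" by (rule vz, linarith)+
        then show ?thesis by (simp add: curve_def edge_def)
      qed
      then have ps: "curve (?K ! i) s = ?c i u" using curveK[OF i, of s] cu ji by simp
      have zu: "?c i (?out i) $ 3 \<le> ?c i u $ 3" "?c i u $ 3 \<le> ?c i (?in i) $ 3" using hull_z[OF i p] ps ji by auto
      have "0 \<le> (u - ?out i) * ?e i $ 3" using zu(1) edge[OF i uE ioE(2)[OF i]] by simp
      then have u1: "u \<le> ?out i" using ez[OF i] by (simp add: zero_le_mult_iff)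
      have "(u - ?in i) * ?e i $ 3 \<le> 0" using zu(2) edge[OF i uE ioE(1)[OF i]] by simp
      then have u2: "?in i \<le> u" using ez[OF i] by (simp add: mult_le_0_iff)
      let ?M = "real N * ?n i"
      have "u * real N = s + real (r i) + of_int z * ?M" using Nr ji by (simp add: u_def field_simps)
      moreover have "u * real N \<le> real (r i)" "real (r i) - 9 \<le> u * real N" using u1 u2 Nr by (simp_all add: field_simps)
      ultimately have sz: "s + of_int z * ?M \<le> 0" "- 9 \<le> s + of_int z * ?M" by linarith+
      have sM: "0 \<le> s" "s < ?M - 9" using s Klen[OF j] ji by auto
      have "z = 0"
      proof (rule ccontr)
        assume "z \<noteq> 0"
        have Mp: "?M > 0" using big(1)[OF i] by linarith
        consider "1 \<le> z" | "z \<le> - 1" using \<open>z \<noteq> 0\<close> by linarith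
        then show False
        proof cases
          case 1
          then have "1 * ?M \<le> of_int z * ?M" using Mp by (intro mult_right_mono) auto
          then show False using sz sM Mp by linarith
        next
          case 2
          then have "real_of_int z \<le> - 1" by (simp flip: of_int_le_iff)
          then have "of_int z * ?M \<le> - 1 * ?M" using Mp by (intro mult_right_mono) auto
          then show False using sz sM Mp by linarith
        qed
      qed
      then show ?thesis using sz sM ji by simp
    qed
    have "finger_position l ?K h \<eta> \<kappa>"
      unfolding finger_position_def
    proof (intro conjI allI impI ballI)
      show "length ?K = l" "0 < \<eta>" "0 < \<kappa>" using lL \<eta> \<kappa> by auto
      fix i assume i: "i < l"
      show "10 \<le> length (?K ! i)" using big(2)[OF i] Klen[OF i] by simp
      show "\<eta> < v $ 2" "0 < v $ 3" "v $ 3 < 1" if "v \<in> set (?K ! i)" for v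
        using ball[OF inside[OF i that]] \<eta> by auto
      show "?K ! i ! (length (?K ! i) - 8 + e) = ?K ! i ! (length (?K ! i) - 9) +
          (real (e + 1) / 9) *\<^sub>R (?K ! i ! 0 - ?K ! i ! (length (?K ! i) - 9))" if e: "e < 8" for e
      proof -
        have "length (?K ! i) - 8 + e = N * length (Q ! i) - 9 + (e + 1)" using big(2)[OF i] Klen[OF i] by simp
        then have 1: "?K ! i ! (length (?K ! i) - 8 + e) = ?c i (?in i + real (e + 1) / real N)" using tail[OF i, of "e + 1"] e by simp
        have out: "?out i = ?in i + 9 / real N" using Nr by (simp add: field_simps)
        have "0 \<le> real (e + 1) / real N" "real (e + 1) / real N \<le> 9 / real N" using e Nr by (simp_all add: divide_right_mono)
        moreover have "real (k i) \<le> ?in i" "?out i \<le> real (k i) + 1" using ioE[OF i] by auto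
        ultimately have "real (k i) \<le> ?in i + real (e + 1) / real N" "?in i + real (e + 1) / real N \<le> real (k i) + 1"
          using out by linarith+
        then have "?in i + real (e + 1) / real N \<in> {real (k i)..real (k i) + 1}" by (simp only: atLeastAtMost_iff)
        then have "?c i (?in i + real (e + 1) / real N) = ?c i (?in i) + (real (e + 1) / real N) *\<^sub>R ?e i"
          using edge[OF i _ ioE(1)[OF i]] by simp
        moreover have "?c i (?out i) - ?c i (?in i) = (9 / real N) *\<^sub>R ?e i"
          using edge[OF i ioE(2,1)[OF i]] out by simp
        moreover have "real (e + 1) / 9 * (9 / real N) = real (e + 1) / real N" using Nr by (simp add: field_simps)
        ultimately show ?thesis unfolding 1 xin[OF i] xout[OF i] by (simp only: scaleR_scaleR)
      qed
      show "h i + \<kappa> < ?K ! i ! (length (?K ! i) - 9) $ 3" "?K ! i ! 0 $ 3 < h i - \<kappa>"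
        unfolding xin[OF i] xout[OF i] using \<kappa>(2)[OF i] by auto
      show "j = i" "s = 0" if "j < l" "0 \<le> s \<and> s < real (length (?K ! j)) - 9 \<and> curve (?K ! j) s \<in> finger_hull l ?K h \<eta> \<kappa> i" for j s
        using clear[OF i that(1), of s] that(2) by auto
      show "?K ! i ! (length (?K ! i) - 9) $ 3 < ?K ! j ! 0 $ 3 \<or> ?K ! j ! (length (?K ! j) - 9) $ 3 < ?K ! i ! 0 $ 3"
        if j: "j < l" "j \<noteq> i" for j
      proof -
        have z: "\<bar>?c m (?in m) $ 3 - h m\<bar> < \<delta>1" "\<bar>?c m (?out m) $ 3 - h m\<bar> < \<delta>1" if m: "m < l" for m
        proof -
          have d: "dist (?c m (?in m)) (?x m) < \<delta>1" "dist (?c m (?out m)) (?x m) < \<delta>1"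
            using \<mu>(2)[OF m near(1)[OF m]] \<mu>(2)[OF m near(2)[OF m]] by auto
          have b: "\<bar>a $ 3 - ?x m $ 3\<bar> \<le> dist a (?x m)" for a
            using component_le_norm_cart[of "a - ?x m" 3] by (simp add: dist_norm)
          show "\<bar>?c m (?in m) $ 3 - h m\<bar> < \<delta>1" "\<bar>?c m (?out m) $ 3 - h m\<bar> < \<delta>1"
            unfolding h_def by (rule order_le_less_trans[OF b d(1)] order_le_less_trans[OF b d(2)])+
        qed
        have "2 * \<delta>1 \<le> \<bar>h i - h j\<bar>" using \<delta>1(2)[OF i j(1)] j(2) by blast
        then show ?thesis unfolding xin[OF i] xout[OF i] xin[OF j(1)] xout[OF j(1)]
          using z[OF i] z[OF j(1)] by (simp only: abs_less_iff abs_le_iff) linarith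
      qed
    qed
    then show ?thesis using inside by blast
  qed
  have 1: "\<forall>a \<in> places ?D. 1 \<le> snd a \<and> snd a + 10 \<le> length (?L ! fst a)" using places by blast
  have 2: "\<forall>w. (\<forall>i k. norm (w i k) \<le> \<delta>) \<and> (\<forall>i k. (i, k) \<notin> fst ` ?D \<longrightarrow> w i k = 0) \<longrightarrow>
    finger_position l (disp ?L w) h \<eta> \<kappa> \<and> (\<forall>i<l. \<forall>v\<in>set (disp ?L w ! i). dist P0 v < \<rho>)"
  proof (intro allI impI)
    fix w :: "nat \<Rightarrow> nat \<Rightarrow> point"
    assume "(\<forall>i k. norm (w i k) \<le> \<delta>) \<and> (\<forall>i k. (i, k) \<notin> fst ` ?D \<longrightarrow> w i k = 0)"
    then show "finger_position l (disp ?L w) h \<eta> \<kappa> \<and> (\<forall>i<l. \<forall>v\<in>set (disp ?L w ! i). dist P0 v < \<rho>)"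
      by (elim conjE) (rule main; simp)
  qed
  show ?thesis
    unfolding finger_room_def
    by (intro exI[of _ N] exI[of _ r] exI[of _ h] exI[of _ \<eta>] exI[of _ \<kappa>] exI[of _ \<delta>] conjI N(1) \<eta>(1) \<eta>(2) \<delta>(1) 1 2)
qed

subsection \<open>Differences over pairs of double points\<close>

lemma sum_Pow_insert:
  assumes "finite A" "x \<notin> A"
  shows "(\<Sum>U\<in>Pow (insert x A). f U) = (\<Sum>U\<in>Pow A. f U) + (\<Sum>U\<in>Pow A. f (insert x U))"
proof -
  have "Pow (insert x A) = Pow A \<union> insert x ` Pow A" by (rule Pow_insert)
  moreover have "Pow A \<inter> insert x ` Pow A = {}" using assms(2) by auto
  moreover have "inj_on (insert x) (Pow A)" using assms(2) by (auto simp: inj_on_def)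
  ultimately show ?thesis using assms(1) by (simp add: sum.union_disjoint sum.reindex)
qed

lemma signed_simps: "signed (Suc n) g = - signed n g" "signed n (a - b) = signed n a - signed n b"
  "signed n (\<Sum>x\<in>A. f x) = (\<Sum>x\<in>A. signed n (f x))"
  by (simp_all add: signed_def sum_negf)

lemma signed_card_insert: "finite U \<Longrightarrow> x \<notin> U \<Longrightarrow> signed (card (insert x U)) g = - signed (card U) g"
  by (simp add: signed_simps)

text \<open>
  \<open>v(+ -) - v(- +) = (v(+ -) - v(- -)) - (v(- +) - v(- -))\<close>: in each bracket one double point of the
  pair is resolved in both ways, while the other one is negative.  \<open>fst ` (Q - R) \<union> snd ` R\<close> selects
  the former double points.
\<close>

lemma pair_differences:
  fixes v :: "'a set \<Rightarrow> 'g::ab_group_add"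
  assumes "finite Q" "card (fst ` Q \<union> snd ` Q) = 2 * card Q"
  shows "(\<Sum>U\<in>Pow Q. signed (card U) (v (snd ` (Q - U) \<union> fst ` U))) =
    (\<Sum>R\<in>Pow Q. signed (card R) (\<Sum>N\<in>Pow (fst ` (Q - R) \<union> snd ` R).
      signed (card N) (v (N \<union> (snd ` (Q - R) \<union> fst ` R)))))"
  using assms
proof (induction Q arbitrary: v rule: finite_induct)
  case empty
  show ?case by (simp add: signed_def)
next
  case (insert q Q)
  obtain p n where q: "q = (p, n)" by (cases q)
  let ?P = "fst ` Q \<union> snd ` Q"
  have fin: "finite ?P" using insert.hyps(1) by simp
  have "card ?P \<le> card (fst ` Q) + card (snd ` Q)" by (rule card_Un_le)
  also have "\<dots> \<le> card Q + card Q" using insert.hyps(1) by (intro add_mono card_image_le)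
  finally have le: "card ?P \<le> 2 * card Q" by simp
  have eqP: "fst ` insert q Q \<union> snd ` insert q Q = insert p (insert n ?P)" by (auto simp: q)
  have total: "card (insert p (insert n ?P)) = 2 * card Q + 2"
    using insert.prems insert.hyps unfolding eqP by simp
  \<comment> \<open>Counting \<open>2 * card Q + 2\<close> double points leaves no room for
    repetitions.\<close>
  have "p \<notin> insert n ?P \<and> n \<notin> ?P \<and> card ?P = 2 * card Q"
    using total le fin by (auto simp: card_insert_if split: if_splits)
  then have pn: "p \<notin> ?P" "n \<notin> ?P" "p \<noteq> n" and card: "card ?P = 2 * card Q" by auto
  have nU: "q \<notin> U" if "U \<in> Pow Q" for U using that insert.hyps by auto
  have fU: "finite U" if "U \<in> Pow Q" for U using that insert.hyps(1) by (auto intro: finite_subset)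
  have d1: "insert q Q - U = insert q (Q - U)" "insert q Q - insert q U = Q - U" if "U \<in> Pow Q" for U
    using nU[OF that] insert.hyps(2) by auto
  let ?vn = "\<lambda>M. v (insert n M)" and ?vp = "\<lambda>M. v (insert p M)"
  have L: "(\<Sum>U\<in>Pow (insert q Q). signed (card U) (v (snd ` (insert q Q - U) \<union> fst ` U))) =
      (\<Sum>U\<in>Pow Q. signed (card U) (?vn (snd ` (Q - U) \<union> fst ` U))) - (\<Sum>U\<in>Pow Q. signed (card U) (?vp (snd ` (Q - U) \<union> fst ` U)))"
  proof -
    have 1: "signed (card U) (v (snd ` (insert q Q - U) \<union> fst ` U)) = signed (card U) (?vn (snd ` (Q - U) \<union> fst ` U))"
      if "U \<in> Pow Q" for U
      unfolding d1(1)[OF that] by (simp add: q)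
    have 2: "signed (card (insert q U)) (v (snd ` (insert q Q - insert q U) \<union> fst ` insert q U)) =
        - signed (card U) (?vp (snd ` (Q - U) \<union> fst ` U))" if "U \<in> Pow Q" for U
      unfolding d1(2)[OF that] signed_card_insert[OF fU[OF that] nU[OF that]] by (simp add: q)
    have "(\<Sum>U\<in>Pow Q. signed (card U) (v (snd ` (insert q Q - U) \<union> fst ` U))) =
        (\<Sum>U\<in>Pow Q. signed (card U) (?vn (snd ` (Q - U) \<union> fst ` U)))" by (intro sum.cong refl 1)
    moreover have "(\<Sum>U\<in>Pow Q. signed (card (insert q U)) (v (snd ` (insert q Q - insert q U) \<union> fst ` insert q U))) =
        (\<Sum>U\<in>Pow Q. - signed (card U) (?vp (snd ` (Q - U) \<union> fst ` U)))" by (intro sum.cong refl 2)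
    ultimately show ?thesis
      unfolding sum_Pow_insert[OF insert.hyps(1,2)] by (simp only: sum_negf diff_conv_add_uminus)
  qed
  have F: "(\<Sum>N\<in>Pow (insert x E). signed (card N) (v (N \<union> insert y M))) =
      (\<Sum>N\<in>Pow E. signed (card N) (v (insert y (N \<union> M)))) - (\<Sum>N\<in>Pow E. signed (card N) (v (insert x (insert y (N \<union> M)))))"
    if E: "finite E" "x \<notin> E" for x y :: 'a and E M
  proof -
    have "signed (card (insert x N)) (v (insert x N \<union> insert y M)) = - signed (card N) (v (insert x (insert y (N \<union> M))))" if "N \<in> Pow E" for N
    proof -
      have "finite N" "x \<notin> N" using that E by (auto intro: finite_subset)
      then show ?thesis by (simp add: signed_simps insert_commute)
    qed
    then have "(\<Sum>N\<in>Pow E. signed (card (insert x N)) (v (insert x N \<union> insert y M))) =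
        (\<Sum>N\<in>Pow E. - signed (card N) (v (insert x (insert y (N \<union> M)))))" by (intro sum.cong refl)
    then show ?thesis unfolding sum_Pow_insert[OF E] by (simp add: sum_negf)
  qed
  have R: "(\<Sum>R\<in>Pow (insert q Q). signed (card R) (\<Sum>N\<in>Pow (fst ` (insert q Q - R) \<union> snd ` R).
        signed (card N) (v (N \<union> (snd ` (insert q Q - R) \<union> fst ` R))))) =
      (\<Sum>R\<in>Pow Q. signed (card R) (\<Sum>N\<in>Pow (fst ` (Q - R) \<union> snd ` R). signed (card N) (?vn (N \<union> (snd ` (Q - R) \<union> fst ` R))))) -
      (\<Sum>R\<in>Pow Q. signed (card R) (\<Sum>N\<in>Pow (fst ` (Q - R) \<union> snd ` R). signed (card N) (?vp (N \<union> (snd ` (Q - R) \<union> fst ` R)))))"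
  proof -
    let ?E = "\<lambda>R. fst ` (Q - R) \<union> snd ` R" and ?M = "\<lambda>R. snd ` (Q - R) \<union> fst ` R"
    have E: "finite (?E R)" "p \<notin> ?E R" "n \<notin> ?E R" if "R \<in> Pow Q" for R
      using that fU[OF that] insert.hyps(1) pn by auto
    have 1: "(\<Sum>N\<in>Pow (fst ` (insert q Q - R) \<union> snd ` R). signed (card N) (v (N \<union> (snd ` (insert q Q - R) \<union> fst ` R)))) =
        (\<Sum>N\<in>Pow (?E R). signed (card N) (?vn (N \<union> ?M R))) - (\<Sum>N\<in>Pow (?E R). signed (card N) (v (insert p (insert n (N \<union> ?M R)))))"
      if "R \<in> Pow Q" for R
      using F[OF E(1,2)[OF that], of n "?M R"] d1(1)[OF that] by (simp add: q)
    have 2: "(\<Sum>N\<in>Pow (fst ` (insert q Q - insert q R) \<union> snd ` insert q R). signed (card N) (v (N \<union> (snd ` (insert q Q - insert q R) \<union> fst ` insert q R)))) =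
        (\<Sum>N\<in>Pow (?E R). signed (card N) (?vp (N \<union> ?M R))) - (\<Sum>N\<in>Pow (?E R). signed (card N) (v (insert p (insert n (N \<union> ?M R)))))"
      if "R \<in> Pow Q" for R
      using F[OF E(1,3)[OF that], of p "?M R"] d1(2)[OF that] by (simp add: q insert_commute)
    have s: "signed (card (insert q R)) x = - signed (card R) x" if "R \<in> Pow Q" for R and x :: 'g
      using nU[OF that] fU[OF that] by (simp add: signed_simps)
    \<comment> \<open>The terms with both points of the new pair negative. They arise once from
      \<open>R\<close> and once from \<open>insert q R\<close>, with opposite signs, and
      cancel.\<close>
    let ?C = "\<lambda>R. \<Sum>N\<in>Pow (?E R). signed (card N) (v (insert p (insert n (N \<union> ?M R))))"
    have "(\<Sum>R\<in>Pow Q. signed (card R) (\<Sum>N\<in>Pow (fst ` (insert q Q - R) \<union> snd ` R).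
          signed (card N) (v (N \<union> (snd ` (insert q Q - R) \<union> fst ` R))))) =
        (\<Sum>R\<in>Pow Q. signed (card R) ((\<Sum>N\<in>Pow (?E R). signed (card N) (?vn (N \<union> ?M R))) - ?C R))"
      by (intro sum.cong refl) (simp only: 1)
    moreover have "(\<Sum>R\<in>Pow Q. signed (card (insert q R)) (\<Sum>N\<in>Pow (fst ` (insert q Q - insert q R) \<union> snd ` insert q R).
          signed (card N) (v (N \<union> (snd ` (insert q Q - insert q R) \<union> fst ` insert q R))))) =
        (\<Sum>R\<in>Pow Q. - signed (card R) ((\<Sum>N\<in>Pow (?E R). signed (card N) (?vp (N \<union> ?M R))) - ?C R))"
      by (intro sum.cong refl) (simp only: 2 s)
    ultimately show ?thesis
      unfolding sum_Pow_insert[OF insert.hyps(1,2)] by (simp add: signed_simps(2) sum_subtractf sum_negf)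
  qed
  show ?case
    unfolding L R using insert.IH[OF card, of ?vn] insert.IH[OF card, of ?vp] by simp
qed

subsection \<open>Tangles and their closures\<close>

lemma curve_append:
  assumes "0 \<le> t" "t \<le> real (length p) - 1"
  shows "curve (p @ q) t = curve p t"
proof -
  define k where "k = nat \<lfloor>t\<rfloor>"
  have k: "int k = \<lfloor>t\<rfloor>" using assms(1) by (simp add: k_def)
  have kt: "real k \<le> t" "t < real k + 1" using k by linarith+
  have kp: "k < length p"
  proof -
    have "real k < real (length p)" using kt(1) assms(2) by linarith
    then show ?thesis by simp
  qed
  have v: "vtx (p @ q) (int m) = vtx p (int m)" if "m < length p" for m
    using that by (subst (1 2) vtx_nat) (auto simp: nth_append)
  show ?thesis
  proof (cases "k + 1 < length p")
    case True
    have "curve r t = vtx r (int k) + (t - of_int (int k)) *\<^sub>R (vtx r (int k + 1) - vtx r (int k))" for r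
      by (rule curve_on_edge) (use kt in auto)
    then show ?thesis using v[OF kp] v[OF True] by (simp add: add_ac)
  next
    case False
    then have "length p = k + 1" using kp by simp
    then have "t = real k" using kt assms(2) by simp
    then show ?thesis using v[OF kp] curve_of_int[of _ "int k"] by simp
  qed
qed

lemma tangle_closure_nth: "i < l \<Longrightarrow> fst (tangle_closure l T) ! i = fst T ! i @ closing_arc l i"
  by (simp add: tangle_closure_def)

lemma length_closing_arc [simp]: "length (closing_arc l i) = 4"
  by (simp add: closing_arc_def)

lemma closure_place:
  assumes i: "fst a < l" "length ts = l" and k: "1 \<le> snd a" "snd a + 2 \<le> length (ts ! fst a)"
  shows "at_place ts a = at_place (fst (tangle_closure l (ts, g))) a \<and> tangent ts a = tangent (fst (tangle_closure l (ts, g))) a \<and>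
    straight_at ts a = straight_at (fst (tangle_closure l (ts, g))) a"
proof -
  let ?c = "fst (tangle_closure l (ts, g))"
  obtain i k where ik: "a = (i, k)" by (cases a)
  have k: "1 \<le> k" "k + 2 \<le> length (ts ! i)" and i: "i < l" using assms ik by auto
  have v: "vtx (?c ! i) (int m) = vtx (ts ! i) (int m)" if "m < length (ts ! i)" for m
    using that i by (subst (1 2) vtx_nat) (auto simp: tangle_closure_nth nth_append)
  have "vtx (?c ! i) (int k) = vtx (ts ! i) (int k)" "vtx (?c ! i) (int (k - 1)) = vtx (ts ! i) (int (k - 1))"
    "vtx (?c ! i) (int (k + 1)) = vtx (ts ! i) (int (k + 1))" by (rule v, use k in linarith)+
  note vv = this
  have e: "int (k - 1) = int k - 1" "int (k + 1) = int k + 1" using k by auto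
  have "at_place ts a = vtx (ts ! i) (int k)" using k by (simp add: ik at_place_vtx)
  moreover have "at_place ?c a = vtx (?c ! i) (int k)" using k i by (simp add: ik at_place_vtx tangle_closure_nth)
  ultimately show ?thesis using vv[unfolded e] by (simp add: ik tangent_def edge_of_nat straight_at_def)
qed

abbreviation strand_ends :: "nat \<Rightarrow> nat \<Rightarrow> point list \<Rightarrow> bool" where
  "strand_ends l i p \<equiv> p \<noteq> [] \<and> hd p = bottom l i \<and> last p = top_point l i \<and>
    (\<forall>k. 0 < k \<and> k < length p - 1 \<longrightarrow> p ! k \<in> interior cylinder)"

text \<open>The strands are initial parts of the closed polygons, so parameters of the tangle are
  parameters of the closure and coincidences are inherited.\<close>

lemma singular_tangle_of_closure:
  assumes S: "singular (fst (tangle_closure l T)) D"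
    and len: "length (fst T) = l" "length (snd T) = l"
    and ends: "\<And>i. i < l \<Longrightarrow> strand_ends l i (fst T ! i)"
    and places: "\<And>a. a \<in> places D \<Longrightarrow> 1 \<le> snd a \<and> snd a + 2 \<le> length (fst T ! fst a)"
  shows "singular_tangle l T D"
proof -
  let ?c = "fst (tangle_closure l T)" and ?t = "fst T"
  have lc: "length ?c = l" by (simp add: tangle_closure_def)
  have same: "at_place ?t a = at_place ?c a \<and> tangent ?t a = tangent ?c a \<and> straight_at ?t a = straight_at ?c a"
    if a: "a \<in> places D" "fst a < l" for a
    using closure_place[OF a(2) len(1), of "snd T"] places[OF a(1)] by simp
  have ok: "fst a < l" if "a \<in> places D" for a using singular_place[OF S that] lc by simp
  have "double_points_of (tangle_dom ?t) ?t D"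
  proof (rule double_points_ofI)
    fix a b assume ab: "(a, b) \<in> D"
    then have m: "a \<in> places D" "b \<in> places D" by force+
    note pa = places[OF m(1)] places[OF m(2)] ok[OF m(1)] ok[OF m(2)]
    have "real (snd a) \<le> real (length (?t ! fst a)) - 1" "real (snd b) \<le> real (length (?t ! fst b)) - 1"
      using pa(1,2) by (simp_all add: le_diff_eq flip: of_nat_Suc)
    then show "a \<noteq> b \<and> (fst a, real (snd a)) \<in> tangle_dom ?t \<and> (fst b, real (snd b)) \<in> tangle_dom ?t \<and>
      at_place ?t a = at_place ?t b \<and> straight_at ?t a \<and> straight_at ?t b \<and> normal ?t (a, b) \<noteq> 0"
      using singular_D[OF S ab] same[OF m(1) pa(3)] same[OF m(2) pa(4)] pa len by (simp add: tangle_dom_def normal_def)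
  next
    have "inj_on (\<lambda>d. at_place ?c (fst d)) D" using S by (simp add: singular_def double_points_of_def)
    moreover have "at_place ?t (fst d) = at_place ?c (fst d)" if "d \<in> D" for d
      using same[of "fst d"] ok[of "fst d"] that by blast
    ultimately show "inj_on (\<lambda>d. at_place ?t (fst d)) D" unfolding inj_on_def by simp
  next
    fix i j s t assume dom: "(i, s) \<in> tangle_dom ?t" "(j, t) \<in> tangle_dom ?t" and ne: "(i, s) \<noteq> (j, t)"
      and eq: "curve (?t ! i) s = curve (?t ! j) t"
    have b: "i < l" "0 \<le> s" "s \<le> real (length (?t ! i)) - 1" "j < l" "0 \<le> t" "t \<le> real (length (?t ! j)) - 1"
      using dom len by (auto simp: tangle_dom_def)
    have "(i, s) \<in> link_dom ?c" "(j, t) \<in> link_dom ?c" using b lc by (auto simp: link_dom_def tangle_closure_nth)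
    moreover have "curve (?c ! i) s = curve (?c ! j) t"
      using eq b by (simp add: tangle_closure_nth curve_append)
    ultimately show "\<exists>k m. s = real k \<and> t = real m \<and> (((i, k), (j, m)) \<in> D \<or> ((j, m), (i, k)) \<in> D)"
      using singular_coincidence_dom[OF S _ _ ne] by blast
  qed
  then show ?thesis using len ends by (simp add: singular_tangle_def)
qed

text \<open>The offset \<open>w\<close> of a point of the middle ball is distributed to the two ends
  in proportion to the radii there. Radius 0 is permitted, as is needed for end points on the
  boundary of the cylinder.\<close>

lemma ball_convex_comb:
  assumes S: "convex S" and A: "A \<in> S" "ball A ra \<subseteq> S" "0 \<le> ra" and B: "B \<in> S" "ball B rb \<subseteq> S" "0 \<le> rb" and u: "0 \<le> u" "u \<le> 1"
  shows "ball ((1 - u) *\<^sub>R A + u *\<^sub>R B) ((1 - u) * ra + u * rb) \<subseteq> (S :: 'a::real_normed_vector set)"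
proof
  let ?r = "(1 - u) * ra + u * rb"
  fix y assume y: "y \<in> ball ((1 - u) *\<^sub>R A + u *\<^sub>R B) ?r"
  define w where "w = y - ((1 - u) *\<^sub>R A + u *\<^sub>R B)"
  have w: "norm w < ?r" using y by (simp add: w_def dist_norm norm_minus_commute)
  then have r: "?r > 0" by (rule order_le_less_trans[OF norm_ge_zero])
  have step: "X + (rx / ?r) *\<^sub>R w \<in> S" if "X \<in> S" "ball X rx \<subseteq> S" "0 \<le> rx" for X rx
  proof (cases "rx = 0")
    case False
    then have "rx / ?r * norm w < rx / ?r * ?r" using that(3) w r by (intro mult_strict_left_mono) auto
    moreover have "rx / ?r * ?r = rx" using r by simp
    moreover have "norm ((rx / ?r) *\<^sub>R w) = rx / ?r * norm w" using that(3) r by simp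
    ultimately have "norm ((rx / ?r) *\<^sub>R w) < rx" by linarith
    then have "X + (rx / ?r) *\<^sub>R w \<in> ball X rx" by (simp add: dist_norm)
    then show ?thesis using that(2) by blast
  qed (use that in simp)
  have "(1 - u) * (ra / ?r) + u * (rb / ?r) = 1" using r by (simp flip: add_divide_distrib)
  then have "w = ((1 - u) * (ra / ?r) + u * (rb / ?r)) *\<^sub>R w" by simp
  also have "\<dots> = (1 - u) *\<^sub>R ((ra / ?r) *\<^sub>R w) + u *\<^sub>R ((rb / ?r) *\<^sub>R w)" by (simp add: scaleR_add_left)
  finally have ww: "w = (1 - u) *\<^sub>R ((ra / ?r) *\<^sub>R w) + u *\<^sub>R ((rb / ?r) *\<^sub>R w)" .
  have "y = ((1 - u) *\<^sub>R A + u *\<^sub>R B) + w" by (simp add: w_def)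
  then have "y = (1 - u) *\<^sub>R (A + (ra / ?r) *\<^sub>R w) + u *\<^sub>R (B + (rb / ?r) *\<^sub>R w)"
    by (subst (asm) ww) (simp add: scaleR_add_right add_ac)
  then show "y \<in> S" using S step[OF A] step[OF B] u by (simp add: convex_alt)
qed

lemma convex_cylinder: "convex cylinder"
proof -
  have eq: "cylinder = {x. (x $ 1)\<^sup>2 + (x $ 2)\<^sup>2 \<le> 1} \<inter> ({x. 0 \<le> x $ 3} \<inter> {x. x $ 3 \<le> 1})" by (auto simp: cylinder_def)
  have "convex {x :: point. (x $ 1)\<^sup>2 + (x $ 2)\<^sup>2 \<le> 1}"
  proof -
    let ?f = "\<lambda>x :: point. (x $ 1, x $ 2)"
    have "linear ?f" by (rule linearI) auto
    then have "convex (?f -` cball 0 1)" by (intro convex_linear_vimage convex_cball)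
    moreover have "?f -` cball 0 1 = {x. (x $ 1)\<^sup>2 + (x $ 2)\<^sup>2 \<le> 1}"
      by (auto simp: norm_prod_def)
    ultimately show ?thesis by simp
  qed
  moreover have "convex {x :: point. 0 \<le> x $ 3}" "convex {x :: point. x $ 3 \<le> 1}"
    using convex_halfspace_ge[of 0 "axis 3 1 :: point"] convex_halfspace_le[of "axis 3 1 :: point" 1] by (simp_all add: inner_axis')
  ultimately show ?thesis unfolding eq by (intro convex_Int)
qed

lemma interior_cylinderI:
  assumes "(x $ 1)\<^sup>2 + (x $ 2)\<^sup>2 < 1" "0 < x $ 3" "x $ 3 < 1"
  shows "x \<in> interior cylinder"
proof (rule interiorI)
  show "open {x :: point. (x $ 1)\<^sup>2 + (x $ 2)\<^sup>2 < 1 \<and> 0 < x $ 3 \<and> x $ 3 < 1}"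
    by (intro open_Collect_conj open_Collect_less continuous_intros)
qed (use assms in \<open>auto simp: cylinder_def\<close>)

subsection \<open>Resolutions of a tangle\<close>

lemma resolution_field_union:
  assumes "finite D" "E \<subseteq> D"
  shows "resolution_field ps (D - E) c i k + resolution_field ps E c' i k =
    resolution_field ps D (\<lambda>d. if d \<in> E then c' d else c d) i k"
proof -
  have "resolution_field ps D (\<lambda>d. if d \<in> E then c' d else c d) i k =
      (\<Sum>d\<in>D - E. if fst d = (i, k) then (if d \<in> E then c' d else c d) *\<^sub>R normal ps d else 0) +
      (\<Sum>d\<in>E. if fst d = (i, k) then (if d \<in> E then c' d else c d) *\<^sub>R normal ps d else 0)"
    unfolding resolution_field_def using assms by (rule sum.subset_diff[rotated])
  also have "(\<Sum>d\<in>D - E. if fst d = (i, k) then (if d \<in> E then c' d else c d) *\<^sub>R normal ps d else 0) =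
      resolution_field ps (D - E) c i k"
    unfolding resolution_field_def by (rule sum.cong) auto
  also have "(\<Sum>d\<in>E. if fst d = (i, k) then (if d \<in> E then c' d else c d) *\<^sub>R normal ps d else 0) =
      resolution_field ps E c' i k"
    unfolding resolution_field_def by (rule sum.cong) auto
  finally show ?thesis by simp
qed

lemma resolution_field_cong:
  assumes "\<And>d. d \<in> D \<Longrightarrow> normal ps d = normal qs d" "\<And>d. d \<in> D \<Longrightarrow> c d = c' d"
  shows "resolution_field ps D c = resolution_field qs D c'"
  unfolding resolution_field_def using assms by (intro ext sum.cong) auto

lemma finite_upper_bound: "finite A \<Longrightarrow> \<exists>M>0. \<forall>a\<in>A. (f a :: real) \<le> M"
proof (induction rule: finite_induct)
  case (insert x A)
  then obtain M where M: "M > 0" "\<forall>a\<in>A. f a \<le> M" by auto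
  show ?case
  proof (intro exI[of _ "max M (f x)"] conjI ballI)
    fix a assume "a \<in> insert x A"
    then show "f a \<le> max M (f x)" using M(2) by (auto simp: le_max_iff_disj)
  qed (use M in \<open>simp add: less_max_iff_disj\<close>)
qed (auto intro: exI[of _ 1])

lemma normals_bounded_below:
  assumes "singular ps D"
  shows "\<exists>B>0. \<forall>d\<in>D. 1 \<le> B * norm (normal ps d)"
proof -
  obtain B where B: "B > 0" "\<forall>d\<in>D. 1 / norm (normal ps d) \<le> B"
    using finite_upper_bound[OF finite_double_points[OF assms], of "\<lambda>d. 1 / norm (normal ps d)"] by blast
  have "1 \<le> B * norm (normal ps d)" if "d \<in> D" for d
    using B(2) that singular_D(9)[OF assms, of "fst d" "snd d"] by (auto simp: divide_le_eq)
  then show ?thesis using B(1) by blast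
qed

text \<open>Singularity and isolation are assumed of the closure, so that the results on closed
  polygons apply. The bounds on places keep the double points away from the two ends of each strand
  and from the closing arcs.\<close>

locale closed_tangle =
  fixes l :: nat and ts :: "point list list" and g :: "int list" and D :: "dpoint set"
  assumes S: "singular (fst (tangle_closure l (ts, g))) D"
    and I: "isolated (fst (tangle_closure l (ts, g))) D"
    and len: "length ts = l" "length g = l"
    and ends: "\<And>i. i < l \<Longrightarrow> strand_ends l i (ts ! i)"
    and places: "\<And>a. a \<in> places D \<Longrightarrow> 1 \<le> snd a \<and> snd a + 2 \<le> length (ts ! fst a)"
begin

definition cs where "cs = fst (tangle_closure l (ts, g))"

lemma S': "singular cs D" and I': "isolated cs D"
  using S I by (simp_all add: cs_def)

lemma cs_nth: "i < l \<Longrightarrow> cs ! i = ts ! i @ closing_arc l i" and length_cs: "length cs = l"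
  by (simp_all add: cs_def tangle_closure_nth) (simp add: tangle_closure_def)

lemma cs_ne: "[] \<notin> set cs"
  using S' by (simp add: singular_def)

lemma finD: "finite D"
  using S' by (rule finite_double_points)

lemma place_less: "a \<in> places D \<Longrightarrow> fst a < l"
  using singular_place[OF S'] length_cs by auto

text \<open>Only places of double points move, and all of them lie on the strands; hence displacing
  commutes with closing.\<close>

lemma closure_disp:
  assumes w: "\<And>i k. w i k \<noteq> 0 \<Longrightarrow> (i, k) \<in> fst ` D"
  shows "tangle_closure l (disp ts w, g') = (disp cs w, g')"
proof -
  have "fst (tangle_closure l (disp ts w, g')) = disp cs w"
  proof (rule nth_equalityI)
    show len1: "length (fst (tangle_closure l (disp ts w, g'))) = length (disp cs w)"
      by (simp add: tangle_closure_def length_cs)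
    fix i assume "i < length (fst (tangle_closure l (disp ts w, g')))"
    then have i: "i < l" by (simp add: tangle_closure_def)
    have "disp ts w ! i @ closing_arc l i = disp cs w ! i"
    proof (rule nth_equalityI)
      show "length (disp ts w ! i @ closing_arc l i) = length (disp cs w ! i)" using i len length_cs by (simp add: cs_nth)
      fix k assume "k < length (disp ts w ! i @ closing_arc l i)"
      then have k: "k < length (ts ! i) + 4" using i len by simp
      show "(disp ts w ! i @ closing_arc l i) ! k = disp cs w ! i ! k"
      proof (cases "k < length (ts ! i)")
        case True
        then show ?thesis using i k len length_cs by (simp add: nth_append disp_nth cs_nth)
      next
        case False
        have "w i k = 0"
        proof (rule ccontr)
          assume "w i k \<noteq> 0"
          then have "(i, k) \<in> places D" using w by blast
          from places[OF this] show False using False by simp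
        qed
        then show ?thesis using False i k len length_cs by (simp add: nth_append disp_nth cs_nth)
      qed
    qed
    then show "fst (tangle_closure l (disp ts w, g')) ! i = disp cs w ! i" using i by (simp add: tangle_closure_nth)
  qed
  then show ?thesis by (metis prod.collapse snd_conv tangle_closure_def)
qed

lemma normal_closure:
  assumes w: "\<And>i k. w i k \<noteq> 0 \<Longrightarrow> (i, k) \<in> fst ` D" and d: "d \<in> D"
  shows "normal (disp ts w) d = normal (disp cs w) d"
proof -
  have m: "fst d \<in> places D" "snd d \<in> places D" using d by auto
  have "tangent (disp ts w) a = tangent (disp cs w) a" if a: "a \<in> places D" for a
  proof -
    have i: "fst a < l" using place_less[OF a] .
    have "snd a + 2 \<le> length (disp ts w ! fst a)" using places[OF a] i len by simp
    then show ?thesis using closure_place[OF i, of "disp ts w" g] places[OF a] len closure_disp[of w g, OF w] by simp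
  qed
  then show ?thesis using m by (simp add: normal_def)
qed

abbreviation rf :: "(dpoint \<Rightarrow> real) \<Rightarrow> nat \<Rightarrow> nat \<Rightarrow> point" where
  "rf c \<equiv> resolution_field cs D c"

lemma rf_support: "E \<subseteq> D \<Longrightarrow> resolution_field cs E c i k \<noteq> 0 \<Longrightarrow> (i, k) \<in> fst ` D"
  using resolution_field_zero by blast

lemma normal_ts: "d \<in> D \<Longrightarrow> normal ts d = normal cs d"
proof -
  assume d: "d \<in> D"
  have "disp ps (\<lambda>i k. 0) = ps" for ps using disp_to[of ps ps] by simp
  then show ?thesis using normal_closure[of "\<lambda>i k. 0", OF _ d] by simp
qed

lemma rf_ts: "resolution_field ts D c = rf c"
  by (rule resolution_field_cong) (auto simp: normal_ts)

lemma place_interior: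
  assumes "a \<in> places D" shows "at_place cs a \<in> interior cylinder"
proof -
  have "snd a < length (ts ! fst a)" using places[OF assms] by simp
  then have "at_place cs a = ts ! fst a ! snd a" using place_less[OF assms] by (simp add: at_place_def cs_nth nth_append)
  moreover have "0 < snd a" "snd a < length (ts ! fst a) - 1" using places[OF assms] by linarith+
  ultimately show ?thesis using ends[OF place_less[OF assms]] by simp
qed

lemma vertex_cylinder:
  assumes i: "i < l" and k: "k < length (ts ! i)" shows "ts ! i ! k \<in> cylinder"
proof -
  consider "k = 0" | "k = length (ts ! i) - 1" | "0 < k \<and> k < length (ts ! i) - 1" using k by linarith
  then show ?thesis
  proof cases
    case 1
    then have "ts ! i ! k = bottom l i" using ends[OF i] hd_conv_nth[of "ts ! i"] by simp
    then show ?thesis using mark_bounds[OF i] by (simp add: cylinder_def bottom_def abs_square_le_1)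
  next
    case 2
    then have "ts ! i ! k = top_point l i" using ends[OF i] last_conv_nth[of "ts ! i"] by simp
    then show ?thesis using mark_bounds[OF i] by (simp add: cylinder_def top_point_def abs_square_le_1)
  next
    case 3
    then show ?thesis using ends[OF i] interior_subset by blast
  qed
qed

text \<open>The factor 2 leaves a ball of radius \<open>R\<close> inside the cylinder around every
  such vertex after it has moved by at most \<open>R\<close>.\<close>

lemma safe_radius: "\<exists>R>0. \<forall>a\<in>fst ` D. ball (at_place cs a) (2 * R) \<subseteq> interior cylinder"
proof (rule uniform_positive[of "fst ` D" "\<lambda>a R. ball (at_place cs a) (2 * R) \<subseteq> interior cylinder"])
  show "finite (fst ` D)" using finD by simp
  fix a assume "a \<in> fst ` D"
  then have "at_place cs a \<in> interior cylinder" by (intro place_interior) auto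
  then obtain e where "e > 0" "ball (at_place cs a) e \<subseteq> interior cylinder" using open_contains_ball[of "interior cylinder"] by auto
  then show "\<exists>m>0. ball (at_place cs a) (2 * m) \<subseteq> interior cylinder" by (intro exI[of _ "e / 2"]) simp
next
  fix a :: place and m m' :: real
  assume "ball (at_place cs a) (2 * m) \<subseteq> interior cylinder" "m' \<le> m"
  moreover have "ball (at_place cs a) (2 * m') \<subseteq> ball (at_place cs a) (2 * m)" using \<open>m' \<le> m\<close> by (intro subset_ball) simp
  ultimately show "ball (at_place cs a) (2 * m') \<subseteq> interior cylinder" by blast
qed

end

lemma curve_comb: "curve p t = (1 - frac t) *\<^sub>R vtx p \<lfloor>t\<rfloor> + frac t *\<^sub>R vtx p (\<lfloor>t\<rfloor> + 1)"
  by (simp add: curve_def edge_def algebra_simps)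

section \<open>Resolutions that stay inside the cylinder\<close>

context closed_tangle
begin

context
  fixes B \<epsilon>s :: real and R :: real
  assumes B0: "\<forall>d\<in>D. 1 \<le> B * norm (normal cs d)"
    and fam: "\<forall>\<sigma> u w s. splitting cs D B \<epsilon>s \<sigma> u \<and> splitting cs D B \<epsilon>s \<sigma> w \<and> 0 \<le> s \<and> s \<le> 1 \<longrightarrow>
      embedded (disp (disp cs u) (\<lambda>i k. s *\<^sub>R (w i k - u i k)))"
    and \<epsilon>s: "0 < \<epsilon>s" "\<epsilon>s \<le> R" and R0: "0 < R" "\<forall>a \<in> fst ` D. ball (at_place cs a) (2 * R) \<subseteq> interior cylinder"
begin

lemma B: "d \<in> D \<Longrightarrow> 1 \<le> B * norm (normal cs d)"
  and R: "0 < R" "a \<in> fst ` D \<Longrightarrow> ball (at_place cs a) (2 * R) \<subseteq> interior cylinder"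
  using B0 R0 by blast+

lemma family:
  "splitting cs D B \<epsilon>s \<sigma> u \<Longrightarrow> splitting cs D B \<epsilon>s \<sigma> w \<Longrightarrow> 0 \<le> s \<Longrightarrow> s \<le> 1 \<Longrightarrow>
    embedded (disp (disp cs u) (\<lambda>i k. s *\<^sub>R (w i k - u i k)))"
  using fam by blast

text \<open>The sizes may differ from one double point to another. This allows a uniform resolution
  to be compared with one in which some double points have been opened beforehand by a fixed
  amount.\<close>

definition admissible :: "(dpoint \<Rightarrow> real) \<Rightarrow> (dpoint \<Rightarrow> real) \<Rightarrow> bool" where
  "admissible \<sigma> c \<longleftrightarrow> (\<forall>d\<in>D. \<bar>\<sigma> d\<bar> = 1 \<and> 0 < \<sigma> d * c d \<and> \<bar>c d\<bar> * norm (normal cs d) \<le> \<epsilon>s)"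

lemma admissible_splitting: "admissible \<sigma> c \<Longrightarrow> splitting cs D B \<epsilon>s \<sigma> (rf c)"
  by (rule splitting_resolution_field[OF S' I' B]) (use \<epsilon>s in \<open>auto simp: admissible_def\<close>)

lemma admissible_norm: "admissible \<sigma> c \<Longrightarrow> norm (rf c i k) \<le> R"
  using resolution_field_norm[OF S', of \<epsilon>s c i k] \<epsilon>s by (force simp: admissible_def)

lemma embedded_admissible:
  assumes "admissible \<sigma> c" shows "embedded (disp cs (rf c))"
proof -
  have "embedded (disp (disp cs (rf c)) (\<lambda>i k. 0 *\<^sub>R (rf c i k - rf c i k)))"
    by (rule family[of \<sigma>]) (use admissible_splitting[OF assms] in auto)
  then show ?thesis by (simp add: disp_disp)
qed

text \<open>A movable vertex gets the radius \<open>R\<close>, a fixed one the radius 0.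
  Interpolated along an edge, these radii are proportional to the bound on the displacement
  there.\<close>

lemma moved_vertex:
  assumes c: "admissible \<sigma> c" and c': "admissible \<sigma> c'" and s: "0 \<le> s" "s \<le> 1" and i: "i < l" and k: "k < length (ts ! i)"
  defines "p \<equiv> cs ! i ! k + rf c i k + s *\<^sub>R (rf c' i k - rf c i k)"
  shows "p \<in> cylinder" "ball p (if (i, k) \<in> fst ` D then R else 0) \<subseteq> cylinder"
proof -
  have "p \<in> cylinder \<and> ball p (if (i, k) \<in> fst ` D then R else 0) \<subseteq> cylinder"
  proof (cases "(i, k) \<in> fst ` D")
    case True
    have "rf c i k + s *\<^sub>R (rf c' i k - rf c i k) = (1 - s) *\<^sub>R rf c i k + s *\<^sub>R rf c' i k" by (simp add: algebra_simps)
    also have "norm \<dots> \<le> (1 - s) * norm (rf c i k) + s * norm (rf c' i k)"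
      using norm_triangle_ineq[of "(1 - s) *\<^sub>R rf c i k" "s *\<^sub>R rf c' i k"] s by simp
    also have "\<dots> \<le> (1 - s) * R + s * R"
      using s admissible_norm[OF c] admissible_norm[OF c'] by (intro add_mono mult_left_mono) auto
    finally have n: "norm (rf c i k + s *\<^sub>R (rf c' i k - rf c i k)) \<le> R" by (simp add: algebra_simps)
    have "ball p R \<subseteq> ball (at_place cs (i, k)) (2 * R)"
    proof
      fix y assume y: "y \<in> ball p R"
      have "dist p (cs ! i ! k) \<le> R" using n by (simp add: p_def dist_norm add_ac)
      then have "dist (cs ! i ! k) p \<le> R" by (simp only: dist_commute)
      then have "dist (cs ! i ! k) y < 2 * R" using y dist_triangle[of "cs ! i ! k" y p] by simp
      then show "y \<in> ball (at_place cs (i, k)) (2 * R)" by (simp add: at_place_def)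
    qed
    then have "ball p R \<subseteq> interior cylinder" using R(2)[OF True] by (rule order_trans)
    then have b: "ball p R \<subseteq> cylinder" using interior_subset by (rule order_trans)
    have "p \<in> ball p R" using R(1) by simp
    then show ?thesis using b True by auto
  next
    case False
    then have "p = ts ! i ! k" using i k by (simp add: p_def resolution_field_zero cs_nth nth_append)
    then show ?thesis using vertex_cylinder[OF i k] False by simp
  qed
  then show "p \<in> cylinder" "ball p (if (i, k) \<in> fst ` D then R else 0) \<subseteq> cylinder" by auto
qed

lemma displaced_ends:
  assumes supp: "\<And>i k. w i k \<noteq> 0 \<Longrightarrow> (i, k) \<in> fst ` D" and wR: "\<And>i k. norm (w i k) \<le> R" and i: "i < l"
  shows "strand_ends l i (disp ts w ! i)"
proof -
  let ?p = "disp ts w ! i"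
  have lp: "length ?p = length (ts ! i)" using i len by simp
  have ne: "ts ! i \<noteq> []" using ends[OF i] by simp
  have z: "w i k = 0" if "k = 0 \<or> k = length (ts ! i) - 1" for k
  proof (rule ccontr)
    assume "w i k \<noteq> 0"
    then have "(i, k) \<in> places D" using supp by blast
    from places[OF this] show False using that by auto
  qed
  have nth: "?p ! k = ts ! i ! k + w i k" if "k < length (ts ! i)" for k using that i len by (simp add: disp_nth)
  have nep: "?p \<noteq> []" using lp ne by auto
  have "0 < length (ts ! i)" "length (ts ! i) - 1 < length (ts ! i)" using ne by simp_all
  then have "?p ! 0 = ts ! i ! 0" "?p ! (length (ts ! i) - 1) = ts ! i ! (length (ts ! i) - 1)" using nth z by auto
  then have "hd ?p = bottom l i" "last ?p = top_point l i"
    using ends[OF i] hd_conv_nth[OF nep] last_conv_nth[OF nep] hd_conv_nth[OF ne] last_conv_nth[OF ne] lp by auto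
  moreover have "?p ! k \<in> interior cylinder" if k: "0 < k" "k < length (ts ! i) - 1" for k
  proof (cases "(i, k) \<in> fst ` D")
    case True
    have "k < length (ts ! i)" using k by linarith
    then have "?p ! k = at_place cs (i, k) + w i k" using nth[of k] i by (simp add: at_place_def cs_nth nth_append)
    then have "dist (at_place cs (i, k)) (?p ! k) \<le> R" using wR[of i k] by (simp add: dist_norm)
    then have "?p ! k \<in> ball (at_place cs (i, k)) (2 * R)" using R(1) by simp
    then show ?thesis using R(2)[OF True] by blast
  next
    case False
    then have "w i k = 0" using supp by blast
    then show ?thesis using nth[of k] k ends[OF i] by simp
  qed
  ultimately show ?thesis using lp nep by auto
qed

lemma pure_admissible:
  assumes c: "admissible \<sigma> c" and g': "length g' = l"
  shows "pure_tangle l (disp ts (rf c), g')"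
  unfolding pure_tangle_def
proof (rule singular_tangle_of_closure)
  show "singular (fst (tangle_closure l (disp ts (rf c), g'))) {}"
    using embedded_admissible[OF c] closure_disp[of "rf c" g', OF rf_support[OF order_refl]] by (simp add: embedded_iff_singular)
  show "length (fst (disp ts (rf c), g')) = l" "length (snd (disp ts (rf c), g')) = l" using len g' by simp_all
next
  fix i assume i: "i < l"
  show "strand_ends l i (fst (disp ts (rf c), g') ! i)"
    using displaced_ends[of "rf c" i, OF rf_support[OF order_refl] admissible_norm[OF c] i] by simp
next
  fix a :: place assume "a \<in> fst ` {} \<union> snd ` {}"
  then show "1 \<le> snd a \<and> snd a + 2 \<le> length (fst (disp ts (rf c), g') ! fst a)" by simp
qed

text \<open>The straight line between the two fields is extended to an isotopy that fixes the
  complement of the open cylinder. The constant 2 works: along an edge the displacement is at most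
  twice the interpolated radius, and the ball of that radius lies in the cylinder by
  convexity.\<close>

lemma isotopic_admissible:
  assumes c: "admissible \<sigma> c" and c': "admissible \<sigma> c'"
  shows "tangle_isotopic (disp ts (rf c), g') (disp ts (rf c'), g')"
proof -
  define K where "K = disp cs (rf c)"
  define w where "w = (\<lambda>i k. rf c' i k - rf c i k)"
  have Kn: "length K = l" "\<And>i. i < l \<Longrightarrow> length (K ! i) = length (ts ! i) + 4" using length_cs by (simp_all add: K_def cs_nth)
  have neK: "[] \<notin> set K" unfolding K_def by (rule Nil_notin_disp[OF cs_ne])
  have Kw: "disp K w = disp cs (rf c')" by (simp add: K_def w_def disp_disp)
  have supp: "(i, k) \<in> fst ` D" if "w i k \<noteq> 0" for i k
    using that rf_support[OF order_refl, of c i k] rf_support[OF order_refl, of c' i k]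
    by (cases "rf c i k = 0") (simp_all add: w_def)
  have wn: "norm (w i k) \<le> 2 * (if (i, k) \<in> fst ` D then R else 0)" for i k
  proof (cases "(i, k) \<in> fst ` D")
    case True
    have "norm (w i k) \<le> norm (rf c' i k) + norm (rf c i k)" unfolding w_def by (rule norm_triangle_ineq4)
    then show ?thesis using admissible_norm[OF c, of i k] admissible_norm[OF c', of i k] True by simp
  next
    case False
    then show ?thesis using supp[of i k] by auto
  qed
  have "\<exists>H. ambient_isotopy H \<and> (\<forall>t\<in>{0..1}. \<forall>z\<in>- interior cylinder. H t z = z) \<and>
    (\<forall>i < length K. \<forall>t. H 1 (curve (K ! i) t) = curve (disp K w ! i) t)"
  proof (rule isotopy_extension[OF neK])
    fix s :: real assume s: "0 \<le> s" "s \<le> 1"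
    show "embedded (disp K (\<lambda>i k. s *\<^sub>R w i k))" unfolding K_def w_def
      by (rule family[OF admissible_splitting[OF c] admissible_splitting[OF c'] s])
  next
    fix s t :: real and i z assume s: "0 \<le> s" "s \<le> 1" and "i < length K" and z: "z \<in> - interior cylinder"
    then have i: "i < l" using Kn by simp
    have nei: "K ! i \<noteq> []" using neK Kn i by (metis nth_mem)
    let ?n = "int (length (K ! i))" and ?k = "\<lfloor>t\<rfloor>" and ?u = "frac t"
    let ?X = "curve (K ! i) t + s *\<^sub>R curve (field K w i) t"
    define q where "q = nat (?k mod ?n)"
    define q' where "q' = nat ((?k + 1) mod ?n)"
    have np: "?n > 0" using nei by simp
    have qi: "int q = ?k mod ?n" "int q' = (?k + 1) mod ?n" using np by (simp_all add: q_def q'_def)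
    have f: "vtx (field K w i) ?k = w i q" "vtx (field K w i) (?k + 1) = w i q'" using nei by (simp_all add: vtx_field q_def q'_def)
    have u: "0 \<le> ?u" "?u \<le> 1" by (simp_all add: frac_lt_1 less_imp_le)
    let ?m = "\<lambda>k. if (i, k) \<in> fst ` D then R else 0"
    show "norm (curve (field K w i) t) \<le> 2 * dist ?X z"
    proof (cases "(i, q) \<in> fst ` D \<or> (i, q') \<in> fst ` D")
      case False
      then have "w i q = 0" "w i q' = 0" using supp by blast+
      then show ?thesis using f by (simp add: curve_comb)
    next
      case True
      \<comment> \<open>An edge on which anything moves joins two vertices of the strand; it never
        reaches the closing arc.\<close>
      have qq: "q < length (ts ! i) \<and> q' < length (ts ! i)"
        using True
      proof
        assume "(i, q) \<in> fst ` D"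
        then have "q + 2 \<le> length (ts ! i)" using places[of "(i, q)"] by auto
        then have "?k mod ?n + 1 < ?n" "0 \<le> ?k mod ?n + 1" using qi Kn(2)[OF i] by linarith+
        then have "int q' = int q + 1" unfolding qi by (metis mod_add_left_eq mod_pos_pos_trivial)
        then show ?thesis using \<open>q + 2 \<le> length (ts ! i)\<close> by linarith
      next
        assume "(i, q') \<in> fst ` D"
        then have q': "1 \<le> q'" "q' + 2 \<le> length (ts ! i)" using places[of "(i, q')"] by auto
        then have "0 \<le> (?k + 1) mod ?n - 1" "(?k + 1) mod ?n - 1 < ?n" using qi Kn(2)[OF i] by linarith+
        moreover have "((?k + 1) mod ?n - 1) mod ?n = ?k mod ?n" by (simp add: mod_diff_left_eq)
        ultimately have "int q = int q' - 1" unfolding qi by simp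
        then show ?thesis using q' by linarith
      qed
      define A where "A = vtx (K ! i) ?k + s *\<^sub>R vtx (field K w i) ?k"
      define A' where "A' = vtx (K ! i) (?k + 1) + s *\<^sub>R vtx (field K w i) (?k + 1)"
      have "vtx (K ! i) ?k = K ! i ! q" "vtx (K ! i) (?k + 1) = K ! i ! q'" by (simp_all add: vtx_def q_def q'_def)
      then have A: "A = cs ! i ! q + rf c i q + s *\<^sub>R (rf c' i q - rf c i q)"
          "A' = cs ! i ! q' + rf c i q' + s *\<^sub>R (rf c' i q' - rf c i q')"
        using qq i length_cs unfolding A_def A'_def f by (simp_all add: K_def disp_nth cs_nth w_def)
      have "curve (K ! i) t + s *\<^sub>R curve (field K w i) t = (1 - ?u) *\<^sub>R A + ?u *\<^sub>R A'"
        unfolding curve_comb[of "K ! i"] curve_comb[of "field K w i"] A_def A'_def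
        by (simp only: scaleR_add_right scaleR_left_commute[of s]) (simp only: add_ac)
      moreover have "ball ((1 - ?u) *\<^sub>R A + ?u *\<^sub>R A') ((1 - ?u) * ?m q + ?u * ?m q') \<subseteq> cylinder"
        by (rule ball_convex_comb[OF convex_cylinder])
          (use moved_vertex[OF c c' s i] qq A u R(1) in auto)
      ultimately have "ball ?X ((1 - ?u) * ?m q + ?u * ?m q') \<subseteq> cylinder" by simp
      then have "ball ?X ((1 - ?u) * ?m q + ?u * ?m q') \<subseteq> interior cylinder" by (intro interior_maximal) auto
      then have "z \<notin> ball ?X ((1 - ?u) * ?m q + ?u * ?m q')" using z by blast
      then have d: "(1 - ?u) * ?m q + ?u * ?m q' \<le> dist ?X z" by (simp only: mem_ball not_less)
      have "norm (curve (field K w i) t) \<le> (1 - ?u) * norm (w i q) + ?u * norm (w i q')"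
        unfolding curve_comb f using norm_triangle_ineq[of "(1 - ?u) *\<^sub>R w i q" "?u *\<^sub>R w i q'"] u by simp
      also have "\<dots> \<le> (1 - ?u) * (2 * ?m q) + ?u * (2 * ?m q')"
        using u wn by (intro add_mono mult_left_mono) auto
      also have "\<dots> = 2 * ((1 - ?u) * ?m q + ?u * ?m q')" by (simp only: distrib_left mult.left_commute)
      finally show ?thesis by (rule order_trans) (intro mult_left_mono d, simp)
    qed
  qed
  then obtain H where H0: "ambient_isotopy H \<and> (\<forall>t\<in>{0..1}. \<forall>z\<in>- interior cylinder. H t z = z) \<and>
    (\<forall>i<l. \<forall>t. H 1 (curve (disp cs (rf c) ! i) t) = curve (disp cs (rf c') ! i) t)"
    unfolding Kw Kn(1) unfolding K_def by (rule exE)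
  have H: "ambient_isotopy H" "\<forall>t\<in>{0..1}. \<forall>x. x \<notin> interior cylinder \<longrightarrow> H t x = x" using H0 by auto
  have H3: "H 1 (curve (disp cs (rf c) ! i) t) = curve (disp cs (rf c') ! i) t" if "i < l" for i t
    using H0 that by simp
  have cc: "curve (disp cs (rf b) ! i) t = curve (disp ts (rf b) ! i) t"
    if i: "i < l" and t: "t \<in> {0..real (length (ts ! i)) - 1}" for b i t
  proof -
    have "disp cs (rf b) ! i = disp ts (rf b) ! i @ closing_arc l i"
      using tangle_closure_nth[OF i, of "(disp ts (rf b), g)"] closure_disp[of "rf b" g, OF rf_support[OF order_refl]] by simp
    then show ?thesis using t i len by (simp add: curve_append)
  qed
  show ?thesis
    unfolding tangle_isotopic_def
  proof (intro conjI exI[of _ H] allI impI)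
    fix i assume "i < length (fst (disp ts (rf c), g'))"
    then have i: "i < l" using len by simp
    have "H 1 (curve (disp ts (rf c) ! i) t) = curve (disp ts (rf c') ! i) t" if "t \<in> {0..real (length (ts ! i)) - 1}" for t
      using H3[OF i, of t] cc[OF i that] by simp
    then have "(\<lambda>t. H 1 (curve (disp ts (rf c) ! i) t)) ` {0..real (length (ts ! i)) - 1} =
        curve (disp ts (rf c') ! i) ` {0..real (length (ts ! i)) - 1}" by (intro image_cong refl)
    then show "H 1 ` curve (fst (disp ts (rf c), g') ! i) ` {0..real (length (fst (disp ts (rf c), g') ! i)) - 1} =
        curve (fst (disp ts (rf c'), g') ! i) ` {0..real (length (fst (disp ts (rf c'), g') ! i)) - 1}"
      using i len by (simp add: image_image)
  qed (use H in auto)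
qed

text \<open>The framing numbers of a resolution depend on the signs only, so the size 1 represents
  all sizes.\<close>

definition framing :: "dpoint set \<Rightarrow> int list" where
  "framing N = snd (resolve 1 (ts, g) D N)"

lemma length_framing: "length (framing N) = l"
  using len by (simp add: framing_def resolve_def)

lemma resolve_ts: "resolve \<epsilon> (ts, g) D N = (disp ts (rf (\<lambda>d. \<epsilon> * real_of_int (dsign N d))), framing N)"
  by (rule prod_eqI) (simp_all add: fst_resolve rf_ts framing_def, simp add: resolve_def)

lemma closure_resolve: "tangle_closure l (resolve \<epsilon> (ts, g) D N) = resolve \<epsilon> (cs, g) D N"
proof -
  have "snd (resolve \<epsilon> (cs, g) D N) = framing N" by (simp add: framing_def resolve_def)
  then have "resolve \<epsilon> (cs, g) D N = (disp cs (rf (\<lambda>d. \<epsilon> * real_of_int (dsign N d))), framing N)"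
    by (intro prod_eqI) (simp_all add: fst_resolve)
  then show ?thesis unfolding resolve_ts using closure_disp[OF rf_support[OF order_refl]] by simp
qed

lemma admissible_dsign:
  assumes "0 < \<epsilon>" "\<And>d. d \<in> D \<Longrightarrow> \<epsilon> * norm (normal cs d) \<le> \<epsilon>s"
  shows "admissible (\<lambda>d. real_of_int (dsign N d)) (\<lambda>d. \<epsilon> * real_of_int (dsign N d))"
  using assms by (auto simp: admissible_def abs_dsign abs_mult dsign_def)

lemma exists_small: "\<exists>\<epsilon>0>0. \<forall>\<epsilon>. 0 < \<epsilon> \<and> \<epsilon> \<le> \<epsilon>0 \<longrightarrow> (\<forall>d\<in>D. \<epsilon> * norm (normal cs d) \<le> min \<epsilon>s e)" if "e > 0"
proof -
  obtain M where M: "M > 0" "\<forall>d\<in>D. norm (normal cs d) \<le> M"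
    using finite_upper_bound[OF finD, of "\<lambda>d. norm (normal cs d)"] by blast
  show ?thesis
  proof (intro exI[of _ "min \<epsilon>s e / M"] conjI allI impI ballI)
    show "0 < min \<epsilon>s e / M" using M \<epsilon>s that by simp
    fix \<epsilon> d assume \<epsilon>: "0 < \<epsilon> \<and> \<epsilon> \<le> min \<epsilon>s e / M" and d: "d \<in> D"
    have "\<epsilon> * norm (normal cs d) \<le> min \<epsilon>s e / M * M" using \<epsilon> M d \<epsilon>s that by (intro mult_mono) auto
    also have "\<dots> = min \<epsilon>s e" using M by simp
    finally show "\<epsilon> * norm (normal cs d) \<le> min \<epsilon>s e" .
  qed
qed

text \<open>The double points outside \<open>E\<close> are opened negatively by one fixed amount.
  Because \<open>D\<close> is isolated, nothing moves at or next to the places of \<open>E\<close>,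
  so these double points keep their tangents and normals.\<close>

lemma partial_resolution_singular:
  assumes E: "E \<subseteq> D"
  shows "\<exists>\<epsilon>1>0. (\<forall>d\<in>D. \<epsilon>1 * norm (normal cs d) \<le> \<epsilon>s) \<and>
    singular (disp cs (resolution_field cs (D - E) (\<lambda>d. - \<epsilon>1))) E \<and>
    (\<forall>d\<in>E. normal (disp cs (resolution_field cs (D - E) (\<lambda>d. - \<epsilon>1))) d = normal cs d)"
proof -
  obtain B' where "B' > 0" "\<forall>d\<in>D. 1 \<le> B' * norm (normal cs d)" using normals_bounded_below[OF S'] by blast
  then have B': "B' > 0" "\<And>d. d \<in> D \<Longrightarrow> 1 \<le> B' * norm (normal cs d)" by blast+
  obtain \<epsilon>2 where \<epsilon>2: "\<epsilon>2 > 0" and sd: "\<forall>w D1 D2. D = D1 \<union> D2 \<and>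
    (\<forall>i < length cs. \<forall>k < length (cs ! i). norm (w i k) \<le> \<epsilon>2) \<and>
    (\<forall>d\<in>D1. gap cs w d \<noteq> 0 \<and>
      (\<forall>p \<in> near_values cs w (fst d) \<union> near_values cs w (snd d). norm p \<le> B' * \<bar>gap cs w d\<bar>)) \<and>
    (\<forall>d\<in>D2. \<forall>p \<in> near_values cs w (fst d) \<union> near_values cs w (snd d). p = 0)
    \<longrightarrow> singular (disp cs w) D2"
    using small_displacement[OF S' B'(1)] by blast
  obtain \<epsilon>1 where \<epsilon>1: "\<epsilon>1 > 0" "\<And>d. d \<in> D \<Longrightarrow> \<epsilon>1 * norm (normal cs d) \<le> min \<epsilon>s \<epsilon>2"
    using exists_small[OF \<epsilon>2] by blast
  define u where "u = resolution_field cs (D - E) (\<lambda>d. - \<epsilon>1)"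
  have u: "u i k = rf (\<lambda>d. if d \<in> E then 0 else - \<epsilon>1) i k" for i k
    using resolution_field_union[OF finD E, of cs "\<lambda>d. - \<epsilon>1" i k "\<lambda>d. 0"] by (simp add: u_def resolution_field_def if_distrib cong: if_cong)
  have near: "p = 0 \<or> d \<in> D - E \<and> p = (- \<epsilon>1) *\<^sub>R normal cs d"
    if "d \<in> D" "p \<in> near_values cs u (fst d) \<union> near_values cs u (snd d)" for d p
    using near_values_resolution_field[OF S' I' that(1), of "D - E"] that(2) unfolding u_def by blast
  have nz: "normal cs d \<noteq> 0" if "d \<in> D" for d using singular_D(9)[OF S', of "fst d" "snd d"] that by simp
  have "singular (disp cs u) E"
  proof (rule sd[rule_format, of "D - E" E u], intro conjI ballI allI impI)
    show "D = D - E \<union> E" using E by auto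
    fix i k
    have "norm (rf (\<lambda>d. if d \<in> E then 0 else - \<epsilon>1) i k) \<le> \<epsilon>2"
      by (rule resolution_field_norm[OF S']) (use \<epsilon>1 \<epsilon>2 in auto)
    then show "norm (u i k) \<le> \<epsilon>2" by (simp only: u)
  next
    fix d assume d: "d \<in> D - E"
    have gd: "gap cs u d = - \<epsilon>1 * (norm (normal cs d))\<^sup>2"
      using gap_resolution_field[OF S', of d "\<lambda>d. if d \<in> E then 0 else - \<epsilon>1"] d by (simp add: gap_def u)
    then show "gap cs u d \<noteq> 0" using \<epsilon>1(1) nz[of d] d by simp
    fix p assume "p \<in> near_values cs u (fst d) \<union> near_values cs u (snd d)"
    then have "p = 0 \<or> p = (- \<epsilon>1) *\<^sub>R normal cs d" using near[of d p] d by blast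
    then have "norm p \<le> \<epsilon>1 * norm (normal cs d) * 1" using \<epsilon>1(1) by auto
    also have "\<dots> \<le> \<epsilon>1 * norm (normal cs d) * (B' * norm (normal cs d))"
      using \<epsilon>1(1) B'(2)[of d] d by (intro mult_left_mono) auto
    also have "\<dots> = B' * \<bar>gap cs u d\<bar>" using \<epsilon>1(1) by (simp add: gd abs_mult power2_eq_square)
    finally show "norm p \<le> B' * \<bar>gap cs u d\<bar>" .
  next
    fix d p assume "d \<in> E" "p \<in> near_values cs u (fst d) \<union> near_values cs u (snd d)"
    then show "p = 0" using near[of d p] E by blast
  qed
  moreover have "normal (disp cs u) d = normal cs d" if d: "d \<in> E" for d
  proof -
    have dD: "d \<in> D" using d E by blast
    have z: "vtx (field cs u (fst a)) (int (snd a) + e) = 0" if a: "a \<in> {fst d, snd d}" and e: "e \<in> {- 1, 0, 1}" for a e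
    proof -
      have "vtx (field cs u (fst a)) (int (snd a) + e) \<in> near_values cs u (fst d) \<union> near_values cs u (snd d)"
        using a e unfolding near_values_def by blast
      then show ?thesis using near[OF dD] d by blast
    qed
    have "tangent (disp cs u) a = tangent cs a" if a: "a \<in> {fst d, snd d}" for a
    proof -
      have "a \<in> places D" using a dD by auto
      then have i: "fst a < length cs" using place_less length_cs by simp
      then have "cs ! fst a \<noteq> []" using cs_ne by (metis nth_mem)
      then show ?thesis using z[OF a, of 0] z[OF a, of 1] i by (simp add: tangent_def edge_of_nat vtx_disp)
    qed
    then show ?thesis by (simp add: normal_def)
  qed
  ultimately show ?thesis
    using \<epsilon>1 unfolding u_def by (intro exI[of _ \<epsilon>1]) (simp add: min.bounded_iff)
qed

context
  fixes m :: nat and V :: "framed \<Rightarrow> 'g::ab_group_add"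
  assumes vass: "vassiliev_invariant l m V"
begin

lemma V_admissible:
  assumes c: "admissible \<sigma> c" and c': "admissible \<sigma> c'"
  shows "V (disp ts (rf c), framing N) = V (disp ts (rf c'), framing N)"
proof -
  have "\<forall>T T'. pure_tangle l T \<and> pure_tangle l T' \<and> tangle_isotopic T T' \<longrightarrow> V T = V T'"
    using vass unfolding vassiliev_invariant_def tangle_invariant_def by (rule conjunct1)
  then show ?thesis
    using pure_admissible[OF c length_framing, of N] pure_admissible[OF c' length_framing, of N] isotopic_admissible[OF c c', of "framing N"]
    by (elim allE[of _ "(disp ts (rf c), framing N)"] allE[of _ "(disp ts (rf c'), framing N)"]) simp
qed

text \<open>With only \<open>E\<close> left singular there are more than \<open>m\<close> double
  points, so the extension of \<open>V\<close> vanishes for small sizes. The resolutions that occur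
  there are small on \<open>E\<close> and of fixed size on \<open>D - E\<close>; being admissible,
  they have the same values of \<open>V\<close> as those with the coefficients
  \<open>c\<close>.\<close>

lemma alternating_sum_zero:
  assumes E: "E \<subseteq> D" "m < card E" and c: "\<And>N. admissible (\<lambda>d. real_of_int (dsign N d)) (c N)"
  shows "(\<Sum>N\<in>Pow E. signed (card N) (V (disp ts (rf (c (N \<union> (D - E)))), framing (N \<union> (D - E))))) = 0"
proof -
  obtain \<epsilon>1 where \<epsilon>1: "\<epsilon>1 > 0" "\<And>d. d \<in> D \<Longrightarrow> \<epsilon>1 * norm (normal cs d) \<le> \<epsilon>s"
    and sing: "singular (disp cs (resolution_field cs (D - E) (\<lambda>d. - \<epsilon>1))) E"
    and nrm: "\<And>d. d \<in> E \<Longrightarrow> normal (disp cs (resolution_field cs (D - E) (\<lambda>d. - \<epsilon>1))) d = normal cs d"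
    using partial_resolution_singular[OF E(1)] by blast
  define u where "u = resolution_field cs (D - E) (\<lambda>d. - \<epsilon>1)"
  have us: "(i, k) \<in> fst ` D" if "u i k \<noteq> 0" for i k using rf_support[of "D - E"] that by (auto simp: u_def)
  have nE: "normal (disp ts u) d = normal cs d" if "d \<in> E" for d
    using normal_closure[of u d, OF us] nrm[OF that] that E(1) by (auto simp: u_def)
  \<comment> \<open>The framing after the partial resolution: the negative crossings of
    \<open>D - E\<close> are already counted.\<close>
  define fr where "fr = snd (resolve 1 (ts, g) (D - E) (D - E))"
  have lfr: "length fr = l" using len by (simp add: fr_def resolve_def)
  have un: "norm (u i k) \<le> R" for i k
  proof -
    have "u i k = rf (\<lambda>d. if d \<in> E then 0 else - \<epsilon>1) i k"
      using resolution_field_union[OF finD E(1), of cs "\<lambda>d. - \<epsilon>1" i k "\<lambda>d. 0"] by (simp add: u_def resolution_field_def if_distrib cong: if_cong)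
    moreover have "norm (rf (\<lambda>d. if d \<in> E then 0 else - \<epsilon>1) i k) \<le> \<epsilon>s"
      by (rule resolution_field_norm[OF S']) (use \<epsilon>1 \<epsilon>s in auto)
    ultimately show ?thesis using \<epsilon>s by simp
  qed
  \<comment> \<open>Coefficients of two scales: the variable \<epsilon> on \<open>E\<close> and the
    fixed \<open>\<epsilon>1\<close> elsewhere.\<close>
  define cc where "cc = (\<lambda>\<epsilon> N d. if d \<in> E then \<epsilon> * real_of_int (dsign N d) else - \<epsilon>1)"
  have res: "resolve \<epsilon> (disp ts u, fr) E N = (disp ts (rf (cc \<epsilon> N)), framing (N \<union> (D - E)))" if N: "N \<subseteq> E" for \<epsilon> N
  proof (rule prod_eqI)
    have "resolution_field (disp ts u) E (\<lambda>d. \<epsilon> * real_of_int (dsign N d)) = resolution_field cs E (\<lambda>d. \<epsilon> * real_of_int (dsign N d))"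
      by (rule resolution_field_cong) (simp_all add: nE)
    then have "fst (resolve \<epsilon> (disp ts u, fr) E N) = disp ts (\<lambda>i k. u i k + resolution_field cs E (\<lambda>d. \<epsilon> * real_of_int (dsign N d)) i k)"
      by (simp add: fst_resolve disp_disp)
    then show "fst (resolve \<epsilon> (disp ts u, fr) E N) = fst (disp ts (rf (cc \<epsilon> N)), framing (N \<union> (D - E)))"
      unfolding u_def resolution_field_union[OF finD E(1)] cc_def by simp
  next
    have "fr ! i + (\<Sum>d\<in>E. if fst (fst d) = i \<and> fst (snd d) = i then dsign N d else 0) =
        g ! i + (\<Sum>d\<in>D. if fst (fst d) = i \<and> fst (snd d) = i then dsign (N \<union> (D - E)) d else 0)" if i: "i < l" for i
    proof -
      have "(\<Sum>d\<in>D. if fst (fst d) = i \<and> fst (snd d) = i then dsign (N \<union> (D - E)) d else 0) =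
          (\<Sum>d\<in>D - E. if fst (fst d) = i \<and> fst (snd d) = i then dsign (N \<union> (D - E)) d else 0) +
          (\<Sum>d\<in>E. if fst (fst d) = i \<and> fst (snd d) = i then dsign (N \<union> (D - E)) d else 0)"
        by (rule sum.subset_diff[OF E(1) finD])
      also have "(\<Sum>d\<in>D - E. if fst (fst d) = i \<and> fst (snd d) = i then dsign (N \<union> (D - E)) d else 0) =
          (\<Sum>d\<in>D - E. if fst (fst d) = i \<and> fst (snd d) = i then dsign (D - E) d else 0)"
        by (intro sum.cong refl) (auto simp: dsign_def)
      also have "(\<Sum>d\<in>E. if fst (fst d) = i \<and> fst (snd d) = i then dsign (N \<union> (D - E)) d else 0) =
          (\<Sum>d\<in>E. if fst (fst d) = i \<and> fst (snd d) = i then dsign N d else 0)"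
        by (intro sum.cong refl) (auto simp: dsign_def)
      finally show ?thesis using i len by (simp add: fr_def resolve_def)
    qed
    then show "snd (resolve \<epsilon> (disp ts u, fr) E N) = snd (disp ts (rf (cc \<epsilon> N)), framing (N \<union> (D - E)))"
      using len lfr by (auto simp: resolve_def framing_def)
  qed
  have T1: "singular_tangle l (disp ts u, fr) E"
  proof (rule singular_tangle_of_closure)
    show "singular (fst (tangle_closure l (disp ts u, fr))) E" using sing closure_disp[of u fr, OF us] by (simp add: u_def)
    show "length (fst (disp ts u, fr)) = l" "length (snd (disp ts u, fr)) = l" using len lfr by simp_all
    show "1 \<le> snd a \<and> snd a + 2 \<le> length (fst (disp ts u, fr) ! fst a)" if "a \<in> places E" for a
    proof -
      have "a \<in> places D" using that E(1) by blast
      then show ?thesis using places[of a] place_less[of a] len by simp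
    qed
    fix i assume i: "i < l"
    show "strand_ends l i (fst (disp ts u, fr) ! i)"
      using displaced_ends[of u i, OF us un i] by simp
  qed
  have "\<forall>\<^sub>F \<epsilon> in at_right 0. extension V \<epsilon> (disp ts u, fr) E = 0"
    using vass T1 E(2) unfolding vassiliev_invariant_def by blast
  moreover obtain \<epsilon>3 where \<epsilon>3: "\<epsilon>3 > 0" "\<And>\<epsilon> d. 0 < \<epsilon> \<Longrightarrow> \<epsilon> \<le> \<epsilon>3 \<Longrightarrow> d \<in> D \<Longrightarrow> \<epsilon> * norm (normal cs d) \<le> min \<epsilon>s 1"
    using exists_small[of 1] by auto
  then have "\<forall>\<^sub>F \<epsilon> in at_right 0. 0 < \<epsilon> \<and> \<epsilon> < \<epsilon>3"
    using eventually_at_right[of 0 1] by (metis (no_types, lifting) eventually_at_right_field)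
  ultimately have "\<forall>\<^sub>F \<epsilon> in at_right 0. extension V \<epsilon> (disp ts u, fr) E = 0 \<and> 0 < \<epsilon> \<and> \<epsilon> < \<epsilon>3" by (rule eventually_conj)
  then obtain \<epsilon> where \<epsilon>: "extension V \<epsilon> (disp ts u, fr) E = 0" "0 < \<epsilon>" "\<epsilon> < \<epsilon>3"
    using eventually_happens'[OF trivial_limit_at_right_real] by blast
  have adm: "admissible (\<lambda>d. real_of_int (dsign (N \<union> (D - E)) d)) (cc \<epsilon> N)" if "N \<subseteq> E" for N
    unfolding admissible_def
  proof (intro ballI conjI)
    fix d assume d: "d \<in> D"
    show "\<bar>real_of_int (dsign (N \<union> (D - E)) d)\<bar> = 1" by (rule abs_dsign)
    show "0 < real_of_int (dsign (N \<union> (D - E)) d) * cc \<epsilon> N d" using d \<epsilon> \<epsilon>1 by (auto simp: cc_def dsign_def)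
    show "\<bar>cc \<epsilon> N d\<bar> * norm (normal cs d) \<le> \<epsilon>s"
      using \<epsilon>3(2)[OF \<epsilon>(2) less_imp_le[OF \<epsilon>(3)] d] \<epsilon>1(2)[OF d] \<epsilon>(2) \<epsilon>1(1) by (auto simp: cc_def dsign_def)
  qed
  have "(\<Sum>N\<in>Pow E. signed (card N) (V (disp ts (rf (c (N \<union> (D - E)))), framing (N \<union> (D - E))))) = extension V \<epsilon> (disp ts u, fr) E"
    unfolding extension_def
  proof (rule sum.cong[OF refl])
    fix N assume "N \<in> Pow E"
    then have N: "N \<subseteq> E" by simp
    show "signed (card N) (V (disp ts (rf (c (N \<union> (D - E)))), framing (N \<union> (D - E)))) = signed (card N) (V (resolve \<epsilon> (disp ts u, fr) E N))"
      unfolding res[OF N] by (simp only: V_admissible[OF c adm[OF N]])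
  qed
  then show ?thesis using \<epsilon>(1) by simp
qed

end

end

text \<open>\<open>v N\<close> is the common value of \<open>V\<close> on all small resolutions
  whose negative crossings are given by \<open>N\<close>. It is defined for every \<open>N\<close>,
  whatever the linking matrix of the closure, and what remains is a statement about alternating sums
  of \<open>v\<close>.\<close>

theorem tangle_resolutions:
  assumes vass: "vassiliev_invariant l m V"
  shows "\<exists>\<epsilon>0>0. \<exists>v. (\<forall>\<epsilon> N. 0 < \<epsilon> \<and> \<epsilon> < \<epsilon>0 \<longrightarrow> pure_tangle l (resolve \<epsilon> (ts, g) D N) \<and>
      tangle_closure l (resolve \<epsilon> (ts, g) D N) = resolve \<epsilon> (tangle_closure l (ts, g)) D N \<and>
      embedded (fst (resolve \<epsilon> (tangle_closure l (ts, g)) D N)) \<and> V (resolve \<epsilon> (ts, g) D N) = v N) \<and>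
    (\<forall>E\<subseteq>D. m < card E \<longrightarrow> (\<Sum>N\<in>Pow E. signed (card N) (v (N \<union> (D - E)))) = 0)"
proof -
  obtain R where R: "0 < R" "\<forall>a \<in> fst ` D. ball (at_place cs a) (2 * R) \<subseteq> interior cylinder" using safe_radius by blast
  obtain B where B0: "B > 0" and B: "\<forall>d\<in>D. 1 \<le> B * norm (normal cs d)" using normals_bounded_below[OF S'] by blast
  obtain \<epsilon>2 where \<epsilon>2: "\<epsilon>2 > 0" and fam: "\<forall>\<sigma> u w s. splitting cs D B \<epsilon>2 \<sigma> u \<and> splitting cs D B \<epsilon>2 \<sigma> w \<and> 0 \<le> s \<and> s \<le> 1 \<longrightarrow>
    embedded (disp (disp cs u) (\<lambda>i k. s *\<^sub>R (w i k - u i k)))"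
    using splitting_embedded_family[OF S' B0] by blast
  define \<epsilon>s where "\<epsilon>s = min \<epsilon>2 R"
  have \<epsilon>s: "0 < \<epsilon>s" "\<epsilon>s \<le> R" using \<epsilon>2 R by (simp_all add: \<epsilon>s_def)
  have mono: "splitting cs D B \<epsilon>s \<sigma> u \<Longrightarrow> splitting cs D B \<epsilon>2 \<sigma> u" for \<sigma> u
    unfolding splitting_def \<epsilon>s_def by fastforce
  have "\<forall>\<sigma> u w s. splitting cs D B \<epsilon>s \<sigma> u \<and> splitting cs D B \<epsilon>s \<sigma> w \<and> 0 \<le> s \<and> s \<le> 1 \<longrightarrow>
    embedded (disp (disp cs u) (\<lambda>i k. s *\<^sub>R (w i k - u i k)))"
    using fam mono by blast
  note ctx = B this \<epsilon>s R
  obtain \<epsilon>0 where \<epsilon>0: "\<epsilon>0 > 0" "\<And>\<epsilon> d. 0 < \<epsilon> \<Longrightarrow> \<epsilon> \<le> \<epsilon>0 \<Longrightarrow> d \<in> D \<Longrightarrow> \<epsilon> * norm (normal cs d) \<le> min \<epsilon>s 1"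
    using exists_small[OF ctx, where e = 1] by auto
  have adm: "admissible \<epsilon>s (\<lambda>d. real_of_int (dsign N d)) (\<lambda>d. \<epsilon> * real_of_int (dsign N d))" if "0 < \<epsilon>" "\<epsilon> \<le> \<epsilon>0" for \<epsilon> N
    by (rule admissible_dsign[OF ctx that(1)]) (use \<epsilon>0(2)[OF that] in auto)
  define c where "c = (\<lambda>N d. \<epsilon>0 * real_of_int (dsign N d))"
  have c: "admissible \<epsilon>s (\<lambda>d. real_of_int (dsign N d)) (c N)" for N unfolding c_def using adm[of \<epsilon>0] \<epsilon>0(1) by simp
  define v where "v = (\<lambda>N. V (disp ts (rf (c N)), framing N))"
  show ?thesis
  proof (intro exI[of _ \<epsilon>0] exI[of _ v] conjI allI impI)
    show "0 < \<epsilon>0" by (rule \<epsilon>0)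
    fix \<epsilon> N assume "0 < \<epsilon> \<and> \<epsilon> < \<epsilon>0"
    then have a: "admissible \<epsilon>s (\<lambda>d. real_of_int (dsign N d)) (\<lambda>d. \<epsilon> * real_of_int (dsign N d))" using adm[of \<epsilon>] by simp
    show "pure_tangle l (resolve \<epsilon> (ts, g) D N)"
      unfolding resolve_ts[OF ctx] by (rule pure_admissible[OF ctx a length_framing[OF ctx]])
    show "tangle_closure l (resolve \<epsilon> (ts, g) D N) = resolve \<epsilon> (tangle_closure l (ts, g)) D N"
      unfolding closure_resolve[OF ctx] by (simp add: cs_def tangle_closure_def)
    have "(cs, g) = tangle_closure l (ts, g)" by (simp add: cs_def tangle_closure_def)
    moreover have "embedded (fst (resolve \<epsilon> (cs, g) D N))"
      using embedded_admissible[OF ctx a] by (simp add: fst_resolve)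
    ultimately show "embedded (fst (resolve \<epsilon> (tangle_closure l (ts, g)) D N))" by simp
    show "V (resolve \<epsilon> (ts, g) D N) = v N"
      unfolding resolve_ts[OF ctx] v_def by (rule V_admissible[OF ctx vass a c])
  next
    fix E assume "E \<subseteq> D" "m < card E"
    then show "(\<Sum>N\<in>Pow E. signed (card N) (v (N \<union> (D - E)))) = 0"
      unfolding v_def by (rule alternating_sum_zero[OF ctx vass _ _ c])
  qed
qed

end

subsection \<open>Links as closures\<close>

lemma orienting_id: "orienting (\<lambda>x. x)"
  by (simp add: orienting_def linear_id[unfolded id_def] inj_on_def)

text \<open>Provides what is needed to pull the fingers out of a resolution: it is embedded, and its
  vertices move within the margin \<delta> of \<open>finger_room\<close>.\<close>

lemma small_resolutions:
  assumes S: "singular ps D" and I: "isolated ps D" and "\<delta> > 0"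
  shows "\<exists>\<epsilon>0>0. \<forall>\<epsilon> N. 0 < \<epsilon> \<and> \<epsilon> < \<epsilon>0 \<longrightarrow>
    embedded (disp ps (resolution_field ps D (\<lambda>d. \<epsilon> * real_of_int (dsign N d)))) \<and>
    (\<forall>i k. norm (resolution_field ps D (\<lambda>d. \<epsilon> * real_of_int (dsign N d)) i k) \<le> \<delta>)"
proof -
  have fin: "finite D" using S by (rule finite_double_points)
  obtain B where B0: "B > 0" and "\<forall>d\<in>D. 1 \<le> B * norm (normal ps d)" using normals_bounded_below[OF S] by blast
  then have B: "1 \<le> B * norm (normal ps d)" if "d \<in> D" for d using that by blast
  obtain \<epsilon>2 where \<epsilon>2: "\<epsilon>2 > 0" and fam: "\<forall>\<sigma> u w s. splitting ps D B \<epsilon>2 \<sigma> u \<and> splitting ps D B \<epsilon>2 \<sigma> w \<and> 0 \<le> s \<and> s \<le> 1 \<longrightarrow>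
    embedded (disp (disp ps u) (\<lambda>i k. s *\<^sub>R (w i k - u i k)))"
    using splitting_embedded_family[OF S B0] by blast
  obtain M where M: "M > 0" "\<forall>d\<in>D. norm (normal ps d) \<le> M"
    using finite_upper_bound[OF fin, of "\<lambda>d. norm (normal ps d)"] by blast
  define e where "e = min \<epsilon>2 \<delta>"
  have e: "0 < e" "e \<le> \<epsilon>2" "e \<le> \<delta>" using \<epsilon>2 assms(3) by (simp_all add: e_def)
  show ?thesis
  proof (intro exI[of _ "e / M"] conjI allI impI)
    show "0 < e / M" using e M by simp
    fix \<epsilon> N assume \<epsilon>: "0 < \<epsilon> \<and> \<epsilon> < e / M"
    let ?c = "\<lambda>d. \<epsilon> * real_of_int (dsign N d)"
    let ?w = "resolution_field ps D ?c"
    have c: "\<bar>?c d\<bar> * norm (normal ps d) \<le> e" if "d \<in> D" for d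
    proof -
      have "\<epsilon> * norm (normal ps d) \<le> e / M * M" using \<epsilon> M that e by (intro mult_mono) auto
      then show ?thesis using \<epsilon> M(1) by (simp add: abs_mult abs_dsign)
    qed
    have sp: "splitting ps D B \<epsilon>2 (\<lambda>d. real_of_int (dsign N d)) ?w"
    proof (rule splitting_resolution_field[OF S I B])
      fix d assume d: "d \<in> D"
      have "\<bar>?c d\<bar> * norm (normal ps d) \<le> \<epsilon>2" using c[OF d] e(2) by (rule order_trans)
      moreover have "0 < real_of_int (dsign N d) * ?c d" using \<epsilon> by (simp add: dsign_def)
      ultimately show "\<bar>real_of_int (dsign N d)\<bar> = 1 \<and> 0 < real_of_int (dsign N d) * ?c d \<and> \<bar>?c d\<bar> * norm (normal ps d) \<le> \<epsilon>2"
        using abs_dsign by blast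
    qed (use \<epsilon>2 in auto)
    have "embedded (disp (disp ps ?w) (\<lambda>i k. 0 *\<^sub>R (?w i k - ?w i k)))" using fam sp by (meson order_refl zero_le_one)
    then show "embedded (disp ps ?w)" by (simp add: disp_disp)
    fix i k
    have "norm (?w i k) \<le> e" by (rule resolution_field_norm[OF S]) (use e c in auto)
    then show "norm (?w i k) \<le> \<delta>" using e(3) by (rule order_trans)
  qed
qed

text \<open>Renumbering carries neighbours to neighbours. The argument of
  \<open>isolated_resample_link\<close> requires a genuine subdivision, which is absent
  here.\<close>

lemma isolated_rotated:
  assumes S: "singular ps D" and I: "isolated ps D"
  shows "isolated (resample_link 1 r A ps) (resample_dpoint 1 r ps ` D)"
  unfolding isolated_def resample_places
proof (intro ballI)
  fix b and e :: int assume "b \<in> resample_place 1 r ps ` (places D)" and e: "e \<in> {- 1, 1}"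
  then obtain a where a: "a \<in> places D" and b: "b = resample_place 1 r ps a" by blast
  have lt: "fst a < length ps" "snd a < length (ps ! fst a)" using singular_place[OF S a] by auto
  then have ne: "ps ! fst a \<noteq> []" by auto
  let ?n = "int (length (ps ! fst a))"
  have fb: "fst b = fst a" by (simp add: b resample_place_def)
  have "int (snd b) = (int (snd a) - int (r (fst a))) mod ?n"
    unfolding b using resample_place_mod[of 1 ps a r, OF _ ne] by simp
  then have "(int (snd b) + e) mod ?n = (int (snd a) - int (r (fst a)) + e) mod ?n" by (simp only: mod_add_left_eq)
  also have "int (snd a) - int (r (fst a)) + e = 1 * (int (snd a) + e) - int (r (fst a))" by simp
  finally have "(int (snd b) + e) mod ?n = (1 * (int (snd a) + e) - int (r (fst a))) mod ?n" .
  then have "pm (resample_link 1 r A ps) (fst b) (int (snd b) + e) = pm (resample_link 1 r A ps) (fst a) (int 1 * (int (snd a) + e) - int (r (fst a)))"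
    using lt fb by simp
  also have "\<dots> = resample_place 1 r ps (pm ps (fst a) (int (snd a) + e))"
    by (rule pm_resample_link[OF lt(1) ne])
  finally have eq: "pm (resample_link 1 r A ps) (fst b) (int (snd b) + e) = resample_place 1 r ps (pm ps (fst a) (int (snd a) + e))" .
  have no: "pm ps (fst a) (int (snd a) + e) \<notin> places D" using I a e unfolding isolated_def by blast
  show "pm (resample_link 1 r A ps) (fst b) (int (snd b) + e) \<notin> resample_place 1 r ps ` (places D)"
  proof
    assume "pm (resample_link 1 r A ps) (fst b) (int (snd b) + e) \<in> resample_place 1 r ps ` (places D)"
    then obtain a' where a': "a' \<in> places D" and e': "resample_place 1 r ps (pm ps (fst a) (int (snd a) + e)) = resample_place 1 r ps a'"
      unfolding eq by auto
    let ?S = "{a. snd a < length (ps ! fst a)}"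
    have "pm ps (fst a) (int (snd a) + e) \<in> ?S" "a' \<in> ?S"
      using nat_mod_length_less[OF ne] singular_place[OF S a'] by simp_all
    then have "pm ps (fst a) (int (snd a) + e) = a'" by (rule inj_onD[OF inj_on_resample_place[OF zero_less_one] e'])
    then show False using no a' by simp
  qed
qed

lemma resample_eq_rotate: "resample 1 r (\<lambda>x. x) p = rotate r p"
proof (rule nth_equalityI)
  fix k assume "k < length (resample 1 r (\<lambda>x. x) p)"
  then have k: "k < length p" by simp
  have "resample 1 r (\<lambda>x. x) p ! k = curve p (real (k + r))" using k by (simp add: resample_def)
  also have "\<dots> = vtx p (int (k + r))" using curve_of_int[of p "int (k + r)"] by simp
  also have "\<dots> = p ! ((r + k) mod length p)" by (simp add: vtx_def add.commute nat_mod_as_int flip: of_nat_add)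
  finally show "resample 1 r (\<lambda>x. x) p ! k = rotate r p ! k" using k by (simp add: nth_rotate)
qed simp

text \<open>The marks keep the distance \<open>2 / (l + 1)\<close>, which exceeds \<eta>, from -1
  and 1. So the absolute values of the first two coordinates have a sum below 1.\<close>

lemma tip_interior:
  assumes i: "i < l" and \<eta>: "0 < \<eta>" "\<eta> < 1 / real (l + 2)" and z: "0 < z" "z < 1"
  shows "tip l \<eta> i z \<in> interior cylinder"
proof (rule interior_cylinderI)
  have "1 / real (l + 2) < 2 / real (l + 1)" by (simp add: field_simps)
  moreover have "\<bar>mark l i\<bar> \<le> 1 - 2 / real (l + 1)"
  proof -
    have "real (i + 1) \<le> real l" using i by simp
    then have "2 * real (i + 1) / real (l + 1) \<le> 2 * real l / real (l + 1)" by (intro divide_right_mono mult_left_mono) auto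
    also have "2 * real l / real (l + 1) = 2 - 2 / real (l + 1)" by (simp add: field_simps)
    finally have u: "mark l i \<le> 1 - 2 / real (l + 1)" by (simp add: mark_def)
    have "2 * 1 / real (l + 1) \<le> 2 * real (i + 1) / real (l + 1)" by (intro divide_right_mono mult_left_mono) auto
    then have low: "- (1 - 2 / real (l + 1)) \<le> mark l i" by (simp add: mark_def)
    show ?thesis by (rule abs_leI[OF u minus_le_iff[THEN iffD1, OF low]])
  qed
  ultimately have s: "\<bar>mark l i\<bar> + \<eta> < 1" using \<eta>(2) by linarith
  have "(mark l i)\<^sup>2 = \<bar>mark l i\<bar> * \<bar>mark l i\<bar>" by (simp add: power2_eq_square)
  also have "\<dots> \<le> \<bar>mark l i\<bar> * 1" using s \<eta> by (intro mult_left_mono) auto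
  finally have m: "(mark l i)\<^sup>2 \<le> \<bar>mark l i\<bar>" by simp
  have "\<eta>\<^sup>2 \<le> \<eta> * 1" unfolding power2_eq_square using s \<eta> abs_ge_zero[of "mark l i"] by (intro mult_left_mono) linarith+
  then show "(tip l \<eta> i z $ 1)\<^sup>2 + (tip l \<eta> i z $ 2)\<^sup>2 < 1" using m s by (simp add: tip_def)
qed (use z in \<open>simp_all add: tip_def\<close>)

text \<open>A small ball about a point \<open>(X, 3/4, 1/2)\<close> with \<open>X\<close> off the
  marks; \<open>|X| < 1/2\<close> keeps it in the cylinder, as 1/4 + 9/16 < 1. The bound
  \<open>1 / (l + 2)\<close> separates the link from the tips, which lie at a smaller second
  coordinate.\<close>

lemma exists_chamber:
  "\<exists>(P0 :: point) \<rho>. \<rho> > 0 \<and> (\<forall>v. dist P0 v < \<rho> \<longrightarrow> 1 / real (l + 2) < v $ 2 \<and> 0 < v $ 3 \<and> v $ 3 < 1 \<and>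
    (\<forall>i<l. v $ 1 \<noteq> mark l i) \<and> (v $ 1)\<^sup>2 + (v $ 2)\<^sup>2 < 1)"
proof -
  obtain X where X: "- 1 / 2 < X" "X < 1 / 2" "X \<notin> mark l ` {..<l}"
    using interval_avoid_finite[of "- 1 / 2" "1 / 2" "mark l ` {..<l}"] by auto
  define P0 :: point where "P0 = vector [X, 3 / 4, 1 / 2]"
  let ?O = "{v :: point. 1 / real (l + 2) < v $ 2} \<inter> {v. 0 < v $ 3} \<inter> {v. v $ 3 < 1} \<inter> (\<Inter>i\<in>{..<l}. {v. v $ 1 \<noteq> mark l i}) \<inter>
    {v. (v $ 1)\<^sup>2 + (v $ 2)\<^sup>2 < 1}"
  have o: "open ?O"
    by (intro open_Int open_INT ballI finite_lessThan open_Collect_less open_Collect_neq continuous_intros)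
  have "X\<^sup>2 \<le> (1 / 2)\<^sup>2" using X by (intro abs_le_square_iff[THEN iffD1]) auto
  then have "X\<^sup>2 + (3 / 4)\<^sup>2 < 1" by (simp add: power2_eq_square)
  moreover have "1 / real (l + 2) < 3 / 4"
  proof -
    have "1 / real (l + 2) \<le> 1 / 2" by (intro divide_left_mono) auto
    also have "(1 :: real) / 2 < 3 / 4" by simp
    finally show ?thesis .
  qed
  ultimately have "P0 \<in> ?O" using X(3) by (auto simp: P0_def)
  then obtain \<rho> where "\<rho> > 0" "ball P0 \<rho> \<subseteq> ?O" using o unfolding open_contains_ball by blast
  then show ?thesis by (intro exI[of _ P0] exI[of _ \<rho>]) (auto simp: subset_iff)
qed

text \<open>Numbering from the second to last vertex raises the old numbers by 2: the bottom end and
  the lower tip now precede the kept part.\<close>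

lemma cyclic_shift:
  assumes "1 \<le> k" "k + 10 \<le> n"
  shows "nat ((int k - int (n - 2)) mod int n) = k + 2"
proof -
  have "(int k - int (n - 2)) mod int n = (int k - int (n - 2) + int n) mod int n" by simp
  also have "int k - int (n - 2) + int n = int (k + 2)" using assms by simp
  also have "int (k + 2) mod int n = int (k + 2)" using assms by (intro mod_pos_pos_trivial) auto
  finally show ?thesis by simp
qed

context fingers
begin

abbreviation closed :: "point list list \<Rightarrow> point list list" where
  "closed K' \<equiv> with_tails K' (tail_closing l h \<eta> \<kappa>)"

lemma closed_disp:
  assumes w: "\<And>i k. w i k \<noteq> 0 \<Longrightarrow> k + 8 < length (K ! i)"
  shows "disp (closed K) w = closed (disp K w)"
proof (rule nth_equalityI)
  show "length (disp (closed K) w) = length (closed (disp K w))" by simp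
  fix i assume "i < length (disp (closed K) w)"
  then have i: "i < length K" "i < l" using len by simp_all
  have lc: "length (closed K ! i) = length (K ! i)" using i at(1)[OF i(2)] by (simp add: length_with_tails_nth)
  have ld: "length (closed (disp K w) ! i) = length (K ! i)" using i at(1)[OF i(2)] by (subst length_with_tails_nth) auto
  show "disp (closed K) w ! i = closed (disp K w) ! i"
  proof (rule nth_equalityI)
    show "length (disp (closed K) w ! i) = length (closed (disp K w) ! i)" using i lc ld by simp
    fix k assume "k < length (disp (closed K) w ! i)"
    then have k: "k < length (K ! i)" using i lc by simp
    have e: "disp (closed K) w ! i ! k = closed K ! i ! k + w i k" using i k lc by (simp add: disp_nth)
    show "disp (closed K) w ! i ! k = closed (disp K w) ! i ! k"
    proof (cases "k + 8 < length (K ! i)")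
      case True
      then show ?thesis unfolding e using i k at(1)[OF i(2)]
        by (simp add: with_tails_nth_old disp_nth)
    next
      case False
      then have "w i k = 0" using w by blast
      moreover have "\<not> k < length (K ! i) - 8" using False by linarith
      ultimately show ?thesis unfolding e using i k by (simp add: with_tails_def nth_append)
    qed
  qed
qed

lemma normal_closed:
  assumes S: "singular K D" and places: "\<And>a. a \<in> places D \<Longrightarrow> snd a + 10 \<le> length (K ! fst a)" and d: "d \<in> D"
  shows "normal (closed K) d = normal K d"
proof -
  have "tangent (closed K) a = tangent K a" if a: "a \<in> places D" for a
  proof -
    have i: "fst a < length K" "fst a < l" using singular_place[OF S a] len by auto
    have p: "snd a + 10 \<le> length (K ! fst a)" by (rule places[OF a])
    have lc: "length (closed K ! fst a) = length (K ! fst a)" using i at(1)[OF i(2)] by (simp add: length_with_tails_nth)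
    have v: "vtx (closed K ! fst a) (int k) = vtx (K ! fst a) (int k)" if "k + 8 < length (K ! fst a)" for k
      using that i lc at(1)[OF i(2)] by (subst (1 2) vtx_nat) (auto simp: with_tails_nth_old)
    have "vtx (closed K ! fst a) (int (snd a)) = vtx (K ! fst a) (int (snd a))"
      "vtx (closed K ! fst a) (int (snd a + 1)) = vtx (K ! fst a) (int (snd a + 1))" by (rule v, use p in linarith)+
    then show ?thesis by (simp add: tangent_def edge_of_nat add.commute)
  qed
  then show ?thesis using d by (simp add: normal_def)
qed

text \<open>The closed link without the closing arcs, numbered from the bottom ends, two vertices
  before the old vertex 0.\<close>

definition strands :: "point list list" where
  "strands = map (\<lambda>i. [bottom l i, tip l \<eta> i (h i - \<kappa>)] @ take (length (K ! i) - 8) (K ! i) @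
     [tip l \<eta> i (h i + \<kappa>), top_point l i]) [0..<l]"

lemma closure_strands:
  "fst (tangle_closure l (strands, g)) = resample_link 1 (\<lambda>i. length (K ! i) - 2) (\<lambda>x. x) (closed K)"
proof (rule nth_equalityI)
  show "length (fst (tangle_closure l (strands, g))) = length (resample_link 1 (\<lambda>i. length (K ! i) - 2) (\<lambda>x. x) (closed K))"
    using len by (simp add: tangle_closure_def)
  fix i assume "i < length (fst (tangle_closure l (strands, g)))"
  then have i: "i < l" "i < length K" using len by (simp_all add: tangle_closure_def)
  let ?n = "length (K ! i)"
  let ?a = "take (?n - 8) (K ! i) @ [tip l \<eta> i (h i + \<kappa>), top_point l i] @ closing_arc l i"
  let ?b = "[bottom l i, tip l \<eta> i (h i - \<kappa>)]"
  have n: "10 \<le> ?n" by (rule at(1)[OF i(1)])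
  have la: "length ?a = ?n - 2" using n by simp
  have "closed K ! i = ?a @ ?b" using i by (simp add: with_tails_def tail_closing_def)
  then have "rotate (?n - 2) (closed K ! i) = ?b @ ?a" using rotate_append[of ?a ?b] la by simp
  then show "fst (tangle_closure l (strands, g)) ! i =
      resample_link 1 (\<lambda>i. length (K ! i) - 2) (\<lambda>x. x) (closed K) ! i"
    using i by (simp add: tangle_closure_nth strands_def resample_eq_rotate[unfolded One_nat_def])
qed

end

text \<open>\<beta> composes the maps of double points under placement in the chamber, subdivision
  and renumbering from the bottom ends. Closing the fingers, between the last two, replaces vertices
  behind all double points and so leaves their numbers alone.\<close>

theorem link_as_closure:
  assumes S: "singular ps D" and l: "length ps = l" "length g = l"
  shows "\<exists>ts D' \<beta> \<epsilon>0. \<epsilon>0 > 0 \<and> closed_tangle l ts g D' \<and> bij_betw \<beta> D D' \<and>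
    (resolutions_agree \<epsilon>0 (ps, g) D (tangle_closure l (ts, g)) D' \<beta>)"
proof -
  obtain P0 :: point and \<rho> where \<rho>: "\<rho> > 0" and chamber: "\<forall>v. dist P0 v < \<rho> \<longrightarrow> 1 / real (l + 2) < v $ 2 \<and> 0 < v $ 3 \<and> v $ 3 < 1 \<and>
    (\<forall>i<l. v $ 1 \<noteq> mark l i) \<and> (v $ 1)\<^sup>2 + (v $ 2)\<^sup>2 < 1"
    using exists_chamber[of l] by (elim exE conjE) (rule that)
  obtain f H where f: "orienting f" and H: "ambient_isotopy H" "\<forall>x. H 1 x = f x + P0"
    and fnear: "\<forall>i<length ps. \<forall>v \<in> set (ps ! i). dist P0 (f v + P0) < \<rho>"
    and fnh: "\<forall>i<length ps. \<forall>k. (f (vtx (ps ! i) (k + 1)) + P0) $ 3 \<noteq> (f (vtx (ps ! i) k) + P0) $ 3"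
    using exists_placement[OF S \<rho>, of P0] by (elim exE conjE) (rule that)
  define A where "A = (\<lambda>x. f x + P0)"
  define Q where "Q = resample_link 1 (\<lambda>_. 0) A ps"
  define \<beta>1 where "\<beta>1 = resample_dpoint 1 (\<lambda>_. 0) ps"
  have ne: "[] \<notin> set ps" using S by (simp add: singular_def)
  have S1: "singular Q (\<beta>1 ` D)" unfolding Q_def \<beta>1_def by (rule singular_resample_link[OF S _ f]) (auto simp: A_def)
  have lQ: "length Q = l" using l by (simp add: Q_def)
  have vQ: "vtx (Q ! i) k = A (vtx (ps ! i) k)" if "i < l" for i k
  proof -
    have "ps ! i \<noteq> []" using ne that l by (metis nth_mem)
    then show ?thesis using that l vtx_resample[of 1 "ps ! i" 0 A k] by (simp add: Q_def curve_of_int)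
  qed
  have near: "dist P0 v < \<rho>" if i: "i < l" and v: "v \<in> set (Q ! i)" for i v
  proof -
    have nei: "ps ! i \<noteq> []" using ne i l by (metis nth_mem)
    obtain k where k: "k < length (Q ! i)" "v = Q ! i ! k" using v by (metis in_set_conv_nth)
    then have "v = A (vtx (ps ! i) (int k))" using vQ[OF i, of "int k"] by (simp add: vtx_nat)
    then show ?thesis using fnear vtx_in_set[OF nei, of "int k"] i l by (simp add: A_def)
  qed
  have ball: "1 / real (l + 2) < v $ 2 \<and> 0 < v $ 3 \<and> v $ 3 < 1 \<and> (\<forall>i<l. v $ 1 \<noteq> mark l i)" if "dist P0 v < \<rho>" for v
    using chamber that by blast
  have nhQ: "vtx (Q ! i) (k + 1) $ 3 \<noteq> vtx (Q ! i) k $ 3" if "i < l" for i k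
    using fnh that l unfolding vQ[OF that] A_def by blast
  have "\<exists>N r h \<eta> \<kappa> \<delta>. 2 \<le> N \<and> 0 < \<eta> \<and> \<eta> < 1 / real (l + 2) \<and> 0 < \<delta> \<and>
    finger_room l P0 \<rho> (resample_link N r (\<lambda>x. x) Q) (resample_dpoint N r Q ` \<beta>1 ` D) h \<eta> \<kappa> \<delta>"
    by (rule finger_placement[OF S1 lQ nhQ near ball]) auto
  then obtain N r h \<eta> \<kappa> \<delta> where N: "2 \<le> N" and \<eta>: "0 < \<eta>" "\<eta> < 1 / real (l + 2)" and \<delta>: "0 < \<delta>"
    and room: "finger_room l P0 \<rho> (resample_link N r (\<lambda>x. x) Q) (resample_dpoint N r Q ` \<beta>1 ` D) h \<eta> \<kappa> \<delta>"
    by (elim exE conjE) (rule that)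
  define L where "L = resample_link N r (\<lambda>x. x) Q"
  define \<beta>2 where "\<beta>2 = resample_dpoint N r Q"
  let ?D2 = "\<beta>2 ` \<beta>1 ` D"
  note room' = room[folded L_def \<beta>2_def, unfolded finger_room_def]
  have places: "1 \<le> snd a" "snd a + 10 \<le> length (L ! fst a)" if "a \<in> places ?D2" for a
    using bspec[OF conjunct1[OF room'] that] by blast+
  have pos: "finger_position l (disp L w) h \<eta> \<kappa> \<and> (\<forall>i<l. \<forall>v \<in> set (disp L w ! i). dist P0 v < \<rho>)"
    if "\<forall>i k. norm (w i k) \<le> \<delta>" "\<forall>i k. (i, k) \<notin> fst ` ?D2 \<longrightarrow> w i k = 0" for w
    using conjunct2[OF room'] that by blast
  have S2: "singular L ?D2" unfolding L_def \<beta>2_def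
    by (rule singular_resample_link[OF S1 _ orienting_id, where c = 0]) (use N in auto)
  have I2: "isolated L ?D2" unfolding L_def \<beta>2_def by (rule isolated_resample_link[OF S1 N])
  have lL: "length L = l" using lQ by (simp add: L_def)
  have "disp L (\<lambda>i k. 0) = L" using disp_to[of L L] by simp
  then have posL: "finger_position l L h \<eta> \<kappa>" "\<And>i v. i < l \<Longrightarrow> v \<in> set (L ! i) \<Longrightarrow> dist P0 v < \<rho>"
    using pos[of "\<lambda>i k. 0"] \<delta> by auto
  interpret F: fingers l L h \<eta> \<kappa> by (unfold_locales) (rule posL)
  define M where "M = F.closed L"
  have S3: "singular M ?D2" unfolding M_def using F.singular_closing[OF S2] places by blast
  have lM: "length M = l" using lL by (simp add: M_def)
  have lMi: "length (M ! i) = length (L ! i)" if "i < l" for i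
    using that lL F.at(1)[OF that] by (simp add: M_def length_with_tails_nth)
  have I3: "isolated M ?D2" unfolding isolated_def
  proof (intro ballI)
    fix a and e :: int assume a: "a \<in> places ?D2" and e: "e \<in> {- 1, 1}"
    have "fst a < l" using singular_place[OF S2 a] lL by simp
    then have eq: "pm M (fst a) (int (snd a) + e) = pm L (fst a) (int (snd a) + e)" by (simp only: lMi)
    show "pm M (fst a) (int (snd a) + e) \<notin> places ?D2" unfolding eq using I2 a e unfolding isolated_def by blast
  qed
  define s where "s = (\<lambda>i. length (L ! i) - 2)"
  define \<beta>3 where "\<beta>3 = resample_dpoint 1 s M"
  let ?D3 = "\<beta>3 ` ?D2"
  have cs: "fst (tangle_closure l (F.strands, g)) = resample_link 1 s (\<lambda>x. x) M"
    using F.closure_strands[of g] by (simp only: M_def s_def)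
  have S4: "singular (resample_link 1 s (\<lambda>x. x) M) ?D3" unfolding \<beta>3_def
    by (rule singular_resample_link[OF S3 _ orienting_id, where c = 0]) auto
  have I4: "isolated (resample_link 1 s (\<lambda>x. x) M) ?D3" unfolding \<beta>3_def by (rule isolated_rotated[OF S3 I3])
  have strand: "F.strands ! i = bottom l i # (tip l \<eta> i (h i - \<kappa>) # take (length (L ! i) - 8) (L ! i) @ [tip l \<eta> i (h i + \<kappa>)]) @ [top_point l i]"
    if "i < l" for i using that by (simp add: F.strands_def)
  have CT: "closed_tangle l F.strands g ?D3"
  proof (unfold_locales)
    show "singular (fst (tangle_closure l (F.strands, g))) ?D3" "isolated (fst (tangle_closure l (F.strands, g))) ?D3"
      unfolding cs by (rule S4 I4)+
    show "length F.strands = l" "length g = l" using l by (simp_all add: F.strands_def)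
    show "1 \<le> snd a \<and> snd a + 2 \<le> length (F.strands ! fst a)" if a: "a \<in> places ?D3" for a
    proof -
      have "a \<in> resample_place 1 s M ` (places ?D2)" using a unfolding \<beta>3_def resample_places .
      then obtain b where b: "b \<in> places ?D2" "a = resample_place 1 s M b" by blast
      have i: "fst b < l" using singular_place[OF S2 b(1)] lL by simp
      have "snd a = snd b + 2"
        using cyclic_shift[OF places[OF b(1)]] by (simp add: b(2) resample_place_def s_def lMi[OF i])
      moreover have "length (F.strands ! fst b) = length (L ! fst b) - 8 + 4" using strand[OF i] by simp
      moreover have "fst a = fst b" by (simp add: b(2) resample_place_def)
      ultimately show ?thesis using places(2)[OF b(1)] by simp
    qed
    fix i assume i: "i < l"
    let ?mid = "tip l \<eta> i (h i - \<kappa>) # take (length (L ! i) - 8) (L ! i) @ [tip l \<eta> i (h i + \<kappa>)]"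
    have in_tip: "tip l \<eta> i (h i - \<kappa>) \<in> interior cylinder" "tip l \<eta> i (h i + \<kappa>) \<in> interior cylinder"
      using F.ends[OF i] F.\<kappa> by (auto intro!: tip_interior[OF i \<eta>])
    have in_L: "v \<in> interior cylinder" if "v \<in> set (L ! i)" for v
      using chamber posL(2)[OF i that] by (intro interior_cylinderI) auto
    have mid: "v \<in> interior cylinder" if "v \<in> set ?mid" for v
      using that in_tip in_L set_take_subset[of "length (L ! i) - 8" "L ! i"] by auto
    have "F.strands ! i ! k \<in> interior cylinder" if k: "0 < k" "k < length (F.strands ! i) - 1" for k
    proof -
      obtain j where j: "k = Suc j" using k(1) by (cases k) auto
      have st: "F.strands ! i = bottom l i # ?mid @ [top_point l i]" by (rule strand[OF i])
      have jm: "j < length ?mid" using k(2) unfolding st j by simp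
      have "F.strands ! i ! k = (?mid @ [top_point l i]) ! j" unfolding st j by (rule nth_Cons_Suc)
      also have "\<dots> = ?mid ! j" using jm by (simp only: nth_append if_True)
      finally show ?thesis using mid[OF nth_mem[OF jm]] by simp
    qed
    then show "strand_ends l i (F.strands ! i)"
      using strand[OF i] by simp
  qed
  have r1: "\<exists>\<epsilon>0>0. resolutions_agree \<epsilon>0 (ps, g) D (Q, g) (\<beta>1 ` D) \<beta>1"
    unfolding Q_def \<beta>1_def by (rule resolution_resample[OF S _ f _ H(1)]) (use H in \<open>auto simp: A_def\<close>)
  have r2: "\<exists>\<epsilon>0>0. resolutions_agree \<epsilon>0 (Q, g) (\<beta>1 ` D) (L, g) ?D2 \<beta>2"
    unfolding L_def \<beta>2_def by (rule resolution_resample[OF S1 _ orienting_id _ ambient_isotopy_id, where c = 0]) (use N in auto)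
  have r3: "\<exists>\<epsilon>0>0. resolutions_agree \<epsilon>0 (M, g) ?D2 (resample_link 1 s (\<lambda>x. x) M, g) ?D3 \<beta>3"
    unfolding \<beta>3_def by (rule resolution_resample[OF S3 _ orienting_id _ ambient_isotopy_id, where c = 0]) auto
  obtain e1 where e1: "e1 > 0" "resolutions_agree e1 (ps, g) D (Q, g) (\<beta>1 ` D) \<beta>1" using r1 by (elim exE conjE) (rule that)
  obtain e2 where e2: "e2 > 0" "resolutions_agree e2 (Q, g) (\<beta>1 ` D) (L, g) ?D2 \<beta>2" using r2 by (elim exE conjE) (rule that)
  obtain e3 where e3: "e3 > 0" "resolutions_agree e3 (M, g) ?D2 (resample_link 1 s (\<lambda>x. x) M, g) ?D3 \<beta>3"
    using r3 by (elim exE conjE) (rule that)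
  obtain e4 where e4: "e4 > 0" "\<forall>\<epsilon> N. 0 < \<epsilon> \<and> \<epsilon> < e4 \<longrightarrow>
    embedded (disp L (resolution_field L ?D2 (\<lambda>d. \<epsilon> * real_of_int (dsign N d)))) \<and>
    (\<forall>i k. norm (resolution_field L ?D2 (\<lambda>d. \<epsilon> * real_of_int (dsign N d)) i k) \<le> \<delta>)"
    using small_resolutions[OF S2 I2 \<delta>] by (elim exE conjE) (rule that)
  \<comment> \<open>The fingers are pulled in each resolution separately, but with the same heights
    and tips, so the resulting tails are those of \<open>M\<close>.\<close>
  have r4: "isotopic (resolve \<epsilon> (L, g) ?D2 U) (resolve \<epsilon> (M, g) ?D2 U)" if \<epsilon>: "0 < \<epsilon>" "\<epsilon> < e4" for \<epsilon> U
  proof -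
    let ?c = "\<lambda>d. \<epsilon> * real_of_int (dsign U d)"
    define w where "w = resolution_field L ?D2 ?c"
    define fr where "fr = snd (resolve \<epsilon> (L, g) ?D2 U)"
    have emb: "embedded (disp L w)" and small: "\<forall>i k. norm (w i k) \<le> \<delta>" using e4(2) \<epsilon> by (auto simp: w_def)
    have supp: "\<forall>i k. (i, k) \<notin> fst ` ?D2 \<longrightarrow> w i k = 0" unfolding w_def using resolution_field_zero by blast
    have "finger_position l (disp L w) h \<eta> \<kappa>" using pos[OF small supp] by blast
    then interpret K: fingers l "disp L w" h \<eta> \<kappa> by unfold_locales
    have iso: "isotopic (disp L w, fr) (F.closed (disp L w), fr)" by (rule K.isotopic_closing[OF emb])
    have wk: "k + 8 < length (L ! i)" if "w i k \<noteq> 0" for i k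
    proof -
      have "(i, k) \<in> places ?D2" using supp that by blast
      from places(2)[OF this] show ?thesis by simp
    qed
    have "w = resolution_field M ?D2 ?c"
      unfolding w_def M_def by (rule resolution_field_cong) (use F.normal_closed[OF S2 places(2)] in auto)
    then have "F.closed (disp L w) = fst (resolve \<epsilon> (M, g) ?D2 U)"
      using F.closed_disp[of w, OF wk] by (simp add: fst_resolve M_def)
    moreover have "fr = snd (resolve \<epsilon> (M, g) ?D2 U)" by (simp add: fr_def resolve_def)
    ultimately have "resolve \<epsilon> (M, g) ?D2 U = (F.closed (disp L w), fr)" by (intro prod_eqI) simp_all
    moreover have "resolve \<epsilon> (L, g) ?D2 U = (disp L w, fr)" by (intro prod_eqI) (simp_all add: fst_resolve w_def fr_def)
    ultimately show ?thesis using iso by simp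
  qed
  define \<beta> where "\<beta> = \<beta>3 \<circ> \<beta>2 \<circ> \<beta>1"
  define e where "e = min (min e1 e2) (min e3 e4)"
  have e: "0 < e" "e \<le> e1" "e \<le> e2" "e \<le> e3" "e \<le> e4" using e1 e2 e3 e4 by (auto simp: e_def)
  have inj: "inj_on \<beta>1 D" "inj_on \<beta>2 (\<beta>1 ` D)" "inj_on \<beta>3 ?D2"
    unfolding \<beta>1_def \<beta>2_def \<beta>3_def
    using inj_on_resample_dpoint[OF S, of 1] inj_on_resample_dpoint[OF S1[unfolded \<beta>1_def], of N]
      inj_on_resample_dpoint[OF S3[unfolded \<beta>1_def \<beta>2_def], of 1] N by auto
  have "bij_betw \<beta> D ?D3"
    unfolding \<beta>_def bij_betw_def using inj by (auto simp: image_comp intro!: comp_inj_on)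
  moreover have "isotopic (resolve \<epsilon> (ps, g) D U) (resolve \<epsilon>' (tangle_closure l (F.strands, g)) ?D3 (\<beta> ` U))"
    if \<epsilon>: "0 < \<epsilon>" "\<epsilon> < e" "0 < \<epsilon>'" "\<epsilon>' < e" and U: "U \<subseteq> D" for \<epsilon> \<epsilon>' U
  proof -
    have b: "\<epsilon> < e1" "\<epsilon> < e2" "\<epsilon> < e3" "\<epsilon> < e4" "\<epsilon>' < e3" using \<epsilon> e by auto
    have U1: "\<beta>1 ` U \<subseteq> \<beta>1 ` D" and U2: "\<beta>2 ` \<beta>1 ` U \<subseteq> ?D2" using U by auto
    have "isotopic (resolve \<epsilon> (ps, g) D U) (resolve \<epsilon> (Q, g) (\<beta>1 ` D) (\<beta>1 ` U))" using e1(2) \<epsilon>(1) b(1) U by blast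
    moreover have "isotopic (resolve \<epsilon> (Q, g) (\<beta>1 ` D) (\<beta>1 ` U)) (resolve \<epsilon> (L, g) ?D2 (\<beta>2 ` \<beta>1 ` U))" using e2(2) \<epsilon>(1) b(2) U1 by blast
    moreover have "isotopic (resolve \<epsilon> (L, g) ?D2 (\<beta>2 ` \<beta>1 ` U)) (resolve \<epsilon> (M, g) ?D2 (\<beta>2 ` \<beta>1 ` U))" by (rule r4[OF \<epsilon>(1) b(4)])
    moreover have "isotopic (resolve \<epsilon> (M, g) ?D2 (\<beta>2 ` \<beta>1 ` U))
        (resolve \<epsilon>' (resample_link 1 s (\<lambda>x. x) M, g) ?D3 (\<beta>3 ` \<beta>2 ` \<beta>1 ` U))" using e3(2) \<epsilon>(1,3) b(3,5) U2 by blast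
    ultimately have "isotopic (resolve \<epsilon> (ps, g) D U) (resolve \<epsilon>' (resample_link 1 s (\<lambda>x. x) M, g) ?D3 (\<beta>3 ` \<beta>2 ` \<beta>1 ` U))"
      using isotopic_trans by blast
    moreover have "tangle_closure l (F.strands, g) = (resample_link 1 s (\<lambda>x. x) M, g)"
      using cs by (intro prod_eqI) (simp_all add: tangle_closure_def)
    moreover have "\<beta>3 ` \<beta>2 ` \<beta>1 ` U = \<beta> ` U" by (simp add: \<beta>_def image_comp)
    ultimately show ?thesis by simp
  qed
  ultimately show ?thesis
    using CT e(1) by (intro exI[of _ F.strands] exI[of _ ?D3] exI[of _ \<beta>] exI[of _ e]) simp
qed

subsection \<open>Paired double points\<close>

text \<open>The linking matrix is read off some isotopic diagram, so the diagram of \<open>A\<close>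
  serves for \<open>C\<close> after reversing the isotopy.\<close>

lemma p_link_isotopic:
  assumes p: "p_link l P A" and iso: "isotopic A C" and emb: "embedded (fst C)"
  shows "p_link l P C"
proof -
  have ne: "[] \<notin> set (fst C)" using emb by (simp add: embedded_def)
  have len: "length (fst C) = l" "length (snd C) = l" and sC: "snd C = snd A"
    using p iso by (auto simp: p_link_def framed_link_def singular_link_def isotopic_def)
  have CA: "isotopic C A" by (rule isotopic_sym[OF iso ne])
  have "framed_link l C"
    using emb len ne unfolding embedded_iff_singular singular_def framed_link_def singular_link_def by simp
  moreover obtain L' where L': "framed_link l L'" "isotopic A L'" "diagram (fst L')"
    "\<forall>i<l. \<forall>j<l. i \<noteq> j \<longrightarrow> (\<Sum>(s, t)\<in>crossings (fst L') i j. crossing_sign (fst L' ! i) (fst L' ! j) s t) = 2 * real_of_int (P i j)"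
    using p unfolding p_link_def has_linking_matrix_def by blast
  moreover have "\<forall>i<l. snd C ! i = P i i" using p sC by (simp add: p_link_def has_linking_matrix_def)
  ultimately show ?thesis
    unfolding p_link_def has_linking_matrix_def using isotopic_trans[OF CA L'(2)] by blast
qed

lemma sum_Pow_image:
  assumes "inj_on \<beta> E"
  shows "(\<Sum>N\<in>Pow (\<beta> ` E). F N) = (\<Sum>N\<in>Pow E. F (\<beta> ` N))"
proof -
  have "Pow (\<beta> ` E) = image \<beta> ` Pow E" by (simp add: image_Pow_surj)
  moreover have "inj_on (image \<beta>) (Pow E)" using assms by (rule inj_on_image_Pow)
  ultimately show ?thesis by (simp add: sum.reindex)
qed

theorem pair_extension_zero:
  fixes V W :: "framed \<Rightarrow> 'g::ab_group_add"
  assumes T: "closed_tangle l ts g D'" and \<beta>: "bij_betw \<beta> (pair_points Q) D'" and \<epsilon>0: "\<epsilon>0 > 0"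
    and iso: "\<And>\<epsilon> \<epsilon>' N. 0 < \<epsilon> \<Longrightarrow> \<epsilon> < \<epsilon>0 \<Longrightarrow> 0 < \<epsilon>' \<Longrightarrow> \<epsilon>' < \<epsilon>0 \<Longrightarrow> N \<subseteq> pair_points Q \<Longrightarrow>
      isotopic (resolve \<epsilon> L (pair_points Q) N) (resolve \<epsilon>' (tangle_closure l (ts, g)) D' (\<beta> ` N))"
    and DD: "DD_singular l P (m + 1) L Q"
    and vass: "vassiliev_invariant l m V" and W: "link_invariant l P W"
    and VW: "\<And>T. pure_tangle l T \<Longrightarrow> p_link l P (tangle_closure l T) \<Longrightarrow> V T = W (tangle_closure l T)"
  shows "\<forall>\<^sub>F \<epsilon> in at_right 0. pair_extension W \<epsilon> L Q = 0"
proof -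
  interpret closed_tangle l ts g D' by (rule T)
  let ?D = "pair_points Q"
  obtain \<epsilon>1 v where \<epsilon>1: "\<epsilon>1 > 0"
    and res: "\<forall>\<epsilon> N. 0 < \<epsilon> \<and> \<epsilon> < \<epsilon>1 \<longrightarrow> pure_tangle l (resolve \<epsilon> (ts, g) D' N) \<and>
      tangle_closure l (resolve \<epsilon> (ts, g) D' N) = resolve \<epsilon> (tangle_closure l (ts, g)) D' N \<and>
      embedded (fst (resolve \<epsilon> (tangle_closure l (ts, g)) D' N)) \<and> V (resolve \<epsilon> (ts, g) D' N) = v N"
    and zero: "\<forall>E\<subseteq>D'. m < card E \<longrightarrow> (\<Sum>N\<in>Pow E. signed (card N) (v (N \<union> (D' - E)))) = 0"
    using tangle_resolutions[OF vass] by blast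
  have Q: "finite Q" "card Q = m + 1" "card ?D = 2 * (m + 1)" using DD by (auto simp: DD_singular_def)
  have inj: "inj_on \<beta> ?D" and im: "\<beta> ` ?D = D'" using \<beta> by (auto simp: bij_betw_def)
  define \<epsilon>' where "\<epsilon>' = min \<epsilon>0 \<epsilon>1 / 2"
  have \<epsilon>': "0 < \<epsilon>'" "\<epsilon>' < \<epsilon>0" "\<epsilon>' < \<epsilon>1" using \<epsilon>0 \<epsilon>1 by (auto simp: \<epsilon>'_def)
  let ?neg = "\<lambda>U. snd ` (Q - U) \<union> fst ` U"
  \<comment> \<open>\<open>W\<close> can be traded for \<open>V\<close> only at links with linking
    matrix \<open>P\<close>. This is applied to the resolutions of pairs alone; afterwards
    everything is expressed by \<open>v\<close>, which has no such restriction.\<close>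
  have W_value: "W (resolve \<epsilon> L ?D N) = v (\<beta> ` N)"
    if \<epsilon>: "0 < \<epsilon>" "\<epsilon> < \<epsilon>0" and N: "N \<subseteq> ?D" and p: "p_link l P (resolve \<epsilon> L ?D N)" for \<epsilon> N
  proof -
    let ?T = "resolve \<epsilon>' (ts, g) D' (\<beta> ` N)"
    have r: "pure_tangle l ?T" "tangle_closure l ?T = resolve \<epsilon>' (tangle_closure l (ts, g)) D' (\<beta> ` N)"
      "embedded (fst (resolve \<epsilon>' (tangle_closure l (ts, g)) D' (\<beta> ` N)))" "V ?T = v (\<beta> ` N)"
      using res \<epsilon>' by blast+
    have i: "isotopic (resolve \<epsilon> L ?D N) (tangle_closure l ?T)"
      unfolding r(2) by (rule iso[OF \<epsilon> \<epsilon>'(1,2) N])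
    have pc: "p_link l P (tangle_closure l ?T)" by (rule p_link_isotopic[OF p i]) (use r in simp)
    have "W (resolve \<epsilon> L ?D N) = W (tangle_closure l ?T)" using W p pc i unfolding link_invariant_def by blast
    also have "\<dots> = V ?T" using VW[OF r(1) pc] by simp
    finally show ?thesis using r(4) by simp
  qed
  have alternating: "(\<Sum>U\<in>Pow Q. signed (card U) (v (\<beta> ` ?neg U))) = 0"
  proof -
    have "(\<Sum>U\<in>Pow Q. signed (card U) (v (\<beta> ` ?neg U))) =
      (\<Sum>R\<in>Pow Q. signed (card R) (\<Sum>N\<in>Pow (fst ` (Q - R) \<union> snd ` R). signed (card N) (v (\<beta> ` (N \<union> ?neg R)))))"
      using pair_differences[of Q "\<lambda>M. v (\<beta> ` M)"] Q by (simp add: pair_points_def)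
    also have "\<dots> = (\<Sum>R\<in>Pow Q. 0)"
    proof (rule sum.cong[OF refl])
      fix R assume "R \<in> Pow Q"
      then have R: "R \<subseteq> Q" by simp
      let ?E = "fst ` (Q - R) \<union> snd ` R"
      have DE: "?D = ?E \<union> ?neg R" using R unfolding pair_points_def by blast
      have fR: "finite R" using R Q(1) by (rule finite_subset)
      have c: "card (Q - R) + card R = m + 1" using card_mono[OF Q(1) R] card_Diff_subset[OF fR R] Q(2) by simp
      have bound: "card (f ` (Q - R) \<union> f' ` R) \<le> m + 1" for f f' :: "dpair \<Rightarrow> dpoint"
      proof -
        have "card (f ` (Q - R) \<union> f' ` R) \<le> card (f ` (Q - R)) + card (f' ` R)" by (rule card_Un_le)
        also have "\<dots> \<le> card (Q - R) + card R" using Q(1) fR by (intro add_mono card_image_le) auto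
        finally show ?thesis using c by simp
      qed
      have fin: "finite ?E" "finite (?neg R)" using Q(1) fR by auto
      \<comment> \<open>Two sets of at most \<open>m + 1\<close> elements cover all
        \<open>2 * (m + 1)\<close> double points. So they are disjoint, and \<open>?E\<close> has
        exactly \<open>m + 1\<close> elements, one from each pair.\<close>
      have "card ?E + card (?neg R) = card ?D + card (?E \<inter> ?neg R)" unfolding DE by (rule card_Un_Int[OF fin])
      have "k \<le> a \<and> x = 0" if "a + b = d + x" "a \<le> k" "b \<le> k" "d = 2 * k" for a b d x k :: nat using that by linarith
      note counts = this[OF \<open>card ?E + card (?neg R) = card ?D + card (?E \<inter> ?neg R)\<close> bound bound Q(3)]
      have "m + 1 \<le> card ?E" "card (?E \<inter> ?neg R) = 0" by (rule conjunct1[OF counts], rule conjunct2[OF counts])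
      then have cE: "card ?E = m + 1" and disj: "?E \<inter> ?neg R = {}" using le_antisym[OF bound[of fst snd]] fin by auto
      have ED: "?E \<subseteq> ?D" using DE by blast
      have injE: "inj_on \<beta> ?E" using inj ED by (rule inj_on_subset)
      have "D' - \<beta> ` ?E = \<beta> ` (?D - ?E)" using inj_on_image_set_diff[OF inj _ ED] im by auto
      also have "?D - ?E = ?neg R" using DE disj by blast
      finally have comp: "D' - \<beta> ` ?E = \<beta> ` ?neg R" .
      have "\<beta> ` ?E \<subseteq> D'" using im ED by blast
      moreover have "m < card (\<beta> ` ?E)" using card_image[OF injE] cE by simp
      ultimately have "(\<Sum>N\<in>Pow (\<beta> ` ?E). signed (card N) (v (N \<union> (D' - \<beta> ` ?E)))) = 0" using zero by blast
      then have "(\<Sum>N\<in>Pow ?E. signed (card (\<beta> ` N)) (v (\<beta> ` N \<union> \<beta> ` ?neg R))) = 0"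
        unfolding sum_Pow_image[OF injE] comp .
      also have "(\<Sum>N\<in>Pow ?E. signed (card (\<beta> ` N)) (v (\<beta> ` N \<union> \<beta> ` ?neg R))) =
          (\<Sum>N\<in>Pow ?E. signed (card N) (v (\<beta> ` (N \<union> ?neg R))))"
      proof (rule sum.cong[OF refl])
        fix N assume "N \<in> Pow ?E"
        then have "card (\<beta> ` N) = card N" using injE by (intro card_image) (meson PowD inj_on_subset)
        then show "signed (card (\<beta> ` N)) (v (\<beta> ` N \<union> \<beta> ` ?neg R)) = signed (card N) (v (\<beta> ` (N \<union> ?neg R)))"
          by (simp only: image_Un)
      qed
      finally show "signed (card R) (\<Sum>N\<in>Pow ?E. signed (card N) (v (\<beta> ` (N \<union> ?neg R)))) = 0"
        by (simp add: signed_def)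
    qed
    finally show ?thesis by simp
  qed
  have "\<forall>\<^sub>F \<epsilon> in at_right 0. 0 < \<epsilon> \<and> \<epsilon> < \<epsilon>0" using \<epsilon>0 unfolding eventually_at_right_field by blast
  moreover have "\<forall>\<^sub>F \<epsilon> in at_right 0. \<forall>U\<subseteq>Q. p_link l P (resolve_pairs \<epsilon> L Q U)" using DD unfolding DD_singular_def by blast
  ultimately show ?thesis
  proof eventually_elim
    case (elim \<epsilon>)
    have "pair_extension W \<epsilon> L Q = (\<Sum>U\<in>Pow Q. signed (card U) (v (\<beta> ` ?neg U)))"
      unfolding pair_extension_def
    proof (rule sum.cong[OF refl])
      fix U assume "U \<in> Pow Q"
      then have U: "U \<subseteq> Q" by simp
      have "?neg U \<subseteq> ?D" using U unfolding pair_points_def by blast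
      moreover have "p_link l P (resolve \<epsilon> L ?D (?neg U))" using elim U unfolding resolve_pairs_def by blast
      ultimately have "W (resolve \<epsilon> L ?D (?neg U)) = v (\<beta> ` ?neg U)" using W_value elim by blast
      then show "signed (card U) (W (resolve_pairs \<epsilon> L Q U)) = signed (card U) (v (\<beta> ` ?neg U))"
        by (simp only: resolve_pairs_def)
    qed
    then show ?case using alternating by simp
  qed
qed

theorem theorem1p6:
  fixes l m :: nat and P :: "nat \<Rightarrow> nat \<Rightarrow> int"
    and V W :: "framed \<Rightarrow> 'g::ab_group_add"
  assumes "l \<ge> 1"
    and "\<forall>i<l. \<forall>j<l. P i j = P j i"
    and "vassiliev_invariant l m V"
    and "link_invariant l P W"
    and "\<forall>T. pure_tangle l T \<and> p_link l P (tangle_closure l T) \<longrightarrow> V T = W (tangle_closure l T)"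
  shows "DD_type l P m W \<and> wedge_type l P m W"
proof -
  have zero: "\<forall>\<^sub>F \<epsilon> in at_right 0. pair_extension W \<epsilon> L Q = 0" if DD: "DD_singular l P (m + 1) L Q" for L Q
  proof -
    obtain ps g where L: "L = (ps, g)" by (cases L)
    have "singular ps (pair_points Q)" "length ps = l" "length g = l"
      using DD by (auto simp: DD_singular_def singular_link_def singular_def L)
    from link_as_closure[OF this] obtain ts D' \<beta> \<epsilon>0
      where "\<epsilon>0 > 0" "closed_tangle l ts g D'" "bij_betw \<beta> (pair_points Q) D'"
        and iso: "resolutions_agree \<epsilon>0 (ps, g) (pair_points Q) (tangle_closure l (ts, g)) D' \<beta>"
      by (elim exE conjE) (rule that)
    from this(2,3,1) show ?thesis
    proof (rule pair_extension_zero)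
      show "DD_singular l P (m + 1) L Q" "vassiliev_invariant l m V" "link_invariant l P W" by (fact DD assms)+
      show "V T = W (tangle_closure l T)" if "pure_tangle l T" "p_link l P (tangle_closure l T)" for T
        using assms(5) that by blast
    qed (use iso L in blast)
  qed
  \<comment> \<open>The second sense is a special case of the first: \<open>wedge_singular\<close>
    contains \<open>DD_singular\<close>, and the extension over pairs is the same.\<close>
  then show ?thesis
    using assms(4) unfolding DD_type_def wedge_type_def wedge_singular_def by blast
qed

end
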